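(* Let $n,m\in\mathbb{N}$, $\alpha>0$ and $d=\binom{n+m-1}{n}$. The operator $R_{\mathcal{F}_{\alpha,m}}\colon\mathcal{F}_{\alpha,m}\to L^2(\mathbb{R}^n,\widetilde\mu_n)^d$ is an isometric isomorphism. If $f\in\mathcal{F}_{\alpha,m}$ and $$\int_{\mathbb{C}^n}|f(z)|\,e^{-\frac{\alpha}{2}|z|^2}\,d\mu_{2n}(z)<+\infty,$$ then, for every $j\in\{1,\ldots,d\}$ (as an equality of elements of $L^2(\mathbb{R}^n,\widetilde\mu_n)$ in the variable $\xi$), $$(R_{\mathcal{F}_{\alpha,m}}f)(\xi)_j=\frac{1}{\pi^{3n/4}}\int_{\mathbb{R}^{2n}}f\left(\frac{u+iv}{\sqrt\alpha}\right)e^{-\frac12|u|^2-\frac12|v|^2-i\langle u,v+\xi\rangle}\prod_{r=1}^n\psi_{\varphi(j)_r}\left(\frac{\xi_r+2v_r}{\sqrt2}\right)d\mu_{2n}(u,v).$$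
   Context: Notation: $\mathbb{N}=\{1,2,\ldots\}$, $\mathbb{N}_0=\{0,1,2,\ldots\}$; $|k|=k_1+\cdots+k_n$ for $k\in\mathbb{N}_0^n$; $\langle z,w\rangle=\sum_{r=1}^n z_r\overline{w_r}$ and $|z|=\sqrt{\langle z,z\rangle}$ on $\mathbb{C}^n$; $\mu_n$ is Lebesgue measure on $\mathbb{R}^n$, $\mu_{2n}$ is Lebesgue measure on $\mathbb{C}^n\cong\mathbb{R}^{2n}$, and $\widetilde{\mu}_n=(2\pi)^{-n/2}\mu_n$ (so $\widetilde\mu_{2n}=(2\pi)^{-n}\mu_{2n}$). A smooth function $f\colon\mathbb{C}^n\to\mathbb{C}$ is $m$-analytic if $\overline{D}^k f=0$ for every $k\in\mathbb{N}_0^n$ with $|k|=m$, where $\overline{D}^k=\partial_{\overline{z}_1}^{k_1}\cdots\partial_{\overline{z}_n}^{k_n}$ (Wirtinger derivatives). $\mathcal{F}_{\alpha,m}$ is the Hilbert space of all $m$-analytic functions $f\colon\mathbb{C}^n\to\mathbb{C}$ with $\|f\|^2_{\mathcal{F}_{\alpha,m}}=\frac{\alpha^n}{\pi^n}\int_{\mathbb{C}^n}|f(z)|^2e^{-\alpha|z|^2}\,d\mu_{2n}(z)<\infty$. For $f\in\mathcal{F}_{\alpha,m}$ put $$(U_{\mathcal{F}_{\alpha,m}}^{\mathcal{H}_m}f)(x,y)=2^{n/2}e^{-\frac12|x|^2-\frac12|y|^2-i\langle x,y\rangle}f\Bigl(\frac{x+iy}{\sqrt\alpha}\Bigr)\qquad(x,y\in\mathbb{R}^n).$$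 $\mathcal{H}_m$ is the image of $U_{\mathcal{F}_{\alpha,m}}^{\mathcal{H}_m}$ (it does not depend on $\alpha$), with the inner product of $L^2(\mathbb{R}^{2n},\widetilde\mu_{2n})$. Let $J_{n,m}=\{k\in\mathbb{N}_0^n\colon |k|\le m-1\}$, which has $d$ elements, and let $\varphi\colon\{1,\ldots,d\}\to J_{n,m}$ be the bijection enumerating $J_{n,m}$ in lexicographic order. Hermite functions: $\psi_j(t)=(2^j j!\sqrt\pi)^{-1/2}e^{-t^2/2}H_j(t)$, with $H_j$ the physicists' Hermite polynomial. For $k\in J_{n,m}$, $\xi,v\in\mathbb{R}^n$, let $q_{k,\xi}(v)=2^{n/2}\pi^{n/4}\prod_{r=1}^n\psi_{k_r}\bigl(\frac{\xi_r+2v_r}{\sqrt2}\bigr)$. Let $F$ be the Fourier–Plancherel transform on $L^2(\mathbb{R}^n,\widetilde\mu_n)$, $(Fh)(\xi)=\int_{\mathbb{R}^n}h(u)e^{-i\langle u,\xi\rangle}\,d\widetilde\mu_n(u)$ for $h\in L^1\cap L^2$, and let $F\otimes I$ be the unitary operator on $L^2(\mathbb{R}^{2n},\widetilde\mu_{2n})$ applying $F$ in the first $n$ variables. Let $\widehat{\mathcal{H}}_m=(F\otimes I)(\mathcal{H}_m)$ and $N\colon\widehat{\mathcal{H}}_m\to L^2(\mathbb{R}^n,\widetilde\mu_n)^d$, $(Ng)(\xi)_j=\int_{\mathbb{R}^n}g(\xi,v)\,q_{\varphi(j),\xi}(v)\,d\widetilde\mu_n(v)$. Define $R_{\mathcal{H}_m}=N(F\otimes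 I)\colon\mathcal{H}_m\to L^2(\mathbb{R}^n,\widetilde\mu_n)^d$ and $R_{\mathcal{F}_{\alpha,m}}=R_{\mathcal{H}_m}U_{\mathcal{F}_{\alpha,m}}^{\mathcal{H}_m}$. *)

theory Defs
  imports "HOL-Analysis.Analysis" "HOL-Library.Fun_Lexorder"
begin

type_synonym 'n rvec = "(real, 'n) vec"

type_synonym 'n cvec = "(complex, 'n) vec"

section \<open>The Hilbert space of square-integrable functions modulo null sets\<close>

text \<open>On a Euclidean space of dimension \<open>N\<close> the measure below is \<open>(2 * pi) powr (- N / 2)\<close> times
  Lebesgue measure; on \<open>'n rvec \<times> 'n rvec\<close> the factor is \<open>(2 * pi) powr (- CARD('n))\<close>.\<close>

definition mu_tilde :: "'a::euclidean_space measure" where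
  "mu_tilde = density lborel (\<lambda>_. ennreal ((2 * pi) powr (- real DIM('a) / 2)))"

definition square_integrable :: "('a::euclidean_space \<Rightarrow> complex) \<Rightarrow> bool" where
  "square_integrable f \<longleftrightarrow>
     f \<in> borel_measurable mu_tilde \<and> integrable mu_tilde (\<lambda>x. (cmod (f x))\<^sup>2)"

definition l2_rel :: "('a::euclidean_space \<Rightarrow> complex) \<Rightarrow> ('a \<Rightarrow> complex) \<Rightarrow> bool" where
  "l2_rel f g \<longleftrightarrow>
     square_integrable f \<and> square_integrable g \<and> (AE x in mu_tilde. f x = g x)"

lemma square_integrable_zero: "square_integrable (\<lambda>_. 0)"
  by (simp add: square_integrable_def)

lemma square_integrable_scale:
  assumes "square_integrable f"
  shows "square_integrable (\<lambda>x. c * f x)"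
  using assms by (auto simp: square_integrable_def norm_mult power_mult_distrib)

lemma square_integrable_add:
  assumes "square_integrable f" "square_integrable g"
  shows "square_integrable (\<lambda>x. f x + g x)"
proof -
  have [measurable]: "f \<in> borel_measurable mu_tilde" "g \<in> borel_measurable mu_tilde"
    using assms by (auto simp: square_integrable_def)
  have bound: "(cmod (a + b))\<^sup>2 \<le> 2 * (cmod a)\<^sup>2 + 2 * (cmod b)\<^sup>2" for a b :: complex
  proof -
    have "(cmod (a + b))\<^sup>2 \<le> (cmod a + cmod b)\<^sup>2"
      by (simp add: norm_triangle_ineq power_mono)
    also have "\<dots> \<le> 2 * (cmod a)\<^sup>2 + 2 * (cmod b)\<^sup>2"
      using sum_squares_bound[of "cmod a" "cmod b"] by (simp add: power2_sum)
    finally show ?thesis .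
  qed
  have "integrable mu_tilde (\<lambda>x. 2 * (cmod (f x))\<^sup>2 + 2 * (cmod (g x))\<^sup>2)"
    using assms by (auto simp: square_integrable_def)
  then have "integrable mu_tilde (\<lambda>x. (cmod (f x + g x))\<^sup>2)"
    by (rule Bochner_Integration.integrable_bound) (auto intro: bound)
  then show ?thesis
    by (simp add: square_integrable_def)
qed

lemma square_integrable_inner:
  assumes "square_integrable f" "square_integrable g"
  shows "integrable mu_tilde (\<lambda>x. f x \<bullet> g x)"
proof -
  have [measurable]: "f \<in> borel_measurable mu_tilde" "g \<in> borel_measurable mu_tilde"
    using assms by (auto simp: square_integrable_def)
  have bound: "\<bar>a \<bullet> b\<bar> \<le> (cmod a)\<^sup>2 + (cmod b)\<^sup>2" for a b :: complex
  proof -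
    have "\<bar>a \<bullet> b\<bar> \<le> cmod a * cmod b"
      by (rule Cauchy_Schwarz_ineq2)
    also have "\<dots> \<le> (cmod a)\<^sup>2 + (cmod b)\<^sup>2"
      using sum_squares_bound[of "cmod a" "cmod b"] mult_nonneg_nonneg[of "cmod a" "cmod b"]
        norm_ge_zero[of a] norm_ge_zero[of b] by linarith
    finally show ?thesis .
  qed
  have "integrable mu_tilde (\<lambda>x. (cmod (f x))\<^sup>2 + (cmod (g x))\<^sup>2)"
    using assms by (auto simp: square_integrable_def)
  then show ?thesis
    by (rule Bochner_Integration.integrable_bound) (auto intro: order_trans[OF bound])
qed

quotient_type (overloaded) 'a l2 = "'a::euclidean_space \<Rightarrow> complex" / partial: l2_rel
proof (rule part_equivpI)
  show "\<exists>x. l2_rel x x"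
    by (rule exI[of _ "\<lambda>_. 0"]) (simp add: l2_rel_def square_integrable_zero)
  show "symp l2_rel"
    by (rule sympI) (auto simp: l2_rel_def)
  show "transp l2_rel"
    by (rule transpI) (auto simp: l2_rel_def)
qed

lift_definition scaleC_l2 :: "complex \<Rightarrow> 'a::euclidean_space l2 \<Rightarrow> 'a l2"
  is "\<lambda>c f x. c * f x"
  by (auto simp: l2_rel_def square_integrable_scale)

instantiation l2 :: (euclidean_space) real_inner
begin

lift_definition zero_l2 :: "'a l2" is "\<lambda>_. 0"
  by (simp add: l2_rel_def square_integrable_zero)

lift_definition plus_l2 :: "'a l2 \<Rightarrow> 'a l2 \<Rightarrow> 'a l2" is "\<lambda>f g x. f x + g x"
  by (auto simp: l2_rel_def square_integrable_add)

definition scaleR_l2 :: "real \<Rightarrow> 'a l2 \<Rightarrow> 'a l2" where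
  "scaleR_l2 r = scaleC_l2 (complex_of_real r)"

definition uminus_l2 :: "'a l2 \<Rightarrow> 'a l2" where
  "uminus_l2 = scaleC_l2 (- 1)"

definition minus_l2 :: "'a l2 \<Rightarrow> 'a l2 \<Rightarrow> 'a l2" where
  "minus_l2 f g = f + - g"

text \<open>The inner product of type class \<^class>\<open>real_inner\<close> is the real part of the usual complex
  inner product. It induces the usual norm.\<close>

lift_definition inner_l2 :: "'a l2 \<Rightarrow> 'a l2 \<Rightarrow> real"
  is "\<lambda>f g. integral\<^sup>L mu_tilde (\<lambda>x. f x \<bullet> g x)"
proof -
  fix f f' g g' :: "'a \<Rightarrow> complex"
  assume a: "l2_rel f f'" "l2_rel g g'"
  then have [measurable]: "f \<in> borel_measurable mu_tilde" "f' \<in> borel_measurable mu_tilde"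
    "g \<in> borel_measurable mu_tilde" "g' \<in> borel_measurable mu_tilde"
    by (auto simp: l2_rel_def square_integrable_def)
  show "integral\<^sup>L mu_tilde (\<lambda>x. f x \<bullet> g x) = integral\<^sup>L mu_tilde (\<lambda>x. f' x \<bullet> g' x)"
    using a by (intro integral_cong_AE) (auto simp: l2_rel_def)
qed

lift_definition norm_l2 :: "'a l2 \<Rightarrow> real"
  is "\<lambda>f. sqrt (integral\<^sup>L mu_tilde (\<lambda>x. (cmod (f x))\<^sup>2))"
proof -
  fix f f' :: "'a \<Rightarrow> complex"
  assume a: "l2_rel f f'"
  then have [measurable]: "f \<in> borel_measurable mu_tilde" "f' \<in> borel_measurable mu_tilde"
    by (auto simp: l2_rel_def square_integrable_def)
  have "integral\<^sup>L mu_tilde (\<lambda>x. (cmod (f x))\<^sup>2) = integral\<^sup>L mu_tilde (\<lambda>x. (cmod (f' x))\<^sup>2)"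
    using a by (intro integral_cong_AE) (auto simp: l2_rel_def)
  then show "sqrt (integral\<^sup>L mu_tilde (\<lambda>x. (cmod (f x))\<^sup>2)) =
      sqrt (integral\<^sup>L mu_tilde (\<lambda>x. (cmod (f' x))\<^sup>2))"
    by simp
qed

definition sgn_l2 :: "'a l2 \<Rightarrow> 'a l2" where
  "sgn_l2 f = inverse (norm f) *\<^sub>R f"

definition dist_l2 :: "'a l2 \<Rightarrow> 'a l2 \<Rightarrow> real" where
  "dist_l2 f g = norm (f - g)"

definition uniformity_l2 :: "('a l2 \<times> 'a l2) filter" where
  "uniformity_l2 = (INF e\<in>{0<..}. principal {(x, y). dist x y < e})"

definition open_l2 :: "'a l2 set \<Rightarrow> bool" where
  "open_l2 U = (\<forall>x\<in>U. \<forall>\<^sub>F (x', y) in uniformity. x' = x \<longrightarrow> y \<in> U)"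

instance
proof
  fix a b c :: "'a l2" and r s :: real and U :: "'a l2 set"
  show "a + b + c = a + (b + c)"
    by transfer (auto simp: l2_rel_def square_integrable_add add.assoc)
  show "a + b = b + a"
    by transfer (auto simp: l2_rel_def square_integrable_add add.commute)
  show "0 + a = a"
    by transfer (auto simp: l2_rel_def)
  show "- a + a = 0"
    unfolding uminus_l2_def
    by transfer (auto simp: l2_rel_def square_integrable_zero)
  show "a - b = a + - b"
    by (simp add: minus_l2_def)
  show "r *\<^sub>R (a + b) = r *\<^sub>R a + r *\<^sub>R b"
    unfolding scaleR_l2_def
    by transfer (auto simp: l2_rel_def square_integrable_add square_integrable_scale
        distrib_left simp del: distrib_left_numeral)
  show "(r + s) *\<^sub>R a = r *\<^sub>R a + s *\<^sub>R a"
    unfolding scaleR_l2_def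
    by transfer (auto simp: l2_rel_def distrib_right
        intro!: square_integrable_add square_integrable_scale)
  show "r *\<^sub>R s *\<^sub>R a = (r * s) *\<^sub>R a"
    unfolding scaleR_l2_def
    by transfer (auto simp: l2_rel_def mult.assoc intro!: square_integrable_scale)
  show "1 *\<^sub>R a = a"
    unfolding scaleR_l2_def
    by transfer (auto simp: l2_rel_def)
  show "sgn a = inverse (norm a) *\<^sub>R a"
    by (simp add: sgn_l2_def)
  show "dist a b = norm (a - b)"
    by (simp add: dist_l2_def)
  show "(uniformity :: ('a l2 \<times> 'a l2) filter) = (INF e\<in>{0<..}. principal {(x, y). dist x y < e})"
    by (simp add: uniformity_l2_def)
  show "open U = (\<forall>x\<in>U. \<forall>\<^sub>F (x', y) in uniformity. x' = x \<longrightarrow> y \<in> U)"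
    by (simp add: open_l2_def)
  show "a \<bullet> b = b \<bullet> a"
    by transfer (simp add: inner_commute)
  show "(a + b) \<bullet> c = a \<bullet> c + b \<bullet> c"
    by transfer (auto simp: l2_rel_def inner_add_left square_integrable_inner)
  show "(r *\<^sub>R a) \<bullet> b = r * (a \<bullet> b)"
    unfolding scaleR_l2_def
    by transfer (simp flip: scaleR_conv_of_real)
  show "0 \<le> a \<bullet> a"
    by transfer simp
  show "a \<bullet> a = 0 \<longleftrightarrow> a = 0"
  proof transfer
    fix f :: "'a \<Rightarrow> complex"
    assume "l2_rel f f"
    then have f: "square_integrable f"
      by (simp add: l2_rel_def)
    have "integral\<^sup>L mu_tilde (\<lambda>x. f x \<bullet> f x) = 0 \<longleftrightarrow> (AE x in mu_tilde. f x \<bullet> f x = 0)"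
      by (rule integral_nonneg_eq_0_iff_AE[OF square_integrable_inner[OF f f]]) simp
    then show "integral\<^sup>L mu_tilde (\<lambda>x. f x \<bullet> f x) = 0 \<longleftrightarrow> l2_rel f (\<lambda>_. 0)"
      by (simp add: l2_rel_def f square_integrable_zero)
  qed
  show "norm a = sqrt (a \<bullet> a)"
    by transfer (simp add: power2_norm_eq_inner)
qed

end

text \<open>\<open>abs_l2 f\<close> is the class of \<open>f\<close>, meaningful only if \<open>f\<close> is square-integrable; \<open>rep_l2 g\<close> is an
  arbitrary square-integrable representative of the class \<open>g\<close>.\<close>

text \<open>The direct sum of \<open>d\<close> copies of the Hilbert space, as tuples indexed by \<open>{1..d}\<close>.\<close>

definition l2_tuples :: "nat \<Rightarrow> (nat \<Rightarrow> 'a::euclidean_space l2) set" where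
  "l2_tuples d = {1..d} \<rightarrow>\<^sub>E UNIV"

definition l2_tuple_norm :: "nat \<Rightarrow> (nat \<Rightarrow> 'a::euclidean_space l2) \<Rightarrow> real" where
  "l2_tuple_norm d h = sqrt (\<Sum>j\<in>{1..d}. (norm (h j))\<^sup>2)"


section \<open>Polyanalytic functions and the Fock space\<close>

primrec times_cont_differentiable ::
    "nat \<Rightarrow> ('a::real_normed_vector \<Rightarrow> 'b::real_normed_vector) \<Rightarrow> bool" where
  "times_cont_differentiable 0 f \<longleftrightarrow> continuous_on UNIV f"
| "times_cont_differentiable (Suc k) f \<longleftrightarrow>
     (\<forall>x. f differentiable at x) \<and>
     (\<forall>v. times_cont_differentiable k (\<lambda>x. frechet_derivative f (at x) v))"

definition smooth :: "('a::real_normed_vector \<Rightarrow> 'b::real_normed_vector) \<Rightarrow> bool" where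
  "smooth f \<longleftrightarrow> (\<forall>k. times_cont_differentiable k f)"

definition wirtinger_bar ::
    "'n::finite \<Rightarrow> ('n cvec \<Rightarrow> complex) \<Rightarrow> 'n cvec \<Rightarrow> complex" where
  "wirtinger_bar r f z =
     (frechet_derivative f (at z) (axis r 1) + \<i> * frechet_derivative f (at z) (axis r \<i>)) / 2"

definition D_bar ::
    "('n::{finite,linorder} \<Rightarrow> nat) \<Rightarrow> ('n cvec \<Rightarrow> complex) \<Rightarrow> 'n cvec \<Rightarrow> complex" where
  "D_bar k f = foldr (\<lambda>r g. (wirtinger_bar r ^^ k r) g) (sorted_list_of_set UNIV) f"

definition polyanalytic :: "nat \<Rightarrow> ('n::{finite,linorder} cvec \<Rightarrow> complex) \<Rightarrow> bool" where
  "polyanalytic m f \<longleftrightarrow>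
     smooth f \<and> (\<forall>k. (\<Sum>r\<in>UNIV. k r) = m \<longrightarrow> (\<forall>z. D_bar k f z = 0))"

definition fock_space :: "real \<Rightarrow> nat \<Rightarrow> ('n::{finite,linorder} cvec \<Rightarrow> complex) set" where
  "fock_space \<alpha> m =
     {f. polyanalytic m f \<and>
         integrable lborel (\<lambda>z. (cmod (f z))\<^sup>2 * exp (- \<alpha> * (norm z)\<^sup>2))}"

definition fock_norm :: "real \<Rightarrow> ('n::finite cvec \<Rightarrow> complex) \<Rightarrow> real" where
  "fock_norm \<alpha> f =
     sqrt (\<alpha> ^ CARD('n) / pi ^ CARD('n) *
       integral\<^sup>L lborel (\<lambda>z. (cmod (f z))\<^sup>2 * exp (- \<alpha> * (norm z)\<^sup>2)))"

definition complex_vec :: "'n::finite rvec \<Rightarrow> 'n rvec \<Rightarrow> 'n cvec" where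
  "complex_vec x y = (\<chi> r. Complex (x $ r) (y $ r))"

definition U_fock ::
    "real \<Rightarrow> ('n::finite cvec \<Rightarrow> complex) \<Rightarrow> 'n rvec \<times> 'n rvec \<Rightarrow> complex" where
  "U_fock \<alpha> f = (\<lambda>(x, y).
     complex_of_real (2 powr (real CARD('n) / 2)) *
     exp (complex_of_real (- (1/2) * (norm x)\<^sup>2 - (1/2) * (norm y)\<^sup>2) -
          \<i> * complex_of_real (x \<bullet> y)) *
     f ((1 / sqrt \<alpha>) *\<^sub>R complex_vec x y))"


section \<open>Hermite functions and multi-indices\<close>

definition hermite :: "nat \<Rightarrow> real \<Rightarrow> real" where
  "hermite j t = (- 1) ^ j * exp (t\<^sup>2) * (deriv ^^ j) (\<lambda>s. exp (- (s\<^sup>2))) t"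

definition hermite_fun :: "nat \<Rightarrow> real \<Rightarrow> real" where
  "hermite_fun j t = (2 ^ j * fact j * sqrt pi) powr (- (1/2)) * exp (- (t\<^sup>2) / 2) * hermite j t"

definition multi_indices :: "nat \<Rightarrow> ('n::finite \<Rightarrow> nat) set" where
  "multi_indices m = {k. (\<Sum>r\<in>UNIV. k r) \<le> m - 1}"

definition lex_enum :: "nat \<Rightarrow> nat \<Rightarrow> 'n::{finite,linorder} \<Rightarrow> nat" where
  "lex_enum m = (THE \<phi>.
     let J = (multi_indices m :: ('n \<Rightarrow> nat) set) in
     \<phi> \<in> extensional {1..card J} \<and> bij_betw \<phi> {1..card J} J \<and>
     (\<forall>i\<in>{1..card J}. \<forall>j\<in>{1..card J}. i < j \<longrightarrow> less_fun (\<phi> i) (\<phi> j)))"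

definition q_fun :: "('n::finite \<Rightarrow> nat) \<Rightarrow> 'n rvec \<Rightarrow> 'n rvec \<Rightarrow> real" where
  "q_fun k \<xi> v =
     2 powr (real CARD('n) / 2) * pi powr (real CARD('n) / 4) *
     (\<Prod>r\<in>UNIV. hermite_fun (k r) ((\<xi> $ r + 2 * v $ r) / sqrt 2))"


section \<open>The Fourier--Plancherel transform and the operator R\<close>

definition fourier_integral ::
    "('a::euclidean_space \<Rightarrow> complex) \<Rightarrow> 'a \<Rightarrow> complex" where
  "fourier_integral h \<xi> =
     integral\<^sup>L mu_tilde (\<lambda>u. h u * exp (- \<i> * complex_of_real (u \<bullet> \<xi>)))"

text \<open>The unique continuous extension from the dense subspace of classes of integrable
  square-integrable functions. Real linearity is enough for uniqueness, since that subspace is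
  closed under complex scalars.\<close>

definition fourier_plancherel :: "'a::euclidean_space l2 \<Rightarrow> 'a l2" where
  "fourier_plancherel = (THE T. bounded_linear T \<and>
     (\<forall>h. square_integrable h \<and> integrable mu_tilde h \<longrightarrow>
        T (abs_l2 h) = abs_l2 (fourier_integral h)))"

definition tensor_l2 ::
    "'a::euclidean_space l2 \<Rightarrow> 'b::euclidean_space l2 \<Rightarrow> ('a \<times> 'b) l2" where
  "tensor_l2 h g = abs_l2 (\<lambda>(u, v). rep_l2 h u * rep_l2 g v)"

text \<open>The operator \<open>F \<otimes> I\<close>, the unique bounded operator with the prescribed values on
  elementary tensors, whose span is dense.\<close>

definition fourier_tensor_id ::
    "('a::euclidean_space \<times> 'b::euclidean_space) l2 \<Rightarrow> ('a \<times> 'b) l2" where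
  "fourier_tensor_id = (THE T. bounded_linear T \<and>
     (\<forall>h g. T (tensor_l2 h g) = tensor_l2 (fourier_plancherel h) g))"

definition N_op ::
    "nat \<Rightarrow> ('n rvec \<times> 'n rvec) l2 \<Rightarrow> nat \<Rightarrow> 'n::{finite,linorder} rvec l2" where
  "N_op m g = (\<lambda>j\<in>{1..card (multi_indices m :: ('n \<Rightarrow> nat) set)}.
     abs_l2 (\<lambda>\<xi>. integral\<^sup>L mu_tilde
       (\<lambda>v. rep_l2 g (\<xi>, v) * complex_of_real (q_fun (lex_enum m j) \<xi> v))))"

definition R_H ::
    "nat \<Rightarrow> ('n rvec \<times> 'n rvec) l2 \<Rightarrow> nat \<Rightarrow> 'n::{finite,linorder} rvec l2" where
  "R_H m g = N_op m (fourier_tensor_id g)"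

definition R_fock ::
    "real \<Rightarrow> nat \<Rightarrow> ('n::{finite,linorder} cvec \<Rightarrow> complex) \<Rightarrow> nat \<Rightarrow> 'n rvec l2" where
  "R_fock \<alpha> m f = R_H m (abs_l2 (U_fock \<alpha> f))"

definition fock_isometric_isomorphism ::
    "real \<Rightarrow> nat \<Rightarrow> nat \<Rightarrow>
     (('n::{finite,linorder} cvec \<Rightarrow> complex) \<Rightarrow> nat \<Rightarrow> 'n rvec l2) \<Rightarrow> bool" where
  "fock_isometric_isomorphism \<alpha> m d T \<longleftrightarrow>
     bij_betw T (fock_space \<alpha> m) (l2_tuples d) \<and>
     (\<forall>f\<in>fock_space \<alpha> m. \<forall>g\<in>fock_space \<alpha> m.
        T (\<lambda>z. f z + g z) = (\<lambda>j\<in>{1..d}. T f j + T g j)) \<and>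
     (\<forall>c. \<forall>f\<in>fock_space \<alpha> m. T (\<lambda>z. c * f z) = (\<lambda>j\<in>{1..d}. scaleC_l2 c (T f j))) \<and>
     (\<forall>f\<in>fock_space \<alpha> m. l2_tuple_norm d (T f) = fock_norm \<alpha> f)"

definition R_integrand ::
    "real \<Rightarrow> ('n::finite \<Rightarrow> nat) \<Rightarrow> ('n cvec \<Rightarrow> complex) \<Rightarrow> 'n rvec \<Rightarrow>
     'n rvec \<times> 'n rvec \<Rightarrow> complex" where
  "R_integrand \<alpha> k f \<xi> = (\<lambda>(u, v).
     f ((1 / sqrt \<alpha>) *\<^sub>R complex_vec u v) *
     exp (complex_of_real (- (1/2) * (norm u)\<^sup>2 - (1/2) * (norm v)\<^sup>2) -
          \<i> * complex_of_real (u \<bullet> (v + \<xi>))) *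
     complex_of_real (\<Prod>r\<in>UNIV. hermite_fun (k r) ((\<xi> $ r + 2 * v $ r) / sqrt 2)))"

end

theory Submission imports Defs "HOL-Probability.Probability" begin

text \<open>Write \<open>z = x + i v\<close>. Under \<open>U_fock\<close>, the inverse partial Fourier transform of
  \<open>q_tensor l (test_fun w)\<close>, where \<open>test_fun w\<close> is a modulated Gaussian, corresponds to one of the
  functions \<open>cnj (z - w) ^ l\<close> times a reproducing kernel. In the pairing with \<open>f\<close>, the conjugate of such
  a function together with the Gaussian weight is, up to sign, the \<open>k\<close>-th Wirtinger derivative of the
  one with \<open>l - k\<close> instead of \<open>l\<close>. Integration by parts with \<open>\<bar>k\<bar> = m\<close> and \<open>k \<le> l\<close> shows that
  \<open>m\<close>-analytic functions are orthogonal to all of them with \<open>\<bar>l\<bar> \<ge> m\<close>: for almost every \<open>\<xi>\<close>, the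
  function \<open>v \<mapsto> (F \<otimes> I)(U f)(\<xi>, v)\<close> only has components along the \<open>q_fun l \<xi>\<close> with \<open>\<bar>l\<bar> < m\<close>. As the
  \<open>q_fun l \<xi>\<close> form an orthonormal basis, Parseval's identity makes \<open>R\<close> isometric.

  For surjectivity, the inverse transform of \<open>\<Sum>k. h k \<xi> * q_fun k \<xi> v\<close> is computed explicitly: expanding
  the Hermite polynomials in powers of \<open>v\<close> produces polynomials in the imaginary parts of degree less
  than \<open>m\<close>, whose coefficients are the Laplace integrals \<open>\<integral> \<eta> \<xi> * exp (i z \<cdot> \<xi>)\<close> of functions \<open>\<eta>\<close>
  decaying faster than every exponential, hence entire.\<close>

section \<open>Square-integrable classes: completeness and dense subsets\<close>

subsection \<open>The measure\<close>

text \<open>Two obstacles shape the proof. The operators \<open>fourier_plancherel\<close> and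
  \<open>fourier_tensor_id\<close> are given by unique existence, so completeness of the space of
  classes, Plancherel's theorem and density of the span of elementary tensors come before any
  evaluation of them. And for \<open>f\<close> in the Fock space only a weighted square integral is
  controlled, none of its derivatives; so integration by parts is done against compactly supported
  factors, and the cut-off is removed only after all derivatives have left \<open>f\<close>. The
  explicit computations rest on one identity. In each coordinate \<open>q_fun k \<xi> v\<close>
  contains the exponent \<open>- (\<xi> + 2 v)^2 / 4\<close>, and \<open>- (\<xi> + 2 v)^2 / 4 + i x
  \<xi> = - v^2 - \<xi>^2 / 4 + i (x + i v) \<xi>\<close>. So apart from
  \<open>exp (- |v|^2)\<close> and the Hermite factors the inverse transform sees \<open>x\<close>
  and \<open>v\<close> only through \<open>z = x + i v\<close>. The factor of \<open>U_fock\<close>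
  splits in the same way: its exponent is \<open>- |v|^2\<close> minus half the sum of the
  \<open>z_r^2\<close>.\<close>

lemma sets_mu_tilde [simp, measurable_cong]: "sets mu_tilde = sets borel"
  by (simp add: mu_tilde_def)

lemma space_mu_tilde [simp]: "space mu_tilde = UNIV"
  by (simp add: mu_tilde_def)

definition mu_const :: "'a::euclidean_space itself \<Rightarrow> real" where
  "mu_const _ = (2 * pi) powr (- real DIM('a) / 2)"

lemma mu_const_pos [simp]: "mu_const TYPE('a::euclidean_space) > 0"
  by (simp add: mu_const_def)

lemma mu_const_nonneg [simp]: "mu_const TYPE('a::euclidean_space) \<ge> 0"
  using mu_const_pos less_imp_le by blast

lemma mu_const_nonzero [simp]: "mu_const TYPE('a::euclidean_space) \<noteq> 0"
  using mu_const_pos less_numeral_extra(3) by metis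

lemma mu_tilde_eq: "(mu_tilde :: 'a::euclidean_space measure) =
    density lborel (\<lambda>_. ennreal (mu_const TYPE('a)))"
  by (simp add: mu_tilde_def mu_const_def)

lemma emeasure_mu_tilde: "A \<in> sets borel \<Longrightarrow>
    emeasure (mu_tilde :: 'a::euclidean_space measure) A = mu_const TYPE('a) * emeasure lborel A"
  by (simp add: mu_tilde_eq emeasure_density nn_integral_cmult)

lemma AE_mu_tilde_iff [simp]: "(AE x in (mu_tilde :: 'a::euclidean_space measure). P x) \<longleftrightarrow> (AE x in lborel. P x)"
  unfolding mu_tilde_eq by (subst AE_density) auto

lemma integrable_mu_tilde_iff:
  fixes f :: "'a::euclidean_space \<Rightarrow> 'b::{banach, second_countable_topology}"
  shows "integrable mu_tilde f \<longleftrightarrow> integrable lborel f"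
proof (cases "f \<in> borel_measurable borel")
  case True
  then have "integrable mu_tilde f \<longleftrightarrow> integrable lborel (\<lambda>x. mu_const TYPE('a) *\<^sub>R f x)"
    unfolding mu_tilde_eq by (intro integrable_density) auto
  also have "\<dots> \<longleftrightarrow> integrable lborel f"
  proof
    assume "integrable lborel (\<lambda>x. mu_const TYPE('a) *\<^sub>R f x)"
    then have "integrable lborel (\<lambda>x. inverse (mu_const TYPE('a)) *\<^sub>R (mu_const TYPE('a) *\<^sub>R f x))"
      by (rule integrable_scaleR_right)
    then show "integrable lborel f" by simp
  qed simp
  finally show ?thesis .
next
  case False
  then show ?thesis
    using borel_measurable_integrable[of mu_tilde f] borel_measurable_integrable[of lborel f]
    by (auto simp: measurable_cong_sets[OF sets_mu_tilde refl])
qed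

lemma integral_mu_tilde:
  fixes f :: "'a::euclidean_space \<Rightarrow> 'b::{banach, second_countable_topology}"
  shows "integral\<^sup>L mu_tilde f = mu_const TYPE('a) *\<^sub>R integral\<^sup>L lborel f"
proof (cases "f \<in> borel_measurable borel")
  case True
  then have "integral\<^sup>L mu_tilde f = integral\<^sup>L lborel (\<lambda>x. mu_const TYPE('a) *\<^sub>R f x)"
    unfolding mu_tilde_eq by (intro integral_density) auto
  then show ?thesis by simp
next
  case False
  then have "\<not> integrable mu_tilde f" "\<not> integrable lborel f"
    using borel_measurable_integrable[of mu_tilde f] borel_measurable_integrable[of lborel f]
    by (auto simp: measurable_cong_sets[OF sets_mu_tilde refl])
  then show ?thesis
    by (simp add: not_integrable_integral_eq)
qed

lemma sigma_finite_mu_tilde: "sigma_finite_measure (mu_tilde :: 'a::euclidean_space measure)"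
  unfolding mu_tilde_eq
  by (subst sigma_finite_measure.sigma_finite_iff_density_finite'[OF sigma_finite_lborel]) auto

interpretation mu: sigma_finite_measure "mu_tilde :: 'a::euclidean_space measure"
  by (rule sigma_finite_mu_tilde)

interpretation mu_pair: pair_sigma_finite "mu_tilde :: 'a::euclidean_space measure"
  "mu_tilde :: 'b::euclidean_space measure" ..

lemma mu_const_prod: "mu_const TYPE('a::euclidean_space \<times> 'b::euclidean_space) =
    mu_const TYPE('a) * mu_const TYPE('b)"
  by (simp add: mu_const_def powr_add[symmetric] add_divide_distrib diff_divide_distrib)

text \<open>The normalising factor is multiplicative in the dimension. Hence Fubini applies to
  \<open>mu_tilde\<close> itself, without any bookkeeping of powers of
  \<open>2 * pi\<close>.\<close>

lemma mu_tilde_prod: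
  "(mu_tilde :: 'a::euclidean_space measure) \<Otimes>\<^sub>M (mu_tilde :: 'b::euclidean_space measure) = mu_tilde"
proof -
  have "(mu_tilde :: 'a measure) \<Otimes>\<^sub>M (mu_tilde :: 'b measure) =
      density (lborel \<Otimes>\<^sub>M lborel) (\<lambda>(x, y). ennreal (mu_const TYPE('a)) * ennreal (mu_const TYPE('b)))"
    unfolding mu_tilde_eq
    by (rule pair_measure_density)
      (auto intro: sigma_finite_lborel mu.sigma_finite_measure_axioms[unfolded mu_tilde_eq])
  also have "\<dots> = mu_tilde"
    by (simp add: lborel_prod mu_tilde_eq mu_const_prod ennreal_mult split_def)
  finally show ?thesis .
qed

lemma lborel_translation_measure: "distr lborel borel (\<lambda>x. x + a) = (lborel :: 'a::euclidean_space measure)"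
  using lborel_distr_plus[of a] by (metis (no_types, lifting) add.commute distr_cong)

lemma integral_mu_translate:
  fixes f :: "'a::euclidean_space \<Rightarrow> 'b::{banach, second_countable_topology}"
  assumes [measurable]: "f \<in> borel_measurable borel"
  shows "integral\<^sup>L mu_tilde (\<lambda>x. f (x + a)) = integral\<^sup>L mu_tilde f"
proof -
  have "integral\<^sup>L lborel f = integral\<^sup>L (distr lborel borel (\<lambda>x. x + a)) f"
    by (simp add: lborel_translation_measure)
  also have "\<dots> = integral\<^sup>L lborel (\<lambda>x. f (x + a))"
    by (rule integral_distr) auto
  finally show ?thesis by (simp add: integral_mu_tilde)
qed

lemma integrable_mu_translate:
  fixes f :: "'a::euclidean_space \<Rightarrow> 'b::{banach, second_countable_topology}"
  assumes "integrable mu_tilde f"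
  shows "integrable mu_tilde (\<lambda>x. f (x + a))"
proof -
  have [measurable]: "f \<in> borel_measurable borel"
    using assms by (simp add: borel_measurable_integrable measurable_cong_sets[OF sets_mu_tilde refl, symmetric])
  have "integrable (distr lborel borel (\<lambda>x. x + a)) f"
    using assms by (simp add: lborel_translation_measure integrable_mu_tilde_iff)
  then show ?thesis
    by (subst (asm) integrable_distr_eq) (auto simp: integrable_mu_tilde_iff)
qed

subsection \<open>Classes of square-integrable functions\<close>

lemma square_integrable_measurable [measurable_dest]:
  "square_integrable f \<Longrightarrow> f \<in> borel_measurable borel"
  by (simp add: square_integrable_def measurable_cong_sets[OF sets_mu_tilde refl])

lemma square_integrableD: "square_integrable f \<Longrightarrow> integrable mu_tilde (\<lambda>x. (cmod (f x))\<^sup>2)"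
  by (simp add: square_integrable_def)

lemma square_integrableI:
  "f \<in> borel_measurable borel \<Longrightarrow> integrable mu_tilde (\<lambda>x. (cmod (f x))\<^sup>2) \<Longrightarrow> square_integrable f"
  by (simp add: square_integrable_def measurable_cong_sets[OF sets_mu_tilde refl])

lemma square_integrableI_nn:
  assumes [measurable]: "f \<in> borel_measurable borel"
    and "(\<integral>\<^sup>+x. ennreal ((cmod (f x))\<^sup>2) \<partial>mu_tilde) < \<infinity>"
  shows "square_integrable f"
proof (rule square_integrableI)
  show "integrable mu_tilde (\<lambda>x. (cmod (f x))\<^sup>2)"
    using assms(2) by (intro integrableI_nonneg) auto
qed (rule assms)

lemma square_integrable_bound:
  assumes "square_integrable f" "g \<in> borel_measurable borel"
    and "AE x in mu_tilde. cmod (g x) \<le> cmod (f x)"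
  shows "square_integrable g"
proof (rule square_integrableI)
  have [measurable]: "g \<in> borel_measurable borel" by (rule assms)
  show "integrable mu_tilde (\<lambda>x. (cmod (g x))\<^sup>2)"
    by (rule Bochner_Integration.integrable_bound[OF square_integrableD[OF assms(1)]])
      (use assms(3) in \<open>auto intro: power_mono\<close>)
qed (rule assms)

lemma square_integrable_uminus: "square_integrable f \<Longrightarrow> square_integrable (\<lambda>x. - f x)"
  using square_integrable_scale[of f "-1"] by simp

lemma square_integrable_diff:
  "square_integrable f \<Longrightarrow> square_integrable g \<Longrightarrow> square_integrable (\<lambda>x. f x - g x)"
  using square_integrable_add[OF _ square_integrable_uminus, of f g] by simp

lemma square_integrable_sum:
  "(\<And>i. i \<in> I \<Longrightarrow> square_integrable (f i)) \<Longrightarrow> square_integrable (\<lambda>x. \<Sum>i\<in>I. f i x)"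
  by (induction I rule: infinite_finite_induct)
    (auto intro: square_integrable_add square_integrable_zero)

lemma borel_measurable_cnj [measurable]: "cnj \<in> borel_measurable borel"
  by (intro borel_measurable_continuous_onI continuous_intros)

lemma square_integrable_cnj: "square_integrable f \<Longrightarrow> square_integrable (\<lambda>x. cnj (f x))"
  by (rule square_integrable_bound[of f]) (auto intro: measurable_compose[OF square_integrable_measurable])

lemma integrable_mult_square_integrable:
  assumes "square_integrable f" "square_integrable g"
  shows "integrable mu_tilde (\<lambda>x. f x * g x)"
proof -
  have [measurable]: "f \<in> borel_measurable borel" "g \<in> borel_measurable borel"
    using assms by auto
  have "integrable mu_tilde (\<lambda>x. (cmod (f x))\<^sup>2 + (cmod (g x))\<^sup>2)"
    using assms by (auto dest: square_integrableD)
  then show ?thesis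
  proof (rule Bochner_Integration.integrable_bound)
    show "AE x in mu_tilde. norm (f x * g x) \<le> norm ((cmod (f x))\<^sup>2 + (cmod (g x))\<^sup>2)"
    proof (rule AE_I2)
      fix x
      show "norm (f x * g x) \<le> norm ((cmod (f x))\<^sup>2 + (cmod (g x))\<^sup>2)"
        using sum_squares_bound[of "cmod (f x)" "cmod (g x)"]
          mult_nonneg_nonneg[OF norm_ge_zero[of "f x"] norm_ge_zero[of "g x"]]
        unfolding norm_mult real_norm_def by linarith
    qed
  qed simp
qed

lemma square_integrable_rep [simp]: "square_integrable (rep_l2 a)"
  using Quotient3_rep_reflp[OF Quotient3_l2, of a] by (simp add: l2_rel_def)

lemma abs_rep_l2 [simp]: "abs_l2 (rep_l2 a) = a"
  by (rule Quotient3_abs_rep[OF Quotient3_l2])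

lemma abs_l2_eqI:
  "square_integrable f \<Longrightarrow> square_integrable g \<Longrightarrow> AE x in lborel. f x = g x \<Longrightarrow> abs_l2 f = abs_l2 g"
  by (rule Quotient3_rel_abs[OF Quotient3_l2]) (simp add: l2_rel_def)

lemma abs_l2_eqD:
  assumes "square_integrable f" "square_integrable g" "abs_l2 f = abs_l2 g"
  shows "AE x in lborel. f x = g x"
  using Quotient3_rel[OF Quotient3_l2, of f g] assms by (simp add: l2_rel_def)

lemma rep_abs_l2: "square_integrable f \<Longrightarrow> AE x in lborel. rep_l2 (abs_l2 f) x = f x"
  by (rule abs_l2_eqD) auto

lemma abs_l2_induct [case_names abs]:
  "(\<And>f. square_integrable f \<Longrightarrow> P (abs_l2 f)) \<Longrightarrow> P a"
  by (metis abs_rep_l2 square_integrable_rep)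

lemma abs_l2_add: "square_integrable f \<Longrightarrow> square_integrable g \<Longrightarrow>
    abs_l2 f + abs_l2 g = abs_l2 (\<lambda>x. f x + g x)"
  by (rule plus_l2.abs_eq) (auto simp: l2_rel_def)

lemma abs_l2_scaleC: "square_integrable f \<Longrightarrow> scaleC_l2 c (abs_l2 f) = abs_l2 (\<lambda>x. c * f x)"
  by (rule scaleC_l2.abs_eq) (auto simp: l2_rel_def)

lemma abs_l2_zero: "abs_l2 (\<lambda>_. 0) = 0"
  by (simp add: zero_l2.abs_eq)

lemma abs_l2_diff: "square_integrable f \<Longrightarrow> square_integrable g \<Longrightarrow>
    abs_l2 f - abs_l2 g = abs_l2 (\<lambda>x. f x - g x)"
  using square_integrable_uminus[of g]
  by (simp add: minus_l2_def uminus_l2_def abs_l2_scaleC abs_l2_add)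

lemma abs_l2_sum:
  "(\<And>i. i \<in> I \<Longrightarrow> square_integrable (f i)) \<Longrightarrow>
    (\<Sum>i\<in>I. abs_l2 (f i)) = abs_l2 (\<lambda>x. \<Sum>i\<in>I. f i x)"
  by (induction I rule: infinite_finite_induct)
    (auto simp: abs_l2_zero abs_l2_add square_integrable_sum)

lemma norm_abs_l2: "square_integrable f \<Longrightarrow> norm (abs_l2 f) = sqrt (integral\<^sup>L mu_tilde (\<lambda>x. (cmod (f x))\<^sup>2))"
  by (rule norm_l2.abs_eq) (auto simp: l2_rel_def)

lemma norm_abs_l2_sq: "square_integrable f \<Longrightarrow> (norm (abs_l2 f))\<^sup>2 = integral\<^sup>L mu_tilde (\<lambda>x. (cmod (f x))\<^sup>2)"
  by (simp add: norm_abs_l2)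

lemma nn_integral_norm_abs_l2: "square_integrable f \<Longrightarrow>
    (\<integral>\<^sup>+x. ennreal ((cmod (f x))\<^sup>2) \<partial>mu_tilde) = ennreal ((norm (abs_l2 f))\<^sup>2)"
  by (subst nn_integral_eq_integral) (auto dest: square_integrableD simp: norm_abs_l2_sq)

lemma square_integrable_norm_leI:
  assumes [measurable]: "f \<in> borel_measurable borel"
    and le: "(\<integral>\<^sup>+x. ennreal ((cmod (f x))\<^sup>2) \<partial>mu_tilde) \<le> ennreal (c\<^sup>2)" and c: "c \<ge> 0"
  shows "square_integrable f" "norm (abs_l2 f) \<le> c"
proof -
  show f: "square_integrable f"
    using le by (intro square_integrableI_nn) (auto intro: le_less_trans)
  have "(norm (abs_l2 f))\<^sup>2 \<le> c\<^sup>2"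
    using le by (simp add: nn_integral_norm_abs_l2[OF f])
  then show "norm (abs_l2 f) \<le> c"
    using c by (rule power2_le_imp_le)
qed

lemma inner_abs_l2: "square_integrable f \<Longrightarrow> square_integrable g \<Longrightarrow>
    abs_l2 f \<bullet> abs_l2 g = Re (integral\<^sup>L mu_tilde (\<lambda>x. f x * cnj (g x)))"
proof -
  assume a: "square_integrable f" "square_integrable g"
  have "abs_l2 f \<bullet> abs_l2 g = integral\<^sup>L mu_tilde (\<lambda>x. f x \<bullet> g x)"
    by (rule inner_l2.abs_eq) (auto simp: l2_rel_def a)
  also have "\<dots> = integral\<^sup>L mu_tilde (\<lambda>x. Re (f x * cnj (g x)))"
    by (simp add: inner_complex_def)
  also have "\<dots> = Re (integral\<^sup>L mu_tilde (\<lambda>x. f x * cnj (g x)))"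
    by (rule integral_Re) (intro integrable_mult_square_integrable square_integrable_cnj a)
  finally show ?thesis .
qed

lemma scaleC_l2_add: "scaleC_l2 c (a + b) = scaleC_l2 c a + scaleC_l2 c (b :: 'a::euclidean_space l2)"
  by transfer (auto simp: l2_rel_def distrib_left intro!: square_integrable_add square_integrable_scale)

lemma scaleC_scaleC_l2: "scaleC_l2 c (scaleC_l2 e a) = scaleC_l2 (c * e) (a :: 'a::euclidean_space l2)"
  by transfer (auto simp: l2_rel_def mult.assoc intro!: square_integrable_scale)

lemma norm_scaleC_l2: "norm (scaleC_l2 c a) = cmod c * norm (a :: 'a::euclidean_space l2)"
  by transfer (auto simp: norm_mult power_mult_distrib real_sqrt_mult)

lemma bounded_linear_scaleC_l2: "bounded_linear (scaleC_l2 c :: 'a::euclidean_space l2 \<Rightarrow> 'a l2)"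
  by (rule bounded_linear_intro[where K="cmod c"])
    (simp_all add: scaleC_l2_add norm_scaleC_l2 scaleR_l2_def scaleC_scaleC_l2 mult.commute)

lemma uminus_scaleC_l2: "- a = scaleC_l2 (-1) (a :: 'a::euclidean_space l2)"
  by (simp add: uminus_l2_def)

text \<open>Only the real inner product belongs to the type class. Letting the scalar run through
  \<open>1\<close> and \<open>\<i>\<close> recovers both parts of the complex one.\<close>

lemma inner_scaleC_left_all_zero:
  assumes f: "square_integrable f" and g: "square_integrable g"
    and "\<And>c. abs_l2 f \<bullet> scaleC_l2 c (abs_l2 g) = 0"
  shows "integral\<^sup>L mu_tilde (\<lambda>x. f x * cnj (g x)) = 0"
proof -
  have "Re (cnj c * integral\<^sup>L mu_tilde (\<lambda>x. f x * cnj (g x))) = 0" for c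
    using assms(3)[of c]
    by (simp add: abs_l2_scaleC g inner_abs_l2 f square_integrable_scale mult.left_commute
        integral_mult_right_zero[symmetric] del: integral_mult_right_zero)
  from this[of 1] this[of \<i>] show ?thesis
    by (simp add: complex_eq_iff)
qed

subsection \<open>Completeness\<close>

text \<open>Riesz--Fischer. Completeness of the target is what lets an isometry on a dense subspace
  extend; through this it provides the operators that are defined by unique existence.\<close>

instance l2 :: (euclidean_space) complete_space
proof
  fix X :: "nat \<Rightarrow> 'a l2"
  assume X: "Cauchy X"
  define f0 where "f0 n = rep_l2 (X n)" for n
  obtain r :: "nat \<Rightarrow> nat" where r: "strict_mono r"
    and r_dist: "\<And>n. norm (X (r (Suc n)) - X (r n)) < (1/2) ^ n"
  proof -
    have "\<exists>N. \<forall>n\<ge>N. \<forall>m\<ge>N. dist (X n) (X m) < (1/2) ^ k" for k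
      using metric_CauchyD[OF X, of "(1/2) ^ k"] by auto
    then obtain M where M: "\<And>k n m. n \<ge> M k \<Longrightarrow> m \<ge> M k \<Longrightarrow> dist (X n) (X m) < (1/2) ^ k"
      by metis
    \<comment> \<open>The maximum with \<open>Suc n\<close> forces strict growth, the one with
      \<open>M (Suc k)\<close> puts \<open>r k\<close> into the range where distances stay below
      \<open>(1/2) ^ k\<close>.\<close>
    define r where "r = rec_nat (M 0) (\<lambda>k n. max (Suc n) (M (Suc k)))"
    have r_Suc: "r (Suc k) = max (Suc (r k)) (M (Suc k))" for k
      by (simp add: r_def)
    have "r k \<ge> M k" for k
      by (cases k) (auto simp: r_Suc, simp add: r_def)
    moreover have "r k \<le> r (Suc k)" for k
      by (simp add: r_Suc)
    ultimately have "norm (X (r (Suc n)) - X (r n)) < (1/2) ^ n" for n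
      using M[of n "r (Suc n)" "r n"] by (metis dist_norm order_trans)
    moreover have "strict_mono r"
      by (rule strict_mono_Suc_iff[THEN iffD2]) (simp add: r_Suc less_max_iff_disj)
    ultimately show ?thesis using that by blast
  qed
  define f where "f n = rep_l2 (X (r n))" for n
  have f: "square_integrable (f n)" for n
    by (simp add: f_def)
  have [measurable]: "f n \<in> borel_measurable borel" for n
    using f by auto
  have abs_f: "abs_l2 (f n) = X (r n)" for n
    by (simp add: f_def)
  define u where "u K x = (\<Sum>k<K. cmod (f (Suc k) x - f k x))" for K x
  have [measurable]: "u K \<in> borel_measurable borel" for K
    unfolding u_def by measurable
  have si: "square_integrable (\<lambda>x. of_real (cmod (f (Suc k) x - f k x)))" for k
    by (rule square_integrable_bound[OF square_integrable_diff[OF f f, of "Suc k" k]]) auto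
  have u: "square_integrable (\<lambda>x. of_real (u K x)) \<and>
      norm (abs_l2 (\<lambda>x. of_real (u K x))) \<le> (\<Sum>k<K. (1/2) ^ k)" for K
  proof (induction K)
    case 0
    then show ?case by (simp add: u_def square_integrable_zero abs_l2_zero)
  next
    case (Suc K)
    have "norm (abs_l2 (\<lambda>x. of_real (cmod (f (Suc K) x - f K x)))) = norm (X (r (Suc K)) - X (r K))"
      using si[of K] square_integrable_diff[OF f f, of "Suc K" K]
      by (simp add: abs_f[symmetric] abs_l2_diff f norm_abs_l2)
    then have "norm (abs_l2 (\<lambda>x. of_real (u K x)) + abs_l2 (\<lambda>x. of_real (cmod (f (Suc K) x - f K x))))
        \<le> (\<Sum>k<K. (1/2) ^ k) + (1/2) ^ K"
      using Suc r_dist[of K] by (intro norm_triangle_mono) auto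
    moreover have "(\<lambda>x. complex_of_real (u (Suc K) x)) =
        (\<lambda>x. of_real (u K x) + of_real (cmod (f (Suc K) x - f K x)))"
      by (simp add: u_def)
    ultimately show ?case
      using Suc si[of K] by (simp add: abs_l2_add square_integrable_add)
  qed
  \<comment> \<open>The bound is the square of the full geometric sum \<open>2\<close>. Monotone
    convergence then makes the increments of \<open>f\<close> absolutely summable almost
    everywhere.\<close>
  have nn_u: "(\<integral>\<^sup>+x. ennreal ((u K x)\<^sup>2) \<partial>mu_tilde) \<le> 4" for K
  proof -
    have "(\<Sum>k<K. (1/2) ^ k) \<le> (2 :: real)"
      using geometric_sum[of "1/2 :: real" K] by simp
    then have "norm (abs_l2 (\<lambda>x. of_real (u K x))) \<le> 2"
      using u[of K] by linarith
    then have "(norm (abs_l2 (\<lambda>x. of_real (u K x))))\<^sup>2 \<le> 2\<^sup>2"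
      by (intro power_mono) auto
    then have "ennreal ((norm (abs_l2 (\<lambda>x. of_real (u K x))))\<^sup>2) \<le> ennreal 4"
      by (intro ennreal_leI) simp
    then show ?thesis
      using nn_integral_norm_abs_l2[of "\<lambda>x. of_real (u K x)"] u[of K] by simp
  qed
  have "(\<integral>\<^sup>+x. (SUP K. ennreal ((u K x)\<^sup>2)) \<partial>mu_tilde) = (SUP K. \<integral>\<^sup>+x. ennreal ((u K x)\<^sup>2) \<partial>mu_tilde)"
  proof (rule nn_integral_monotone_convergence_SUP)
    show "incseq (\<lambda>K x. ennreal ((u K x)\<^sup>2))"
      unfolding incseq_def le_fun_def u_def
      by (auto intro!: ennreal_leI power_mono sum_mono2 sum_nonneg)
  qed simp
  also have "\<dots> \<le> 4"
    by (rule SUP_least) (rule nn_u)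
  finally have "AE x in mu_tilde. (SUP K. ennreal ((u K x)\<^sup>2)) \<noteq> \<infinity>"
    by (intro nn_integral_PInf_AE) (auto simp: top_unique)
  then have conv: "AE x in mu_tilde. convergent (\<lambda>n. f n x)"
  proof eventually_elim
    case (elim x)
    then obtain B where B: "B \<ge> 0" "(SUP K. ennreal ((u K x)\<^sup>2)) = ennreal B"
      by (cases "SUP K. ennreal ((u K x)\<^sup>2)") auto
    have "u K x \<le> sqrt B" for K
    proof -
      have "ennreal ((u K x)\<^sup>2) \<le> ennreal B"
        unfolding B(2)[symmetric] by (rule SUP_upper) simp
      then show ?thesis using B(1) by (simp add: real_le_rsqrt)
    qed
    then have "summable (\<lambda>k. norm (f (Suc k) x - f k x))"
      unfolding u_def lessThan_Suc_atMost[symmetric]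
      by (intro bounded_imp_summable[where B="sqrt B"])
        (auto simp: lessThan_Suc_atMost[symmetric] simp del: sum.lessThan_Suc)
    then have "summable (\<lambda>k. f (Suc k) x - f k x)"
      by (rule summable_norm_cancel)
    then have "convergent (\<lambda>n. \<Sum>k<n. f (Suc k) x - f k x)"
      by (simp add: summable_iff_convergent)
    then have "convergent (\<lambda>n. (\<Sum>k<n. f (Suc k) x - f k x) + f 0 x)"
      by (intro convergent_add convergent_const)
    then show ?case by (simp add: sum_lessThan_telescope[of "\<lambda>k. f k x"])
  qed
  define F where "F x = lim (\<lambda>n. f n x)" for x
  have [measurable]: "F \<in> borel_measurable borel"
    unfolding F_def by (rule borel_measurable_lim_metric) measurable
  have lim: "AE x in mu_tilde. (\<lambda>n. f n x) \<longlonglongrightarrow> F x"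
    using conv by eventually_elim (simp add: F_def convergent_LIMSEQ_iff)
  \<comment> \<open>Fatou's lemma along the subsequence turns the Cauchy estimate into an estimate
    for the pointwise limit.\<close>
  have close: "square_integrable (\<lambda>x. F x - f n x) \<and> norm (abs_l2 (\<lambda>x. F x - f n x)) \<le> e"
    if e: "e > 0" and N: "\<And>n m. n \<ge> N \<Longrightarrow> m \<ge> N \<Longrightarrow> dist (X n) (X m) < e" and n: "n \<ge> N" for e N n
  proof -
    have "(\<integral>\<^sup>+x. ennreal ((cmod (F x - f n x))\<^sup>2) \<partial>mu_tilde) =
        (\<integral>\<^sup>+x. liminf (\<lambda>j. ennreal ((cmod (f j x - f n x))\<^sup>2)) \<partial>mu_tilde)"
    proof (rule nn_integral_cong_AE)
      show "AE x in mu_tilde. ennreal ((cmod (F x - f n x))\<^sup>2) = liminf (\<lambda>j. ennreal ((cmod (f j x - f n x))\<^sup>2))"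
        using lim
      proof eventually_elim
        case (elim x)
        then have "(\<lambda>j. ennreal ((cmod (f j x - f n x))\<^sup>2)) \<longlonglongrightarrow> ennreal ((cmod (F x - f n x))\<^sup>2)"
          by (intro tendsto_ennrealI tendsto_intros)
        then show ?case
          by (intro lim_imp_Liminf[symmetric]) auto
      qed
    qed
    also have "\<dots> \<le> liminf (\<lambda>j. \<integral>\<^sup>+x. ennreal ((cmod (f j x - f n x))\<^sup>2) \<partial>mu_tilde)"
      by (rule nn_integral_liminf) measurable
    also have "\<dots> \<le> liminf (\<lambda>j::nat. ennreal (e\<^sup>2))"
    proof (rule Liminf_mono)
      show "\<forall>\<^sub>F j in sequentially. (\<integral>\<^sup>+x. ennreal ((cmod (f j x - f n x))\<^sup>2) \<partial>mu_tilde) \<le> ennreal (e\<^sup>2)"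
        using eventually_ge_at_top[of N]
      proof eventually_elim
        case (elim j)
        have "r j \<ge> N" "r n \<ge> N"
          using elim n r by (auto intro: order_trans[OF _ strict_mono_imp_increasing])
        then have "norm (X (r j) - X (r n)) \<le> e"
          using N by (simp add: dist_norm less_imp_le)
        then have "norm (abs_l2 (\<lambda>x. f j x - f n x)) \<le> e"
          by (simp add: abs_f[symmetric] abs_l2_diff f)
        then show ?case
          using nn_integral_norm_abs_l2[OF square_integrable_diff[OF f f], of j n]
          by (simp add: ennreal_leI power_mono)
      qed
    qed
    also have "\<dots> = ennreal (e\<^sup>2)"
      by (simp add: Liminf_const)
    finally have "(\<integral>\<^sup>+x. ennreal ((cmod (F x - f n x))\<^sup>2) \<partial>mu_tilde) \<le> ennreal (e\<^sup>2)" .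
    from square_integrable_norm_leI[OF _ this] show ?thesis
      using e by simp
  qed
  obtain N1 where N1: "\<And>n m. n \<ge> N1 \<Longrightarrow> m \<ge> N1 \<Longrightarrow> dist (X n) (X m) < 1"
    using metric_CauchyD[OF X, of 1] by auto
  have "square_integrable (\<lambda>x. (F x - f N1 x) + f N1 x)"
    by (intro square_integrable_add f) (use close[OF _ N1, of N1] in auto)
  then have F: "square_integrable F" by simp
  have "X \<longlonglongrightarrow> abs_l2 F"
  proof (rule metric_LIMSEQ_I)
    fix e :: real assume "e > 0"
    then have e: "e / 3 > 0" by simp
    obtain N where N: "\<And>n m. n \<ge> N \<Longrightarrow> m \<ge> N \<Longrightarrow> dist (X n) (X m) < e / 3"
      using metric_CauchyD[OF X e] by auto
    show "\<exists>no. \<forall>n\<ge>no. dist (X n) (abs_l2 F) < e"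
    proof (intro exI[of _ N] allI impI)
      fix n assume n: "N \<le> n"
      have "dist (X (r n)) (abs_l2 F) \<le> e / 3"
        using close[OF e N n]
        by (subst dist_commute) (simp add: dist_norm abs_f[symmetric] abs_l2_diff f F)
      moreover have "dist (X n) (X (r n)) < e / 3"
        using n r by (intro N) (auto intro: order_trans[OF _ strict_mono_imp_increasing])
      ultimately show "dist (X n) (abs_l2 F) < e"
        using dist_triangle[of "X n" "abs_l2 F" "X (r n)"] \<open>e > 0\<close> by linarith
    qed
  qed
  then show "convergent X" by (auto simp: convergent_def)
qed


subsection \<open>Density\<close>

lemma square_integrable_indicator:
  assumes "A \<in> sets borel" "emeasure lborel A < \<infinity>"
  shows "square_integrable (indicator A)"
proof (rule square_integrableI_nn)
  have "(\<integral>\<^sup>+x. ennreal ((cmod (indicator A x))\<^sup>2) \<partial>mu_tilde) = (\<integral>\<^sup>+x. indicator A x \<partial>mu_tilde)"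
    by (intro nn_integral_cong) (auto split: split_indicator)
  also have "\<dots> < \<infinity>"
    using assms by (simp add: emeasure_mu_tilde ennreal_mult_less_top)
  finally show "(\<integral>\<^sup>+x. ennreal ((cmod (indicator A x))\<^sup>2) \<partial>mu_tilde) < \<infinity>" .
qed (use assms in auto)

lemma l2_tendsto_dominated:
  fixes f :: "nat \<Rightarrow> 'a::euclidean_space \<Rightarrow> complex"
  assumes [measurable]: "\<And>i. f i \<in> borel_measurable borel" "g \<in> borel_measurable borel"
    and w: "square_integrable w"
    and lim: "AE x in lborel. (\<lambda>i. f i x) \<longlonglongrightarrow> g x"
    and bound: "\<And>i. AE x in lborel. cmod (f i x) \<le> cmod (w x)"
  shows "square_integrable (f i)" "square_integrable g" "(\<lambda>i. abs_l2 (f i)) \<longlonglongrightarrow> abs_l2 g"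
proof -
  have [measurable]: "w \<in> borel_measurable borel" using w by auto
  show f: "square_integrable (f i)" for i
    using bound by (intro square_integrable_bound[OF w]) auto
  have gb: "AE x in lborel. cmod (g x) \<le> cmod (w x)"
  proof -
    have "AE x in lborel. \<forall>i. cmod (f i x) \<le> cmod (w x)"
      using bound by (simp add: AE_all_countable)
    with lim show ?thesis
    proof eventually_elim
      case (elim x)
      show ?case
        by (rule LIMSEQ_le_const2[OF tendsto_norm[OF elim(1)]]) (use elim in auto)
    qed
  qed
  then show g: "square_integrable g"
    by (intro square_integrable_bound[OF w]) auto
  have "(\<lambda>i. integral\<^sup>L mu_tilde (\<lambda>x. (cmod (f i x - g x))\<^sup>2)) \<longlonglongrightarrow> integral\<^sup>L mu_tilde (\<lambda>x :: 'a. 0 :: real)"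
  proof (rule integral_dominated_convergence[where w="\<lambda>x. 4 * (cmod (w x))\<^sup>2"])
    show "integrable mu_tilde (\<lambda>x. 4 * (cmod (w x))\<^sup>2)"
      using square_integrableD[OF w] by simp
    show "AE x in mu_tilde. (\<lambda>i. (cmod (f i x - g x))\<^sup>2) \<longlonglongrightarrow> 0"
      using lim unfolding AE_mu_tilde_iff
      by eventually_elim (auto intro!: tendsto_eq_intros simp: LIM_zero)
    show "AE x in mu_tilde. norm ((cmod (f i x - g x))\<^sup>2) \<le> 4 * (cmod (w x))\<^sup>2" for i
      using gb bound[of i] unfolding AE_mu_tilde_iff
    proof eventually_elim
      case (elim x)
      have "cmod (f i x - g x) \<le> 2 * cmod (w x)"
        using norm_triangle_ineq4[of "f i x" "g x"] elim by linarith
      then have "(cmod (f i x - g x))\<^sup>2 \<le> (2 * cmod (w x))\<^sup>2"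
        by (intro power_mono) auto
      then show ?case by (simp add: power_mult_distrib)
    qed
  qed (simp_all add: measurable_cong_sets[OF sets_mu_tilde refl])
  then have "(\<lambda>i. sqrt (integral\<^sup>L mu_tilde (\<lambda>x. (cmod (f i x - g x))\<^sup>2))) \<longlonglongrightarrow> sqrt 0"
    by (intro tendsto_real_sqrt) simp
  then have "(\<lambda>i. norm (abs_l2 (f i) - abs_l2 g)) \<longlonglongrightarrow> 0"
    by (simp add: abs_l2_diff f g norm_abs_l2 square_integrable_diff)
  then show "(\<lambda>i. abs_l2 (f i)) \<longlonglongrightarrow> abs_l2 g"
    by (simp add: LIM_zero_iff tendsto_norm_zero_iff)
qed

text \<open>Simple functions approximate \<open>f\<close> pointwise and stay below
  \<open>2 * cmod (f x)\<close>, so they also converge in the mean, and closedness of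
  \<open>S\<close> reaches every class. With \<open>S\<close> given by an equation or a limit this
  is the usual proof by density.\<close>

lemma l2_dense_induct [consumes 1, case_names add scaleC indicator]:
  fixes S :: "'a::euclidean_space l2 set"
  assumes S: "closed S"
    and add: "\<And>a b. a \<in> S \<Longrightarrow> b \<in> S \<Longrightarrow> a + b \<in> S"
    and scale: "\<And>c a. a \<in> S \<Longrightarrow> scaleC_l2 c a \<in> S"
    and ind: "\<And>A. A \<in> sets borel \<Longrightarrow> emeasure lborel A < \<infinity> \<Longrightarrow> abs_l2 (indicator A) \<in> S"
  shows "a \<in> S"
proof (induction a rule: abs_l2_induct)
  case (abs f)
  have [measurable]: "f \<in> borel_measurable borel" using abs by auto
  have [measurable]: "f \<in> borel_measurable mu_tilde" by simp
  obtain F where F: "\<And>i. simple_function mu_tilde (F i)" "\<And>x. (\<lambda>i. F i x) \<longlonglongrightarrow> f x"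
    "\<And>i x. cmod (F i x) \<le> 2 * cmod (f x)"
    using borel_measurable_implies_sequence_metric[of f mu_tilde 0] by auto
  have [measurable]: "F i \<in> borel_measurable borel" for i
    using borel_measurable_simple_function[OF F(1), of i] by simp
  have zero: "0 \<in> S"
    using ind[of "{}"] abs_l2_zero[where 'a='a] by (simp add: indicator_def[abs_def])
  have F_S: "abs_l2 (F i) \<in> S" for i
  proof -
    define Y where "Y = range (F i)"
    have fin: "finite Y" using simple_functionD(1)[OF F(1), of i] by (simp add: Y_def)
    have F_eq: "F i = (\<lambda>x. \<Sum>y\<in>Y. y * indicator (F i -` {y}) x)"
      using fin by (auto simp: fun_eq_iff Y_def indicator_def if_distrib sum.delta cong: if_cong)
    have *: "square_integrable (\<lambda>x. y * indicator (F i -` {y}) x) \<and>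
        abs_l2 (\<lambda>x. y * indicator (F i -` {y}) x) \<in> S" if "y \<in> Y" for y
    proof (cases "y = 0")
      case True
      then show ?thesis by (simp add: abs_l2_zero zero square_integrable_zero)
    next
      case False
      have meas [measurable]: "F i -` {y} \<in> sets borel"
        using measurable_sets[of "F i" borel borel "{y}"] by simp
      have "emeasure mu_tilde (F i -` {y}) = (\<integral>\<^sup>+x. indicator (F i -` {y}) x \<partial>mu_tilde)"
        by (simp add: nn_integral_indicator)
      \<comment> \<open>Chebyshev's inequality: on a level set with value
        \<open>y \<noteq> 0\<close> the bound on the approximants gives
        \<open>cmod y \<le> 2 * cmod (f x)\<close>, so the level set has finite measure.\<close>
      also have "\<dots> \<le> (\<integral>\<^sup>+x. ennreal (4 / (cmod y)\<^sup>2 * (cmod (f x))\<^sup>2) \<partial>mu_tilde)"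
      proof (rule nn_integral_mono)
        fix x
        have "1 \<le> 4 / (cmod y)\<^sup>2 * (cmod (f x))\<^sup>2" if "F i x = y"
        proof -
          have "(cmod y)\<^sup>2 \<le> (2 * cmod (f x))\<^sup>2"
            using F(3)[of i x] that by (intro power_mono) auto
          then show ?thesis using False by (simp add: power_mult_distrib field_simps)
        qed
        then show "indicator (F i -` {y}) x \<le> ennreal (4 / (cmod y)\<^sup>2 * (cmod (f x))\<^sup>2)"
          by (auto split: split_indicator simp del: times_divide_eq_left)
      qed
      also have "\<dots> < \<infinity>"
        using integrable_mult_right[OF square_integrableD[OF abs], of "4 / (cmod y)\<^sup>2"]
        by (subst nn_integral_eq_integral) (auto simp del: times_divide_eq_left)
      finally have fin: "emeasure lborel (F i -` {y}) < \<infinity>"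
        by (auto simp: emeasure_mu_tilde ennreal_mult_less_top)
      have si: "square_integrable (indicator (F i -` {y}))"
        by (rule square_integrable_indicator) (use fin in auto)
      have "scaleC_l2 y (abs_l2 (indicator (F i -` {y}))) \<in> S"
        by (intro scale ind) (use fin in auto)
      then show ?thesis
        using si by (auto simp: abs_l2_scaleC square_integrable_scale)
    qed
    have "(\<Sum>y\<in>Y. abs_l2 (\<lambda>x. y * indicator (F i -` {y}) x)) \<in> S"
      using fin * by (induction rule: finite_induct) (auto intro: add zero)
    then show ?thesis
      using * by (subst F_eq) (simp add: abs_l2_sum)
  qed
  have "(\<lambda>i. abs_l2 (F i)) \<longlonglongrightarrow> abs_l2 f"
    by (rule l2_tendsto_dominated(3)[OF _ _ square_integrable_scale[OF abs, of 2]])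
      (use F in \<open>auto simp: norm_mult\<close>)
  then show ?case
    using closed_sequentially[OF S, of "\<lambda>i. abs_l2 (F i)"] F_S by blast
qed

lemma closure_eq_UNIV_property:
  assumes "closure X = UNIV" "closed {x. P x}" "\<And>x. x \<in> X \<Longrightarrow> P x"
  shows "P x"
  using closure_minimal[of X "{x. P x}"] assms by auto

text \<open>An isometry of a subspace is uniformly continuous and so extends to the closure;
  additivity, homogeneity and isometry are closed conditions and survive. Differences in the
  subspace come from the scalar \<open>-1\<close>, and additivity is extended in one argument at a
  time.\<close>

lemma isometry_extension:
  fixes X :: "'a::euclidean_space l2 set" and \<Phi> :: "'a l2 \<Rightarrow> 'b::euclidean_space l2"
  assumes dense: "closure X = UNIV"
    and add: "\<And>x y. x \<in> X \<Longrightarrow> y \<in> X \<Longrightarrow> x + y \<in> X \<and> \<Phi> (x + y) = \<Phi> x + \<Phi> y"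
    and scale: "\<And>c x. x \<in> X \<Longrightarrow> scaleC_l2 c x \<in> X \<and> \<Phi> (scaleC_l2 c x) = scaleC_l2 c (\<Phi> x)"
    and norm: "\<And>x. x \<in> X \<Longrightarrow> norm (\<Phi> x) = norm x"
  obtains T where "bounded_linear T" "\<And>c x. T (scaleC_l2 c x) = scaleC_l2 c (T x)"
    "\<And>x. norm (T x) = norm x" "\<And>x. x \<in> X \<Longrightarrow> T x = \<Phi> x"
proof -
  have diff: "norm (\<Phi> x - \<Phi> y) = norm (x - y)" if "x \<in> X" "y \<in> X" for x y
  proof -
    have "x - y \<in> X \<and> \<Phi> (x - y) = \<Phi> x - \<Phi> y"
      using that add scale by (metis (no_types, lifting) diff_conv_add_uminus uminus_scaleC_l2)
    then show ?thesis
      using norm[of "x - y"] by simp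
  qed
  have "uniformly_continuous_on X \<Phi>"
    unfolding uniformly_continuous_on_def dist_norm by (metis diff)
  then obtain T where T: "uniformly_continuous_on (closure X) T" and eq: "\<And>x. x \<in> X \<Longrightarrow> \<Phi> x = T x"
    by (rule uniformly_continuous_on_extension_on_closure) blast
  have contT: "continuous_on UNIV T"
    using uniformly_continuous_imp_continuous[OF T] dense by simp
  have contS: "continuous_on UNIV (scaleC_l2 c :: 'c::euclidean_space l2 \<Rightarrow> 'c l2)" for c
    using bounded_linear_scaleC_l2 by (rule linear_continuous_on)
  note cont = continuous_on_compose2[OF contT] continuous_on_compose2[OF contS]
  have T_norm: "norm (T x) = norm x" for x
    by (rule closure_eq_UNIV_property[OF dense])
      (auto intro!: closed_Collect_eq continuous_intros cont simp: eq[symmetric] norm)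
  have T_scale: "T (scaleC_l2 c x) = scaleC_l2 c (T x)" for c x
  proof (rule closure_eq_UNIV_property[OF dense])
    show "T (scaleC_l2 c x) = scaleC_l2 c (T x)" if "x \<in> X" for x
      using that scale[OF that, of c] by (simp add: eq[symmetric])
  qed (auto intro!: closed_Collect_eq continuous_intros cont)
  have T_add: "T (x + y) = T x + T y" for x y
  proof (rule closure_eq_UNIV_property[OF dense, where P="\<lambda>y. T (x + y) = T x + T y"])
    fix y assume y: "y \<in> X"
    show "T (x + y) = T x + T y"
    proof (rule closure_eq_UNIV_property[OF dense, where P="\<lambda>x. T (x + y) = T x + T y"])
      fix x assume "x \<in> X"
      then show "T (x + y) = T x + T y"
        using y add[of x y] by (simp add: eq[symmetric])
    qed (auto intro!: closed_Collect_eq continuous_intros cont)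
  qed (auto intro!: closed_Collect_eq continuous_intros cont)
  have "bounded_linear T"
    by (rule bounded_linear_intro[where K=1]) (simp_all add: T_add T_norm T_scale scaleR_l2_def)
  then show ?thesis
    using that T_scale T_norm eq by metis
qed

section \<open>From Gaussian integrals to the Plancherel theorem\<close>

subsection \<open>Gaussian integrals\<close>

lemma integral_lborel_prod_Basis:
  fixes f :: "'a::euclidean_space \<Rightarrow> real \<Rightarrow> complex"
  assumes f: "\<And>b. b \<in> Basis \<Longrightarrow> integrable lborel (f b)"
  shows "integrable lborel (\<lambda>x::'a. \<Prod>b\<in>Basis. f b (x \<bullet> b))" (is ?int)
    and "integral\<^sup>L lborel (\<lambda>x::'a. \<Prod>b\<in>Basis. f b (x \<bullet> b)) = (\<Prod>b\<in>Basis. integral\<^sup>L lborel (f b))" (is ?eq)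
proof -
  interpret P: product_sigma_finite "\<lambda>_::'a. lborel :: real measure" ..
  have [measurable]: "f b \<in> borel_measurable borel" if "b \<in> Basis" for b
    using borel_measurable_integrable[OF f[OF that]] by simp
  have [measurable]: "(\<lambda>x::'a. \<Prod>b\<in>Basis. f b (x \<bullet> b)) \<in> borel_measurable borel"
    by (rule borel_measurable_prod) measurable
  have [measurable]: "(\<lambda>g. \<Sum>b\<in>Basis. g b *\<^sub>R b) \<in> (\<Pi>\<^sub>M b\<in>Basis. lborel) \<rightarrow>\<^sub>M (borel :: 'a measure)"
    by (rule borel_measurable_sum) measurable
  have eq: "(\<Prod>b\<in>Basis. f b ((\<Sum>b'\<in>Basis. g b' *\<^sub>R b') \<bullet> b)) = (\<Prod>b\<in>Basis. f b (g b))" for g :: "'a \<Rightarrow> real"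
    by (intro prod.cong refl) (simp add: inner_sum_left inner_Basis if_distrib cong: if_cong)
  show ?int
    by (subst lborel_eq, subst integrable_distr_eq) (auto simp: eq intro!: P.product_integrable_prod f)
  show ?eq
    by (subst lborel_eq, subst integral_distr) (auto simp: eq intro!: P.product_integral_prod f)
qed

lemma gaussian_integrable: "integrable lborel (\<lambda>x::real. exp (- (x\<^sup>2) / 2))"
  using integrable_mult_right[OF integrable_std_normal_moment[of 0], of "sqrt (2 * pi)"]
  by (simp add: std_normal_density_def)

text \<open>This is the characteristic function of the standard normal distribution, stripped of its
  normalisation.\<close>

lemma gaussian_fourier_real:
  "integrable lborel (\<lambda>x::real. complex_of_real (exp (- (x\<^sup>2) / 2)) * exp (- \<i> * complex_of_real (x * t)))"
  "integral\<^sup>L lborel (\<lambda>x::real. complex_of_real (exp (- (x\<^sup>2) / 2)) * exp (- \<i> * complex_of_real (x * t))) =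
    complex_of_real (sqrt (2 * pi) * exp (- (t\<^sup>2) / 2))"
proof -
  show "integrable lborel (\<lambda>x::real. complex_of_real (exp (- (x\<^sup>2) / 2)) * exp (- \<i> * complex_of_real (x * t)))"
    by (rule Bochner_Integration.integrable_bound[OF gaussian_integrable]) (auto simp: norm_mult)
  have "complex_of_real (exp (- (t\<^sup>2) / 2)) = (CLINT x|std_normal_distribution. iexp (- t * x))"
    using fun_cong[OF char_std_normal_distribution, of "- t"] by (simp add: char_def)
  also have "\<dots> = integral\<^sup>L lborel (\<lambda>x. std_normal_density x *\<^sub>R iexp (- t * x))"
    by (rule integral_density) auto
  also have "\<dots> = integral\<^sup>L lborel (\<lambda>x::real. complex_of_real (1 / sqrt (2 * pi)) *
      (complex_of_real (exp (- (x\<^sup>2) / 2)) * exp (- \<i> * complex_of_real (x * t))))"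
    by (intro Bochner_Integration.integral_cong refl)
      (simp add: std_normal_density_def scaleR_conv_of_real mult.commute)
  also have "\<dots> = complex_of_real (1 / sqrt (2 * pi)) *
      integral\<^sup>L lborel (\<lambda>x::real. complex_of_real (exp (- (x\<^sup>2) / 2)) * exp (- \<i> * complex_of_real (x * t)))"
    by (rule integral_mult_right_zero)
  finally show "integral\<^sup>L lborel (\<lambda>x::real. complex_of_real (exp (- (x\<^sup>2) / 2)) * exp (- \<i> * complex_of_real (x * t))) =
    complex_of_real (sqrt (2 * pi) * exp (- (t\<^sup>2) / 2))"
    by (simp add: field_simps)
qed

definition gauss :: "'a::euclidean_space \<Rightarrow> real" where
  "gauss x = exp (- (norm x)\<^sup>2 / 2)"

lemma gauss_pos [simp]: "gauss x > 0"
  by (simp add: gauss_def)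

lemma gauss_measurable [measurable]: "gauss \<in> borel_measurable borel"
  unfolding gauss_def[abs_def] by measurable

lemma gauss_prod: "gauss x = (\<Prod>b\<in>Basis. exp (- ((x \<bullet> b)\<^sup>2) / 2))"
  by (simp add: gauss_def norm_eq_sqrt_inner euclidean_inner[of x x] power2_eq_square exp_sum[symmetric]
      sum_divide_distrib sum_negf sum_nonneg)

lemma gauss_fourier_prod:
  "complex_of_real (gauss x) * exp (- \<i> * complex_of_real (x \<bullet> \<xi>)) =
    (\<Prod>b\<in>Basis. complex_of_real (exp (- ((x \<bullet> b)\<^sup>2) / 2)) * exp (- \<i> * complex_of_real ((x \<bullet> b) * (\<xi> \<bullet> b))))"
proof -
  have "exp (- \<i> * complex_of_real (x \<bullet> \<xi>)) = (\<Prod>b\<in>Basis. exp (- \<i> * complex_of_real ((x \<bullet> b) * (\<xi> \<bullet> b))))"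
    by (simp add: euclidean_inner[of x \<xi>] exp_sum[symmetric] sum_distrib_left sum_negf)
  then show ?thesis
    by (simp only: gauss_prod of_real_prod prod.distrib)
qed

lemma integrable_gauss: "integrable mu_tilde (gauss :: 'a::euclidean_space \<Rightarrow> real)"
proof -
  have "integrable lborel (\<lambda>x::'a. complex_of_real (gauss x) * exp (- \<i> * complex_of_real (x \<bullet> 0)))"
    unfolding gauss_fourier_prod
    by (rule integral_lborel_prod_Basis(1)[where f="\<lambda>b t. complex_of_real (exp (- (t\<^sup>2) / 2)) * exp (- \<i> * complex_of_real (t * (0 \<bullet> b)))"])
      (rule gaussian_fourier_real)
  then have "integrable lborel (\<lambda>x::'a. complex_of_real (gauss x))"
    by simp
  then show ?thesis
    unfolding integrable_mu_tilde_iff using integrable_Re by fastforce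
qed

lemma mu_const_sqrt: "mu_const TYPE('a::euclidean_space) * sqrt (2 * pi) ^ DIM('a) = 1"
proof -
  have "sqrt (2 * pi) ^ DIM('a) = (2 * pi) powr (real DIM('a) / 2)"
    by (simp add: powr_half_sqrt[symmetric] powr_powr powr_realpow[symmetric])
  then show ?thesis
    by (simp add: mu_const_def powr_add[symmetric])
qed

text \<open>Each coordinate yields a factor \<open>sqrt (2 * pi)\<close>, and the constant in
  \<open>mu_tilde\<close> is the one that cancels their product.\<close>

lemma fourier_gauss: "fourier_integral (\<lambda>x. complex_of_real (gauss x)) (\<xi> :: 'a::euclidean_space) = complex_of_real (gauss \<xi>)"
proof -
  have "integral\<^sup>L lborel (\<lambda>x::'a. complex_of_real (gauss x) * exp (- \<i> * complex_of_real (x \<bullet> \<xi>))) =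
      (\<Prod>b\<in>Basis. complex_of_real (sqrt (2 * pi) * exp (- ((\<xi> \<bullet> b)\<^sup>2) / 2)))"
    unfolding gauss_fourier_prod
    by (subst integral_lborel_prod_Basis(2)[where f="\<lambda>b t. complex_of_real (exp (- (t\<^sup>2) / 2)) * exp (- \<i> * complex_of_real (t * (\<xi> \<bullet> b)))"])
      (simp_all only: gaussian_fourier_real)
  also have "\<dots> = complex_of_real (sqrt (2 * pi) ^ DIM('a) * gauss \<xi>)"
    by (simp add: gauss_prod prod.distrib del: of_real_exp)
  finally show ?thesis
    using mu_const_sqrt[where 'a='a]
    by (simp add: fourier_integral_def integral_mu_tilde scaleR_conv_of_real mult.assoc[symmetric]
        of_real_mult[symmetric] del: of_real_mult)
qed

lemma integral_gauss: "integral\<^sup>L mu_tilde (gauss :: 'a::euclidean_space \<Rightarrow> real) = 1"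
proof -
  have "complex_of_real (integral\<^sup>L mu_tilde (gauss :: 'a \<Rightarrow> real)) = fourier_integral (\<lambda>x. complex_of_real (gauss x)) (0 :: 'a)"
    by (simp add: fourier_integral_def)
  then show ?thesis
    by (simp only: fourier_gauss) (simp add: gauss_def)
qed

lemma mu_scale:
  fixes f :: "'a::euclidean_space \<Rightarrow> 'b::{banach, second_countable_topology}"
  assumes [measurable]: "f \<in> borel_measurable borel" and c: "c > 0"
  shows "integral\<^sup>L mu_tilde f = c ^ DIM('a) *\<^sub>R integral\<^sup>L mu_tilde (\<lambda>x. f (c *\<^sub>R x))"
    and "integrable mu_tilde f \<longleftrightarrow> integrable mu_tilde (\<lambda>x. f (c *\<^sub>R x))"
proof -
  have l: "(lborel :: 'a measure) = density (distr lborel borel (\<lambda>x. c *\<^sub>R x)) (\<lambda>_. ennreal (c ^ DIM('a)))"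
    using lborel_affine[of c "0 :: 'a"] c by (simp add: ennreal_power)
  have "integral\<^sup>L lborel f = integral\<^sup>L lborel (\<lambda>x. c ^ DIM('a) *\<^sub>R f (c *\<^sub>R x))"
    using c by (subst l, subst integral_density) (auto simp: integral_distr)
  then show "integral\<^sup>L mu_tilde f = c ^ DIM('a) *\<^sub>R integral\<^sup>L mu_tilde (\<lambda>x. f (c *\<^sub>R x))"
    by (simp add: integral_mu_tilde)
  have "integrable lborel f \<longleftrightarrow> integrable lborel (\<lambda>x. c ^ DIM('a) *\<^sub>R f (c *\<^sub>R x))"
    using c by (subst l, subst integrable_density) (auto simp: integrable_distr_eq)
  also have "\<dots> \<longleftrightarrow> integrable lborel (\<lambda>x. f (c *\<^sub>R x))"
    using c integrable_scaleR_right[of "inverse (c ^ DIM('a))" lborel "\<lambda>x. c ^ DIM('a) *\<^sub>R f (c *\<^sub>R x)"]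
    by auto
  finally show "integrable mu_tilde f \<longleftrightarrow> integrable mu_tilde (\<lambda>x. f (c *\<^sub>R x))"
    by (simp add: integrable_mu_tilde_iff)
qed

subsection \<open>Elementary properties of the Fourier integral\<close>

lemma integrable_pair_mult:
  fixes f :: "'a::euclidean_space \<Rightarrow> complex" and g :: "'b::euclidean_space \<Rightarrow> complex"
  assumes f: "integrable mu_tilde f" and g: "integrable mu_tilde g"
  shows "integrable (mu_tilde \<Otimes>\<^sub>M mu_tilde) (\<lambda>(x, y). f x * g y)"
proof (rule mu_pair.Fubini_integrable)
  have [measurable]: "f \<in> borel_measurable mu_tilde" "g \<in> borel_measurable mu_tilde" using f g by auto
  show "(\<lambda>(x, y). f x * g y) \<in> borel_measurable (mu_tilde \<Otimes>\<^sub>M mu_tilde)"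
    by measurable
  show "integrable mu_tilde (\<lambda>x. \<integral>y. norm (case (x, y) of (x, y) \<Rightarrow> f x * g y) \<partial>mu_tilde)"
    using f by (simp add: norm_mult)
  show "AE x in mu_tilde. integrable mu_tilde (\<lambda>y. case (x, y) of (x, y) \<Rightarrow> f x * g y)"
    using g by simp
qed

lemma integrable_fourier_integrand:
  assumes "integrable mu_tilde h"
  shows "integrable mu_tilde (\<lambda>u. h u * exp (- \<i> * complex_of_real (u \<bullet> \<xi>)))"
proof -
  have [measurable]: "h \<in> borel_measurable mu_tilde" using assms by auto
  show ?thesis
    by (rule Bochner_Integration.integrable_bound[OF assms]) (auto simp: norm_mult)
qed

lemma fourier_integral_measurable [measurable]:
  assumes [measurable]: "h \<in> borel_measurable borel"
  shows "fourier_integral h \<in> borel_measurable borel"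
  unfolding fourier_integral_def[abs_def] by measurable

lemma fourier_integral_bound:
  assumes "integrable mu_tilde h"
  shows "cmod (fourier_integral h \<xi>) \<le> integral\<^sup>L mu_tilde (\<lambda>u. cmod (h u))"
proof -
  have "cmod (fourier_integral h \<xi>) \<le> integral\<^sup>L mu_tilde (\<lambda>u. cmod (h u * exp (- \<i> * complex_of_real (u \<bullet> \<xi>))))"
    unfolding fourier_integral_def by (rule integral_norm_bound)
  then show ?thesis by (simp add: norm_mult)
qed

text \<open>Fubini, since the kernel is symmetric in \<open>u\<close> and \<open>\<xi>\<close>. The
  formula drives both the proof of Plancherel's theorem and the adjoint of the partial
  transform.\<close>

lemma fourier_integral_mult_formula:
  fixes f g :: "'a::euclidean_space \<Rightarrow> complex"
  assumes f: "integrable mu_tilde f" and g: "integrable mu_tilde g"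
  shows "integral\<^sup>L mu_tilde (\<lambda>\<xi>. fourier_integral f \<xi> * g \<xi>) = integral\<^sup>L mu_tilde (\<lambda>u. f u * fourier_integral g u)"
proof -
  have [measurable]: "f \<in> borel_measurable mu_tilde" "g \<in> borel_measurable mu_tilde" using f g by auto
  have int: "integrable (mu_tilde \<Otimes>\<^sub>M mu_tilde) (\<lambda>(u, \<xi>). f u * g \<xi> * exp (- \<i> * complex_of_real (u \<bullet> \<xi>)))"
    by (rule Bochner_Integration.integrable_bound[OF integrable_pair_mult[OF f g]])
      (auto simp: norm_mult)
  have "integral\<^sup>L mu_tilde (\<lambda>\<xi>. fourier_integral f \<xi> * g \<xi>) =
      (\<integral>\<xi>. (\<integral>u. f u * g \<xi> * exp (- \<i> * complex_of_real (u \<bullet> \<xi>)) \<partial>mu_tilde) \<partial>mu_tilde)"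
    by (simp add: fourier_integral_def mult_ac flip: integral_mult_right_zero)
  also have "\<dots> = (\<integral>u. (\<integral>\<xi>. f u * g \<xi> * exp (- \<i> * complex_of_real (u \<bullet> \<xi>)) \<partial>mu_tilde) \<partial>mu_tilde)"
    using mu_pair.Fubini_integral[OF int] .
  also have "\<dots> = integral\<^sup>L mu_tilde (\<lambda>u. f u * fourier_integral g u)"
    by (simp add: fourier_integral_def mult.assoc inner_commute)
  finally show ?thesis .
qed

subsection \<open>Continuity of translations in the mean\<close>

lemma square_integrable_translate:
  "square_integrable f \<Longrightarrow> square_integrable (\<lambda>x. f (x + s))"
  using integrable_mu_translate[of "\<lambda>x. (cmod (f x))\<^sup>2" s]
  by (intro square_integrableI) (auto dest: square_integrableD square_integrable_measurable)

lemma norm_translate: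
  assumes f: "square_integrable f"
  shows "norm (abs_l2 (\<lambda>x. f (x + s))) = norm (abs_l2 f)"
proof -
  have [measurable]: "f \<in> borel_measurable borel" using f by auto
  show ?thesis
    using integral_mu_translate[of "\<lambda>x. (cmod (f x))\<^sup>2" s]
    by (simp add: norm_abs_l2 f square_integrable_translate)
qed

lemma AE_translate:
  assumes "AE x in (lborel :: 'a::euclidean_space measure). P x"
  shows "AE x in lborel. P (x + s)"
proof -
  have "AE x in distr lborel borel (\<lambda>x::'a. x + s). P x"
    unfolding lborel_translation_measure by (rule assms)
  then show ?thesis
    by (rule AE_distrD[rotated]) simp
qed

text \<open>The set of classes on which the translations converge is closed, because translations
  are isometries; so indicators suffice. Open sets are treated directly, Borel sets by outer
  regularity.\<close>

lemma translation_continuous: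
  fixes h :: "'a::euclidean_space \<Rightarrow> complex"
  assumes s: "s \<longlonglongrightarrow> 0" and h: "square_integrable h"
  shows "(\<lambda>i::nat. abs_l2 (\<lambda>x. h (x + s i))) \<longlonglongrightarrow> abs_l2 h"
proof -
  define tr where "tr t a = abs_l2 (\<lambda>x. rep_l2 a (x + t))" for t :: 'a and a :: "'a l2"
  have tr: "tr t (abs_l2 f) = abs_l2 (\<lambda>x. f (x + t))" if "square_integrable f" for t f
    unfolding tr_def using AE_translate[OF rep_abs_l2[OF that]]
    by (intro abs_l2_eqI square_integrable_translate that square_integrable_rep)
  have norm_tr: "norm (tr t a) = norm a" for t a
    by (induction a rule: abs_l2_induct) (simp add: tr norm_translate)
  have tr_add: "tr t (a + b) = tr t a + tr t b" for t a b
    by (induction a rule: abs_l2_induct, induction b rule: abs_l2_induct)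
      (simp add: abs_l2_add tr square_integrable_add square_integrable_translate)
  have tr_scale: "tr t (scaleC_l2 c a) = scaleC_l2 c (tr t a)" for t c a
    by (induction a rule: abs_l2_induct)
      (simp add: abs_l2_scaleC tr square_integrable_scale square_integrable_translate)
  have tr_diff: "tr t (a - b) = tr t a - tr t b" for t a b
    using tr_add[of t "a - b" b] by simp
  define S where "S = {a. (\<lambda>i. tr (s i) a) \<longlonglongrightarrow> a}"
  have S: "closed S"
    unfolding closed_sequential_limits
  proof (intro allI impI, elim conjE)
    fix x a assume x: "\<forall>n. x n \<in> S" "x \<longlonglongrightarrow> a"
    show "a \<in> S"
      unfolding S_def mem_Collect_eq
    proof (rule metric_LIMSEQ_I)
      fix e :: real assume e: "e > 0"
      then obtain n where n: "norm (x n - a) < e / 3"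
        using metric_LIMSEQ_D[OF x(2), of "e / 3"] by (auto simp: dist_norm)
      have "(\<lambda>i. tr (s i) (x n)) \<longlonglongrightarrow> x n" using x(1) by (simp add: S_def)
      from metric_LIMSEQ_D[OF this, of "e / 3"] e
      obtain N where N: "\<And>i. i \<ge> N \<Longrightarrow> norm (tr (s i) (x n) - x n) < e / 3"
        by (auto simp: dist_norm)
      show "\<exists>no. \<forall>i\<ge>no. dist (tr (s i) a) a < e"
      proof (intro exI[of _ N] allI impI)
        fix i assume "N \<le> i"
        have "norm (tr (s i) a - tr (s i) (x n)) < e / 3"
          using n by (simp add: tr_diff[symmetric] norm_tr norm_minus_commute)
        moreover have "tr (s i) a - a = (tr (s i) a - tr (s i) (x n)) + (tr (s i) (x n) - x n) + (x n - a)"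
          by simp
        ultimately have "norm (tr (s i) a - a) < e / 3 + e / 3 + e / 3"
          using N[OF \<open>N \<le> i\<close>] n by (smt (verit, best) norm_triangle_ineq)
        then show "dist (tr (s i) a) a < e"
          by (simp add: dist_norm)
      qed
    qed
  qed
  have "abs_l2 h \<in> S"
  proof (rule l2_dense_induct[OF S])
    show "a + b \<in> S" if "a \<in> S" "b \<in> S" for a b
      using that by (auto simp: S_def tr_add intro: tendsto_add)
    show "scaleC_l2 c a \<in> S" if "a \<in> S" for c a
      using that bounded_linear.tendsto[OF bounded_linear_scaleC_l2] by (auto simp: S_def tr_scale)
    \<comment> \<open>Translation keeps the norm, so mean convergence follows from convergence of
      the inner product with the untranslated indicator. There only points of \<open>U\<close>
      count, and openness keeps their small translates in \<open>U\<close>.\<close>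
    have open_S: "abs_l2 (indicator U) \<in> S" if U: "open U" "emeasure lborel U < \<infinity>" for U :: "'a set"
    proof -
      have [measurable]: "U \<in> sets borel" using U by auto
      have si: "square_integrable (indicator U)" by (rule square_integrable_indicator) (use U in auto)
      have "(\<lambda>i. integral\<^sup>L mu_tilde (\<lambda>x. indicator U (x + s i) * cnj (indicator U x) :: complex))
          \<longlonglongrightarrow> integral\<^sup>L mu_tilde (\<lambda>x. indicator U x * cnj (indicator U x))"
      proof (rule integral_dominated_convergence[where w="\<lambda>x. (cmod (indicator U x))\<^sup>2"])
        show "integrable mu_tilde (\<lambda>x. (cmod (indicator U x))\<^sup>2)"
          by (rule square_integrableD[OF si])
        show "AE x in mu_tilde. (\<lambda>i. indicator U (x + s i) * cnj (indicator U x) :: complex)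
            \<longlonglongrightarrow> indicator U x * cnj (indicator U x)"
        proof (rule AE_I2)
          fix x
          show "(\<lambda>i. indicator U (x + s i) * cnj (indicator U x) :: complex) \<longlonglongrightarrow> indicator U x * cnj (indicator U x)"
          proof (cases "x \<in> U")
            case True
            have "(\<lambda>i. x + s i) \<longlonglongrightarrow> x"
              using tendsto_add[OF tendsto_const[of x] s] by simp
            then have "\<forall>\<^sub>F i in sequentially. x + s i \<in> U"
              using topological_tendstoD U(1) True by blast
            then have "\<forall>\<^sub>F i in sequentially. indicator U (x + s i) * cnj (indicator U x) = (indicator U x * cnj (indicator U x) :: complex)"
              by eventually_elim (simp add: True)
            then show ?thesis by (rule tendsto_eventually)
          qed simp
        qed
        show "AE x in mu_tilde. norm (indicator U (x + s i) * cnj (indicator U x) :: complex) \<le> (cmod (indicator U x))\<^sup>2" for i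
          by (auto split: split_indicator)
      qed auto
      then have lim: "(\<lambda>i. tr (s i) (abs_l2 (indicator U)) \<bullet> abs_l2 (indicator U)) \<longlonglongrightarrow> abs_l2 (indicator U) \<bullet> abs_l2 (indicator U)"
        unfolding tr[OF si] inner_abs_l2[OF square_integrable_translate[OF si] si] inner_abs_l2[OF si si]
        by (rule tendsto_Re)
      let ?a = "abs_l2 (indicator U)"
      have "(norm (tr t ?a - ?a))\<^sup>2 = 2 * (?a \<bullet> ?a) - 2 * (tr t ?a \<bullet> ?a)" for t
        using dot_norm_neg[of "tr t ?a" ?a] norm_tr[of t ?a] by (simp add: power2_norm_eq_inner[symmetric])
      moreover have "(\<lambda>i. 2 * (?a \<bullet> ?a) - 2 * (tr (s i) ?a \<bullet> ?a)) \<longlonglongrightarrow> 2 * (?a \<bullet> ?a) - 2 * (?a \<bullet> ?a)"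
        by (intro tendsto_intros lim)
      ultimately have "(\<lambda>i. (norm (tr (s i) ?a - ?a))\<^sup>2) \<longlonglongrightarrow> 0" by simp
      then have "(\<lambda>i. sqrt ((norm (tr (s i) ?a - ?a))\<^sup>2)) \<longlonglongrightarrow> sqrt 0"
        by (rule tendsto_real_sqrt)
      then show ?thesis
        by (simp add: S_def tendsto_norm_zero_iff LIM_zero_iff)
    qed
    show "abs_l2 (indicator A) \<in> S" if A: "A \<in> sets borel" "emeasure lborel A < \<infinity>" for A :: "'a set"
    proof -
      have siA: "square_integrable (indicator A)" by (rule square_integrable_indicator) (use A in auto)
      have "\<exists>b\<in>S. dist b (abs_l2 (indicator A)) < e" if e: "e > 0" for e
      proof -
        define K where "K = mu_const TYPE('a)"
        have K: "K > 0" by (simp add: K_def)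
        obtain U where U: "open U" "A \<subseteq> U" "emeasure lborel (U - A) < e\<^sup>2 / K"
          using outer_regular_lborel[OF A(1), of "e\<^sup>2 / K"] e K by auto
        have [measurable]: "U \<in> sets borel" "A \<in> sets borel" using U A by auto
        have "emeasure lborel (A \<union> (U - A)) \<le> emeasure lborel A + emeasure lborel (U - A)"
          by (rule emeasure_subadditive) auto
        also have "\<dots> < \<infinity>"
          using A U(3) by (auto simp: less_top intro: order.strict_trans)
        finally have fin: "emeasure lborel U < \<infinity>"
          using U(2) by (simp add: Un_absorb1)
        have siU: "square_integrable (indicator U)" by (rule square_integrable_indicator) (use fin in auto)
        have siD: "square_integrable (indicator (U - A))"
          by (rule square_integrable_bound[OF siU]) (auto split: split_indicator)
        have "abs_l2 (indicator U) - abs_l2 (indicator A) = abs_l2 (indicator (U - A) :: 'a \<Rightarrow> complex)"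
          unfolding abs_l2_diff[OF siU siA] using U(2)
          by (intro arg_cong[where f=abs_l2]) (auto simp: fun_eq_iff split: split_indicator)
        moreover have "(norm (abs_l2 (indicator (U - A) :: 'a \<Rightarrow> complex)))\<^sup>2 < e\<^sup>2"
        proof -
          have "ennreal ((norm (abs_l2 (indicator (U - A) :: 'a \<Rightarrow> complex)))\<^sup>2) = (\<integral>\<^sup>+x. indicator (U - A) x \<partial>mu_tilde)"
            unfolding nn_integral_norm_abs_l2[OF siD, symmetric]
            by (intro nn_integral_cong) (auto split: split_indicator)
          also have "\<dots> = K * emeasure lborel (U - A)"
            by (simp add: nn_integral_indicator emeasure_mu_tilde K_def)
          also have "\<dots> < K * ennreal (e\<^sup>2 / K)"
            using U(3) K by (intro ennreal_mult_strict_left_mono) auto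
          also have "\<dots> = ennreal (e\<^sup>2)"
            using K by (simp add: ennreal_mult'[symmetric])
          finally show ?thesis
            by (simp add: ennreal_less_iff)
        qed
        ultimately have "dist (abs_l2 (indicator U)) (abs_l2 (indicator A :: 'a \<Rightarrow> complex)) < e"
          using e by (simp add: dist_norm power2_less_imp_less)
        with open_S[OF U(1) fin] show ?thesis by blast
      qed
      then have "abs_l2 (indicator A) \<in> closure S"
        unfolding closure_approachable by blast
      then show ?thesis using S by simp
    qed
  qed
  then show ?thesis
    by (simp add: S_def tr h)
qed

subsection \<open>Plancherel's theorem\<close>

lemma cauchy_schwarz_abs_l2:
  assumes f: "square_integrable f" and g: "square_integrable g"
  shows "cmod (integral\<^sup>L mu_tilde (\<lambda>x. f x * cnj (g x))) \<le> norm (abs_l2 f) * norm (abs_l2 g)"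
proof (cases "integral\<^sup>L mu_tilde (\<lambda>x. f x * cnj (g x)) = 0")
  case False
  define z where "z = integral\<^sup>L mu_tilde (\<lambda>x. f x * cnj (g x))"
  \<comment> \<open>Rotation by this phase makes the integral a nonnegative real, so that the real
    Cauchy--Schwarz inequality bounds its modulus.\<close>
  define c where "c = cnj (sgn z)"
  have c: "cmod c = 1" "c * z = cmod z"
  proof -
    have "cnj z * z = complex_of_real (cmod z * cmod z)"
      by (simp only: power2_eq_square[symmetric] complex_norm_square mult.commute)
    then have "cnj z * z / complex_of_real (cmod z) = complex_of_real (cmod z)"
      using False by (simp add: z_def)
    then show "c * z = cmod z" by (simp add: c_def sgn_eq)
    show "cmod c = 1" using False by (simp add: c_def z_def norm_sgn)
  qed
  have "cmod z = Re (c * z)" by (simp add: c)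
  also have "\<dots> = scaleC_l2 c (abs_l2 f) \<bullet> abs_l2 g"
    by (simp add: abs_l2_scaleC f g inner_abs_l2 square_integrable_scale z_def mult.assoc)
  also have "\<dots> \<le> norm (scaleC_l2 c (abs_l2 f)) * norm (abs_l2 g)"
    by (rule norm_cauchy_schwarz)
  finally show ?thesis by (simp add: norm_scaleC_l2 c z_def)
qed simp

text \<open>\<open>A\<close> is the convolution of \<open>h\<close> with its reflected conjugate;
  the shift in the inner integral produces the phase that conjugates the second factor. In this way
  Plancherel's identity becomes a statement about the value of one integrable function at the point
  \<open>0\<close>.\<close>

lemma fourier_autocorrelation:
  fixes h :: "'a::euclidean_space \<Rightarrow> complex"
  assumes h: "integrable mu_tilde h"
  defines "A \<equiv> \<lambda>s. integral\<^sup>L mu_tilde (\<lambda>w. h (w + s) * cnj (h w))"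
  shows "integrable mu_tilde A" "fourier_integral A \<xi> = complex_of_real ((cmod (fourier_integral h \<xi>))\<^sup>2)"
proof -
  have [measurable]: "h \<in> borel_measurable borel" using borel_measurable_integrable[OF h] by simp
  let ?e = "\<lambda>u. exp (- \<i> * complex_of_real (u \<bullet> \<xi>))"
  have K: "integrable (mu_tilde \<Otimes>\<^sub>M mu_tilde) (\<lambda>(w, s). h (w + s) * cnj (h w))"
  proof (rule mu_pair.Fubini_integrable)
    have "(\<integral>y. cmod (h (x + y)) \<partial>mu_tilde) = integral\<^sup>L mu_tilde (\<lambda>y. cmod (h y))" for x
      using integral_mu_translate[of "\<lambda>y. cmod (h y)" x] by (simp add: add.commute)
    then show "integrable mu_tilde (\<lambda>x. \<integral>y. norm (case (x, y) of (w, s) \<Rightarrow> h (w + s) * cnj (h w)) \<partial>mu_tilde)"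
      using h by (simp add: norm_mult)
    show "AE x in mu_tilde. integrable mu_tilde (\<lambda>y. case (x, y) of (w, s) \<Rightarrow> h (w + s) * cnj (h w))"
      using integrable_mu_translate[OF h] by (simp add: add.commute)
  qed measurable
  show "integrable mu_tilde A"
    unfolding A_def using mu_pair.integrable_snd[OF K] .
  have K': "integrable (mu_tilde \<Otimes>\<^sub>M mu_tilde) (\<lambda>(w, s). h (w + s) * cnj (h w) * ?e s)"
    by (rule Bochner_Integration.integrable_bound[OF K]) (auto simp: norm_mult)
  have "fourier_integral A \<xi> = (\<integral>s. (\<integral>w. h (w + s) * cnj (h w) * ?e s \<partial>mu_tilde) \<partial>mu_tilde)"
    by (simp add: fourier_integral_def A_def)
  also have "\<dots> = (\<integral>w. (\<integral>s. h (w + s) * cnj (h w) * ?e s \<partial>mu_tilde) \<partial>mu_tilde)"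
    by (rule mu_pair.Fubini_integral[OF K'])
  also have "\<dots> = (\<integral>w. fourier_integral h \<xi> * cnj (h w * ?e w) \<partial>mu_tilde)"
  proof (intro Bochner_Integration.integral_cong refl)
    fix w
    have e: "?e (w + s) * cnj (?e w) = ?e s" for s
      by (simp add: exp_cnj exp_add[symmetric] inner_add_left algebra_simps)
    have "fourier_integral h \<xi> = (\<integral>s. h (s + w) * ?e (s + w) \<partial>mu_tilde)"
      unfolding fourier_integral_def by (rule integral_mu_translate[symmetric]) measurable
    then have "fourier_integral h \<xi> * cnj (h w * ?e w) = (\<integral>s. h (s + w) * ?e (s + w) * cnj (h w * ?e w) \<partial>mu_tilde)"
      by simp
    also have "\<dots> = (\<integral>s. h (w + s) * cnj (h w) * ?e s \<partial>mu_tilde)"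
      using e by (intro Bochner_Integration.integral_cong refl) (simp add: add.commute mult_ac)
    finally show "(\<integral>s. h (w + s) * cnj (h w) * ?e s \<partial>mu_tilde) = fourier_integral h \<xi> * cnj (h w * ?e w)" ..
  qed
  also have "\<dots> = fourier_integral h \<xi> * cnj (fourier_integral h \<xi>)"
    by (simp add: fourier_integral_def del: complex_cnj_mult)
  finally show "fourier_integral A \<xi> = complex_of_real ((cmod (fourier_integral h \<xi>))\<^sup>2)"
    by (simp add: complex_norm_square del: of_real_power)
qed

text \<open>The squared modulus of \<open>fourier_integral h\<close> is integrated against a
  Gaussian that widens to the constant \<open>1\<close>. Monotone convergence identifies the limit
  with the squared norm of the transform. The multiplication formula turns the Gaussian into an
  approximate identity acting on the autocorrelation \<open>A\<close>, which is bounded and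
  continuous at \<open>0\<close>, where its value is the squared norm of \<open>h\<close>.\<close>

theorem plancherel:
  fixes h :: "'a::euclidean_space \<Rightarrow> complex"
  assumes si: "square_integrable h" and h: "integrable mu_tilde h"
  shows "square_integrable (fourier_integral h)"
    and "norm (abs_l2 (fourier_integral h)) = norm (abs_l2 h)"
proof -
  have [measurable]: "h \<in> borel_measurable borel" using borel_measurable_integrable[OF h] by simp
  define A where "A = (\<lambda>s. integral\<^sup>L mu_tilde (\<lambda>w. h (w + s) * cnj (h w)))"
  have A_int: "integrable mu_tilde A" and FA: "fourier_integral A \<xi> = complex_of_real ((cmod (fourier_integral h \<xi>))\<^sup>2)" for \<xi>
    unfolding A_def using fourier_autocorrelation[OF h] by auto
  have [measurable]: "A \<in> borel_measurable borel" using borel_measurable_integrable[OF A_int] by simp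
  have A_bound: "cmod (A s) \<le> (norm (abs_l2 h))\<^sup>2" for s
    using cauchy_schwarz_abs_l2[OF square_integrable_translate[OF si, of s] si]
    by (simp add: A_def norm_translate si power2_eq_square)
  have A0: "A 0 = complex_of_real ((norm (abs_l2 h))\<^sup>2)"
    by (simp add: A_def norm_abs_l2_sq[OF si] complex_norm_square[symmetric] del: of_real_power)
  have A_lim: "(\<lambda>i. A (s i)) \<longlonglongrightarrow> A 0" if "s \<longlonglongrightarrow> 0" for s :: "nat \<Rightarrow> 'a"
  proof -
    have "cmod (A (s i) - A 0) \<le> norm (abs_l2 (\<lambda>x. h (x + s i)) - abs_l2 h) * norm (abs_l2 h)" for i
    proof -
      have "A (s i) - A 0 = integral\<^sup>L mu_tilde (\<lambda>w. (h (w + s i) - h w) * cnj (h w))"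
        unfolding A_def left_diff_distrib using si
        by (subst Bochner_Integration.integral_diff)
          (auto intro!: integrable_mult_square_integrable square_integrable_translate square_integrable_cnj)
      then show ?thesis
        using cauchy_schwarz_abs_l2[OF square_integrable_diff[OF square_integrable_translate[OF si, of "s i"] si] si]
        by (simp add: abs_l2_diff si square_integrable_translate)
    qed
    moreover have "(\<lambda>i. norm (abs_l2 (\<lambda>x. h (x + s i)) - abs_l2 h) * norm (abs_l2 h)) \<longlonglongrightarrow> 0"
      using translation_continuous[OF that si]
      by (intro tendsto_mult_left_zero tendsto_norm_zero) (simp add: LIM_zero)
    ultimately have "(\<lambda>i. A (s i) - A 0) \<longlonglongrightarrow> 0"
      by (rule Lim_null_comparison[OF always_eventually[OF allI]])
    then show ?thesis by (simp add: LIM_zero_iff)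
  qed
  define \<epsilon> where "\<epsilon> i = 1 / real (Suc i)" for i
  have \<epsilon>: "\<epsilon> i > 0" for i by (simp add: \<epsilon>_def)
  have \<epsilon>_lim: "\<epsilon> \<longlonglongrightarrow> 0" unfolding \<epsilon>_def by real_asymp
  define a where "a i = integral\<^sup>L mu_tilde (\<lambda>\<xi>. (cmod (fourier_integral h \<xi>))\<^sup>2 * gauss (\<epsilon> i *\<^sub>R \<xi>))" for i
  have gs: "integrable mu_tilde (\<lambda>x::'a. gauss (c *\<^sub>R x))" if "c > 0" for c
    by (rule mu_scale(2)[OF gauss_measurable that, THEN iffD1, OF integrable_gauss])
  have int: "integrable mu_tilde (\<lambda>\<xi>. (cmod (fourier_integral h \<xi>))\<^sup>2 * gauss (\<epsilon> i *\<^sub>R \<xi>))" for i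
  proof (rule Bochner_Integration.integrable_bound[OF integrable_mult_right[OF gs[OF \<epsilon>[of i]]]])
    show "AE x in mu_tilde. norm ((cmod (fourier_integral h x))\<^sup>2 * gauss (\<epsilon> i *\<^sub>R x))
        \<le> norm ((integral\<^sup>L mu_tilde (\<lambda>u. cmod (h u)))\<^sup>2 * gauss (\<epsilon> i *\<^sub>R x))"
      using fourier_integral_bound[OF h] by (auto simp: abs_mult intro!: mult_right_mono power_mono)
  qed measurable
  have a_eq: "complex_of_real (a i) = integral\<^sup>L mu_tilde (\<lambda>t. A (\<epsilon> i *\<^sub>R t) * complex_of_real (gauss t))" for i
  proof -
    \<comment> \<open>A wide Gaussian has a narrow transform. The later substitution
      \<open>s = \<epsilon> t\<close> restores the fixed Gaussian and moves
      \<open>\<epsilon>\<close> into the argument of \<open>A\<close>, ready for dominated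
      convergence.\<close>
    have FG: "fourier_integral (\<lambda>\<xi>. complex_of_real (gauss (\<epsilon> i *\<^sub>R \<xi>))) s =
        complex_of_real (inverse (\<epsilon> i ^ DIM('a)) * gauss (inverse (\<epsilon> i) *\<^sub>R s))" for s :: 'a
    proof -
      have "complex_of_real (gauss (inverse (\<epsilon> i) *\<^sub>R s)) =
          integral\<^sup>L mu_tilde (\<lambda>u. complex_of_real (gauss u) * exp (- \<i> * complex_of_real (u \<bullet> (inverse (\<epsilon> i) *\<^sub>R s))))"
        by (subst fourier_gauss[symmetric]) (rule fourier_integral_def)
      also have "\<dots> = \<epsilon> i ^ DIM('a) *\<^sub>R integral\<^sup>L mu_tilde (\<lambda>u. complex_of_real (gauss (\<epsilon> i *\<^sub>R u)) *
          exp (- \<i> * complex_of_real ((\<epsilon> i *\<^sub>R u) \<bullet> (inverse (\<epsilon> i) *\<^sub>R s))))"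
        by (rule mu_scale(1)[OF _ \<epsilon>]) measurable
      also have "integral\<^sup>L mu_tilde (\<lambda>u. complex_of_real (gauss (\<epsilon> i *\<^sub>R u)) *
          exp (- \<i> * complex_of_real ((\<epsilon> i *\<^sub>R u) \<bullet> (inverse (\<epsilon> i) *\<^sub>R s)))) =
          fourier_integral (\<lambda>\<xi>. complex_of_real (gauss (\<epsilon> i *\<^sub>R \<xi>))) s"
        using \<epsilon>[of i] unfolding fourier_integral_def by (simp add: mult.assoc[symmetric])
      finally show ?thesis
        using \<epsilon>[of i] by (simp add: scaleR_conv_of_real field_simps)
    qed
    have "complex_of_real (a i) = integral\<^sup>L mu_tilde (\<lambda>\<xi>. fourier_integral A \<xi> * complex_of_real (gauss (\<epsilon> i *\<^sub>R \<xi>)))"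
      by (simp add: a_def FA flip: of_real_power of_real_mult)
    also have "\<dots> = integral\<^sup>L mu_tilde (\<lambda>s. A s * complex_of_real (inverse (\<epsilon> i ^ DIM('a)) * gauss (inverse (\<epsilon> i) *\<^sub>R s)))"
      by (subst fourier_integral_mult_formula[OF A_int]) (use gs[OF \<epsilon>[of i]] FG in auto)
    also have "\<dots> = \<epsilon> i ^ DIM('a) *\<^sub>R integral\<^sup>L mu_tilde (\<lambda>t. A (\<epsilon> i *\<^sub>R t) * complex_of_real (inverse (\<epsilon> i ^ DIM('a)) * gauss (inverse (\<epsilon> i) *\<^sub>R \<epsilon> i *\<^sub>R t)))"
      by (rule mu_scale(1)[OF _ \<epsilon>]) measurable
    also have "\<dots> = integral\<^sup>L mu_tilde (\<lambda>t. \<epsilon> i ^ DIM('a) *\<^sub>R (A (\<epsilon> i *\<^sub>R t) * complex_of_real (inverse (\<epsilon> i ^ DIM('a)) * gauss (inverse (\<epsilon> i) *\<^sub>R \<epsilon> i *\<^sub>R t))))"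
      by (rule integral_scaleR_right[symmetric])
    also have "\<dots> = integral\<^sup>L mu_tilde (\<lambda>t. A (\<epsilon> i *\<^sub>R t) * complex_of_real (gauss t))"
      using \<epsilon>[of i] by (intro Bochner_Integration.integral_cong refl) (simp add: scaleR_conv_of_real field_simps)
    finally show ?thesis .
  qed
  have "(\<lambda>i. complex_of_real (a i)) \<longlonglongrightarrow> integral\<^sup>L mu_tilde (\<lambda>t::'a. A 0 * complex_of_real (gauss t))"
    unfolding a_eq
  proof (rule integral_dominated_convergence[where w="\<lambda>t. (norm (abs_l2 h))\<^sup>2 * gauss t"])
    show "integrable mu_tilde (\<lambda>t::'a. (norm (abs_l2 h))\<^sup>2 * gauss t)"
      by (simp add: integrable_gauss)
    show "AE x in mu_tilde. (\<lambda>i. A (\<epsilon> i *\<^sub>R x) * complex_of_real (gauss x)) \<longlonglongrightarrow> A 0 * complex_of_real (gauss x)"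
    proof (intro AE_I2 tendsto_mult tendsto_const A_lim)
      show "(\<lambda>i. \<epsilon> i *\<^sub>R x) \<longlonglongrightarrow> 0" for x :: 'a
        using tendsto_scaleR[OF \<epsilon>_lim tendsto_const[of x]] by simp
    qed
    show "AE x in mu_tilde. norm (A (\<epsilon> i *\<^sub>R x) * complex_of_real (gauss x)) \<le> (norm (abs_l2 h))\<^sup>2 * gauss x" for i
      using A_bound by (auto simp: norm_mult less_imp_le intro!: mult_right_mono)
  qed measurable
  also have "integral\<^sup>L mu_tilde (\<lambda>t::'a. A 0 * complex_of_real (gauss t)) = complex_of_real ((norm (abs_l2 h))\<^sup>2)"
    by (simp add: A0 integral_gauss)
  finally have a_lim: "a \<longlonglongrightarrow> (norm (abs_l2 h))\<^sup>2"
    using tendsto_of_real_iff by blast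
  have "(\<integral>\<^sup>+\<xi>. ennreal ((cmod (fourier_integral h \<xi>))\<^sup>2) \<partial>mu_tilde) = ennreal ((norm (abs_l2 h))\<^sup>2)"
  proof -
    let ?f = "\<lambda>i \<xi>. ennreal ((cmod (fourier_integral h \<xi>))\<^sup>2 * gauss (\<epsilon> i *\<^sub>R \<xi>))"
    have inc: "incseq ?f"
      unfolding incseq_def le_fun_def
    proof (intro allI impI ennreal_leI mult_left_mono zero_le_power2)
      fix i j :: nat and \<xi> :: 'a assume "i \<le> j"
      then have "\<epsilon> j \<le> \<epsilon> i" by (simp add: \<epsilon>_def field_simps)
      then have "(\<epsilon> j * norm \<xi>)\<^sup>2 \<le> (\<epsilon> i * norm \<xi>)\<^sup>2"
        using \<epsilon>[of j] by (intro power_mono mult_right_mono) auto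
      then show "gauss (\<epsilon> i *\<^sub>R \<xi>) \<le> gauss (\<epsilon> j *\<^sub>R \<xi>)"
        using \<epsilon>[of i] \<epsilon>[of j] by (simp add: gauss_def)
    qed
    have "(SUP i. ?f i \<xi>) = ennreal ((cmod (fourier_integral h \<xi>))\<^sup>2)" for \<xi>
    proof (rule LIMSEQ_unique)
      show "(\<lambda>i. ?f i \<xi>) \<longlonglongrightarrow> (SUP i. ?f i \<xi>)"
        using inc by (intro LIMSEQ_SUP) (auto simp: incseq_def le_fun_def)
      have "(\<lambda>i. \<epsilon> i *\<^sub>R \<xi>) \<longlonglongrightarrow> 0"
        using tendsto_scaleR[OF \<epsilon>_lim tendsto_const[of \<xi>]] by simp
      then have "(\<lambda>i. gauss (\<epsilon> i *\<^sub>R \<xi>)) \<longlonglongrightarrow> exp (- (norm (0 :: 'a))\<^sup>2 / 2)"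
        unfolding gauss_def by (intro tendsto_intros) simp_all
      then have "(\<lambda>i. (cmod (fourier_integral h \<xi>))\<^sup>2 * gauss (\<epsilon> i *\<^sub>R \<xi>)) \<longlonglongrightarrow> (cmod (fourier_integral h \<xi>))\<^sup>2 * 1"
        by (intro tendsto_mult tendsto_const) simp
      then show "(\<lambda>i. ?f i \<xi>) \<longlonglongrightarrow> ennreal ((cmod (fourier_integral h \<xi>))\<^sup>2)"
        by (intro tendsto_ennrealI) simp
    qed
    then have "(\<integral>\<^sup>+\<xi>. ennreal ((cmod (fourier_integral h \<xi>))\<^sup>2) \<partial>mu_tilde) = (\<integral>\<^sup>+\<xi>. (SUP i. ?f i \<xi>) \<partial>mu_tilde)"
      by simp
    also have "\<dots> = (SUP i. \<integral>\<^sup>+\<xi>. ?f i \<xi> \<partial>mu_tilde)"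
      by (rule nn_integral_monotone_convergence_SUP[OF inc]) measurable
    also have "\<dots> = (SUP i. ennreal (a i))"
      unfolding a_def using int by (subst nn_integral_eq_integral) (auto simp: less_imp_le)
    also have "\<dots> = ennreal ((norm (abs_l2 h))\<^sup>2)"
    proof (rule LIMSEQ_unique)
      have "a i \<le> a j" if "i \<le> j" for i j
        unfolding a_def using inc that int
        by (intro integral_mono) (auto simp: incseq_def le_fun_def less_imp_le)
      then show "(\<lambda>i. ennreal (a i)) \<longlonglongrightarrow> (SUP i. ennreal (a i))"
        by (intro LIMSEQ_SUP) (auto simp: incseq_def intro: ennreal_leI)
      show "(\<lambda>i. ennreal (a i)) \<longlonglongrightarrow> ennreal ((norm (abs_l2 h))\<^sup>2)"
        using a_lim by (rule tendsto_ennrealI)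
    qed
    finally show ?thesis .
  qed
  note eq = this
  show F: "square_integrable (fourier_integral h)"
    by (rule square_integrableI_nn) (use eq in auto)
  show "norm (abs_l2 (fourier_integral h)) = norm (abs_l2 h)"
    using eq nn_integral_norm_abs_l2[OF F] by simp
qed

subsection \<open>The Fourier--Plancherel transform\<close>

lemma closure_eq_UNIV_l2:
  fixes X :: "'a::euclidean_space l2 set"
  assumes add: "\<And>a b. a \<in> X \<Longrightarrow> b \<in> X \<Longrightarrow> a + b \<in> X"
    and scale: "\<And>c a. a \<in> X \<Longrightarrow> scaleC_l2 c a \<in> X"
    and ind: "\<And>A. A \<in> sets borel \<Longrightarrow> emeasure lborel A < \<infinity> \<Longrightarrow> abs_l2 (indicator A) \<in> X"
  shows "closure X = UNIV"
proof -
  have "a \<in> closure X" for a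
  proof (rule l2_dense_induct)
    show "a + b \<in> closure X" if "a \<in> closure X" "b \<in> closure X" for a b
    proof -
      obtain x where "\<And>n. x n \<in> X" "x \<longlonglongrightarrow> a" using \<open>a \<in> closure X\<close> by (auto simp: closure_sequential)
      moreover obtain y where "\<And>n. y n \<in> X" "y \<longlonglongrightarrow> b" using \<open>b \<in> closure X\<close> by (auto simp: closure_sequential)
      ultimately have "(\<lambda>n. x n + y n) \<longlonglongrightarrow> a + b" "\<And>n. x n + y n \<in> X"
        using add by (auto intro: tendsto_add)
      then show ?thesis unfolding closure_sequential by (intro exI[of _ "\<lambda>n. x n + y n"]) auto
    qed
    show "scaleC_l2 c a \<in> closure X" if "a \<in> closure X" for c a
    proof -
      obtain x where "\<And>n. x n \<in> X" "x \<longlonglongrightarrow> a" using \<open>a \<in> closure X\<close> by (auto simp: closure_sequential)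
      then have "(\<lambda>n. scaleC_l2 c (x n)) \<longlonglongrightarrow> scaleC_l2 c a" "\<And>n. scaleC_l2 c (x n) \<in> X"
        using bounded_linear.tendsto[OF bounded_linear_scaleC_l2] scale by auto
      then show ?thesis unfolding closure_sequential by (intro exI[of _ "\<lambda>n. scaleC_l2 c (x n)"]) auto
    qed
    show "abs_l2 (indicator A) \<in> closure X" if "A \<in> sets borel" "emeasure lborel A < \<infinity>" for A
      using ind[OF that] closure_subset by blast
  qed simp
  then show ?thesis by auto
qed

lemma integrable_indicator_mu:
  "A \<in> sets borel \<Longrightarrow> emeasure lborel A < \<infinity> \<Longrightarrow> integrable mu_tilde (indicator A :: 'a::euclidean_space \<Rightarrow> complex)"
proof -
  assume "A \<in> sets borel" "emeasure lborel A < \<infinity>"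
  then have "integrable lborel (\<lambda>x. complex_of_real (indicator A x))"
    by (intro integrable_of_real integrable_real_indicator) auto
  moreover have "(\<lambda>x. complex_of_real (indicator A x)) = indicator A"
    by (auto split: split_indicator)
  ultimately show ?thesis by (simp add: integrable_mu_tilde_iff)
qed

definition l1_l2 :: "'a::euclidean_space l2 set" where
  "l1_l2 = abs_l2 ` {h. square_integrable h \<and> integrable mu_tilde h}"

lemma closure_l1_l2: "closure (l1_l2 :: 'a::euclidean_space l2 set) = UNIV"
proof (rule closure_eq_UNIV_l2)
  show "a + b \<in> l1_l2" if ab: "a \<in> l1_l2" "b \<in> l1_l2" for a b :: "'a l2"
  proof -
    obtain f g where "a = abs_l2 f" "b = abs_l2 g" "square_integrable f" "square_integrable g"
      "integrable mu_tilde f" "integrable mu_tilde g"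
      using ab by (auto simp: l1_l2_def)
    then show ?thesis
      by (auto simp: l1_l2_def abs_l2_add intro!: imageI square_integrable_add)
  qed
  show "scaleC_l2 c a \<in> l1_l2" if a: "a \<in> l1_l2" for c and a :: "'a l2"
  proof -
    obtain f where "a = abs_l2 f" "square_integrable f" "integrable mu_tilde f"
      using a by (auto simp: l1_l2_def)
    then show ?thesis
      by (auto simp: l1_l2_def abs_l2_scaleC intro!: imageI square_integrable_scale)
  qed
  show "abs_l2 (indicator A) \<in> l1_l2" if "A \<in> sets borel" "emeasure lborel A < \<infinity>" for A :: "'a set"
    using that unfolding l1_l2_def
    by (intro imageI CollectI conjI square_integrable_indicator integrable_indicator_mu)
qed

lemma fourier_integral_cong_AE:
  assumes "f \<in> borel_measurable borel" "g \<in> borel_measurable borel" "AE x in lborel. f x = g x"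
  shows "fourier_integral f \<xi> = fourier_integral g \<xi>"
proof -
  have [measurable]: "f \<in> borel_measurable borel" "g \<in> borel_measurable borel" by fact+
  show ?thesis
    unfolding fourier_integral_def using assms(3) by (intro integral_cong_AE) auto
qed

lemma fourier_integral_add:
  "integrable mu_tilde f \<Longrightarrow> integrable mu_tilde g \<Longrightarrow>
    fourier_integral (\<lambda>x. f x + g x) = (\<lambda>\<xi>. fourier_integral f \<xi> + fourier_integral g \<xi>)"
  unfolding fourier_integral_def[abs_def] distrib_right
  by (intro ext Bochner_Integration.integral_add integrable_fourier_integrand)

lemma fourier_integral_scale:
  "fourier_integral (\<lambda>x. c * f x) = (\<lambda>\<xi>. c * fourier_integral f \<xi>)"
  unfolding fourier_integral_def[abs_def] mult.assoc by simp

text \<open>Plancherel's theorem on the dense subspace of integrable classes extends to an isometry,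
  and bounded operators that agree on this subspace are equal. So the definite description denotes
  the extension, and complex homogeneity is inherited from it.\<close>

lemma fourier_plancherel_properties:
  "bounded_linear (fourier_plancherel :: 'a::euclidean_space l2 \<Rightarrow> 'a l2)"
  "\<And>h. square_integrable h \<Longrightarrow> integrable mu_tilde h \<Longrightarrow>
    fourier_plancherel (abs_l2 h) = abs_l2 (fourier_integral h :: 'a::euclidean_space \<Rightarrow> complex)"
  "\<And>c a. fourier_plancherel (scaleC_l2 c a) = scaleC_l2 c (fourier_plancherel (a :: 'a::euclidean_space l2))"
  "\<And>a. norm (fourier_plancherel a) = norm (a :: 'a::euclidean_space l2)"
proof -
  \<comment> \<open>An arbitrary representative of such a class is fixed; representatives that agree
    almost everywhere share one Fourier integral, so the choice does not matter.\<close>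
  define g where "g a = (SOME h. square_integrable h \<and> integrable mu_tilde h \<and> a = abs_l2 h)" for a :: "'a l2"
  have g: "square_integrable (g a) \<and> integrable mu_tilde (g a) \<and> a = abs_l2 (g a)" if "a \<in> l1_l2" for a
  proof -
    have "\<exists>h. square_integrable h \<and> integrable mu_tilde h \<and> a = abs_l2 h"
      using that by (auto simp: l1_l2_def)
    then show ?thesis unfolding g_def by (rule someI_ex)
  qed
  define \<Phi> where "\<Phi> a = abs_l2 (fourier_integral (g a))" for a :: "'a l2"
  have mem: "abs_l2 h \<in> l1_l2" if "square_integrable h" "integrable mu_tilde h" for h :: "'a \<Rightarrow> complex"
    using that by (auto simp: l1_l2_def)
  have \<Phi>: "\<Phi> (abs_l2 h) = abs_l2 (fourier_integral h)" if "square_integrable h" "integrable mu_tilde h" for h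
  proof -
    have "AE x in lborel. g (abs_l2 h) x = h x"
      using g[OF mem[OF that]] that by (intro abs_l2_eqD) auto
    then have "fourier_integral (g (abs_l2 h)) = fourier_integral h"
      using g[OF mem[OF that]] that by (intro ext fourier_integral_cong_AE) auto
    then show ?thesis by (simp add: \<Phi>_def)
  qed
  obtain T where T: "bounded_linear T" "\<And>c x. T (scaleC_l2 c x) = scaleC_l2 c (T x)"
    "\<And>x. norm (T x) = norm x" "\<And>x. x \<in> l1_l2 \<Longrightarrow> T x = \<Phi> x"
  proof (rule isometry_extension[OF closure_l1_l2, of \<Phi>])
    fix x y :: "'a l2" assume "x \<in> l1_l2" "y \<in> l1_l2"
    then obtain f h where *: "x = abs_l2 f" "square_integrable f" "integrable mu_tilde f"
      "y = abs_l2 h" "square_integrable h" "integrable mu_tilde h"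
      by (auto simp: l1_l2_def)
    then show "x + y \<in> l1_l2 \<and> \<Phi> (x + y) = \<Phi> x + \<Phi> y"
      by (simp add: abs_l2_add \<Phi> mem square_integrable_add plancherel fourier_integral_add)
  next
    fix c and x :: "'a l2" assume "x \<in> l1_l2"
    then obtain f where *: "x = abs_l2 f" "square_integrable f" "integrable mu_tilde f"
      by (auto simp: l1_l2_def)
    then show "scaleC_l2 c x \<in> l1_l2 \<and> \<Phi> (scaleC_l2 c x) = scaleC_l2 c (\<Phi> x)"
      by (simp add: abs_l2_scaleC \<Phi> mem square_integrable_scale plancherel fourier_integral_scale)
  next
    fix x :: "'a l2" assume "x \<in> l1_l2"
    then obtain f where *: "x = abs_l2 f" "square_integrable f" "integrable mu_tilde f"
      by (auto simp: l1_l2_def)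
    then show "norm (\<Phi> x) = norm x"
      by (simp add: \<Phi> plancherel)
  qed blast
  have "(fourier_plancherel :: 'a l2 \<Rightarrow> 'a l2) = T"
    unfolding fourier_plancherel_def
  proof (rule the_equality)
    show "bounded_linear T \<and> (\<forall>h. square_integrable h \<and> integrable mu_tilde h \<longrightarrow> T (abs_l2 h) = abs_l2 (fourier_integral h))"
      using T(1,4) \<Phi> mem by simp
    fix T' :: "'a l2 \<Rightarrow> 'a l2"
    assume T': "bounded_linear T' \<and> (\<forall>h. square_integrable h \<and> integrable mu_tilde h \<longrightarrow> T' (abs_l2 h) = abs_l2 (fourier_integral h))"
    have "T' x = T x" for x
    proof (rule closure_eq_UNIV_property[OF closure_l1_l2, where P="\<lambda>x. T' x = T x"])
      show "closed {x. T' x = T x}"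
        using T' T(1) by (intro closed_Collect_eq linear_continuous_on) auto
      show "T' x = T x" if "x \<in> l1_l2" for x
        using that T' T(4)[OF that] \<Phi> by (auto simp: l1_l2_def)
    qed
    then show "T' = T" by auto
  qed
  then show "bounded_linear (fourier_plancherel :: 'a l2 \<Rightarrow> 'a l2)"
    "\<And>h. square_integrable h \<Longrightarrow> integrable mu_tilde h \<Longrightarrow>
      fourier_plancherel (abs_l2 h) = abs_l2 (fourier_integral h :: 'a \<Rightarrow> complex)"
    "\<And>c a. fourier_plancherel (scaleC_l2 c a) = scaleC_l2 c (fourier_plancherel (a :: 'a l2))"
    "\<And>a. norm (fourier_plancherel a) = norm (a :: 'a l2)"
    using T \<Phi> mem by auto
qed

lemma fourier_integral_eq_0_AE:
  fixes h :: "'a::euclidean_space \<Rightarrow> complex"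
  assumes h: "square_integrable h" "integrable mu_tilde h" and 0: "\<And>\<xi>. fourier_integral h \<xi> = 0"
  shows "AE x in lborel. h x = 0"
proof -
  have "fourier_integral h = (\<lambda>_. 0)" using 0 by auto
  then have "norm (abs_l2 h) = 0"
    using plancherel(2)[OF h] by (simp add: abs_l2_zero)
  then have "abs_l2 h = abs_l2 (\<lambda>_. 0)" by (simp add: abs_l2_zero)
  then show ?thesis
    using h(1) by (intro abs_l2_eqD square_integrable_zero)
qed

section \<open>The operator F tensor I: evaluation by integrals and inversion\<close>

subsection \<open>The Fourier transform in the first variable\<close>

text \<open>Weaker than joint integrability, so that \<open>q_tensor k h\<close> with
  \<open>h\<close> merely square-integrable qualifies, while the Fourier integral in the first
  variable still converges for almost every \<open>v\<close>.\<close>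

definition slice_integrable :: "('a::euclidean_space \<times> 'b::euclidean_space \<Rightarrow> complex) \<Rightarrow> bool" where
  "slice_integrable g \<longleftrightarrow> square_integrable g \<and> (AE v in lborel. integrable mu_tilde (\<lambda>u. g (u, v)))"

definition partial_fourier :: "('a::euclidean_space \<times> 'b::euclidean_space \<Rightarrow> complex) \<Rightarrow> 'a \<times> 'b \<Rightarrow> complex" where
  "partial_fourier g = (\<lambda>(\<xi>, v). fourier_integral (\<lambda>u. g (u, v)) \<xi>)"

lemma partial_fourier_measurable [measurable]:
  assumes [measurable]: "g \<in> borel_measurable borel"
  shows "partial_fourier g \<in> borel_measurable borel"
proof -
  have [measurable]: "g \<in> borel_measurable (borel \<Otimes>\<^sub>M borel)"
    using assms by (simp add: borel_prod)
  have "partial_fourier g \<in> borel_measurable (borel \<Otimes>\<^sub>M borel)"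
    unfolding partial_fourier_def fourier_integral_def by measurable
  then show ?thesis by (simp add: borel_prod)
qed

lemma square_integrable_slices:
  fixes g :: "'a::euclidean_space \<times> 'b::euclidean_space \<Rightarrow> complex"
  assumes "square_integrable g"
  shows "AE v in lborel. square_integrable (\<lambda>u. g (u, v))"
    and "AE u in lborel. square_integrable (\<lambda>v. g (u, v))"
proof -
  have [measurable]: "g \<in> borel_measurable (borel \<Otimes>\<^sub>M borel)"
    using assms by (auto simp: borel_prod)
  have int: "integrable (mu_tilde \<Otimes>\<^sub>M mu_tilde) (\<lambda>(u, v). (cmod (g (u, v)))\<^sup>2)"
    using square_integrableD[OF assms] by (simp add: mu_tilde_prod split_def)
  show "AE v in lborel. square_integrable (\<lambda>u. g (u, v))"
    using mu_pair.AE_integrable_snd[OF int] unfolding AE_mu_tilde_iff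
    by eventually_elim (auto intro!: square_integrableI)
  show "AE u in lborel. square_integrable (\<lambda>v. g (u, v))"
    using mu_pair.AE_integrable_fst[OF int] unfolding AE_mu_tilde_iff
    by eventually_elim (auto intro!: square_integrableI)
qed

text \<open>Plancherel's theorem on almost every slice, integrated over \<open>v\<close> by
  Tonelli.\<close>

lemma partial_fourier_isometry:
  fixes g :: "'a::euclidean_space \<times> 'b::euclidean_space \<Rightarrow> complex"
  assumes g: "slice_integrable g"
  shows "square_integrable (partial_fourier g)" "norm (abs_l2 (partial_fourier g)) = norm (abs_l2 g)"
proof -
  have si: "square_integrable g" using g by (simp add: slice_integrable_def)
  have [measurable]: "g \<in> borel_measurable borel" using si by auto
  have m: "(\<lambda>p. ennreal ((cmod (f p))\<^sup>2)) \<in> borel_measurable (mu_tilde \<Otimes>\<^sub>M mu_tilde)"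
    if "f \<in> borel_measurable borel" for f :: "'a \<times> 'b \<Rightarrow> complex"
    using that by (simp add: mu_tilde_prod)
  have "(\<integral>\<^sup>+p. ennreal ((cmod (partial_fourier g p))\<^sup>2) \<partial>mu_tilde) =
      (\<integral>\<^sup>+v. \<integral>\<^sup>+\<xi>. ennreal ((cmod (partial_fourier g (\<xi>, v)))\<^sup>2) \<partial>mu_tilde \<partial>mu_tilde)"
    by (subst mu_pair.nn_integral_snd[OF m]) (simp_all add: mu_tilde_prod)
  also have "\<dots> = (\<integral>\<^sup>+v. \<integral>\<^sup>+u. ennreal ((cmod (g (u, v)))\<^sup>2) \<partial>mu_tilde \<partial>mu_tilde)"
  proof (rule nn_integral_cong_AE)
    have "AE v in lborel. integrable mu_tilde (\<lambda>u. g (u, v))"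
      using g by (simp add: slice_integrable_def)
    with square_integrable_slices(1)[OF si]
    show "AE v in mu_tilde. (\<integral>\<^sup>+\<xi>. ennreal ((cmod (partial_fourier g (\<xi>, v)))\<^sup>2) \<partial>mu_tilde) =
        (\<integral>\<^sup>+u. ennreal ((cmod (g (u, v)))\<^sup>2) \<partial>mu_tilde)"
      unfolding AE_mu_tilde_iff
    proof eventually_elim
      case (elim v)
      then show ?case
        using nn_integral_norm_abs_l2[OF elim(1)] nn_integral_norm_abs_l2[OF plancherel(1)[OF elim]]
          plancherel(2)[OF elim]
        by (simp add: partial_fourier_def)
    qed
  qed
  also have "\<dots> = (\<integral>\<^sup>+p. ennreal ((cmod (g p))\<^sup>2) \<partial>mu_tilde)"
    by (subst mu_pair.nn_integral_snd[OF m]) (simp_all add: mu_tilde_prod)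
  also have "\<dots> = ennreal ((norm (abs_l2 g))\<^sup>2)"
    by (rule nn_integral_norm_abs_l2[OF si])
  finally have eq: "(\<integral>\<^sup>+p. ennreal ((cmod (partial_fourier g p))\<^sup>2) \<partial>mu_tilde) = ennreal ((norm (abs_l2 g))\<^sup>2)" .
  show F: "square_integrable (partial_fourier g)"
    by (rule square_integrableI_nn) (use eq in auto)
  show "norm (abs_l2 (partial_fourier g)) = norm (abs_l2 g)"
    using eq nn_integral_norm_abs_l2[OF F] by simp
qed

lemma partial_fourier_adjoint:
  fixes f g :: "'a::euclidean_space \<times> 'b::euclidean_space \<Rightarrow> complex"
  assumes f: "slice_integrable f" and g: "slice_integrable g"
  shows "integral\<^sup>L mu_tilde (\<lambda>p. partial_fourier f p * g p) = integral\<^sup>L mu_tilde (\<lambda>p. f p * partial_fourier g p)"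
proof -
  have si: "square_integrable f" "square_integrable g" "square_integrable (partial_fourier f)" "square_integrable (partial_fourier g)"
    using f g partial_fourier_isometry by (auto simp: slice_integrable_def)
  have [measurable]: "f \<in> borel_measurable borel" "g \<in> borel_measurable borel"
    using si by auto
  have int1: "integrable (mu_tilde \<Otimes>\<^sub>M mu_tilde) (\<lambda>(x, y). partial_fourier f (x, y) * g (x, y))"
    using integrable_mult_square_integrable[OF si(3,2)] by (simp add: mu_tilde_prod split_def)
  have int2: "integrable (mu_tilde \<Otimes>\<^sub>M mu_tilde) (\<lambda>(x, y). f (x, y) * partial_fourier g (x, y))"
    using integrable_mult_square_integrable[OF si(1,4)] by (simp add: mu_tilde_prod split_def)
  have [measurable]: "f \<in> borel_measurable (borel \<Otimes>\<^sub>M borel)" "g \<in> borel_measurable (borel \<Otimes>\<^sub>M borel)"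
    "partial_fourier f \<in> borel_measurable (borel \<Otimes>\<^sub>M borel)" "partial_fourier g \<in> borel_measurable (borel \<Otimes>\<^sub>M borel)"
    unfolding borel_prod by measurable
  have "integral\<^sup>L mu_tilde (\<lambda>p. partial_fourier f p * g p) =
      (\<integral>v. (\<integral>\<xi>. partial_fourier f (\<xi>, v) * g (\<xi>, v) \<partial>mu_tilde) \<partial>mu_tilde)"
    using mu_pair.integral_snd[OF int1] by (simp add: mu_tilde_prod split_def)
  also have "\<dots> = (\<integral>v. (\<integral>u. f (u, v) * partial_fourier g (u, v) \<partial>mu_tilde) \<partial>mu_tilde)"
  proof (rule integral_cong_AE)
    have "AE v in lborel. integrable mu_tilde (\<lambda>u. f (u, v))" "AE v in lborel. integrable mu_tilde (\<lambda>u. g (u, v))"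
      using f g by (auto simp: slice_integrable_def)
    then show "AE v in mu_tilde. (\<integral>\<xi>. partial_fourier f (\<xi>, v) * g (\<xi>, v) \<partial>mu_tilde) =
        (\<integral>u. f (u, v) * partial_fourier g (u, v) \<partial>mu_tilde)"
      unfolding AE_mu_tilde_iff
      by eventually_elim (simp add: partial_fourier_def fourier_integral_mult_formula)
  qed measurable
  also have "\<dots> = integral\<^sup>L mu_tilde (\<lambda>p. f p * partial_fourier g p)"
    using mu_pair.integral_snd[OF int2] by (simp add: mu_tilde_prod split_def)
  finally show ?thesis .
qed

lemma AE_lborel_snd:
  assumes "AE v in (lborel :: 'b::euclidean_space measure). P v"
  shows "AE p in (lborel :: ('a::euclidean_space \<times> 'b) measure). P (snd p)"
proof -
  obtain N where N: "N \<in> null_sets lborel" "{v. \<not> P v} \<subseteq> N"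
    using assms by (auto simp: eventually_ae_filter)
  have "emeasure (lborel \<Otimes>\<^sub>M lborel) ((UNIV :: 'a set) \<times> N) = emeasure lborel (UNIV :: 'a set) * emeasure lborel N"
    using N(1) by (intro lborel.emeasure_pair_measure_Times) auto
  then have "(UNIV :: 'a set) \<times> N \<in> null_sets lborel"
    using N(1) unfolding lborel_prod null_sets_def
    by (simp add: sets_lborel) (metis borel_Times sets.top space_borel)
  then show ?thesis
    using N(2) by (intro AE_I'[of "UNIV \<times> N"]) auto
qed

lemma AE_lborel_fst:
  assumes "AE u in (lborel :: 'a::euclidean_space measure). P u"
  shows "AE p in (lborel :: ('a \<times> 'b::euclidean_space) measure). P (fst p)"
proof -
  obtain N where N: "N \<in> null_sets lborel" "{u. \<not> P u} \<subseteq> N"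
    using assms by (auto simp: eventually_ae_filter)
  have "emeasure (lborel \<Otimes>\<^sub>M lborel) (N \<times> (UNIV :: 'b set)) = emeasure lborel N * emeasure lborel (UNIV :: 'b set)"
    using N(1) by (intro lborel.emeasure_pair_measure_Times) auto
  then have "N \<times> (UNIV :: 'b set) \<in> null_sets lborel"
    using N(1) unfolding lborel_prod null_sets_def
    by (simp add: sets_lborel) (metis borel_Times sets.top space_borel)
  then show ?thesis
    using N(2) by (intro AE_I'[of "N \<times> UNIV"]) auto
qed

lemma slice_integrable_add:
  assumes "slice_integrable f" "slice_integrable g"
  shows "slice_integrable (\<lambda>p. f p + g p)"
    and "abs_l2 (partial_fourier (\<lambda>p. f p + g p)) = abs_l2 (partial_fourier f) + abs_l2 (partial_fourier g)"
proof -
  have AE: "AE v in lborel. integrable mu_tilde (\<lambda>u. f (u, v))" "AE v in lborel. integrable mu_tilde (\<lambda>u. g (u, v))"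
    using assms by (auto simp: slice_integrable_def)
  have "AE v in lborel. integrable mu_tilde (\<lambda>u. f (u, v) + g (u, v))"
    using AE by eventually_elim simp
  then show sl: "slice_integrable (\<lambda>p. f p + g p)"
    using assms by (simp add: slice_integrable_def square_integrable_add)
  have "AE p in lborel. partial_fourier (\<lambda>p. f p + g p) p = partial_fourier f p + partial_fourier g p"
    using AE_lborel_snd[OF AE(1)] AE_lborel_snd[OF AE(2)]
    by eventually_elim (auto simp: partial_fourier_def fourier_integral_add split: prod.split)
  then show "abs_l2 (partial_fourier (\<lambda>p. f p + g p)) = abs_l2 (partial_fourier f) + abs_l2 (partial_fourier g)"
    using partial_fourier_isometry(1)[OF sl] partial_fourier_isometry(1)[OF assms(1)] partial_fourier_isometry(1)[OF assms(2)]
    by (simp add: abs_l2_add) (intro abs_l2_eqI square_integrable_add, simp_all)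
qed

lemma slice_integrable_scale:
  assumes "slice_integrable f"
  shows "slice_integrable (\<lambda>p. c * f p)"
    and "partial_fourier (\<lambda>p. c * f p) = (\<lambda>p. c * partial_fourier f p)"
proof -
  have AE: "AE v in lborel. integrable mu_tilde (\<lambda>u. f (u, v))"
    using assms by (auto simp: slice_integrable_def)
  have "AE v in lborel. integrable mu_tilde (\<lambda>u. c * f (u, v))"
    using AE by eventually_elim simp
  then show "slice_integrable (\<lambda>p. c * f p)"
    using assms by (simp add: slice_integrable_def square_integrable_scale)
  show "partial_fourier (\<lambda>p. c * f p) = (\<lambda>p. c * partial_fourier f p)"
    by (auto simp: partial_fourier_def fourier_integral_scale)
qed

lemma slice_integrable_cnj:
  assumes "slice_integrable f"
  shows "slice_integrable (\<lambda>p. cnj (f p))"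
proof -
  have AE: "AE v in lborel. integrable mu_tilde (\<lambda>u. f (u, v))"
    using assms by (auto simp: slice_integrable_def)
  have "AE v in lborel. integrable mu_tilde (\<lambda>u. cnj (f (u, v)))"
    using AE by eventually_elim simp
  then show ?thesis
    using assms by (simp add: slice_integrable_def square_integrable_cnj)
qed

text \<open>The isometry is applied to the difference, whose class is zero. This makes the partial
  transform a map of classes.\<close>

lemma partial_fourier_cong:
  assumes f: "slice_integrable f" and g: "slice_integrable g" and eq: "abs_l2 f = abs_l2 g"
  shows "abs_l2 (partial_fourier f) = abs_l2 (partial_fourier g)"
proof -
  let ?g = "\<lambda>p. (-1) * g p"
  note g' = slice_integrable_scale[OF g, of "-1"]
  note sum = slice_integrable_add[OF f g'(1)]
  have si: "square_integrable f" "square_integrable g" using f g by (auto simp: slice_integrable_def)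
  have "abs_l2 (\<lambda>p. f p + ?g p) = 0"
    using abs_l2_diff[OF si] eq by simp
  then have "norm (abs_l2 (partial_fourier (\<lambda>p. f p + ?g p))) = 0"
    using partial_fourier_isometry(2)[OF sum(1)] by simp
  then have "abs_l2 (partial_fourier f) + abs_l2 (partial_fourier ?g) = 0"
    using sum(2) by simp
  moreover have "abs_l2 (partial_fourier ?g) = - abs_l2 (partial_fourier g)"
    unfolding g'(2) uminus_scaleC_l2 by (rule abs_l2_scaleC[symmetric]) (rule partial_fourier_isometry(1)[OF g])
  ultimately show ?thesis by simp
qed

definition slice_l2 :: "('a::euclidean_space \<times> 'b::euclidean_space) l2 set" where
  "slice_l2 = abs_l2 ` {g. slice_integrable g}"

lemma integrable_imp_slice_integrable:
  fixes g :: "'a::euclidean_space \<times> 'b::euclidean_space \<Rightarrow> complex"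
  assumes "square_integrable g" "integrable mu_tilde g"
  shows "slice_integrable g"
proof -
  have "integrable (mu_tilde \<Otimes>\<^sub>M mu_tilde) (\<lambda>(u, v). g (u, v))"
    using assms by (simp add: mu_tilde_prod)
  from mu_pair.AE_integrable_snd[OF this] show ?thesis
    using assms(1) by (simp add: slice_integrable_def)
qed

lemma closure_slice_l2: "closure (slice_l2 :: ('a::euclidean_space \<times> 'b::euclidean_space) l2 set) = UNIV"
proof -
  have "(l1_l2 :: ('a \<times> 'b) l2 set) \<subseteq> slice_l2"
    by (auto simp: l1_l2_def slice_l2_def integrable_imp_slice_integrable)
  from closure_mono[OF this] show ?thesis
    unfolding closure_l1_l2 by auto
qed

lemma partial_fourier_extension:
  obtains T :: "('a::euclidean_space \<times> 'b::euclidean_space) l2 \<Rightarrow> ('a \<times> 'b) l2"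
  where "bounded_linear T" "\<And>c x. T (scaleC_l2 c x) = scaleC_l2 c (T x)" "\<And>x. norm (T x) = norm x"
    "\<And>g. slice_integrable g \<Longrightarrow> T (abs_l2 g) = abs_l2 (partial_fourier g)"
proof -
  define r where "r a = (SOME h. slice_integrable h \<and> a = abs_l2 h)" for a :: "('a \<times> 'b) l2"
  define \<Phi> where "\<Phi> a = abs_l2 (partial_fourier (r a))" for a :: "('a \<times> 'b) l2"
  have mem: "abs_l2 g \<in> slice_l2" if "slice_integrable g" for g :: "'a \<times> 'b \<Rightarrow> complex"
    using that by (auto simp: slice_l2_def)
  have \<Phi>: "\<Phi> (abs_l2 g) = abs_l2 (partial_fourier g)" if g: "slice_integrable g" for g
  proof -
    have "\<exists>h. slice_integrable h \<and> abs_l2 g = abs_l2 h"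
      using g by blast
    then have "slice_integrable (r (abs_l2 g)) \<and> abs_l2 g = abs_l2 (r (abs_l2 g))"
      unfolding r_def by (rule someI_ex)
    then show ?thesis
      unfolding \<Phi>_def using g by (intro partial_fourier_cong) auto
  qed
  obtain T where T: "bounded_linear T" "\<And>c x. T (scaleC_l2 c x) = scaleC_l2 c (T x)"
    "\<And>x. norm (T x) = norm x" "\<And>x. x \<in> slice_l2 \<Longrightarrow> T x = \<Phi> x"
  proof (rule isometry_extension[OF closure_slice_l2, of \<Phi>])
    fix x y :: "('a \<times> 'b) l2" assume "x \<in> slice_l2" "y \<in> slice_l2"
    then obtain f h where *: "x = abs_l2 f" "slice_integrable f" "y = abs_l2 h" "slice_integrable h"
      by (auto simp: slice_l2_def)
    then have "x + y = abs_l2 (\<lambda>p. f p + h p)"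
      by (simp add: abs_l2_add slice_integrable_def)
    then show "x + y \<in> slice_l2 \<and> \<Phi> (x + y) = \<Phi> x + \<Phi> y"
      using * slice_integrable_add[OF *(2,4)] by (simp add: mem \<Phi>)
  next
    fix c and x :: "('a \<times> 'b) l2" assume "x \<in> slice_l2"
    then obtain f where *: "x = abs_l2 f" "slice_integrable f"
      by (auto simp: slice_l2_def)
    then have "scaleC_l2 c x = abs_l2 (\<lambda>p. c * f p)"
      by (simp add: abs_l2_scaleC slice_integrable_def)
    then show "scaleC_l2 c x \<in> slice_l2 \<and> \<Phi> (scaleC_l2 c x) = scaleC_l2 c (\<Phi> x)"
      using * slice_integrable_scale[OF *(2)] partial_fourier_isometry(1)[OF *(2)]
      by (simp add: mem \<Phi> abs_l2_scaleC)
  next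
    fix x :: "('a \<times> 'b) l2" assume "x \<in> slice_l2"
    then show "norm (\<Phi> x) = norm x"
      by (auto simp: slice_l2_def \<Phi> partial_fourier_isometry)
  qed blast
  then show ?thesis
    using that[of T] mem \<Phi> by simp
qed

subsection \<open>Elementary tensors\<close>

lemma square_integrable_tensor:
  fixes h :: "'a::euclidean_space \<Rightarrow> complex" and g :: "'b::euclidean_space \<Rightarrow> complex"
  assumes h: "square_integrable h" and g: "square_integrable g"
  shows "square_integrable (\<lambda>(u, v). h u * g v)"
    and "norm (abs_l2 (\<lambda>(u, v). h u * g v)) = norm (abs_l2 h) * norm (abs_l2 g)"
proof -
  have [measurable]: "h \<in> borel_measurable borel" "g \<in> borel_measurable borel" using h g by auto
  have m: "(\<lambda>(u, v). h u * g v) \<in> borel_measurable (borel \<Otimes>\<^sub>M borel)"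
    by measurable
  have "(\<lambda>p. (cmod (h (fst p) * g (snd p)))\<^sup>2) \<in> borel_measurable (borel \<Otimes>\<^sub>M borel)"
    by measurable
  then have m': "(\<lambda>p. (cmod (h (fst p) * g (snd p)))\<^sup>2) \<in> borel_measurable borel"
    by (simp add: borel_prod)
  have "(\<integral>\<^sup>+p. ennreal ((cmod (case p of (u, v) \<Rightarrow> h u * g v))\<^sup>2) \<partial>mu_tilde) =
      (\<integral>\<^sup>+v. \<integral>\<^sup>+u. ennreal ((cmod (h u * g v))\<^sup>2) \<partial>mu_tilde \<partial>mu_tilde)"
    using mu_pair.nn_integral_snd[of "\<lambda>(u, v). ennreal ((cmod (h u * g v))\<^sup>2)"] m'
    by (simp add: mu_tilde_prod split_def)
  also have "\<dots> = (\<integral>\<^sup>+v. (\<integral>\<^sup>+u. ennreal ((cmod (h u))\<^sup>2) \<partial>mu_tilde) * ennreal ((cmod (g v))\<^sup>2) \<partial>mu_tilde)"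
    by (simp add: norm_mult power_mult_distrib ennreal_mult nn_integral_multc)
  also have "\<dots> = ennreal ((norm (abs_l2 h) * norm (abs_l2 g))\<^sup>2)"
    using h g by (simp add: nn_integral_norm_abs_l2 nn_integral_cmult power_mult_distrib ennreal_mult)
  finally have eq: "(\<integral>\<^sup>+p. ennreal ((cmod (case p of (u, v) \<Rightarrow> h u * g v))\<^sup>2) \<partial>mu_tilde) =
      ennreal ((norm (abs_l2 h) * norm (abs_l2 g))\<^sup>2)" .
  show si: "square_integrable (\<lambda>(u, v). h u * g v)"
    by (rule square_integrableI_nn) (use eq m in \<open>auto simp: borel_prod\<close>)
  show "norm (abs_l2 (\<lambda>(u, v). h u * g v)) = norm (abs_l2 h) * norm (abs_l2 g)"
    using eq nn_integral_norm_abs_l2[OF si] by (simp add: power2_eq_iff_nonneg)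
qed

lemma tensor_abs_l2:
  fixes h :: "'a::euclidean_space \<Rightarrow> complex" and g :: "'b::euclidean_space \<Rightarrow> complex"
  assumes h: "square_integrable h" and g: "square_integrable g"
  shows "tensor_l2 (abs_l2 h) (abs_l2 g) = abs_l2 (\<lambda>(u, v). h u * g v)"
  unfolding tensor_l2_def
proof (intro abs_l2_eqI square_integrable_tensor square_integrable_rep h g)
  show "AE p in lborel. (case p of (u, v) \<Rightarrow> rep_l2 (abs_l2 h) u * rep_l2 (abs_l2 g) v) = (case p of (u, v) \<Rightarrow> h u * g v)"
    using AE_lborel_fst[OF rep_abs_l2[OF h]] AE_lborel_snd[OF rep_abs_l2[OF g]]
    by eventually_elim (auto split: prod.split)
qed

lemma norm_tensor_l2: "norm (tensor_l2 a b) = norm a * norm b"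
  by (induction a rule: abs_l2_induct, induction b rule: abs_l2_induct)
    (simp add: tensor_abs_l2 square_integrable_tensor)

lemma tensor_l2_add: "tensor_l2 (a + a') b = tensor_l2 a b + tensor_l2 a' b"
  by (induction a rule: abs_l2_induct, induction a' rule: abs_l2_induct, induction b rule: abs_l2_induct)
    (simp add: tensor_abs_l2 abs_l2_add square_integrable_add square_integrable_tensor split_def distrib_right
      square_integrable_tensor[unfolded split_def])

lemma tensor_l2_scaleC: "tensor_l2 (scaleC_l2 c a) b = scaleC_l2 c (tensor_l2 a b)"
  by (induction a rule: abs_l2_induct, induction b rule: abs_l2_induct)
    (simp add: tensor_abs_l2 abs_l2_scaleC square_integrable_scale split_def mult.assoc
      square_integrable_tensor[unfolded split_def])

lemma bounded_linear_tensor_l2: "bounded_linear (\<lambda>a. tensor_l2 a b)"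
  by (rule bounded_linear_intro[where K="norm b"])
    (simp_all add: tensor_l2_add tensor_l2_scaleC scaleR_l2_def norm_tensor_l2)

text \<open>Indicators of rectangles of finite measure are elementary tensors. Inside a fixed
  rectangle a Dynkin argument reaches all Borel sets, and exhaustion by products of balls reaches
  all Borel sets of finite measure.\<close>

lemma tensor_l2_dense_induct:
  fixes S :: "('a::euclidean_space \<times> 'b::euclidean_space) l2 set"
  assumes S: "closed S"
    and add: "\<And>a b. a \<in> S \<Longrightarrow> b \<in> S \<Longrightarrow> a + b \<in> S"
    and scale: "\<And>c a. a \<in> S \<Longrightarrow> scaleC_l2 c a \<in> S"
    and tensor: "\<And>h g. tensor_l2 h g \<in> S"
  shows "a \<in> S"
proof (rule l2_dense_induct[OF S add scale])
  have rect: "abs_l2 (indicator (A \<times> B)) \<in> S"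
    if "A \<in> sets borel" "B \<in> sets borel" "emeasure lborel A < \<infinity>" "emeasure lborel B < \<infinity>"
    for A :: "'a set" and B :: "'b set"
  proof -
    have "tensor_l2 (abs_l2 (indicator A)) (abs_l2 (indicator B)) = abs_l2 (\<lambda>(u, v). indicator A u * indicator B v)"
      using that by (intro tensor_abs_l2 square_integrable_indicator)
    also have "(\<lambda>(u, v). indicator A u * indicator B v) = (indicator (A \<times> B) :: 'a \<times> 'b \<Rightarrow> complex)"
      by (auto simp: fun_eq_iff split: split_indicator)
    finally show ?thesis using tensor by metis
  qed
  have zero: "abs_l2 (\<lambda>_. 0) \<in> S"
    using scale[of "tensor_l2 0 0" 0] tensor abs_l2_scaleC[OF square_integrable_rep, of 0 "tensor_l2 0 0 :: ('a \<times> 'b) l2"]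
    by simp
  \<comment> \<open>Intersecting with \<open>C \<times> D\<close> keeps complements and countable
    unions within finite measure, where indicators are square-integrable.\<close>
  have box: "abs_l2 (indicator (E \<inter> (C \<times> D))) \<in> S"
    if E: "E \<in> sets borel" and CD: "C \<in> sets borel" "D \<in> sets borel" "emeasure lborel C < \<infinity>" "emeasure lborel D < \<infinity>"
    for E :: "('a \<times> 'b) set" and C D
  proof -
    let ?G = "{a \<times> b | a b. a \<in> sets (borel :: 'a measure) \<and> b \<in> sets (borel :: 'b measure)}"
    have CDm: "C \<times> D \<in> sets borel" using CD borel_Times by blast
    have fin: "emeasure lborel (C \<times> D) < \<infinity>"
      using CD lborel.emeasure_pair_measure_Times[of C lborel D]
      by (simp add: lborel_prod ennreal_mult_less_top)
    have siCD: "square_integrable (indicator (C \<times> D))"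
      by (rule square_integrable_indicator[OF CDm fin])
    have sets_eq: "sigma_sets UNIV ?G = sets borel"
      unfolding borel_prod[symmetric] sets_pair_measure by simp
    have E': "E \<in> sigma_sets UNIV ?G" using E by (simp add: sets_eq)
    have si: "square_integrable (indicator (A \<inter> C \<times> D))" if "A \<in> sets borel" for A
      using that CDm by (intro square_integrable_bound[OF siCD]) (auto split: split_indicator)
    have G: "?G \<subseteq> Pow UNIV" by auto
    from Int_stable_pair_measure_generator G E' show ?thesis
    proof (induction rule: sigma_sets_induct_disjoint)
      case (basic A)
      then obtain a b where A: "A = a \<times> b" "a \<in> sets borel" "b \<in> sets borel" by auto
      have "emeasure lborel (a \<inter> C) \<le> emeasure lborel C" "emeasure lborel (b \<inter> D) \<le> emeasure lborel D"
        using A CD by (auto intro!: emeasure_mono)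
      then have "abs_l2 (indicator ((a \<inter> C) \<times> (b \<inter> D))) \<in> S"
        using A CD by (intro rect) (auto elim: le_less_trans)
      then show ?case by (simp add: A Times_Int_Times)
    next
      case empty
      show ?case using zero by simp
    next
      case (compl A)
      then have A: "A \<in> sets borel" by (simp add: sets_eq)
      have "abs_l2 (indicator (C \<times> D)) + scaleC_l2 (-1) (abs_l2 (indicator (A \<inter> C \<times> D))) \<in> S"
        by (intro add scale compl rect CD)
      moreover have "abs_l2 (indicator (C \<times> D)) + scaleC_l2 (-1) (abs_l2 (indicator (A \<inter> C \<times> D))) =
          abs_l2 (\<lambda>x. indicator (C \<times> D) x + (-1) * indicator (A \<inter> C \<times> D) x)"
        by (simp add: abs_l2_scaleC abs_l2_add siCD si[OF A] square_integrable_scale square_integrable_uminus)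
      moreover have "(\<lambda>x. indicator (C \<times> D) x + (-1) * indicator (A \<inter> C \<times> D) x) = (indicator ((UNIV - A) \<inter> C \<times> D) :: 'a \<times> 'b \<Rightarrow> complex)"
        by (auto simp: fun_eq_iff split: split_indicator)
      ultimately show ?case by simp
    next
      case (union A)
      have A: "A i \<in> sets borel" for i
        using union(2) sets_eq by auto
      let ?f = "\<lambda>n x. \<Sum>i<n. indicator (A i \<inter> C \<times> D) x :: complex"
      have f_eq: "?f n = indicator ((\<Union>i<n. A i) \<inter> C \<times> D)" for n
      proof
        fix x
        have "disjoint_family_on (\<lambda>i. A i \<inter> C \<times> D) {..<n}"
          using union(1) by (auto simp: disjoint_family_on_def)
        then have "indicator (\<Union>i<n. A i \<inter> C \<times> D) x = ?f n x"
          by (subst indicator_UN_disjoint) auto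
        then show "?f n x = indicator ((\<Union>i<n. A i) \<inter> C \<times> D) x"
          by (simp add: Int_UN_distrib2)
      qed
      have "abs_l2 (?f n) \<in> S" for n
      proof (induction n)
        case 0
        show ?case using zero by simp
      next
        case (Suc n)
        have "abs_l2 (?f n) + abs_l2 (indicator (A n \<inter> C \<times> D)) \<in> S"
          by (intro add Suc union)
        then show ?case
          using si[OF A] by (simp add: abs_l2_add square_integrable_sum)
      qed
      moreover have "(\<lambda>n. abs_l2 (?f n)) \<longlonglongrightarrow> abs_l2 (indicator ((\<Union>i. A i) \<inter> C \<times> D))"
      proof (rule l2_tendsto_dominated(3)[OF _ _ siCD])
        show "?f n \<in> borel_measurable borel" for n
          unfolding f_eq using A CDm by auto
        show "indicator ((\<Union>i. A i) \<inter> C \<times> D) \<in> borel_measurable borel"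
          using A CDm by auto
        show "AE x in lborel. (\<lambda>n. ?f n x) \<longlonglongrightarrow> indicator ((\<Union>i. A i) \<inter> C \<times> D) x"
          unfolding fun_cong[OF f_eq] unfolding indicator_inter_arith by (intro AE_I2 tendsto_mult tendsto_const LIMSEQ_indicator_UN)
        show "AE x in lborel. cmod (?f n x) \<le> cmod (indicator (C \<times> D) x)" for n
          unfolding fun_cong[OF f_eq] by (auto split: split_indicator)
      qed
      ultimately show ?case
        using closed_sequentially[OF S, of "\<lambda>n. abs_l2 (?f n)"] by blast
    qed
  qed
  show "abs_l2 (indicator E) \<in> S" if E: "E \<in> sets borel" "emeasure lborel E < \<infinity>" for E :: "('a \<times> 'b) set"
  proof -
    define K where "K n = ball (0 :: 'a) (real n) \<times> ball (0 :: 'b) (real n)" for n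
    have "(\<lambda>n. abs_l2 (indicator (E \<inter> K n))) \<longlonglongrightarrow> abs_l2 (indicator E :: 'a \<times> 'b \<Rightarrow> complex)"
    proof (rule l2_tendsto_dominated(3)[OF _ _ square_integrable_indicator[OF E]])
      have [measurable]: "K n \<in> sets borel" for n
        unfolding K_def by (intro borel_open open_Times) auto
      show "indicator (E \<inter> K n) \<in> borel_measurable borel" for n using E by auto
      show "indicator E \<in> borel_measurable borel" using E by auto
      show "AE x in lborel. cmod (indicator (E \<inter> K n) x) \<le> cmod (indicator E x)" for n
        by (auto split: split_indicator)
      show "AE x in lborel. (\<lambda>n. indicator (E \<inter> K n) x) \<longlonglongrightarrow> (indicator E x :: complex)"
      proof (rule AE_I2)
        fix x :: "'a \<times> 'b"
        obtain N where N: "norm (fst x) < real N" "norm (snd x) < real N"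
          using reals_Archimedean2[of "max (norm (fst x)) (norm (snd x))"] by auto
        have "\<forall>\<^sub>F n in sequentially. indicator (E \<inter> K n) x = (indicator E x :: complex)"
          using eventually_ge_at_top[of N]
        proof eventually_elim
          case (elim n)
          then have "x \<in> K n" using N by (cases x) (auto simp: K_def)
          then show ?case by (simp add: indicator_def)
        qed
        then show "(\<lambda>n. indicator (E \<inter> K n) x) \<longlonglongrightarrow> (indicator E x :: complex)"
          by (rule tendsto_eventually)
      qed
    qed
    moreover have "abs_l2 (indicator (E \<inter> K n)) \<in> S" for n
      unfolding K_def using E by (intro box) (use emeasure_lborel_ball_finite in auto)
    ultimately show ?thesis
      using closed_sequentially[OF S, of "\<lambda>n. abs_l2 (indicator (E \<inter> K n))"] by blast
  qed
qed

text \<open>Existence: the extension of \<open>partial_fourier\<close> acts on elementary tensors as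
  prescribed, for integrable \<open>h\<close> by computation and for all \<open>h\<close> by
  continuity. Uniqueness: density of the span of tensors. As a result the abstract operator is an
  integral on every \<open>slice_integrable\<close> function.\<close>

lemma fourier_tensor_id_properties:
  "bounded_linear (fourier_tensor_id :: ('a::euclidean_space \<times> 'b::euclidean_space) l2 \<Rightarrow> ('a \<times> 'b) l2)"
  "\<And>c x. fourier_tensor_id (scaleC_l2 c x) = scaleC_l2 c (fourier_tensor_id (x :: ('a \<times> 'b) l2))"
  "\<And>x. norm (fourier_tensor_id x) = norm (x :: ('a \<times> 'b) l2)"
  "\<And>g. slice_integrable g \<Longrightarrow> fourier_tensor_id (abs_l2 g) = abs_l2 (partial_fourier g :: 'a \<times> 'b \<Rightarrow> complex)"
proof -
  obtain T :: "('a \<times> 'b) l2 \<Rightarrow> ('a \<times> 'b) l2"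
    where T: "bounded_linear T" "\<And>c x. T (scaleC_l2 c x) = scaleC_l2 c (T x)" "\<And>x. norm (T x) = norm x"
      "\<And>g. slice_integrable g \<Longrightarrow> T (abs_l2 g) = abs_l2 (partial_fourier g)"
    using partial_fourier_extension by blast
  have tensor: "T (tensor_l2 h g) = tensor_l2 (fourier_plancherel h) g" for h g
  proof (rule closure_eq_UNIV_property[OF closure_l1_l2, where P="\<lambda>h. T (tensor_l2 h g) = tensor_l2 (fourier_plancherel h) g"])
    show "closed {h. T (tensor_l2 h g) = tensor_l2 (fourier_plancherel h) g}"
      by (intro closed_Collect_eq linear_continuous_on bounded_linear_compose[OF T(1)]
          bounded_linear_compose[OF bounded_linear_tensor_l2] bounded_linear_tensor_l2 fourier_plancherel_properties)
    fix a :: "'a l2" assume "a \<in> l1_l2"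
    then obtain h where h: "a = abs_l2 h" "square_integrable h" "integrable mu_tilde h"
      by (auto simp: l1_l2_def)
    show "T (tensor_l2 a g) = tensor_l2 (fourier_plancherel a) g"
    proof (induction g rule: abs_l2_induct)
      case (abs g)
      have sl: "slice_integrable (\<lambda>(u, v). h u * g v)"
        unfolding slice_integrable_def using square_integrable_tensor(1)[OF h(2) abs] h(3) by simp
      have "partial_fourier (\<lambda>(u, v). h u * g v) = (\<lambda>(\<xi>, v). fourier_integral h \<xi> * g v)"
        by (auto simp: partial_fourier_def fourier_integral_def fun_eq_iff mult_ac simp flip: integral_mult_right_zero)
      then show ?case
        by (simp add: h tensor_abs_l2 abs T(4)[OF sl] fourier_plancherel_properties(2) plancherel(1))
    qed
  qed
  have "(fourier_tensor_id :: ('a \<times> 'b) l2 \<Rightarrow> ('a \<times> 'b) l2) = T"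
    unfolding fourier_tensor_id_def
  proof (rule the_equality)
    show "bounded_linear T \<and> (\<forall>h g. T (tensor_l2 h g) = tensor_l2 (fourier_plancherel h) g)"
      using T(1) tensor by blast
    fix T' :: "('a \<times> 'b) l2 \<Rightarrow> ('a \<times> 'b) l2"
    assume T': "bounded_linear T' \<and> (\<forall>h g. T' (tensor_l2 h g) = tensor_l2 (fourier_plancherel h) g)"
    show "T' = T"
    proof
      fix a
      \<comment> \<open>\<open>T'\<close> is only known to be real linear, hence the quantification over scalars.\<close>
      define S where "S = {a. \<forall>c. T' (scaleC_l2 c a) = T (scaleC_l2 c a)}"
      have "a \<in> S"
      proof (rule tensor_l2_dense_induct)
        show "closed S"
          unfolding S_def using T' T(1)
          by (intro closed_Collect_all closed_Collect_eq linear_continuous_on)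
            (auto intro: bounded_linear_compose bounded_linear_scaleC_l2)
        show "a + b \<in> S" if "a \<in> S" "b \<in> S" for a b
          using that T' T(1) by (simp add: S_def scaleC_l2_add linear_simps)
        show "scaleC_l2 c a \<in> S" if "a \<in> S" for c a
          using that by (simp add: S_def scaleC_scaleC_l2)
        show "tensor_l2 h g \<in> S" for h g
          using T' by (simp add: S_def tensor_l2_scaleC[symmetric] tensor)
      qed
      then have "T' (scaleC_l2 1 a) = T (scaleC_l2 1 a)"
        by (simp add: S_def)
      moreover have "scaleC_l2 1 a = a"
        using scaleR_one[of a] by (simp add: scaleR_l2_def)
      ultimately show "T' a = T a" by simp
    qed
  qed
  then show "bounded_linear (fourier_tensor_id :: ('a \<times> 'b) l2 \<Rightarrow> ('a \<times> 'b) l2)"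
    "\<And>c x. fourier_tensor_id (scaleC_l2 c x) = scaleC_l2 c (fourier_tensor_id (x :: ('a \<times> 'b) l2))"
    "\<And>x. norm (fourier_tensor_id x) = norm (x :: ('a \<times> 'b) l2)"
    "\<And>g. slice_integrable g \<Longrightarrow> fourier_tensor_id (abs_l2 g) = abs_l2 (partial_fourier g :: 'a \<times> 'b \<Rightarrow> complex)"
    using T by auto
qed

lemma inner_fourier_tensor_id: "fourier_tensor_id a \<bullet> fourier_tensor_id b = a \<bullet> b"
proof -
  have "fourier_tensor_id (a + b) = fourier_tensor_id a + fourier_tensor_id b"
    using fourier_tensor_id_properties(1) by (rule linear_simps)
  then show ?thesis
    using dot_norm[of "fourier_tensor_id a" "fourier_tensor_id b"] dot_norm[of a b]
    by (metis fourier_tensor_id_properties(3))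
qed

definition inverse_partial_fourier ::
    "('a::euclidean_space \<times> 'b::euclidean_space \<Rightarrow> complex) \<Rightarrow> 'a \<times> 'b \<Rightarrow> complex" where
  "inverse_partial_fourier g = (\<lambda>(x, v). integral\<^sup>L mu_tilde (\<lambda>\<xi>. g (\<xi>, v) * exp (\<i> * complex_of_real (x \<bullet> \<xi>))))"

lemma inverse_partial_fourier_eq:
  "inverse_partial_fourier g p = cnj (partial_fourier (\<lambda>q. cnj (g q)) p)"
  unfolding inverse_partial_fourier_def partial_fourier_def fourier_integral_def split_def
  by (subst Bochner_Integration.integral_cnj[symmetric]) (simp add: exp_cnj inner_commute del: Bochner_Integration.integral_cnj)

text \<open>A Hilbert space argument: \<open>inverse_partial_fourier g\<close> is the adjoint
  applied to \<open>g\<close> and has the norm of \<open>g\<close>. Both the squared norm of its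
  image and the inner product of its image with \<open>g\<close> therefore equal the squared norm of
  \<open>g\<close>, so the image and \<open>g\<close> have distance \<open>0\<close>.\<close>

theorem fourier_tensor_id_inverse:
  fixes g :: "'a::euclidean_space \<times> 'b::euclidean_space \<Rightarrow> complex"
  assumes g: "slice_integrable g"
  shows "square_integrable (inverse_partial_fourier g)"
    and "fourier_tensor_id (abs_l2 (inverse_partial_fourier g)) = abs_l2 g"
proof -
  let ?V = "inverse_partial_fourier g" and ?T = "fourier_tensor_id :: ('a \<times> 'b) l2 \<Rightarrow> ('a \<times> 'b) l2"
  note gc = slice_integrable_cnj[OF g]
  have si: "square_integrable g" using g by (simp add: slice_integrable_def)
  have V_eq: "?V = (\<lambda>p. cnj (partial_fourier (\<lambda>q. cnj (g q)) p))"
    by (rule ext) (rule inverse_partial_fourier_eq)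
  show V: "square_integrable ?V"
    unfolding V_eq by (intro square_integrable_cnj partial_fourier_isometry gc)
  have norm_V: "norm (abs_l2 ?V) = norm (abs_l2 g)"
    using partial_fourier_isometry[OF gc] si V unfolding V_eq
    by (simp add: norm_abs_l2 square_integrable_cnj)
  have adj: "?T a \<bullet> abs_l2 g = a \<bullet> abs_l2 ?V" for a
  proof (rule closure_eq_UNIV_property[OF closure_slice_l2, where P="\<lambda>a. ?T a \<bullet> abs_l2 g = a \<bullet> abs_l2 ?V"])
    show "closed {a. ?T a \<bullet> abs_l2 g = a \<bullet> abs_l2 ?V}"
      by (intro closed_Collect_eq continuous_intros linear_continuous_on fourier_tensor_id_properties)
    fix a :: "('a \<times> 'b) l2" assume "a \<in> slice_l2"
    then obtain f where f: "a = abs_l2 f" "slice_integrable f" by (auto simp: slice_l2_def)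
    then have "square_integrable f" by (simp add: slice_integrable_def)
    then show "?T a \<bullet> abs_l2 g = a \<bullet> abs_l2 ?V"
      using partial_fourier_adjoint[OF f(2) gc] partial_fourier_isometry(1)[OF f(2)] si V
      by (simp add: f fourier_tensor_id_properties(4) inner_abs_l2) (simp add: V_eq)
  qed
  have "(norm (?T (abs_l2 ?V) - abs_l2 g))\<^sup>2 = (norm (?T (abs_l2 ?V)))\<^sup>2 + (norm (abs_l2 g))\<^sup>2 - 2 * (?T (abs_l2 ?V) \<bullet> abs_l2 g)"
    using dot_norm_neg[of "?T (abs_l2 ?V)" "abs_l2 g"] by simp
  also have "\<dots> = 0"
    by (simp add: fourier_tensor_id_properties(3) norm_V adj power2_norm_eq_inner[symmetric])
  finally show "?T (abs_l2 ?V) = abs_l2 g" by simp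
qed

section \<open>Hermite functions and completeness of the functions \<open>q_fun\<close>\<close>

subsection \<open>Functions of exponential growth on the line\<close>

text \<open>A class closed under sums, products and affine substitutions that contains polynomials
  and exponentials, and whose members become integrable and vanish at infinity against any Gaussian.
  It replaces separate estimates for the integrands of the Hermite calculus.\<close>

definition exp_growth :: "(real \<Rightarrow> complex) \<Rightarrow> bool" where
  "exp_growth u \<longleftrightarrow> u \<in> borel_measurable borel \<and> (\<exists>C a. \<forall>x. cmod (u x) \<le> C * exp (a * \<bar>x\<bar>))"

lemma exp_growthI:
  "u \<in> borel_measurable borel \<Longrightarrow> (\<And>x. cmod (u x) \<le> C * exp (a * \<bar>x\<bar>)) \<Longrightarrow> exp_growth u"
  by (auto simp: exp_growth_def)

lemma exp_growth_measurable [measurable_dest]: "exp_growth u \<Longrightarrow> u \<in> borel_measurable borel"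
  by (simp add: exp_growth_def)

lemma exp_growthE:
  assumes "exp_growth u"
  obtains C a where "C \<ge> 0" "a \<ge> 0" "\<And>x. cmod (u x) \<le> C * exp (a * \<bar>x\<bar>)"
proof -
  obtain C a where *: "\<And>x. cmod (u x) \<le> C * exp (a * \<bar>x\<bar>)"
    using assms by (auto simp: exp_growth_def)
  have "cmod (u x) \<le> \<bar>C\<bar> * exp (\<bar>a\<bar> * \<bar>x\<bar>)" for x
  proof -
    have "C * exp (a * \<bar>x\<bar>) \<le> \<bar>C\<bar> * exp (\<bar>a\<bar> * \<bar>x\<bar>)"
      by (intro mult_mono) (auto intro: mult_right_mono)
    with *[of x] show ?thesis by linarith
  qed
  then show ?thesis using that[of "\<bar>C\<bar>" "\<bar>a\<bar>"] by simp
qed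

lemma exp_growth_const [intro]: "exp_growth (\<lambda>_. c)"
  by (rule exp_growthI[where C="cmod c" and a=0]) auto

lemma exp_growth_add [intro]:
  assumes "exp_growth u" "exp_growth v"
  shows "exp_growth (\<lambda>x. u x + v x)"
proof -
  obtain C a where 1: "C \<ge> 0" "a \<ge> 0" "\<And>x. cmod (u x) \<le> C * exp (a * \<bar>x\<bar>)"
    using exp_growthE[OF assms(1)] by blast
  obtain D b where 2: "D \<ge> 0" "b \<ge> 0" "\<And>x. cmod (v x) \<le> D * exp (b * \<bar>x\<bar>)"
    using exp_growthE[OF assms(2)] by blast
  show ?thesis
  proof (rule exp_growthI)
    fix x
    have "cmod (u x + v x) \<le> C * exp (a * \<bar>x\<bar>) + D * exp (b * \<bar>x\<bar>)"
      using norm_triangle_ineq[of "u x" "v x"] 1(3)[of x] 2(3)[of x] by linarith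
    also have "\<dots> \<le> C * exp ((a + b) * \<bar>x\<bar>) + D * exp ((a + b) * \<bar>x\<bar>)"
      using 1 2 by (intro add_mono mult_left_mono) (auto simp: mult_right_mono)
    finally show "cmod (u x + v x) \<le> (C + D) * exp ((a + b) * \<bar>x\<bar>)"
      by (simp add: distrib_right)
  qed (use assms in auto)
qed

lemma exp_growth_mult [intro]:
  assumes "exp_growth u" "exp_growth v"
  shows "exp_growth (\<lambda>x. u x * v x)"
proof -
  obtain C a where 1: "C \<ge> 0" "a \<ge> 0" "\<And>x. cmod (u x) \<le> C * exp (a * \<bar>x\<bar>)"
    using exp_growthE[OF assms(1)] by blast
  obtain D b where 2: "D \<ge> 0" "b \<ge> 0" "\<And>x. cmod (v x) \<le> D * exp (b * \<bar>x\<bar>)"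
    using exp_growthE[OF assms(2)] by blast
  show ?thesis
  proof (rule exp_growthI)
    fix x
    have "cmod (u x * v x) \<le> (C * exp (a * \<bar>x\<bar>)) * (D * exp (b * \<bar>x\<bar>))"
      unfolding norm_mult using 1 2 by (intro mult_mono) auto
    also have "\<dots> = (C * D) * exp ((a + b) * \<bar>x\<bar>)"
      unfolding distrib_right exp_add by simp
    finally show "cmod (u x * v x) \<le> (C * D) * exp ((a + b) * \<bar>x\<bar>)" .
  qed (use assms in auto)
qed

lemma exp_growth_diff [intro]:
  "exp_growth u \<Longrightarrow> exp_growth v \<Longrightarrow> exp_growth (\<lambda>x. u x - v x)"
  using exp_growth_add[of u "\<lambda>x. (-1) * v x"] exp_growth_mult[OF exp_growth_const, of v "-1"] by simp

lemma exp_growth_of_real [intro]: "exp_growth complex_of_real"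
proof (rule exp_growthI)
  show "cmod (complex_of_real x) \<le> 1 * exp (1 * \<bar>x\<bar>)" for x
  proof -
    have "\<bar>x\<bar> \<le> exp \<bar>x\<bar>"
      using exp_ge_add_one_self[of "\<bar>x\<bar>"] by linarith
    then show ?thesis by simp
  qed
qed simp

lemma exp_growth_power [intro]: "exp_growth u \<Longrightarrow> exp_growth (\<lambda>x. u x ^ n)"
  by (induction n) auto

lemma exp_growth_exp [intro]: "exp_growth (\<lambda>x. exp (c * complex_of_real x))"
proof (rule exp_growthI)
  show "cmod (exp (c * complex_of_real x)) \<le> 1 * exp (cmod c * \<bar>x\<bar>)" for x
  proof -
    have "Re (c * complex_of_real x) \<le> cmod c * \<bar>x\<bar>"
      using complex_Re_le_cmod[of "c * complex_of_real x"] by (simp add: norm_mult)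
    then show ?thesis by (simp add: norm_exp_eq_Re)
  qed
qed measurable

lemma exp_growth_affine:
  assumes "exp_growth u"
  shows "exp_growth (\<lambda>x. u (t + c * x))"
proof -
  have [measurable]: "u \<in> borel_measurable borel" using assms by auto
  obtain C a where 1: "C \<ge> 0" "a \<ge> 0" "\<And>x. cmod (u x) \<le> C * exp (a * \<bar>x\<bar>)"
    using exp_growthE[OF assms(1)] by blast
  show ?thesis
  proof (rule exp_growthI)
    fix x
    have "\<bar>t + c * x\<bar> \<le> \<bar>t\<bar> + \<bar>c\<bar> * \<bar>x\<bar>"
      using abs_triangle_ineq[of t "c * x"] by (simp add: abs_mult)
    then have "a * \<bar>t + c * x\<bar> \<le> a * \<bar>t\<bar> + a * \<bar>c\<bar> * \<bar>x\<bar>"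
      using mult_left_mono[of _ _ a] 1(2) by (fastforce simp: distrib_left)
    then have "C * exp (a * \<bar>t + c * x\<bar>) \<le> C * exp (a * \<bar>t\<bar> + a * \<bar>c\<bar> * \<bar>x\<bar>)"
      using 1(1) by (intro mult_left_mono) auto
    then show "cmod (u (t + c * x)) \<le> (C * exp (a * \<bar>t\<bar>)) * exp ((a * \<bar>c\<bar>) * \<bar>x\<bar>)"
      using 1(3)[of "t + c * x"] by (simp add: exp_add mult_ac)
  qed measurable
qed

lemma exp_growth_gauss_bound:
  assumes "exp_growth u" "b > 0"
  obtains C where "C \<ge> 0" "\<And>x. cmod (u x) \<le> C * exp (b * x\<^sup>2)"
proof -
  obtain C a where 1: "C \<ge> 0" "a \<ge> 0" "\<And>x. cmod (u x) \<le> C * exp (a * \<bar>x\<bar>)"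
    using exp_growthE[OF assms(1)] by blast
  have "cmod (u x) \<le> C * exp (a\<^sup>2 / (4 * b)) * exp (b * x\<^sup>2)" for x
  proof -
    have "0 \<le> (a / (2 * sqrt b) - sqrt b * \<bar>x\<bar>)\<^sup>2" by simp
    also have "\<dots> = a\<^sup>2 / (4 * b) + b * x\<^sup>2 - a * \<bar>x\<bar>"
      using assms(2) by (simp add: power2_diff power_divide power_mult_distrib)
    finally have "C * exp (a * \<bar>x\<bar>) \<le> C * exp (a\<^sup>2 / (4 * b) + b * x\<^sup>2)"
      using 1(1) by (intro mult_left_mono) auto
    then show ?thesis using 1(3)[of x] by (simp add: exp_add mult_ac)
  qed
  then show ?thesis using that[of "C * exp (a\<^sup>2 / (4 * b))"] 1(1) by simp
qed

lemma integrable_exp_square: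
  assumes "c > 0"
  shows "integrable lborel (\<lambda>x::real. exp (- c * x\<^sup>2))"
proof -
  have "integrable lborel (\<lambda>x::real. exp (- ((0 + sqrt (2 * c) * x)\<^sup>2) / 2))"
    using assms gaussian_integrable
    by (subst lborel_integrable_real_affine_iff[where f="\<lambda>x. exp (- (x\<^sup>2) / 2)"]) auto
  then show ?thesis using assms by (simp add: power_mult_distrib)
qed

lemma exp_growth_integrable:
  assumes u: "exp_growth u" and c: "c > 0"
  shows "integrable lborel (\<lambda>x. u x * complex_of_real (exp (- c * x\<^sup>2)))"
proof -
  have [measurable]: "u \<in> borel_measurable borel" using u by auto
  obtain C where C: "C \<ge> 0" "\<And>x. cmod (u x) \<le> C * exp (c / 2 * x\<^sup>2)"
    using exp_growth_gauss_bound[OF u, of "c / 2"] c by auto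
  have "integrable lborel (\<lambda>x::real. C * exp (- (c / 2) * x\<^sup>2))"
    using integrable_exp_square[of "c / 2"] c by simp
  then show ?thesis
  proof (rule Bochner_Integration.integrable_bound)
    show "AE x in lborel. norm (u x * complex_of_real (exp (- c * x\<^sup>2))) \<le> norm (C * exp (- (c / 2) * x\<^sup>2))"
    proof (rule AE_I2)
      fix x
      have "cmod (u x) * exp (- c * x\<^sup>2) \<le> C * exp (c / 2 * x\<^sup>2) * exp (- c * x\<^sup>2)"
        using C by (intro mult_right_mono) auto
      also have "\<dots> = C * exp (- (c / 2) * x\<^sup>2)"
        by (simp add: exp_add[symmetric] mult.assoc)
      finally show "norm (u x * complex_of_real (exp (- c * x\<^sup>2))) \<le> norm (C * exp (- (c / 2) * x\<^sup>2))"
        using C(1) by (simp add: norm_mult abs_mult)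
    qed
  qed measurable
qed

lemma exp_growth_decay:
  assumes u: "exp_growth u" and c: "c > 0"
  shows "((\<lambda>x. u x * complex_of_real (exp (- c * x\<^sup>2))) \<longlongrightarrow> 0) at_top"
    and "((\<lambda>x. u x * complex_of_real (exp (- c * x\<^sup>2))) \<longlongrightarrow> 0) at_bot"
proof -
  obtain C where C: "C \<ge> 0" "\<And>x. cmod (u x) \<le> C * exp (c / 2 * x\<^sup>2)"
    using exp_growth_gauss_bound[OF u, of "c / 2"] c by auto
  have *: "norm (u x * complex_of_real (exp (- c * x\<^sup>2))) \<le> C * exp (- (c / 2) * x\<^sup>2)" for x
  proof -
    have "cmod (u x) * exp (- c * x\<^sup>2) \<le> C * exp (c / 2 * x\<^sup>2) * exp (- c * x\<^sup>2)"
      using C by (intro mult_right_mono) auto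
    also have "\<dots> = C * exp (- (c / 2) * x\<^sup>2)"
      by (simp add: exp_add[symmetric] mult.assoc)
    finally show ?thesis by (simp add: norm_mult)
  qed
  have **: "((\<lambda>x. C * exp (- (c / 2) * x\<^sup>2)) \<longlongrightarrow> 0) at_top" "((\<lambda>x. C * exp (- (c / 2) * x\<^sup>2)) \<longlongrightarrow> 0) at_bot"
    using c by real_asymp+
  show "((\<lambda>x. u x * complex_of_real (exp (- c * x\<^sup>2))) \<longlongrightarrow> 0) at_top"
    by (rule Lim_null_comparison[OF always_eventually[OF allI[OF *]] **(1)])
  show "((\<lambda>x. u x * complex_of_real (exp (- c * x\<^sup>2))) \<longlongrightarrow> 0) at_bot"
    by (rule Lim_null_comparison[OF always_eventually[OF allI[OF *]] **(2)])
qed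

text \<open>The fundamental theorem of calculus on the whole line; the Gaussian kills the boundary
  terms. Both integral recurrences for Hermite polynomials come from a suitable choice of
  \<open>u\<close>.\<close>

lemma integral_derivative_eq_0:
  assumes u: "exp_growth u" and v: "exp_growth v" and c: "c > 0" and cont: "continuous_on UNIV v"
    and deriv: "\<And>x. ((\<lambda>x. u x * complex_of_real (exp (- c * x\<^sup>2))) has_vector_derivative
      v x * complex_of_real (exp (- c * x\<^sup>2))) (at x)"
  shows "integral\<^sup>L lborel (\<lambda>x. v x * complex_of_real (exp (- c * x\<^sup>2))) = 0"
proof -
  have "(LBINT x=-\<infinity>..\<infinity>. v x * complex_of_real (exp (- c * x\<^sup>2))) = 0 - 0"
  proof (rule interval_integral_FTC_integrable[OF _ deriv])
    show "set_integrable lborel (einterval (- \<infinity>) \<infinity>) (\<lambda>x. v x * complex_of_real (exp (- c * x\<^sup>2)))"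
      using exp_growth_integrable[OF v c] by (simp add: set_integrable_def)
    show "isCont (\<lambda>x. v x * complex_of_real (exp (- c * x\<^sup>2))) x" for x
      using cont by (auto intro!: continuous_intros simp: continuous_on_eq_continuous_at)
    show "(((\<lambda>x. u x * complex_of_real (exp (- c * x\<^sup>2))) \<circ> real_of_ereal) \<longlongrightarrow> 0) (at_left \<infinity>)"
      "(((\<lambda>x. u x * complex_of_real (exp (- c * x\<^sup>2))) \<circ> real_of_ereal) \<longlongrightarrow> 0) (at_right (-\<infinity>))"
      unfolding ereal_tendsto_simps1 by (rule exp_growth_decay[OF u c])+
  qed simp
  then show ?thesis
    by (simp add: interval_lebesgue_integral_def set_lebesgue_integral_def)
qed

subsection \<open>Hermite functions\<close>

text \<open>The recursion is what differentiation does to a polynomial times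
  \<open>exp (- s^2)\<close>, apart from the sign that \<open>hermite\<close> removes.\<close>

primrec hermite_poly :: "nat \<Rightarrow> real poly" where
  "hermite_poly 0 = 1"
| "hermite_poly (Suc j) = [:0, 2:] * hermite_poly j - pderiv (hermite_poly j)"

lemma hermite_eq_poly: "hermite j t = poly (hermite_poly j) t"
proof -
  have "(deriv ^^ j) (\<lambda>s. exp (- (s\<^sup>2))) = (\<lambda>t. (-1) ^ j * poly (hermite_poly j) t * exp (- (t\<^sup>2)))" for j
  proof (induction j)
    case (Suc j)
    have "deriv (\<lambda>t. (-1) ^ j * poly (hermite_poly j) t * exp (- (t\<^sup>2))) t =
        (-1) ^ Suc j * poly (hermite_poly (Suc j)) t * exp (- (t\<^sup>2))" for t :: real
      by (rule DERIV_imp_deriv) (auto intro!: derivative_eq_intros poly_DERIV simp: algebra_simps)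
    then show ?case unfolding funpow.simps comp_apply Suc.IH by (rule ext)
  qed simp
  then have "hermite j t = ((-1) ^ j * (-1) ^ j) * (exp (t\<^sup>2) * exp (- (t\<^sup>2))) * poly (hermite_poly j) t"
    by (simp only: hermite_def mult_ac)
  moreover have "(-1) ^ j * (-1) ^ j = (1 :: real)"
    by (simp flip: power_mult_distrib)
  moreover have "exp (t\<^sup>2) * exp (- (t\<^sup>2)) = 1"
    by (simp add: exp_minus)
  ultimately show ?thesis by simp
qed

lemma pderiv_hermite_poly: "pderiv (hermite_poly (Suc j)) = smult (2 * real (Suc j)) (hermite_poly j)"
proof (induction j)
  case 0
  then show ?case by (simp add: pderiv_pCons)
next
  case (Suc j)
  have "pderiv (hermite_poly (Suc (Suc j))) =
      smult 2 (hermite_poly (Suc j)) + ([:0, 2:] * pderiv (hermite_poly (Suc j)) - pderiv (pderiv (hermite_poly (Suc j))))"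
    by (subst hermite_poly.simps(2))
      (simp only: pderiv_diff pderiv_mult, simp add: pderiv_pCons)
  also have "\<dots> = smult 2 (hermite_poly (Suc j)) + smult (2 * real (Suc j)) ([:0, 2:] * hermite_poly j - pderiv (hermite_poly j))"
    unfolding Suc.IH pderiv_smult by (simp only: mult_smult_right smult_diff_right)
  also have "\<dots> = smult (2 * real (Suc (Suc j))) (hermite_poly (Suc j))"
    by (simp only: hermite_poly.simps(2)[symmetric] smult_add_left[symmetric]) (simp add: algebra_simps)
  finally show ?case .
qed

lemma hermite_0 [simp]: "hermite 0 t = 1"
  by (simp add: hermite_eq_poly)

text \<open>At \<open>j = 0\<close> the truncated index \<open>j - 1\<close> is \<open>0\<close>
  again, but the factor \<open>real j\<close> vanishes; so one formula covers all \<open>j\<close>,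
  here and in the three-term recurrence.\<close>

lemma hermite_has_derivative: "(hermite j has_real_derivative 2 * real j * hermite (j - 1) t) (at t)"
proof -
  have "poly (pderiv (hermite_poly j)) t = 2 * real j * hermite (j - 1) t"
    by (cases j) (simp_all add: pderiv_hermite_poly hermite_eq_poly del: hermite_poly.simps(2))
  then show ?thesis
    using poly_DERIV[of "hermite_poly j" t] by (simp add: hermite_eq_poly[abs_def])
qed

lemma hermite_Suc: "hermite (Suc j) t = 2 * t * hermite j t - 2 * real j * hermite (j - 1) t"
  by (cases j) (simp_all add: hermite_eq_poly pderiv_hermite_poly algebra_simps del: hermite_poly.simps(2),
      simp_all add: hermite_poly.simps(2) pderiv_hermite_poly[simplified] algebra_simps pderiv_1)

lemma continuous_on_hermite [continuous_intros]:
  "continuous_on S f \<Longrightarrow> continuous_on S (\<lambda>x. hermite j (f x))"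
  unfolding hermite_eq_poly by (intro continuous_intros)

lemma exp_growth_hermite [intro]: "exp_growth (\<lambda>x. complex_of_real (hermite j x))"
proof (induction j rule: less_induct)
  case (less j)
  show ?case
  proof (cases j)
    case (Suc i)
    have 1: "exp_growth (\<lambda>x. complex_of_real (hermite i x))" "exp_growth (\<lambda>x. complex_of_real (hermite (i - 1) x))"
      using Suc by (auto intro!: less)
    have "exp_growth (\<lambda>x. 2 * complex_of_real x * complex_of_real (hermite i x) -
        complex_of_real (2 * real i) * complex_of_real (hermite (i - 1) x))"
      by (intro exp_growth_diff exp_growth_mult exp_growth_const exp_growth_of_real 1)
    then show ?thesis by (simp add: Suc hermite_Suc)
  qed auto
qed

text \<open>Integrating the derivative of \<open>hermite j x * hermite k x * exp (- x^2)\<close>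
  gives \<open>L (Suc j) k = 2 k L j (k - 1)\<close>. Lowering both indices ends at the Gaussian
  integral \<open>L 0 0\<close> on the diagonal and at \<open>0\<close> off it.\<close>

lemma hermite_orthogonal:
  "integral\<^sup>L lborel (\<lambda>x. complex_of_real (hermite j x * hermite k x) * complex_of_real (exp (- 1 * x\<^sup>2))) =
    (if j = k then 2 ^ j * fact j * complex_of_real (sqrt pi) else 0)"
proof -
  define L where "L j k = integral\<^sup>L lborel (\<lambda>x. complex_of_real (hermite j x * hermite k x) * complex_of_real (exp (- 1 * x\<^sup>2)))" for j k
  have L_commute: "L j k = L k j" for j k
    by (simp add: L_def mult.commute)
  have L_Suc: "L (Suc j) k = 2 * of_nat k * L j (k - 1)" for j k
  proof -
    let ?v = "\<lambda>x. 2 * of_nat k * complex_of_real (hermite j x * hermite (k - 1) x) - complex_of_real (hermite (Suc j) x * hermite k x)"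
    have g: "exp_growth (\<lambda>x. complex_of_real (hermite a x * hermite b x))" for a b
      unfolding of_real_mult by (intro exp_growth_mult exp_growth_hermite)
    have "integral\<^sup>L lborel (\<lambda>x. ?v x * complex_of_real (exp (- 1 * x\<^sup>2))) = 0"
    proof (rule integral_derivative_eq_0[where u="\<lambda>x. complex_of_real (hermite j x * hermite k x)"])
      show "continuous_on UNIV ?v" by (intro continuous_intros)
      show "exp_growth ?v" by (intro exp_growth_diff exp_growth_mult exp_growth_const g)
      show "((\<lambda>x. complex_of_real (hermite j x * hermite k x) * complex_of_real (exp (- 1 * x\<^sup>2))) has_vector_derivative
          ?v x * complex_of_real (exp (- 1 * x\<^sup>2))) (at x)" for x
      proof -
        have "((\<lambda>x. hermite j x * hermite k x * exp (- 1 * x\<^sup>2)) has_real_derivative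
            (2 * real k * (hermite j x * hermite (k - 1) x) - hermite (Suc j) x * hermite k x) * exp (- 1 * x\<^sup>2)) (at x)"
          by (auto intro!: derivative_eq_intros hermite_has_derivative simp: hermite_Suc algebra_simps)
        then show ?thesis
          using has_vector_derivative_of_real by (fastforce simp: has_real_derivative_iff_has_vector_derivative)
      qed
    qed (use g in auto)
    moreover have "integral\<^sup>L lborel (\<lambda>x. ?v x * complex_of_real (exp (- 1 * x\<^sup>2))) = 2 * of_nat k * L j (k - 1) - L (Suc j) k"
      unfolding L_def left_diff_distrib mult.assoc
      by (subst Bochner_Integration.integral_diff)
        (use exp_growth_integrable[OF g, of 1] in \<open>auto simp: mult.assoc\<close>)
    ultimately show ?thesis by simp
  qed
  have L_0: "L 0 0 = complex_of_real (sqrt pi)"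
  proof -
    have "integral\<^sup>L lborel (\<lambda>x::real. complex_of_real (exp (- (x\<^sup>2) / 2)) * exp (- \<i> * complex_of_real (x * 0))) =
        \<bar>sqrt 2\<bar> *\<^sub>R integral\<^sup>L lborel (\<lambda>x::real. complex_of_real (exp (- ((0 + sqrt 2 * x)\<^sup>2) / 2)) * exp (- \<i> * complex_of_real ((0 + sqrt 2 * x) * 0)))"
      by (rule lborel_integral_real_affine) simp
    then have "complex_of_real (sqrt (2 * pi)) = complex_of_real (sqrt 2) * L 0 0"
      unfolding gaussian_fourier_real(2) by (simp add: L_def power_mult_distrib scaleR_conv_of_real)
    then show ?thesis by (simp add: real_sqrt_mult)
  qed
  have "L j k = (if j = k then 2 ^ j * fact j * complex_of_real (sqrt pi) else 0)" for j k
  proof (induction j arbitrary: k)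
    case 0
    show ?case
    proof (cases k)
      case (Suc i)
      then show ?thesis using L_Suc[of i 0] L_commute[of 0 k] by simp
    qed (simp add: L_0)
  next
    case (Suc j)
    show ?case
      by (cases k) (simp_all add: L_Suc Suc algebra_simps)
  qed
  then show ?thesis by (simp add: L_def)
qed

lemma hermite_fun_eq:
  "hermite_fun j t = (2 ^ j * fact j * sqrt pi) powr (- (1/2)) * hermite j t * exp (- (t\<^sup>2) / 2)"
  by (simp add: hermite_fun_def)

lemma hermite_fun_orthonormal:
  "integrable lborel (\<lambda>t. complex_of_real (hermite_fun j t * hermite_fun k t))"
  "integral\<^sup>L lborel (\<lambda>t. complex_of_real (hermite_fun j t * hermite_fun k t)) = (if j = k then 1 else 0)"
proof -
  define c where "c j = (2 ^ j * fact j * sqrt pi) powr (- (1/2))" for j :: nat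
  have c: "c j * c j * (2 ^ j * fact j * sqrt pi) = 1" for j
  proof -
    define x where "x = 2 ^ j * fact j * sqrt pi"
    have "x > 0" by (simp add: x_def)
    have "c j * c j = x powr (-1)"
      unfolding c_def powr_add[symmetric] x_def by simp
    then show ?thesis using \<open>x > 0\<close> by (simp add: powr_minus flip: x_def)
  qed
  have eq: "complex_of_real (hermite_fun j t * hermite_fun k t) = complex_of_real (c j * c k) *
      (complex_of_real (hermite j t * hermite k t) * complex_of_real (exp (- 1 * t\<^sup>2)))" for t
    by (simp add: hermite_fun_eq c_def exp_add[symmetric] mult_ac flip: of_real_mult)
  have "exp_growth (\<lambda>x. complex_of_real (hermite j x * hermite k x))"
    unfolding of_real_mult by (intro exp_growth_mult exp_growth_hermite)
  then show "integrable lborel (\<lambda>t. complex_of_real (hermite_fun j t * hermite_fun k t))"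
    unfolding eq using exp_growth_integrable[of _ 1] by simp
  have "integral\<^sup>L lborel (\<lambda>t. complex_of_real (hermite_fun j t * hermite_fun k t)) =
      complex_of_real (c j * c k) * (if j = k then 2 ^ j * fact j * complex_of_real (sqrt pi) else 0)"
    unfolding eq by (simp only: integral_mult_right_zero hermite_orthogonal)
  also have "\<dots> = (if j = k then complex_of_real (c j * c j * (2 ^ j * fact j * sqrt pi)) else 0)"
    by (simp add: mult_ac)
  finally show "integral\<^sup>L lborel (\<lambda>t. complex_of_real (hermite_fun j t * hermite_fun k t)) = (if j = k then 1 else 0)"
    by (simp add: c)
qed

lemma continuous_on_hermite_fun [continuous_intros]:
  "continuous_on S f \<Longrightarrow> continuous_on S (\<lambda>x. hermite_fun j (f x))"
  unfolding hermite_fun_def by (auto intro!: continuous_intros)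

lemma hermite_fun_bounded:
  obtains C where "C \<ge> 0" "\<And>t. \<bar>hermite_fun j t\<bar> \<le> C"
proof -
  obtain C where C: "C \<ge> 0" "\<And>x. cmod (complex_of_real (hermite j x)) \<le> C * exp (1 / 2 * x\<^sup>2)"
    using exp_growth_gauss_bound[OF exp_growth_hermite[of j], of "1 / 2"] by auto
  have "\<bar>hermite_fun j t\<bar> \<le> (2 ^ j * fact j * sqrt pi) powr (- (1/2)) * C" for t
  proof -
    have "\<bar>hermite j t\<bar> * exp (- (t\<^sup>2) / 2) \<le> C * exp (1 / 2 * t\<^sup>2) * exp (- (t\<^sup>2) / 2)"
      using C(2)[of t] by (intro mult_right_mono) auto
    also have "\<dots> = C" by (simp add: exp_add[symmetric] mult.assoc)
    finally show ?thesis
      unfolding hermite_fun_eq abs_mult by (simp add: mult_left_mono mult.assoc)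
  qed
  then show ?thesis using that[of "(2 ^ j * fact j * sqrt pi) powr (- (1/2)) * C"] C(1) by simp
qed

subsection \<open>Products of functions of the coordinates\<close>

lemma prod_Basis_vec:
  fixes F :: "'n::finite rvec \<Rightarrow> complex"
  shows "(\<Prod>b\<in>Basis. F b) = (\<Prod>r\<in>UNIV. F (axis r 1))"
proof -
  have B: "(Basis :: 'n rvec set) = range (\<lambda>r. axis r 1)"
    by (auto simp: Basis_vec_def)
  have inj: "inj (\<lambda>r. axis r 1 :: 'n rvec)"
    by (auto simp: inj_def axis_eq_axis)
  show ?thesis
    unfolding B prod.reindex[OF inj] comp_def ..
qed

lemma integral_lborel_prod_vec:
  fixes f :: "'n::finite \<Rightarrow> real \<Rightarrow> complex"
  assumes f: "\<And>r. integrable lborel (f r)"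
  shows "integrable lborel (\<lambda>x::'n rvec. \<Prod>r\<in>UNIV. f r (x $ r))"
    and "integral\<^sup>L lborel (\<lambda>x::'n rvec. \<Prod>r\<in>UNIV. f r (x $ r)) = (\<Prod>r\<in>UNIV. integral\<^sup>L lborel (f r))"
proof -
  define g where "g b = f (SOME r. b = axis r 1)" for b :: "'n rvec"
  have g: "g (axis r 1) = f r" for r
  proof -
    have "(SOME r'. axis r 1 = (axis r' 1 :: 'n rvec)) = r"
      by (rule some_equality) (auto simp: axis_eq_axis)
    then show ?thesis by (simp add: g_def)
  qed
  have int: "integrable lborel (g b)" for b
    by (simp add: g_def f)
  have eq: "(\<Prod>r\<in>UNIV. f r (x $ r)) = (\<Prod>b\<in>Basis. g b (x \<bullet> b))" for x :: "'n rvec"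
    unfolding prod_Basis_vec by (simp add: g inner_axis)
  have eq': "(\<Prod>b\<in>Basis. integral\<^sup>L lborel (g b)) = (\<Prod>r\<in>UNIV. integral\<^sup>L lborel (f r))"
    unfolding prod_Basis_vec by (simp add: g)
  show "integrable lborel (\<lambda>x::'n rvec. \<Prod>r\<in>UNIV. f r (x $ r))"
    unfolding eq by (rule integral_lborel_prod_Basis(1)) (rule int)
  show "integral\<^sup>L lborel (\<lambda>x::'n rvec. \<Prod>r\<in>UNIV. f r (x $ r)) = (\<Prod>r\<in>UNIV. integral\<^sup>L lborel (f r))"
    unfolding eq by (subst integral_lborel_prod_Basis(2)) (simp_all add: int eq')
qed

lemma mu_const_rvec: "mu_const TYPE('n::finite rvec) = (2 * pi) powr (- real CARD('n) / 2)"
  by (simp add: mu_const_def)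

subsection \<open>The orthonormal bases \<open>q_fun\<close>\<close>

definition hcoord :: "'n::finite rvec \<Rightarrow> 'n rvec \<Rightarrow> 'n \<Rightarrow> real" where
  "hcoord \<xi> v r = (\<xi> $ r + 2 * v $ r) / sqrt 2"

definition hweight :: "('n::finite \<Rightarrow> real \<Rightarrow> complex) \<Rightarrow> 'n rvec \<Rightarrow> 'n rvec \<Rightarrow> complex" where
  "hweight u \<xi> v = (\<Prod>r\<in>UNIV. u r (hcoord \<xi> v r) * complex_of_real (exp (- (hcoord \<xi> v r)\<^sup>2 / 2)))"

lemma hcoord_affine: "hcoord \<xi> v r = \<xi> $ r / sqrt 2 + sqrt 2 * v $ r"
proof -
  have "2 * v $ r / sqrt 2 = (2 / sqrt 2) * v $ r" by simp
  then show ?thesis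
    by (simp only: hcoord_def add_divide_distrib real_div_sqrt zero_le_numeral)
qed

lemma hcoord_measurable [measurable]: "(\<lambda>v. hcoord \<xi> v r) \<in> borel_measurable borel"
  unfolding hcoord_def by measurable

lemma q_fun_eq: "q_fun k \<xi> v = 2 powr (real CARD('n) / 2) * pi powr (real CARD('n) / 4) *
    (\<Prod>r\<in>UNIV. hermite_fun (k r) (hcoord \<xi> v r))" for \<xi> :: "'n::finite rvec"
  by (simp add: q_fun_def hcoord_def)

lemma q_fun_continuous [continuous_intros]:
  "continuous_on S (\<lambda>p. q_fun k (fst p) (snd p))"
  unfolding q_fun_def by (intro continuous_intros) auto

lemma q_fun_measurable [measurable]:
  "(\<lambda>p. q_fun k (fst p) (snd p)) \<in> borel_measurable borel"
  by (intro borel_measurable_continuous_onI q_fun_continuous)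

lemma q_fun_measurable_pair [measurable]:
  "(\<lambda>(\<xi>, v). q_fun k \<xi> v) \<in> borel_measurable (borel \<Otimes>\<^sub>M borel)"
  unfolding borel_prod using q_fun_measurable by (simp add: split_def)

lemma q_fun_bounded:
  fixes k :: "'n::finite \<Rightarrow> nat"
  obtains C where "C \<ge> 0" "\<And>\<xi> v. \<bar>q_fun k \<xi> v\<bar> \<le> C"
proof -
  have "\<exists>C. C \<ge> 0 \<and> (\<forall>t. \<bar>hermite_fun j t\<bar> \<le> C)" for j
    using hermite_fun_bounded[of j] by metis
  then obtain C where C: "\<And>j. C j \<ge> 0" "\<And>j t. \<bar>hermite_fun j t\<bar> \<le> C j" by metis
  define D where "D = 2 powr (real CARD('n) / 2) * pi powr (real CARD('n) / 4)"
  have "\<bar>q_fun k \<xi> v\<bar> \<le> D * (\<Prod>r\<in>UNIV. C (k r))" for \<xi> v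
    unfolding q_fun_eq D_def[symmetric] abs_mult abs_prod
    using C by (intro mult_mono prod_mono) (auto simp: D_def prod_nonneg)
  moreover have "0 \<le> D * (\<Prod>r\<in>UNIV. C (k r))"
    using C by (auto simp: D_def prod_nonneg)
  ultimately show ?thesis using that by blast
qed

text \<open>The substitution \<open>t = \<xi>_r / sqrt 2 + sqrt 2 v_r\<close> reduces each
  coordinate to the Hermite functions and costs a factor \<open>1 / sqrt 2\<close>. The prefactor of
  \<open>q_fun\<close> is the one that cancels these factors and the constant of
  \<open>mu_tilde\<close>.\<close>

lemma q_fun_orthonormal:
  fixes k l :: "'n::finite \<Rightarrow> nat"
  shows "integrable mu_tilde (\<lambda>v. complex_of_real (q_fun k \<xi> v * q_fun l \<xi> v))"
    and "integral\<^sup>L mu_tilde (\<lambda>v. complex_of_real (q_fun k \<xi> v * q_fun l \<xi> v)) = (if k = l then 1 else 0)"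
proof -
  define g where "g r t = complex_of_real (hermite_fun (k r) t * hermite_fun (l r) t)" for r t
  define f where "f r s = g r (\<xi> $ r / sqrt 2 + sqrt 2 * s)" for r s
  have g_int: "integrable lborel (g r)" and g_val: "integral\<^sup>L lborel (g r) = (if k r = l r then 1 else 0)" for r
    unfolding g_def using hermite_fun_orthonormal by auto
  have f_int: "integrable lborel (f r)" for r
    unfolding f_def by (subst lborel_integrable_real_affine_iff) (auto simp: g_int)
  have f_val: "integral\<^sup>L lborel (f r) = (if k r = l r then complex_of_real (1 / sqrt 2) else 0)" for r
  proof -
    have "integral\<^sup>L lborel (g r) = \<bar>sqrt 2\<bar> *\<^sub>R integral\<^sup>L lborel (f r)"
      unfolding f_def by (rule lborel_integral_real_affine) simp
    then show ?thesis
      by (auto simp: g_val scaleR_conv_of_real field_simps split: if_splits)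
  qed
  define c where "c = (2 powr (real CARD('n) / 2) * pi powr (real CARD('n) / 4))\<^sup>2"
  have eq: "complex_of_real (q_fun k \<xi> v * q_fun l \<xi> v) = complex_of_real c * (\<Prod>r\<in>UNIV. f r (v $ r))" for v
    by (simp add: q_fun_eq f_def g_def c_def hcoord_affine power2_eq_square prod.distrib mult_ac)
  show "integrable mu_tilde (\<lambda>v. complex_of_real (q_fun k \<xi> v * q_fun l \<xi> v))"
    unfolding eq integrable_mu_tilde_iff
    by (intro integrable_mult_right integral_lborel_prod_vec(1) f_int)
  have "integral\<^sup>L mu_tilde (\<lambda>v. complex_of_real (q_fun k \<xi> v * q_fun l \<xi> v)) =
      complex_of_real (mu_const TYPE('n rvec) * c) * (\<Prod>r\<in>UNIV. integral\<^sup>L lborel (f r))"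
    unfolding eq integral_mu_tilde integral_mult_right_zero integral_lborel_prod_vec(2)[OF f_int]
    by (simp add: scaleR_conv_of_real)
  also have "(\<Prod>r\<in>UNIV. integral\<^sup>L lborel (f r)) = (if k = l then complex_of_real ((1 / sqrt 2) ^ CARD('n)) else 0)"
    unfolding f_val by (auto simp: fun_eq_iff)
  also have "complex_of_real (mu_const TYPE('n rvec) * c) * \<dots> = (if k = l then complex_of_real (mu_const TYPE('n rvec) * c * (1 / sqrt 2) ^ CARD('n)) else 0)"
    by simp
  also have "mu_const TYPE('n rvec) * c * (1 / sqrt 2) ^ CARD('n) = 1"
  proof -
    let ?N = "real CARD('n)"
    have "c = 2 powr ?N * pi powr (?N / 2)"
      by (simp add: c_def power_mult_distrib powr_power)
    moreover have "(1 / sqrt 2) ^ CARD('n) = 2 powr (- ?N / 2)"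
      by (simp add: powr_half_sqrt[symmetric] powr_minus_divide[symmetric] powr_power)
    moreover have "mu_const TYPE('n rvec) = 2 powr (- ?N / 2) * pi powr (- ?N / 2)"
      by (simp add: mu_const_rvec powr_mult)
    ultimately show ?thesis
      by (simp add: powr_add[symmetric] mult_ac)
  qed
  finally show "integral\<^sup>L mu_tilde (\<lambda>v. complex_of_real (q_fun k \<xi> v * q_fun l \<xi> v)) = (if k = l then 1 else 0)"
    by simp
qed

lemma q_fun_orthonormal_real:
  "integral\<^sup>L mu_tilde (\<lambda>v. q_fun k \<xi> v * q_fun l \<xi> v) = (if k = l then 1 else 0)"
  using q_fun_orthonormal(2)[of k \<xi> l] by (simp only: integral_complex_of_real) (simp split: if_splits)

lemma square_integrable_q_fun: "square_integrable (\<lambda>v. complex_of_real (q_fun k \<xi> v))"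
proof (rule square_integrableI)
  show "integrable mu_tilde (\<lambda>v. (cmod (complex_of_real (q_fun k \<xi> v)))\<^sup>2)"
    using integrable_Re[OF q_fun_orthonormal(1)[of k \<xi> k]] by (simp add: power2_eq_square)
qed measurable

lemma square_integrable_hweight:
  assumes u: "\<And>r. exp_growth (u r)"
  shows "square_integrable (\<lambda>v. hweight u \<xi> v)"
proof (rule square_integrableI)
  have [measurable]: "u r \<in> borel_measurable borel" for r using u[of r] by auto
  show "(\<lambda>v. hweight u \<xi> v) \<in> borel_measurable borel"
    unfolding hweight_def by (intro borel_measurable_prod) measurable
  define g where "g r t = u r t * cnj (u r t) * complex_of_real (exp (- 1 * t\<^sup>2))" for r t
  have g_int: "integrable lborel (g r)" for r
  proof -
    have "exp_growth (\<lambda>t. cnj (u r t))"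
      using exp_growthE[OF u[of r]] by (metis complex_mod_cnj exp_growth_def u measurable_compose borel_measurable_cnj)
    then show ?thesis
      unfolding g_def by (intro exp_growth_integrable exp_growth_mult u) auto
  qed
  have "integrable lborel (\<lambda>v. \<Prod>r\<in>UNIV. g r (\<xi> $ r / sqrt 2 + sqrt 2 * (v $ r)))"
    by (rule integral_lborel_prod_vec(1)[where f="\<lambda>r s. g r (\<xi> $ r / sqrt 2 + sqrt 2 * s)"],
        subst lborel_integrable_real_affine_iff) (auto simp: g_int)
  then have "integrable mu_tilde (\<lambda>v. cmod (\<Prod>r\<in>UNIV. g r (hcoord \<xi> v r)))"
    unfolding integrable_mu_tilde_iff hcoord_affine by (rule integrable_norm)
  moreover have "cmod (g r t) = (cmod (u r t * complex_of_real (exp (- t\<^sup>2 / 2))))\<^sup>2" for r t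
    by (simp add: g_def norm_mult power_mult_distrib power2_eq_square[of "cmod _"] exp_double[symmetric] power2_eq_square[of "exp _"] exp_add[symmetric])
  ultimately show "integrable mu_tilde (\<lambda>v. (cmod (hweight u \<xi> v))\<^sup>2)"
    by (simp add: hweight_def prod_norm[symmetric] prod_power_distrib)
qed

text \<open>The linear span of the Hermite polynomials, generated one summand at a time so that rule
  induction carries the linearity of an integral through a single coordinate.\<close>

inductive_set hermite_span :: "(real \<Rightarrow> complex) set" where
  zero: "(\<lambda>_. 0) \<in> hermite_span"
| step: "f \<in> hermite_span \<Longrightarrow> (\<lambda>x. f x + c * complex_of_real (hermite j x)) \<in> hermite_span"

lemma hermite_span_add:
  assumes "f \<in> hermite_span" "g \<in> hermite_span"
  shows "(\<lambda>x. f x + g x) \<in> hermite_span"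
  using assms(2)
proof induction
  case (step g c j)
  from hermite_span.step[OF step.IH, of c j] show ?case by (simp add: add.assoc)
qed (use assms in simp)

lemma hermite_span_hermite: "(\<lambda>x. c * complex_of_real (hermite j x)) \<in> hermite_span"
  using hermite_span.step[OF hermite_span.zero, of c j] by simp

lemma hermite_span_scale: "f \<in> hermite_span \<Longrightarrow> (\<lambda>x. c * f x) \<in> hermite_span"
proof (induction rule: hermite_span.induct)
  case (step f d j)
  from hermite_span.step[OF step.IH, of "c * d" j] show ?case
    by (simp add: distrib_left mult.assoc)
qed (simp add: hermite_span.zero)

text \<open>The three-term recurrence solved for \<open>x H_j\<close>, which is
  \<open>H_(j+1) / 2 + j H_(j-1)\<close>. It follows that the span contains all powers of
  \<open>x\<close>.\<close>

lemma hermite_span_times: "f \<in> hermite_span \<Longrightarrow> (\<lambda>x. complex_of_real x * f x) \<in> hermite_span"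
proof (induction rule: hermite_span.induct)
  case (step f c j)
  have "(\<lambda>x. complex_of_real x * f x +
      ((c / 2) * complex_of_real (hermite (Suc j) x) + (c * of_nat j) * complex_of_real (hermite (j - 1) x))) \<in> hermite_span"
    by (intro hermite_span_add step.IH hermite_span_hermite)
  then show ?case by (simp add: hermite_Suc field_simps)
qed (simp add: hermite_span.zero)

lemma hermite_span_power: "(\<lambda>x. complex_of_real x ^ n) \<in> hermite_span"
proof (induction n)
  case 0
  then show ?case using hermite_span_hermite[of 1 0] by simp
qed (simp add: hermite_span_times)

lemma hermite_span_sum:
  "finite I \<Longrightarrow> (\<And>i. i \<in> I \<Longrightarrow> f i \<in> hermite_span) \<Longrightarrow> (\<lambda>x. \<Sum>i\<in>I. f i x) \<in> hermite_span"
  by (induction I rule: finite_induct) (auto intro: hermite_span_add hermite_span.zero)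

lemma exp_growth_hermite_span: "f \<in> hermite_span \<Longrightarrow> exp_growth f"
  by (induction rule: hermite_span.induct)
    (auto intro!: exp_growth_add exp_growth_mult exp_growth_const exp_growth_hermite)

text \<open>Orthogonality to Hermite products passes to products of polynomials and, by dominated
  convergence of the exponential series, to products of exponentials. So \<open>\<phi>\<close> times
  a positive Gaussian has vanishing Fourier integral, and Plancherel's theorem gives
  \<open>\<phi> = 0\<close>.\<close>

theorem q_fun_complete:
  fixes \<phi> :: "'n::finite rvec \<Rightarrow> complex"
  assumes \<phi>: "square_integrable \<phi>"
    and 0: "\<And>l. integral\<^sup>L mu_tilde (\<lambda>v. \<phi> v * complex_of_real (q_fun l \<xi> v)) = 0"
  shows "AE v in lborel. \<phi> v = 0"
proof -
  have [measurable]: "\<phi> \<in> borel_measurable borel" using \<phi> by auto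
  let ?I = "\<lambda>u. integral\<^sup>L mu_tilde (\<lambda>v. \<phi> v * hweight u \<xi> v)"
  have int: "integrable mu_tilde (\<lambda>v. \<phi> v * hweight u \<xi> v)" if "\<And>r. exp_growth (u r)" for u
    by (intro integrable_mult_square_integrable \<phi> square_integrable_hweight that)
  have base: "?I (\<lambda>r x. complex_of_real (hermite (l r) x)) = 0" for l
  proof -
    define c where "c = 2 powr (real CARD('n) / 2) * pi powr (real CARD('n) / 4) *
      (\<Prod>r\<in>UNIV. (2 ^ l r * fact (l r) * sqrt pi) powr (- (1/2)))"
    have "c \<noteq> 0" by (simp add: c_def)
    have "complex_of_real (q_fun l \<xi> v) = complex_of_real c * hweight (\<lambda>r x. complex_of_real (hermite (l r) x)) \<xi> v" for v
      by (simp add: c_def hweight_def q_fun_eq hermite_fun_eq prod.distrib mult_ac)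
    then have "complex_of_real c * ?I (\<lambda>r x. complex_of_real (hermite (l r) x)) = 0"
      using 0[of l] by (simp add: mult.left_commute)
    then show ?thesis using \<open>c \<noteq> 0\<close> by simp
  qed
  \<comment> \<open>Induction on the set \<open>S\<close> of coordinates whose factor is an
    arbitrary element of the span. The other factors are single Hermite polynomials, so the case of
    empty \<open>S\<close> is the assumption.\<close>
  have span: "?I u = 0"
    if "finite S" "\<And>r. r \<in> S \<Longrightarrow> u r \<in> hermite_span" "\<And>r. r \<notin> S \<Longrightarrow> \<exists>j. u r = (\<lambda>x. complex_of_real (hermite j x))" for S u
    using that
  proof (induction S arbitrary: u rule: finite_induct)
    case empty
    then have "\<forall>r. \<exists>j. u r = (\<lambda>x. complex_of_real (hermite j x))" by simp
    from choice[OF this] obtain l where "\<And>r. u r = (\<lambda>x. complex_of_real (hermite (l r) x))" by blast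
    then have "u = (\<lambda>r x. complex_of_real (hermite (l r) x))" by (rule ext)
    then show ?case using base by simp
  next
    case (insert s S)
    have eg: "exp_growth (u r)" for r
      using insert.prems by (metis exp_growth_hermite exp_growth_hermite_span)
    have split: "hweight (u(s := f)) \<xi> v = f (hcoord \<xi> v s) * (complex_of_real (exp (- (hcoord \<xi> v s)\<^sup>2 / 2)) *
        (\<Prod>r\<in>UNIV - {s}. u r (hcoord \<xi> v r) * complex_of_real (exp (- (hcoord \<xi> v r)\<^sup>2 / 2))))" for f v
      by (simp add: hweight_def prod.remove[of UNIV s] mult.assoc)
    have "?I (u(s := f)) = 0" if "f \<in> hermite_span" for f
      using that
    proof induction
      case zero
      show ?case unfolding split by simp
    next
      case (step f c j)
      let ?H = "\<lambda>x. complex_of_real (hermite j x)"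
      have eq: "\<phi> v * hweight (u(s := \<lambda>x. f x + c * ?H x)) \<xi> v = \<phi> v * hweight (u(s := f)) \<xi> v + c * (\<phi> v * hweight (u(s := ?H)) \<xi> v)" for v
        unfolding split by (simp add: algebra_simps)
      have IH: "?I (u(s := ?H)) = 0"
        using insert.prems insert.hyps by (intro insert.IH) auto
      have ints: "integrable mu_tilde (\<lambda>v. \<phi> v * hweight (u(s := f)) \<xi> v)"
        "integrable mu_tilde (\<lambda>v. \<phi> v * hweight (u(s := ?H)) \<xi> v)"
        using eg exp_growth_hermite_span[OF step.hyps] by (auto intro!: int)
      have "?I (u(s := \<lambda>x. f x + c * ?H x)) = ?I (u(s := f)) + c * ?I (u(s := ?H))"
        unfolding eq integral_mult_right_zero[symmetric]
        by (rule Bochner_Integration.integral_add[OF ints(1) integrable_mult_right[OF ints(2)]])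
      then show ?case
        by (simp only: step.IH IH mult_zero_right add_0_right)
    qed
    from this[of "u s"] show ?case using insert.prems by (simp only: fun_upd_triv insertI1)
  qed
  have expo: "?I (\<lambda>r x. exp (- \<i> * complex_of_real (\<tau> $ r) * complex_of_real x)) = 0" for \<tau> :: "'n rvec"
  proof -
    define P where "P N r x = (\<Sum>i<N. (- \<i> * complex_of_real (\<tau> $ r) * complex_of_real x) ^ i /\<^sub>R fact i)" for N :: nat and r x
    \<comment> \<open>The series of absolute values dominates all partial sums at once and still has
      exponential growth.\<close>
    define w where "w r x = exp (complex_of_real (\<bar>\<tau> $ r\<bar>) * complex_of_real \<bar>x\<bar>)" for r x
    have P_span: "P N r \<in> hermite_span" for N r
    proof -
      have "(\<lambda>x. \<Sum>i<N. ((- \<i> * complex_of_real (\<tau> $ r)) ^ i / fact i) * complex_of_real x ^ i) \<in> hermite_span"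
        by (intro hermite_span_sum hermite_span_scale hermite_span_power) auto
      also have "(\<lambda>x. \<Sum>i<N. ((- \<i> * complex_of_real (\<tau> $ r)) ^ i / fact i) * complex_of_real x ^ i) = P N r"
        unfolding P_def power_mult_distrib by (simp add: scaleR_conv_of_real divide_inverse mult_ac)
      finally show ?thesis .
    qed
    have w_growth: "exp_growth (w r)" for r
    proof (rule exp_growthI)
      show "cmod (w r x) \<le> 1 * exp (\<bar>\<tau> $ r\<bar> * \<bar>x\<bar>)" for x
        by (simp add: w_def norm_exp_eq_Re)
    qed (unfold w_def, measurable)
    have P_bound: "cmod (P N r x) \<le> cmod (w r x)" for N r x
    proof -
      let ?z = "- \<i> * complex_of_real (\<tau> $ r) * complex_of_real x"
      have s: "(\<lambda>i. norm ?z ^ i /\<^sub>R fact i) sums exp (norm ?z)"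
        using exp_converges[of "norm ?z"] .
      have "cmod (P N r x) \<le> (\<Sum>i<N. norm ?z ^ i /\<^sub>R fact i)"
        unfolding P_def by (intro order_trans[OF norm_sum] sum_mono) (simp add: norm_power norm_mult)
      also have "\<dots> \<le> exp (norm ?z)"
        using s by (subst sums_unique[OF s]) (intro sum_le_suminf, auto simp: sums_iff)
      finally show ?thesis by (simp add: w_def norm_exp_eq_Re norm_mult)
    qed
    have "(\<lambda>N. ?I (P N)) \<longlonglongrightarrow> ?I (\<lambda>r x. exp (- \<i> * complex_of_real (\<tau> $ r) * complex_of_real x))"
    proof (rule integral_dominated_convergence[where w="\<lambda>v. cmod (\<phi> v * hweight w \<xi> v)"])
      show "integrable mu_tilde (\<lambda>v. cmod (\<phi> v * hweight w \<xi> v))"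
        by (intro integrable_norm int w_growth)
      show "(\<lambda>v. \<phi> v * hweight (P N) \<xi> v) \<in> borel_measurable mu_tilde" for N
        by (intro borel_measurable_integrable int exp_growth_hermite_span P_span)
      show "(\<lambda>v. \<phi> v * hweight (\<lambda>r x. exp (- \<i> * complex_of_real (\<tau> $ r) * complex_of_real x)) \<xi> v) \<in> borel_measurable mu_tilde"
        by (intro borel_measurable_integrable int exp_growth_exp)
      show "AE v in mu_tilde. (\<lambda>N. \<phi> v * hweight (P N) \<xi> v) \<longlonglongrightarrow> \<phi> v * hweight (\<lambda>r x. exp (- \<i> * complex_of_real (\<tau> $ r) * complex_of_real x)) \<xi> v"
        unfolding hweight_def
      proof (intro AE_I2 tendsto_mult tendsto_prod tendsto_const)
        show "(\<lambda>N. P N r x) \<longlonglongrightarrow> exp (- \<i> * complex_of_real (\<tau> $ r) * complex_of_real x)" for r x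
          using exp_converges[of "- \<i> * complex_of_real (\<tau> $ r) * complex_of_real x"] by (simp add: P_def sums_def)
      qed
      show "AE v in mu_tilde. norm (\<phi> v * hweight (P N) \<xi> v) \<le> cmod (\<phi> v * hweight w \<xi> v)" for N
        unfolding hweight_def norm_mult prod_norm[symmetric]
        by (intro AE_I2 mult_left_mono prod_mono) (auto intro!: mult_right_mono P_bound)
    qed
    moreover have "?I (P N) = 0" for N
      using span[of UNIV "P N"] P_span by simp
    ultimately show ?thesis by (simp add: LIMSEQ_const_iff)
  qed
  \<comment> \<open>This Gaussian does double duty: multiplied by it, \<open>\<phi>\<close> is
    integrable as well as square-integrable, and since it has no zeros it can be divided out at the
    end.\<close>
  define G where "G = hweight (\<lambda>_ _. 1) \<xi>"
  have siG: "square_integrable G" unfolding G_def by (intro square_integrable_hweight) auto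
  have G_eq: "G v = complex_of_real (\<Prod>r\<in>UNIV. exp (- (hcoord \<xi> v r)\<^sup>2 / 2))" for v
    by (simp add: G_def hweight_def)
  have G_le: "cmod (G v) \<le> 1" for v
    unfolding G_eq norm_of_real abs_prod by (intro prod_le_1) auto
  have G_pos: "G v \<noteq> 0" for v
    by (simp add: G_eq)
  have [measurable]: "G \<in> borel_measurable borel" using siG by auto
  have si: "square_integrable (\<lambda>v. \<phi> v * G v)"
    by (rule square_integrable_bound[OF \<phi>]) (auto simp: norm_mult mult_left_le G_le)
  have FI: "fourier_integral (\<lambda>v. \<phi> v * G v) \<eta> = 0" for \<eta>
  proof -
    \<comment> \<open>\<open>hcoord\<close> scales \<open>v\<close> by \<open>sqrt 2\<close> and
      shifts it by \<open>\<xi> / sqrt 2\<close>. The factor \<open>1 / sqrt 2\<close> undoes the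
      scaling, the phase in \<open>\<xi> \<bullet> \<eta> / 2\<close> the shift.\<close>
    define \<tau> where "\<tau> = (1 / sqrt 2) *\<^sub>R \<eta>"
    have "G v * exp (- \<i> * complex_of_real (v \<bullet> \<eta>)) =
        exp (\<i> * complex_of_real (\<xi> \<bullet> \<eta> / 2)) * hweight (\<lambda>r x. exp (- \<i> * complex_of_real (\<tau> $ r) * complex_of_real x)) \<xi> v" for v
    proof -
      have c: "\<tau> $ r * hcoord \<xi> v r = \<xi> $ r * \<eta> $ r / 2 + v $ r * \<eta> $ r" for r
        by (simp add: \<tau>_def hcoord_def field_simps)
      have S: "(\<Sum>r\<in>UNIV. \<tau> $ r * hcoord \<xi> v r) = \<xi> \<bullet> \<eta> / 2 + v \<bullet> \<eta>"
        unfolding c by (simp add: inner_vec_def sum.distrib sum_divide_distrib)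
      have "(\<Prod>r\<in>UNIV. exp (- \<i> * complex_of_real (\<tau> $ r) * complex_of_real (hcoord \<xi> v r))) =
          exp (\<Sum>r\<in>UNIV. - \<i> * complex_of_real (\<tau> $ r * hcoord \<xi> v r))"
        by (simp add: exp_sum mult.assoc)
      also have "(\<Sum>r\<in>UNIV. - \<i> * complex_of_real (\<tau> $ r * hcoord \<xi> v r)) =
          - \<i> * complex_of_real (\<xi> \<bullet> \<eta> / 2 + v \<bullet> \<eta>)"
        unfolding S[symmetric] of_real_sum sum_distrib_left ..
      finally have "hweight (\<lambda>r x. exp (- \<i> * complex_of_real (\<tau> $ r) * complex_of_real x)) \<xi> v =
          exp (- \<i> * complex_of_real (\<xi> \<bullet> \<eta> / 2 + v \<bullet> \<eta>)) * G v"
        by (simp add: hweight_def G_eq prod.distrib)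
      moreover have "exp (\<i> * complex_of_real (\<xi> \<bullet> \<eta> / 2)) * exp (- \<i> * complex_of_real (\<xi> \<bullet> \<eta> / 2 + v \<bullet> \<eta>)) =
          exp (- \<i> * complex_of_real (v \<bullet> \<eta>))"
        unfolding exp_add[symmetric] of_real_add distrib_left by simp
      ultimately show ?thesis
        by (simp only: mult.assoc[symmetric]) (simp only: mult.commute)
    qed
    then have "fourier_integral (\<lambda>v. \<phi> v * G v) \<eta> = integral\<^sup>L mu_tilde (\<lambda>v. exp (\<i> * complex_of_real (\<xi> \<bullet> \<eta> / 2)) *
        (\<phi> v * hweight (\<lambda>r x. exp (- \<i> * complex_of_real (\<tau> $ r) * complex_of_real x)) \<xi> v))"
      unfolding fourier_integral_def mult.assoc by (simp only: mult.left_commute)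
    then show ?thesis using expo[of \<tau>] by simp
  qed
  have "AE v in lborel. \<phi> v * G v = 0"
    by (rule fourier_integral_eq_0_AE[OF si _ FI]) (rule integrable_mult_square_integrable[OF \<phi> siG])
  then show ?thesis
    by eventually_elim (simp add: G_pos)
qed

subsection \<open>Expansion in finitely many \<open>q_fun\<close>\<close>

text \<open>The remainder has no coefficients left: orthonormality removes those in
  \<open>J\<close>, the assumption those outside. Completeness makes it vanish.\<close>

lemma q_fun_expansion:
  fixes \<phi> :: "'n::finite rvec \<Rightarrow> complex"
  assumes \<phi>: "square_integrable \<phi>" and J: "finite J"
    and 0: "\<And>l. l \<notin> J \<Longrightarrow> integral\<^sup>L mu_tilde (\<lambda>v. \<phi> v * complex_of_real (q_fun l \<xi> v)) = 0"
  defines "c \<equiv> \<lambda>k. integral\<^sup>L mu_tilde (\<lambda>v. \<phi> v * complex_of_real (q_fun k \<xi> v))"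
  shows "AE v in lborel. \<phi> v = (\<Sum>k\<in>J. c k * complex_of_real (q_fun k \<xi> v))"
proof -
  let ?r = "\<lambda>v. \<phi> v - (\<Sum>k\<in>J. c k * complex_of_real (q_fun k \<xi> v))"
  have si: "square_integrable ?r"
    by (intro square_integrable_diff \<phi> square_integrable_sum square_integrable_scale square_integrable_q_fun)
  have "AE v in lborel. ?r v = 0"
  proof (rule q_fun_complete[OF si])
    fix l
    have "integral\<^sup>L mu_tilde (\<lambda>v. ?r v * complex_of_real (q_fun l \<xi> v)) =
        integral\<^sup>L mu_tilde (\<lambda>v. \<phi> v * complex_of_real (q_fun l \<xi> v) - (\<Sum>k\<in>J. c k * complex_of_real (q_fun k \<xi> v * q_fun l \<xi> v)))"
      by (simp add: left_diff_distrib sum_distrib_right mult.assoc)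
    also have "\<dots> = c l - (\<Sum>k\<in>J. c k * (if k = l then 1 else 0))"
      unfolding c_def
      by (subst Bochner_Integration.integral_diff)
        (auto intro!: integrable_mult_square_integrable \<phi> square_integrable_q_fun Bochner_Integration.integrable_sum integrable_mult_right
          q_fun_orthonormal(1) simp: Bochner_Integration.integral_sum q_fun_orthonormal q_fun_orthonormal_real if_distrib[of complex_of_real] simp del: of_real_mult cong: if_cong)
    also have "\<dots> = 0"
      using J 0[of l] by (auto simp: sum.delta if_distrib c_def cong: if_cong)
    finally show "integral\<^sup>L mu_tilde (\<lambda>v. ?r v * complex_of_real (q_fun l \<xi> v)) = 0" .
  qed
  then show ?thesis by eventually_elim simp
qed

lemma q_fun_sum_norm:
  assumes J: "finite J"
  shows "integral\<^sup>L mu_tilde (\<lambda>v. (cmod (\<Sum>k\<in>J. c k * complex_of_real (q_fun k \<xi> v)))\<^sup>2) = (\<Sum>k\<in>J. (cmod (c k))\<^sup>2)"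
proof -
  let ?s = "\<lambda>v. \<Sum>k\<in>J. c k * complex_of_real (q_fun k \<xi> v)"
  have "complex_of_real (integral\<^sup>L mu_tilde (\<lambda>v. (cmod (?s v))\<^sup>2)) = integral\<^sup>L mu_tilde (\<lambda>v. ?s v * cnj (?s v))"
    by (simp add: complex_norm_square flip: integral_complex_of_real del: of_real_power)
  also have "\<dots> = integral\<^sup>L mu_tilde (\<lambda>v. \<Sum>k\<in>J. \<Sum>l\<in>J. c k * cnj (c l) * complex_of_real (q_fun k \<xi> v * q_fun l \<xi> v))"
    by (simp add: sum_product mult_ac)
  also have "\<dots> = (\<Sum>k\<in>J. \<Sum>l\<in>J. c k * cnj (c l) * (if k = l then 1 else 0))"
    by (simp add: Bochner_Integration.integral_sum q_fun_orthonormal q_fun_orthonormal_real if_distrib[of complex_of_real] del: of_real_mult cong: if_cong)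
  also have "\<dots> = complex_of_real (\<Sum>k\<in>J. (cmod (c k))\<^sup>2)"
    using J by (simp add: if_distrib sum.delta' complex_norm_square del: of_real_power cong: if_cong)
  finally show ?thesis by (simp only: of_real_eq_iff)
qed

section \<open>Coefficients along \<open>q_fun\<close> and the test functions that detect
  them\<close>

subsection \<open>Multi-indices\<close>

lemma sum_list_sorted_UNIV:
  fixes k :: "'n::{finite,linorder} \<Rightarrow> nat"
  shows "sum_list (map k (sorted_list_of_set UNIV)) = (\<Sum>r\<in>UNIV. k r)"
  by (simp add: sum_list_distinct_conv_sum_set)

text \<open>Stars and bars: prepending the slack \<open>m - 1 - |k|\<close> turns \<open>k\<close>
  into a list of \<open>CARD('n) + 1\<close> natural numbers with sum exactly
  \<open>m - 1\<close>.\<close>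

lemma card_multi_indices:
  assumes "m \<ge> 1"
  shows "finite (multi_indices m :: ('n::{finite,linorder} \<Rightarrow> nat) set)"
    and "card (multi_indices m :: ('n \<Rightarrow> nat) set) = (CARD('n) + m - 1) choose CARD('n)"
proof -
  let ?L = "{l :: nat list. length l = Suc CARD('n) \<and> sum_list l = m - 1}"
  let ?J = "multi_indices m :: ('n \<Rightarrow> nat) set"
  let ?s = "sorted_list_of_set (UNIV :: 'n set)"
  define g where "g k = (m - 1 - (\<Sum>r\<in>UNIV. k r)) # map k ?s" for k :: "'n \<Rightarrow> nat"
  have bij: "bij_betw g ?J ?L"
  proof (rule bij_betw_imageI)
    show "inj_on g ?J"
      by (auto simp: inj_on_def g_def fun_eq_iff)
    show "g ` ?J = ?L"
    proof (intro equalityI subsetI)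
      fix l assume "l \<in> g ` ?J"
      then show "l \<in> ?L"
        by (auto simp: g_def multi_indices_def sum_list_sorted_UNIV)
    next
      fix l assume l: "l \<in> ?L"
      then obtain a l' where al: "l = a # l'" "length l' = CARD('n)" "a + sum_list l' = m - 1"
        by (cases l) auto
      have len: "length ?s = CARD('n)" by simp
      have "\<exists>k. map k ?s = l'"
      proof -
        define k where "k r = (the (map_of (zip ?s l') r))" for r
        have "map k ?s = l'"
          unfolding k_def
          by (rule nth_equalityI) (use al len in \<open>auto simp: map_of_zip_nth\<close>)
        then show ?thesis by blast
      qed
      then obtain k where k: "map k ?s = l'" by blast
      then have "(\<Sum>r\<in>UNIV. k r) = sum_list l'"
        using sum_list_sorted_UNIV[of k] by simp
      then have "g k = l" "k \<in> ?J"
        using al k by (auto simp: g_def multi_indices_def)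
      then show "l \<in> g ` ?J" by blast
    qed
  qed
  have fin: "finite ?L"
    by (rule finite_subset[OF _ finite_lists_length_eq[of "{..m - 1}" "Suc CARD('n)"]])
      (auto dest: member_le_sum_list)
  show "finite ?J"
    using bij fin bij_betw_finite by blast
  have "card ?J = card ?L"
    using bij by (rule bij_betw_same_card)
  also have "\<dots> = (m - 1 + Suc CARD('n) - 1) choose (m - 1)"
    by (rule card_length_sum_list)
  also have "\<dots> = (CARD('n) + m - 1) choose CARD('n)"
    using assms binomial_symmetric[of "m - 1" "m - 1 + CARD('n)"] by (simp add: add.commute)
  finally show "card ?J = (CARD('n) + m - 1) choose CARD('n)" .
qed

text \<open>A finite linear order has exactly one increasing enumeration, so the definite
  description denotes it. It is the inverse of the rank \<open>rk\<close>, the number of elements up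
  to a given one.\<close>

lemma lex_enum_bij:
  assumes "m \<ge> 1"
  shows "bij_betw (lex_enum m) {1..card (multi_indices m :: ('n::{finite,linorder} \<Rightarrow> nat) set)}
    (multi_indices m :: ('n \<Rightarrow> nat) set)"
proof -
  let ?J = "multi_indices m :: ('n \<Rightarrow> nat) set"
  let ?d = "card ?J"
  let ?Q = "\<lambda>\<phi>. \<phi> \<in> extensional {1..?d} \<and> bij_betw \<phi> {1..?d} ?J \<and>
     (\<forall>i\<in>{1..?d}. \<forall>j\<in>{1..?d}. i < j \<longrightarrow> less_fun (\<phi> i) (\<phi> j))"
  have fin: "finite ?J" by (rule card_multi_indices(1)[OF assms])
  define rk where "rk k = card {l \<in> ?J. l = k \<or> less_fun l k}" for k
  have tri: "less_fun k l \<or> k = l \<or> less_fun l k" for k l :: "'n \<Rightarrow> nat"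
    by (rule less_fun_trichotomy) simp
  have rk_mono: "rk k < rk l" if "k \<in> ?J" "l \<in> ?J" "less_fun k l" for k l
    unfolding rk_def
  proof (rule psubset_card_mono)
    show "{x \<in> ?J. x = k \<or> less_fun x k} \<subset> {x \<in> ?J. x = l \<or> less_fun x l}"
    proof (rule psubsetI)
      show "{x \<in> ?J. x = k \<or> less_fun x k} \<subseteq> {x \<in> ?J. x = l \<or> less_fun x l}"
        using less_fun_trans[OF _ that(3)] that(3) by auto
      have "l \<noteq> k" "\<not> less_fun l k"
        using that(3) less_fun_irrefl less_fun_asym by auto
      then show "{x \<in> ?J. x = k \<or> less_fun x k} \<noteq> {x \<in> ?J. x = l \<or> less_fun x l}"
        using that(2) by blast
    qed
  qed (use fin in simp)
  have inj: "inj_on rk ?J"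
  proof (rule inj_onI)
    fix k l assume "k \<in> ?J" "l \<in> ?J" "rk k = rk l"
    then show "k = l"
      using tri[of k l] rk_mono[of k l] rk_mono[of l k] by auto
  qed
  have "rk k \<in> {1..?d}" if "k \<in> ?J" for k
  proof -
    have "card {l \<in> ?J. l = k \<or> less_fun l k} > 0"
      using that fin by (auto simp: card_gt_0_iff)
    moreover have "card {l \<in> ?J. l = k \<or> less_fun l k} \<le> ?d"
      using fin by (intro card_mono) auto
    ultimately show ?thesis by (simp add: rk_def)
  qed
  then have "rk ` ?J = {1..?d}"
    using inj by (intro card_subset_eq) (auto simp: card_image)
  then have bij: "bij_betw rk ?J {1..?d}"
    using inj by (simp add: bij_betw_def)
  define \<phi> where "\<phi> = restrict (the_inv_into ?J rk) {1..?d}"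
  have \<phi>: "\<phi> i \<in> ?J" "rk (\<phi> i) = i" if "i \<in> {1..?d}" for i
    using that bij bij_betw_the_inv_into[OF bij] f_the_inv_into_f_bij_betw[OF bij, of i]
    by (auto simp: \<phi>_def bij_betw_def)
  have "?Q \<phi>"
  proof (intro conjI ballI impI)
    show "\<phi> \<in> extensional {1..?d}" by (simp add: \<phi>_def)
    show "bij_betw \<phi> {1..?d} ?J"
      by (rule bij_betw_cong[THEN iffD1, rotated, OF bij_betw_the_inv_into[OF bij]]) (simp add: \<phi>_def)
    fix i j assume ij: "i \<in> {1..?d}" "j \<in> {1..?d}" "i < j"
    then show "less_fun (\<phi> i) (\<phi> j)"
      using tri[of "\<phi> i" "\<phi> j"] rk_mono[of "\<phi> j" "\<phi> i"] \<phi>[of i] \<phi>[of j] by (metis less_asym less_irrefl)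
  qed
  \<comment> \<open>An increasing enumeration maps \<open>{1..i}\<close> onto the elements up to
    \<open>\<psi> i\<close>. So the rank of \<open>\<psi> i\<close> is \<open>i\<close>, and ranks
    are injective.\<close>
  moreover have "\<psi> = \<phi>" if \<psi>: "?Q \<psi>" for \<psi>
  proof
    fix i
    show "\<psi> i = \<phi> i"
    proof (cases "i \<in> {1..?d}")
      case True
      have mem: "\<psi> j \<in> ?J" if "j \<in> {1..?d}" for j
        using \<psi> that by (auto simp: bij_betw_def)
      have "{l \<in> ?J. l = \<psi> i \<or> less_fun l (\<psi> i)} = \<psi> ` {1..i}"
      proof (intro equalityI subsetI)
        fix l assume l: "l \<in> {l \<in> ?J. l = \<psi> i \<or> less_fun l (\<psi> i)}"
        have "\<psi> ` {1..?d} = ?J" using \<psi> by (simp only: bij_betw_def)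
        with l obtain j where j: "j \<in> {1..?d}" "l = \<psi> j" by blast
        have "\<not> i < j"
        proof
          assume "i < j"
          then have "less_fun (\<psi> i) (\<psi> j)" using \<psi> True j(1) by blast
          moreover have "l = \<psi> i \<or> less_fun l (\<psi> i)" using l by simp
          ultimately show False using j(2) by (metis less_fun_asym)
        qed
        then show "l \<in> \<psi> ` {1..i}" using j by auto
      next
        fix l assume "l \<in> \<psi> ` {1..i}"
        then obtain j where "j \<in> {1..i}" "l = \<psi> j" by auto
        then show "l \<in> {l \<in> ?J. l = \<psi> i \<or> less_fun l (\<psi> i)}"
          using \<psi> True mem[of j] by (cases "j = i") auto
      qed
      moreover have "inj_on \<psi> {1..i}"
        using \<psi> True by (auto simp: bij_betw_def intro: inj_on_subset)
      ultimately have "rk (\<psi> i) = i"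
        by (simp add: rk_def card_image)
      then show ?thesis
        using inj mem[OF True] \<phi>[OF True] inj_onD[OF inj, of "\<psi> i" "\<phi> i"] by simp
    next
      case False
      then show ?thesis using \<psi> by (auto simp: \<phi>_def extensional_def)
    qed
  qed
  ultimately have "lex_enum m = \<phi>"
    unfolding lex_enum_def Let_def by (rule the_equality)
  then show ?thesis using \<open>?Q \<phi>\<close> by simp
qed

subsection \<open>Coefficients with respect to \<open>q_fun\<close>\<close>

definition q_coeff :: "('n::finite \<Rightarrow> nat) \<Rightarrow> ('n rvec \<times> 'n rvec \<Rightarrow> complex) \<Rightarrow> 'n rvec \<Rightarrow> complex" where
  "q_coeff k g \<xi> = integral\<^sup>L mu_tilde (\<lambda>v. g (\<xi>, v) * complex_of_real (q_fun k \<xi> v))"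

definition q_tensor :: "('n::finite \<Rightarrow> nat) \<Rightarrow> ('n rvec \<Rightarrow> complex) \<Rightarrow> 'n rvec \<times> 'n rvec \<Rightarrow> complex" where
  "q_tensor k h = (\<lambda>(\<xi>, v). h \<xi> * complex_of_real (q_fun k \<xi> v))"

lemma q_coeff_measurable [measurable]:
  assumes "g \<in> borel_measurable borel"
  shows "q_coeff k g \<in> borel_measurable borel"
proof -
  have [measurable]: "g \<in> borel_measurable (borel \<Otimes>\<^sub>M borel)"
    using assms by (simp add: borel_prod)
  have "(\<lambda>(\<xi>, v). g (\<xi>, v) * complex_of_real (q_fun k \<xi> v)) \<in> borel_measurable (borel \<Otimes>\<^sub>M borel)"
    by measurable
  then have [measurable]: "(\<lambda>(\<xi>, v). g (\<xi>, v) * complex_of_real (q_fun k \<xi> v)) \<in> borel_measurable (borel \<Otimes>\<^sub>M mu_tilde)"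
    by (simp cong: measurable_cong_sets)
  show ?thesis
    unfolding q_coeff_def[abs_def] by (rule mu.borel_measurable_lebesgue_integral) measurable
qed

text \<open>\<open>q_fun k \<xi>\<close> is a unit vector, so for almost every \<open>\<xi>\<close>
  the coefficient is bounded by the norm of the slice; Tonelli integrates the squares.\<close>

lemma square_integrable_q_coeff:
  assumes g: "square_integrable g"
  shows "square_integrable (q_coeff k g)"
proof (rule square_integrableI_nn)
  have [measurable]: "g \<in> borel_measurable borel" using g by auto
  show "q_coeff k g \<in> borel_measurable borel" by measurable
  have [measurable]: "g \<in> borel_measurable (borel \<Otimes>\<^sub>M borel)"
    using g by (auto simp: borel_prod)
  have "(\<integral>\<^sup>+\<xi>. ennreal ((cmod (q_coeff k g \<xi>))\<^sup>2) \<partial>mu_tilde) \<le> (\<integral>\<^sup>+\<xi>. \<integral>\<^sup>+v. ennreal ((cmod (g (\<xi>, v)))\<^sup>2) \<partial>mu_tilde \<partial>mu_tilde)"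
  proof (rule nn_integral_mono_AE)
    show "AE \<xi> in mu_tilde. ennreal ((cmod (q_coeff k g \<xi>))\<^sup>2) \<le> (\<integral>\<^sup>+v. ennreal ((cmod (g (\<xi>, v)))\<^sup>2) \<partial>mu_tilde)"
      using square_integrable_slices(2)[OF g] unfolding AE_mu_tilde_iff
    proof eventually_elim
      case (elim \<xi>)
      have "norm (abs_l2 (\<lambda>v. complex_of_real (q_fun k \<xi> v))) = 1"
        using norm_abs_l2[OF square_integrable_q_fun, of k \<xi>] q_fun_orthonormal_real[of k \<xi> k]
        by (simp add: power2_eq_square)
      then have "cmod (q_coeff k g \<xi>) \<le> norm (abs_l2 (\<lambda>v. g (\<xi>, v)))"
        using cauchy_schwarz_abs_l2[OF elim square_integrable_q_fun, of k \<xi>] by (simp add: q_coeff_def)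
      then show ?case
        by (simp add: nn_integral_norm_abs_l2[OF elim] ennreal_leI power_mono)
    qed
  qed
  also have "\<dots> = (\<integral>\<^sup>+p. ennreal ((cmod (g p))\<^sup>2) \<partial>mu_tilde)"
    by (subst mu.nn_integral_fst) (simp_all add: mu_tilde_prod)
  also have "\<dots> < \<infinity>"
    by (simp add: nn_integral_norm_abs_l2[OF g])
  finally show "(\<integral>\<^sup>+\<xi>. ennreal ((cmod (q_coeff k g \<xi>))\<^sup>2) \<partial>mu_tilde) < \<infinity>" .
qed

lemma AE_slices:
  assumes "AE p in (lborel :: ('a::euclidean_space \<times> 'b::euclidean_space) measure). P p"
  shows "AE x in lborel. AE y in lborel. P (x, y)"
proof -
  have "AE p in (lborel :: 'a measure) \<Otimes>\<^sub>M (lborel :: 'b measure). P p"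
    unfolding lborel_prod by (rule assms)
  then show ?thesis by (rule lborel_pair.AE_pair)
qed

lemma q_coeff_cong_AE:
  assumes f: "square_integrable f" and g: "square_integrable g" and eq: "abs_l2 f = abs_l2 g"
  shows "AE \<xi> in lborel. q_coeff k f \<xi> = q_coeff k g \<xi>"
  using AE_slices[OF abs_l2_eqD[OF f g eq]] square_integrable_slices(2)[OF f] square_integrable_slices(2)[OF g]
proof eventually_elim
  case (elim \<xi>)
  then have [measurable]: "(\<lambda>v. f (\<xi>, v)) \<in> borel_measurable borel" "(\<lambda>v. g (\<xi>, v)) \<in> borel_measurable borel"
    by auto
  show ?case
    unfolding q_coeff_def using elim(1) by (intro integral_cong_AE) auto
qed

text \<open>\<open>N_op\<close> works with an arbitrary representative of the class. Two
  representatives differ on a null set, which meets almost every slice in a null set, so all of them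
  give the same class of coefficients.\<close>

lemma N_op_abs_l2:
  fixes g :: "'n::{finite,linorder} rvec \<times> 'n rvec \<Rightarrow> complex"
  assumes g: "square_integrable g" and j: "j \<in> {1..card (multi_indices m :: ('n \<Rightarrow> nat) set)}"
  shows "N_op m (abs_l2 g) j = abs_l2 (q_coeff (lex_enum m j) g)"
proof -
  have "N_op m (abs_l2 g) j = abs_l2 (q_coeff (lex_enum m j) (rep_l2 (abs_l2 g)))"
    using j by (simp add: N_op_def q_coeff_def[abs_def])
  also have "\<dots> = abs_l2 (q_coeff (lex_enum m j) g)"
    by (rule abs_l2_eqI[OF square_integrable_q_coeff[OF square_integrable_rep] square_integrable_q_coeff[OF g]
          q_coeff_cong_AE[OF square_integrable_rep g]]) simp
  finally show ?thesis .
qed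

lemma q_coeff_add:
  assumes "square_integrable f" "square_integrable g"
  shows "abs_l2 (q_coeff k (\<lambda>p. f p + g p)) = abs_l2 (q_coeff k f) + abs_l2 (q_coeff k g)"
proof -
  have "AE \<xi> in lborel. q_coeff k (\<lambda>p. f p + g p) \<xi> = q_coeff k f \<xi> + q_coeff k g \<xi>"
    using square_integrable_slices(2)[OF assms(1)] square_integrable_slices(2)[OF assms(2)]
  proof eventually_elim
    case (elim \<xi>)
    then show ?case
      unfolding q_coeff_def distrib_right
      by (intro Bochner_Integration.integral_add integrable_mult_square_integrable square_integrable_q_fun)
  qed
  then show ?thesis
    using assms by (simp add: abs_l2_add square_integrable_q_coeff)
      (intro abs_l2_eqI square_integrable_q_coeff square_integrable_add)
qed

lemma q_coeff_scale: "q_coeff k (\<lambda>p. c * f p) = (\<lambda>\<xi>. c * q_coeff k f \<xi>)"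
  by (simp add: q_coeff_def fun_eq_iff mult.assoc)

text \<open>For almost every \<open>\<xi>\<close> the slice is the finite sum of its components
  along \<open>J\<close>, to which Pythagoras applies; then the identity is integrated over
  \<open>\<xi>\<close>.\<close>

lemma q_coeff_parseval:
  fixes g :: "'n::finite rvec \<times> 'n rvec \<Rightarrow> complex"
  assumes g: "square_integrable g" and J: "finite J"
    and 0: "\<And>l. l \<notin> J \<Longrightarrow> AE \<xi> in lborel. q_coeff l g \<xi> = 0"
  shows "(norm (abs_l2 g))\<^sup>2 = (\<Sum>k\<in>J. (norm (abs_l2 (q_coeff k g)))\<^sup>2)"
proof -
  have [measurable]: "g \<in> borel_measurable (borel \<Otimes>\<^sub>M borel)"
    using g by (auto simp: borel_prod)
  have int: "integrable (mu_tilde \<Otimes>\<^sub>M mu_tilde) (\<lambda>(\<xi>, v). (cmod (g (\<xi>, v)))\<^sup>2)"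
    using square_integrableD[OF g] by (simp add: mu_tilde_prod split_def)
  \<comment> \<open>The assumption provides one null set for each \<open>l\<close>. There are only
    countably many multi-indices, so a single null set serves all of them.\<close>
  have AE0: "AE \<xi> in lborel. \<forall>l. l \<notin> J \<longrightarrow> q_coeff l g \<xi> = 0"
  proof -
    have "AE \<xi> in lborel. \<forall>l. l \<notin> J \<longrightarrow> q_coeff l g \<xi> = 0" if "\<And>l. AE \<xi> in lborel. l \<notin> J \<longrightarrow> q_coeff l g \<xi> = 0"
      using that by (simp add: AE_all_countable)
    then show ?thesis using 0 by fastforce
  qed
  have "(norm (abs_l2 g))\<^sup>2 = (\<integral>\<xi>. (\<integral>v. (cmod (g (\<xi>, v)))\<^sup>2 \<partial>mu_tilde) \<partial>mu_tilde)"
    using mu_pair.integral_fst[OF int] by (simp add: norm_abs_l2_sq[OF g] mu_tilde_prod split_def)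
  also have "\<dots> = (\<integral>\<xi>. (\<Sum>k\<in>J. (cmod (q_coeff k g \<xi>))\<^sup>2) \<partial>mu_tilde)"
  proof (rule integral_cong_AE)
    show "AE \<xi> in mu_tilde. (\<integral>v. (cmod (g (\<xi>, v)))\<^sup>2 \<partial>mu_tilde) = (\<Sum>k\<in>J. (cmod (q_coeff k g \<xi>))\<^sup>2)"
      using AE0 square_integrable_slices(2)[OF g] unfolding AE_mu_tilde_iff
    proof eventually_elim
      case (elim \<xi>)
      have [measurable]: "(\<lambda>v. g (\<xi>, v)) \<in> borel_measurable borel" using elim(2) by auto
      have "AE v in lborel. g (\<xi>, v) = (\<Sum>k\<in>J. q_coeff k g \<xi> * complex_of_real (q_fun k \<xi> v))"
        using q_fun_expansion[OF elim(2) J, of \<xi>] elim(1) by (simp add: q_coeff_def)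
      then have "(\<integral>v. (cmod (g (\<xi>, v)))\<^sup>2 \<partial>mu_tilde) =
          (\<integral>v. (cmod (\<Sum>k\<in>J. q_coeff k g \<xi> * complex_of_real (q_fun k \<xi> v)))\<^sup>2 \<partial>mu_tilde)"
        by (intro integral_cong_AE) auto
      then show ?case by (simp add: q_fun_sum_norm J)
    qed
    show "(\<lambda>\<xi>. \<integral>v. (cmod (g (\<xi>, v)))\<^sup>2 \<partial>mu_tilde) \<in> borel_measurable mu_tilde"
      using mu_pair.integrable_fst[OF int] by auto
    show "(\<lambda>\<xi>. \<Sum>k\<in>J. (cmod (q_coeff k g \<xi>))\<^sup>2) \<in> borel_measurable mu_tilde"
      using g by auto
  qed
  also have "\<dots> = (\<Sum>k\<in>J. (norm (abs_l2 (q_coeff k g)))\<^sup>2)"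
    by (subst Bochner_Integration.integral_sum)
      (auto simp: norm_abs_l2_sq g square_integrable_q_coeff intro!: square_integrableD square_integrable_q_coeff)
  finally show ?thesis .
qed

subsection \<open>Functions \<open>(\<xi>, v) \<mapsto> h \<xi> * q_fun k \<xi> v\<close>\<close>

text \<open>The value depends on \<open>\<xi> + 2 v\<close> alone, so integrability in
  \<open>\<xi>\<close> is integrability in \<open>v\<close> after a dilation.\<close>

lemma square_integrable_q_fun1:
  fixes k :: "'n::finite \<Rightarrow> nat"
  shows "square_integrable (\<lambda>\<xi>. complex_of_real (q_fun k \<xi> v))"
proof (rule square_integrableI)
  have eq: "q_fun k \<xi> v = q_fun k (2 *\<^sub>R v) ((1 / 2) *\<^sub>R \<xi>)" for \<xi>
    by (simp add: q_fun_def add.commute)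
  have [measurable]: "(\<lambda>x. q_fun k (2 *\<^sub>R v) x) \<in> borel_measurable borel" by measurable
  have "integrable mu_tilde (\<lambda>x. (cmod (complex_of_real (q_fun k (2 *\<^sub>R v) x)))\<^sup>2)"
    by (rule square_integrableD[OF square_integrable_q_fun])
  then show "integrable mu_tilde (\<lambda>\<xi>. (cmod (complex_of_real (q_fun k \<xi> v)))\<^sup>2)"
    unfolding eq by (subst (asm) mu_scale(2)[of _ "1 / 2"]) auto
qed measurable

lemma q_tensor_measurable [measurable]:
  assumes [measurable]: "h \<in> borel_measurable borel"
  shows "q_tensor k h \<in> borel_measurable borel"
  unfolding q_tensor_def borel_prod[symmetric] by measurable

text \<open>Integrating over \<open>v\<close> first leaves the norm of \<open>h\<close>. For fixed
  \<open>v\<close> the slice is a product of two square-integrable functions, hence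
  integrable.\<close>

lemma slice_integrable_q_tensor:
  fixes h :: "'n::finite rvec \<Rightarrow> complex"
  assumes h: "square_integrable h"
  shows "slice_integrable (q_tensor k h)"
proof -
  have [measurable]: "h \<in> borel_measurable borel" using h by auto
  have m: "(\<lambda>p. ennreal ((cmod (q_tensor k h p))\<^sup>2)) \<in> borel_measurable (mu_tilde \<Otimes>\<^sub>M mu_tilde)"
    by (simp add: mu_tilde_prod)
  have "(\<integral>\<^sup>+p. ennreal ((cmod (q_tensor k h p))\<^sup>2) \<partial>mu_tilde) =
      (\<integral>\<^sup>+\<xi>. \<integral>\<^sup>+v. ennreal ((cmod (q_tensor k h (\<xi>, v)))\<^sup>2) \<partial>mu_tilde \<partial>mu_tilde)"
    by (subst mu.nn_integral_fst[OF m]) (simp add: mu_tilde_prod)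
  also have "\<dots> = (\<integral>\<^sup>+\<xi>. ennreal ((cmod (h \<xi>))\<^sup>2) \<partial>mu_tilde)"
  proof (rule nn_integral_cong)
    fix \<xi> :: "'n rvec"
    have "(\<integral>\<^sup>+v. ennreal ((cmod (q_tensor k h (\<xi>, v)))\<^sup>2) \<partial>mu_tilde) =
        ennreal ((cmod (h \<xi>))\<^sup>2) * (\<integral>\<^sup>+v. ennreal ((cmod (complex_of_real (q_fun k \<xi> v)))\<^sup>2) \<partial>mu_tilde)"
      by (simp add: q_tensor_def norm_mult power_mult_distrib ennreal_mult nn_integral_cmult)
    also have "(\<integral>\<^sup>+v. ennreal ((cmod (complex_of_real (q_fun k \<xi> v)))\<^sup>2) \<partial>mu_tilde) = 1"
      by (subst nn_integral_eq_integral[OF square_integrableD[OF square_integrable_q_fun]])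
        (use q_fun_orthonormal_real[of k \<xi> k] in \<open>auto simp: power2_eq_square\<close>)
    finally show "(\<integral>\<^sup>+v. ennreal ((cmod (q_tensor k h (\<xi>, v)))\<^sup>2) \<partial>mu_tilde) = ennreal ((cmod (h \<xi>))\<^sup>2)"
      by simp
  qed
  also have "\<dots> < \<infinity>"
    by (simp add: nn_integral_norm_abs_l2[OF h])
  finally have "square_integrable (q_tensor k h)"
    by (intro square_integrableI_nn) auto
  moreover have "integrable mu_tilde (\<lambda>\<xi>. q_tensor k h (\<xi>, v))" for v
    unfolding q_tensor_def by (simp add: integrable_mult_square_integrable h square_integrable_q_fun1)
  ultimately show ?thesis
    by (simp add: slice_integrable_def)
qed

lemma slice_integrable_sum:
  "finite I \<Longrightarrow> (\<And>i. i \<in> I \<Longrightarrow> slice_integrable (f i)) \<Longrightarrow> slice_integrable (\<lambda>p. \<Sum>i\<in>I. f i p)"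
proof (induction I rule: finite_induct)
  case empty
  then show ?case by (simp add: slice_integrable_def square_integrable_zero)
next
  case (insert i I)
  then have "slice_integrable (\<lambda>p. f i p + (\<Sum>i\<in>I. f i p))"
    by (intro slice_integrable_add) auto
  then show ?case using insert by simp
qed

lemma q_coeff_sum_q_tensor:
  fixes h :: "('n::finite \<Rightarrow> nat) \<Rightarrow> 'n rvec \<Rightarrow> complex"
  assumes J: "finite J"
  shows "q_coeff l (\<lambda>p. \<Sum>k\<in>J. q_tensor k (h k) p) \<xi> = (if l \<in> J then h l \<xi> else 0)"
proof -
  have "q_coeff l (\<lambda>p. \<Sum>k\<in>J. q_tensor k (h k) p) \<xi> =
      integral\<^sup>L mu_tilde (\<lambda>v. \<Sum>k\<in>J. h k \<xi> * complex_of_real (q_fun k \<xi> v * q_fun l \<xi> v))"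
    by (simp add: q_coeff_def q_tensor_def sum_distrib_right mult.assoc)
  also have "\<dots> = (\<Sum>k\<in>J. h k \<xi> * (if k = l then 1 else 0))"
    by (simp add: Bochner_Integration.integral_sum q_fun_orthonormal q_fun_orthonormal_real if_distrib[of complex_of_real]
        del: of_real_mult cong: if_cong)
  finally show ?thesis
    using J by (simp add: if_distrib sum.delta cong: if_cong)
qed

subsection \<open>Test functions\<close>

text \<open>The integral of the derivative of Hermite factor times exponential times Gaussian
  vanishes. With the three-term recurrence this reads
  \<open>J (Suc l) = \<i> sqrt 2 (t - \<i> v) J l\<close>, so each index contributes one power of
  the conjugate of \<open>t + \<i> v\<close>.\<close>

lemma hermite_fourier_integral:
  fixes t v :: real
  defines "J \<equiv> \<lambda>l. integral\<^sup>L lborel (\<lambda>\<xi>. complex_of_real (hermite l ((\<xi> + 2 * v) / sqrt 2)) *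
    exp ((\<i> * complex_of_real t - complex_of_real v) * complex_of_real \<xi>) * complex_of_real (exp (- (1 / 2) * \<xi>\<^sup>2)))"
  shows "integrable lborel (\<lambda>\<xi>. complex_of_real (hermite l ((\<xi> + 2 * v) / sqrt 2)) *
    exp ((\<i> * complex_of_real t - complex_of_real v) * complex_of_real \<xi>) * complex_of_real (exp (- (1 / 2) * \<xi>\<^sup>2)))" (is ?int)
    and "J l = (\<i> * complex_of_real (sqrt 2) * (complex_of_real t - \<i> * complex_of_real v)) ^ l *
      (complex_of_real (sqrt (2 * pi)) * exp (complex_of_real (v\<^sup>2 / 2 - t\<^sup>2 / 2) - \<i> * complex_of_real (t * v)))" (is ?val)
proof -
  let ?c = "\<i> * complex_of_real t - complex_of_real v"
  let ?H = "\<lambda>l \<xi>. complex_of_real (hermite l ((\<xi> + 2 * v) / sqrt 2))"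
  let ?E = "\<lambda>\<xi>. exp (?c * complex_of_real \<xi>)"
  let ?G = "\<lambda>\<xi>::real. complex_of_real (exp (- (1 / 2) * \<xi>\<^sup>2))"
  have H: "exp_growth (?H l)" for l
  proof -
    have "exp_growth (\<lambda>\<xi>. complex_of_real (hermite l (2 * v / sqrt 2 + (1 / sqrt 2) * \<xi>)))"
      by (rule exp_growth_affine[OF exp_growth_hermite])
    then show ?thesis by (simp add: add_divide_distrib add.commute)
  qed
  have HE: "exp_growth (\<lambda>\<xi>. ?H l \<xi> * ?E \<xi>)" for l
    by (intro exp_growth_mult H exp_growth_exp)
  have int: "integrable lborel (\<lambda>\<xi>. ?H l \<xi> * ?E \<xi> * ?G \<xi>)" for l
    by (intro exp_growth_integrable HE) simp
  then show ?int .
  have rec: "J (Suc l) = \<i> * complex_of_real (sqrt 2) * (complex_of_real t - \<i> * complex_of_real v) * J l" for l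
  proof -
    let ?K = "\<i> * complex_of_real (sqrt 2) * (complex_of_real t - \<i> * complex_of_real v)"
    let ?w = "\<lambda>\<xi>. ?H (Suc l) \<xi> * ?E \<xi> - ?K * (?H l \<xi> * ?E \<xi>)"
    have "integral\<^sup>L lborel (\<lambda>\<xi>. ?w \<xi> * ?G \<xi>) = 0"
    proof (rule integral_derivative_eq_0[where u="\<lambda>\<xi>. - complex_of_real (sqrt 2) * (?H l \<xi> * ?E \<xi>)"])
      show "exp_growth (\<lambda>\<xi>. - complex_of_real (sqrt 2) * (?H l \<xi> * ?E \<xi>))"
        by (intro exp_growth_mult[OF exp_growth_const] HE)
      show "exp_growth ?w"
        by (intro exp_growth_diff exp_growth_mult[OF exp_growth_const] HE)
      show "continuous_on UNIV ?w" by (intro continuous_intros) auto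
      show "((\<lambda>\<xi>. - complex_of_real (sqrt 2) * (?H l \<xi> * ?E \<xi>) * ?G \<xi>) has_vector_derivative ?w x * ?G x) (at x)" for x
      proof -
        let ?X = "(x + 2 * v) / sqrt 2"
        have "((\<lambda>\<xi>. hermite l ((\<xi> + 2 * v) / sqrt 2)) has_real_derivative
            2 * real l * hermite (l - 1) ?X * (1 / sqrt 2)) (at x)"
          by (rule DERIV_chain2[OF hermite_has_derivative])
            (auto intro!: derivative_eq_intros simp: real_div_sqrt)
        then have dH: "(?H l has_vector_derivative complex_of_real (2 * real l * hermite (l - 1) ?X * (1 / sqrt 2))) (at x)"
          by (intro has_vector_derivative_of_real) (simp add: has_real_derivative_iff_has_vector_derivative)
        have dE: "(?E has_vector_derivative ?c * ?E x) (at x)"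
          by (auto intro!: derivative_eq_intros has_vector_derivative_real_field simp: mult.commute)
        have "((\<lambda>\<xi>::real. exp (- (1 / 2) * \<xi>\<^sup>2)) has_real_derivative - x * exp (- (1 / 2) * x\<^sup>2)) (at x)"
          by (auto intro!: derivative_eq_intros)
        then have dG: "(?G has_vector_derivative complex_of_real (- x * exp (- (1 / 2) * x\<^sup>2))) (at x)"
          by (intro has_vector_derivative_of_real) (simp add: has_real_derivative_iff_has_vector_derivative)
        have s: "complex_of_real (sqrt 2) * complex_of_real (sqrt 2) = 2"
          by (simp flip: of_real_mult)
        have X: "complex_of_real (sqrt 2) * complex_of_real ?X = complex_of_real x + 2 * complex_of_real v"
          by simp
        have HS: "?H (Suc l) x = complex_of_real (sqrt 2) * (complex_of_real x + 2 * complex_of_real v) * ?H l x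
            - 2 * of_nat l * complex_of_real (hermite (l - 1) ?X)"
          unfolding X[symmetric] mult.assoc[symmetric] s by (simp only: hermite_Suc of_real_diff of_real_mult of_real_numeral of_real_of_nat_eq)
        have "((\<lambda>\<xi>. - complex_of_real (sqrt 2) * (?H l \<xi> * ?E \<xi>) * ?G \<xi>) has_vector_derivative
            - complex_of_real (sqrt 2) * (?H l x * ?E x) * complex_of_real (- x * exp (- (1 / 2) * x\<^sup>2)) +
            - complex_of_real (sqrt 2) * (?H l x * (?c * ?E x) + complex_of_real (2 * real l * hermite (l - 1) ?X * (1 / sqrt 2)) * ?E x) * ?G x) (at x)"
          by (intro has_vector_derivative_mult has_vector_derivative_mult_right dH dE dG)
        moreover have "- complex_of_real (sqrt 2) * (?H l x * ?E x) * complex_of_real (- x * exp (- (1 / 2) * x\<^sup>2)) +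
            - complex_of_real (sqrt 2) * (?H l x * (?c * ?E x) + complex_of_real (2 * real l * hermite (l - 1) ?X * (1 / sqrt 2)) * ?E x) * ?G x
            = ?w x * ?G x"
          unfolding HS by (simp add: algebra_simps)
        ultimately show ?thesis by simp
      qed
    qed simp
    moreover have "integral\<^sup>L lborel (\<lambda>\<xi>. ?w \<xi> * ?G \<xi>) = J (Suc l) - ?K * J l"
    proof -
      have "integral\<^sup>L lborel (\<lambda>\<xi>. ?w \<xi> * ?G \<xi>) = integral\<^sup>L lborel (\<lambda>\<xi>. ?H (Suc l) \<xi> * ?E \<xi> * ?G \<xi> - ?K * (?H l \<xi> * ?E \<xi> * ?G \<xi>))"
        by (simp only: left_diff_distrib mult.assoc)
      also have "\<dots> = J (Suc l) - ?K * J l"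
        unfolding J_def integral_mult_right_zero[symmetric]
        by (rule Bochner_Integration.integral_diff[OF int integrable_mult_right[OF int]])
      finally show ?thesis .
    qed
    ultimately show ?thesis by simp
  qed
  have J0: "J 0 = complex_of_real (sqrt (2 * pi)) * exp (complex_of_real (v\<^sup>2 / 2 - t\<^sup>2 / 2) - \<i> * complex_of_real (t * v))"
  proof -
    let ?F = "\<lambda>\<xi>::real. complex_of_real (exp (- (\<xi>\<^sup>2) / 2)) * exp (- \<i> * complex_of_real (\<xi> * (- t)))"
    \<comment> \<open>Completing the square by the real shift
      \<open>\<xi> \<mapsto> v + \<xi>\<close> leaves the Fourier integrand of the Gaussian at
      \<open>- t\<close>.\<close>
    have eq: "?E \<xi> * ?G \<xi> = exp (complex_of_real (v\<^sup>2 / 2) - \<i> * complex_of_real (t * v)) * ?F (v + 1 * \<xi>)" for \<xi>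
      by (simp add: exp_of_real[symmetric] exp_add[symmetric] power2_eq_square algebra_simps add_divide_distrib
          del: exp_of_real)
        (simp add: field_simps)
    have "J 0 = exp (complex_of_real (v\<^sup>2 / 2) - \<i> * complex_of_real (t * v)) * integral\<^sup>L lborel (\<lambda>\<xi>. ?F (v + 1 * \<xi>))"
      unfolding J_def hermite_0 of_real_1 mult_1_left eq integral_mult_right_zero ..
    also have "integral\<^sup>L lborel (\<lambda>\<xi>. ?F (v + 1 * \<xi>)) = integral\<^sup>L lborel ?F"
      using lborel_integral_real_affine[of 1 ?F v] by simp
    also have "\<dots> = complex_of_real (sqrt (2 * pi) * exp (- (t\<^sup>2) / 2))"
      using gaussian_fourier_real(2)[of "- t"] by simp
    finally have "J 0 = exp (complex_of_real (v\<^sup>2 / 2) - \<i> * complex_of_real (t * v)) *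
        complex_of_real (sqrt (2 * pi) * exp (- (t\<^sup>2) / 2))" .
    moreover have "exp (complex_of_real (v\<^sup>2 / 2 - t\<^sup>2 / 2) - \<i> * complex_of_real (t * v)) =
        exp (complex_of_real (v\<^sup>2 / 2) - \<i> * complex_of_real (t * v)) * complex_of_real (exp (- (t\<^sup>2) / 2))"
      unfolding exp_of_real[symmetric] exp_add[symmetric]
      by (rule arg_cong[where f=exp]) simp
    ultimately show ?thesis by (simp only: of_real_mult mult_ac)
  qed
  show ?val
    by (induction l) (simp_all add: J0 rec mult_ac)
qed

text \<open>The Gaussian has this width because together with that of \<open>q_fun\<close> it gives
  the exponent \<open>- \<xi>^2 / 2 - v \<xi> - v^2\<close> in each coordinate, whose inverse
  transform is explicit. The phases in \<open>w\<close> make the pairings with this family a Fourier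
  integral.\<close>

definition test_fun :: "'n::finite rvec \<Rightarrow> 'n rvec \<Rightarrow> complex" where
  "test_fun w \<xi> = complex_of_real (exp (- (norm \<xi>)\<^sup>2 / 4)) * exp (- \<i> * complex_of_real (\<xi> \<bullet> w))"

lemma test_fun_measurable [measurable]: "test_fun w \<in> borel_measurable borel"
  unfolding test_fun_def[abs_def] by measurable

lemma cmod_test_fun: "cmod (test_fun w \<xi>) = exp (- (norm \<xi>)\<^sup>2 / 4)"
  by (simp add: test_fun_def norm_mult)

lemma square_integrable_test_fun: "square_integrable (test_fun w)"
proof (rule square_integrableI)
  have "(cmod (test_fun w \<xi>))\<^sup>2 = gauss \<xi>" for \<xi>
    by (simp add: cmod_test_fun gauss_def exp_double[symmetric])
  then show "integrable mu_tilde (\<lambda>\<xi>. (cmod (test_fun w \<xi>))\<^sup>2)"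
    by (simp add: integrable_gauss)
qed measurable

text \<open>Pairing with \<open>q_tensor l (test_fun w)\<close> is the Fourier integral of
  \<open>q_coeff l g * test_fun 0\<close> at \<open>- w\<close>. As all pairings vanish, the product
  is zero almost everywhere, and \<open>test_fun 0\<close> has no zeros.\<close>

lemma q_coeff_eq_0:
  fixes g :: "'n::finite rvec \<times> 'n rvec \<Rightarrow> complex"
  assumes g: "square_integrable g"
    and orth: "\<And>w. integral\<^sup>L mu_tilde (\<lambda>p. g p * cnj (q_tensor l (test_fun w) p)) = 0"
  shows "AE \<xi> in lborel. q_coeff l g \<xi> = 0"
proof -
  let ?h = "\<lambda>\<xi>. q_coeff l g \<xi> * test_fun 0 \<xi>"
  have si: "square_integrable ?h"
  proof (rule square_integrable_bound[OF square_integrable_q_coeff[OF g, of l]])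
    show "AE \<xi> in mu_tilde. cmod (?h \<xi>) \<le> cmod (q_coeff l g \<xi>)"
      by (auto simp: norm_mult cmod_test_fun intro!: mult_left_le)
  qed (use g in measurable)
  have int: "integrable mu_tilde ?h"
    by (intro integrable_mult_square_integrable square_integrable_q_coeff g square_integrable_test_fun)
  have "fourier_integral ?h \<eta> = 0" for \<eta>
  proof -
    have "integrable mu_tilde (\<lambda>p. g p * cnj (q_tensor l (test_fun (- \<eta>)) p))"
      using slice_integrable_q_tensor[OF square_integrable_test_fun]
      by (intro integrable_mult_square_integrable square_integrable_cnj g) (auto simp: slice_integrable_def)
    then have I: "integrable (mu_tilde \<Otimes>\<^sub>M mu_tilde) (\<lambda>(\<xi>, v). g (\<xi>, v) * cnj (q_tensor l (test_fun (- \<eta>)) (\<xi>, v)))"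
      by (simp add: mu_tilde_prod split_def)
    have "fourier_integral ?h \<eta> = (\<integral>\<xi>. (\<integral>v. g (\<xi>, v) * cnj (q_tensor l (test_fun (- \<eta>)) (\<xi>, v)) \<partial>mu_tilde) \<partial>mu_tilde)"
      unfolding fourier_integral_def
    proof (intro Bochner_Integration.integral_cong refl)
      fix \<xi> :: "'n rvec"
      have "?h \<xi> * exp (- \<i> * complex_of_real (\<xi> \<bullet> \<eta>)) = q_coeff l g \<xi> * cnj (test_fun (- \<eta>) \<xi>)"
        by (simp add: test_fun_def exp_cnj)
      also have "\<dots> = (\<integral>v. g (\<xi>, v) * complex_of_real (q_fun l \<xi> v) * cnj (test_fun (- \<eta>) \<xi>) \<partial>mu_tilde)"
        by (simp add: q_coeff_def)
      also have "\<dots> = (\<integral>v. g (\<xi>, v) * cnj (q_tensor l (test_fun (- \<eta>)) (\<xi>, v)) \<partial>mu_tilde)"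
        by (simp add: q_tensor_def mult_ac)
      finally show "?h \<xi> * exp (- \<i> * complex_of_real (\<xi> \<bullet> \<eta>)) = (\<integral>v. g (\<xi>, v) * cnj (q_tensor l (test_fun (- \<eta>)) (\<xi>, v)) \<partial>mu_tilde)" .
    qed
    also have "\<dots> = integral\<^sup>L mu_tilde (\<lambda>p. g p * cnj (q_tensor l (test_fun (- \<eta>)) p))"
      using mu_pair.integral_fst[OF I] by (simp add: mu_tilde_prod split_def)
    finally show ?thesis by (simp add: orth)
  qed
  from fourier_integral_eq_0_AE[OF si int this] show ?thesis
    by eventually_elim (simp add: test_fun_def)
qed

text \<open>What matters is that \<open>C\<close> depends neither on \<open>w\<close> nor on the
  point. In terms of \<open>z = x + \<i> v\<close> the factor at \<open>r\<close> is the conjugate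
  of \<open>(z_r - w_r) ^ l_r\<close> times an exponential of a quadratic, the shape against which
  m-analytic functions are tested.\<close>

lemma inverse_partial_fourier_test:
  fixes l :: "'n::finite \<Rightarrow> nat"
  obtains C where "\<And>w x v. inverse_partial_fourier (q_tensor l (test_fun w)) (x, v) =
    C * (\<Prod>r\<in>UNIV. (complex_of_real (x $ r - w $ r) - \<i> * complex_of_real (v $ r)) ^ l r *
      exp (complex_of_real (- (v $ r)\<^sup>2 / 2 - (x $ r - w $ r)\<^sup>2 / 2) - \<i> * complex_of_real ((x $ r - w $ r) * v $ r)))"
proof -
  define D where "D = 2 powr (real CARD('n) / 2) * pi powr (real CARD('n) / 4) *
      (\<Prod>r\<in>UNIV. (2 ^ l r * fact (l r) * sqrt pi) powr (- (1/2)))"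
  let ?f = "\<lambda>(w :: 'n rvec) (x :: 'n rvec) (v :: 'n rvec) r \<xi>. complex_of_real (exp (- (v $ r)\<^sup>2)) * (complex_of_real (hermite (l r) ((\<xi> + 2 * v $ r) / sqrt 2)) *
    exp ((\<i> * complex_of_real (x $ r - w $ r) - complex_of_real (v $ r)) * complex_of_real \<xi>) * complex_of_real (exp (- (1 / 2) * \<xi>\<^sup>2)))"
  define C where "C = complex_of_real (mu_const TYPE('n rvec) * D) *
    (\<Prod>r\<in>UNIV. (\<i> * complex_of_real (sqrt 2)) ^ l r * complex_of_real (sqrt (2 * pi)))"
  have "inverse_partial_fourier (q_tensor l (test_fun w)) (x, v) =
    C * (\<Prod>r\<in>UNIV. (complex_of_real (x $ r - w $ r) - \<i> * complex_of_real (v $ r)) ^ l r *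
      exp (complex_of_real (- (v $ r)\<^sup>2 / 2 - (x $ r - w $ r)\<^sup>2 / 2) - \<i> * complex_of_real ((x $ r - w $ r) * v $ r)))" for w x v
  proof -
    \<comment> \<open>The real exponents are collected as \<open>- \<xi>^2 / 4 - (\<xi> + 2 v)^2 / 4
      = - v^2 - v \<xi> - \<xi>^2 / 2\<close>, so \<open>exp (- v^2)\<close> leaves the
      integral.\<close>
    have factor: "complex_of_real (exp (- (\<xi> $ r)\<^sup>2 / 4)) * exp (- \<i> * complex_of_real (\<xi> $ r * w $ r)) *
        (complex_of_real (hermite (l r) (hcoord \<xi> v r)) * complex_of_real (exp (- (hcoord \<xi> v r)\<^sup>2 / 2))) *
        exp (\<i> * complex_of_real (x $ r * \<xi> $ r)) = ?f w x v r (\<xi> $ r)" for \<xi> r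
    proof -
      have "complex_of_real (exp (- (\<xi> $ r)\<^sup>2 / 4)) * exp (- \<i> * complex_of_real (\<xi> $ r * w $ r)) *
          complex_of_real (exp (- (hcoord \<xi> v r)\<^sup>2 / 2)) * exp (\<i> * complex_of_real (x $ r * \<xi> $ r)) =
          complex_of_real (exp (- (v $ r)\<^sup>2)) * exp ((\<i> * complex_of_real (x $ r - w $ r) - complex_of_real (v $ r)) * complex_of_real (\<xi> $ r)) *
          complex_of_real (exp (- (1 / 2) * (\<xi> $ r)\<^sup>2))"
        unfolding exp_of_real[symmetric] exp_add[symmetric]
        by (rule arg_cong[where f=exp]) (simp add: hcoord_def power_divide power2_eq_square field_simps)
      then show ?thesis by (simp add: hcoord_def mult_ac)
    qed
    have eq: "q_tensor l (test_fun w) (\<xi>, v) * exp (\<i> * complex_of_real (x \<bullet> \<xi>)) = complex_of_real D * (\<Prod>r\<in>UNIV. ?f w x v r (\<xi> $ r))" for \<xi>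
    proof -
      have n: "complex_of_real (exp (- (norm \<xi>)\<^sup>2 / 4)) = (\<Prod>r\<in>UNIV. complex_of_real (exp (- (\<xi> $ r)\<^sup>2 / 4)))"
      proof -
        have "(norm \<xi>)\<^sup>2 = (\<Sum>r\<in>UNIV. (\<xi> $ r)\<^sup>2)"
          unfolding power2_norm_eq_inner by (simp add: inner_vec_def power2_eq_square)
        then show ?thesis
          unfolding of_real_prod[symmetric] exp_sum[OF finite, symmetric]
          by (simp add: sum_negf sum_divide_distrib)
      qed
      have e1: "exp (- \<i> * complex_of_real (\<xi> \<bullet> w)) = (\<Prod>r\<in>UNIV. exp (- \<i> * complex_of_real (\<xi> $ r * w $ r)))"
        unfolding exp_sum[OF finite, symmetric] by (simp add: inner_vec_def sum_distrib_left sum_negf)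
      have e2: "exp (\<i> * complex_of_real (x \<bullet> \<xi>)) = (\<Prod>r\<in>UNIV. exp (\<i> * complex_of_real (x $ r * \<xi> $ r)))"
        unfolding exp_sum[OF finite, symmetric] by (simp add: inner_vec_def sum_distrib_left)
      have q: "complex_of_real (q_fun l \<xi> v) = complex_of_real D * (\<Prod>r\<in>UNIV. complex_of_real (hermite (l r) (hcoord \<xi> v r)) * complex_of_real (exp (- (hcoord \<xi> v r)\<^sup>2 / 2)))"
        by (simp add: D_def q_fun_eq hermite_fun_eq prod.distrib mult_ac)
      show ?thesis
        unfolding factor[symmetric] q_tensor_def test_fun_def split_conv n e1 e2 q prod.distrib by (simp only: mult_ac)
    qed
    have int: "integrable lborel (?f w x v r)" for r
      by (intro integrable_mult_right hermite_fourier_integral(1))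
    have val: "integral\<^sup>L lborel (?f w x v r) = (\<i> * complex_of_real (sqrt 2)) ^ l r * complex_of_real (sqrt (2 * pi)) *
        ((complex_of_real (x $ r - w $ r) - \<i> * complex_of_real (v $ r)) ^ l r *
      exp (complex_of_real (- (v $ r)\<^sup>2 / 2 - (x $ r - w $ r)\<^sup>2 / 2) - \<i> * complex_of_real ((x $ r - w $ r) * v $ r)))" for r
    proof -
      let ?t = "x $ r - w $ r"
      have "exp (complex_of_real (- (v $ r)\<^sup>2 / 2 - ?t\<^sup>2 / 2) - \<i> * complex_of_real (?t * v $ r)) =
          complex_of_real (exp (- (v $ r)\<^sup>2)) * exp (complex_of_real ((v $ r)\<^sup>2 / 2 - ?t\<^sup>2 / 2) - \<i> * complex_of_real (?t * v $ r))"
        unfolding exp_of_real[symmetric] exp_add[symmetric]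
        by (rule arg_cong[where f=exp]) (simp add: field_simps)
      then show ?thesis
        unfolding integral_mult_right_zero hermite_fourier_integral(2) power_mult_distrib by (simp add: mult_ac)
    qed
    show ?thesis
      unfolding inverse_partial_fourier_def split_conv eq integral_mult_right_zero integral_mu_tilde
      unfolding integral_lborel_prod_vec(2)[OF int] val
      unfolding prod.distrib C_def
      by (simp add: scaleR_conv_of_real mult_ac)
  qed
  then show ?thesis by (rule that)
qed

section \<open>Wirtinger calculus and orthogonality relations of m-analytic functions\<close>

subsection \<open>Smooth functions\<close>

text \<open>An explicit derivative \<open>D\<close> is easier to iterate than
  \<open>frechet_derivative\<close>; uniqueness of derivatives identifies the two.\<close>

lemma times_cont_differentiable_SucI:
  assumes "\<And>x. (f has_derivative D x) (at x)" "\<And>v. times_cont_differentiable k (\<lambda>x. D x v)"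
  shows "times_cont_differentiable (Suc k) f"
proof -
  have "frechet_derivative f (at x) = D x" for x
    using frechet_derivative_at[OF assms(1)] by simp
  then show ?thesis
    using assms by (auto simp: differentiable_def)
qed

lemma times_cont_differentiable_SucD:
  assumes "times_cont_differentiable (Suc k) f"
  shows "(f has_derivative frechet_derivative f (at x)) (at x)"
    and "times_cont_differentiable k (\<lambda>x. frechet_derivative f (at x) v)"
  using assms by (auto simp: frechet_derivative_works)

lemma times_cont_differentiable_lower:
  "times_cont_differentiable (Suc k) f \<Longrightarrow> times_cont_differentiable k f"
proof (induction k arbitrary: f)
  case 0
  then show ?case
    by (auto simp: continuous_on_eq_continuous_within differentiable_imp_continuous_within)
next
  case (Suc k)
  show ?case
    by (rule times_cont_differentiable_SucI) (use Suc times_cont_differentiable_SucD in blast)+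
qed

lemma times_cont_differentiable_const [intro]: "times_cont_differentiable k (\<lambda>_. c)"
proof (induction k arbitrary: c)
  case (Suc k)
  show ?case
    by (rule times_cont_differentiable_SucI[where D="\<lambda>_ _. 0"]) (use Suc in auto)
qed simp

lemma times_cont_differentiable_linear: "bounded_linear L \<Longrightarrow> times_cont_differentiable k L"
proof (cases k)
  case 0
  then show "bounded_linear L \<Longrightarrow> ?thesis" by (simp add: linear_continuous_on)
next
  case (Suc k')
  assume "bounded_linear L"
  then show ?thesis unfolding Suc
    by (intro times_cont_differentiable_SucI[where D="\<lambda>_. L"])
      (auto intro: bounded_linear_imp_has_derivative)
qed

lemma times_cont_differentiable_add:
  "times_cont_differentiable k f \<Longrightarrow> times_cont_differentiable k g \<Longrightarrow> times_cont_differentiable k (\<lambda>x. f x + g x)"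
proof (induction k arbitrary: f g)
  case (Suc k)
  show ?case
    by (rule times_cont_differentiable_SucI)
      (auto intro!: derivative_intros Suc.IH times_cont_differentiable_SucD Suc.prems)
qed (auto intro: continuous_on_add)

lemma times_cont_differentiable_mult:
  fixes f g :: "'a::real_normed_vector \<Rightarrow> 'b::real_normed_algebra"
  shows "times_cont_differentiable k f \<Longrightarrow> times_cont_differentiable k g \<Longrightarrow> times_cont_differentiable k (\<lambda>x. f x * g x)"
proof (induction k arbitrary: f g)
  case (Suc k)
  show ?case
  proof (rule times_cont_differentiable_SucI)
    show "((\<lambda>x. f x * g x) has_derivative
        (\<lambda>h. f x * frechet_derivative g (at x) h + frechet_derivative f (at x) h * g x)) (at x)" for x
      by (intro has_derivative_mult times_cont_differentiable_SucD(1)[OF Suc.prems(1)] times_cont_differentiable_SucD(1)[OF Suc.prems(2)])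
    show "times_cont_differentiable k (\<lambda>x. f x * frechet_derivative g (at x) v + frechet_derivative f (at x) v * g x)" for v
      by (intro times_cont_differentiable_add Suc.IH times_cont_differentiable_lower[OF Suc.prems(1)]
          times_cont_differentiable_lower[OF Suc.prems(2)] times_cont_differentiable_SucD(2)[OF Suc.prems(1)]
          times_cont_differentiable_SucD(2)[OF Suc.prems(2)])
  qed
qed (auto intro: continuous_on_mult)

lemma times_cont_differentiable_compose_linear:
  "bounded_linear L \<Longrightarrow> times_cont_differentiable k f \<Longrightarrow> times_cont_differentiable k (\<lambda>x. f (L x))"
proof (induction k arbitrary: f)
  case 0
  then show ?case
    by (auto intro: continuous_on_compose2 linear_continuous_on)
next
  case (Suc k)
  show ?case
  proof (rule times_cont_differentiable_SucI)
    show "((\<lambda>x. f (L x)) has_derivative (\<lambda>h. frechet_derivative f (at (L x)) (L h))) (at x)" for x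
      by (rule has_derivative_compose[OF bounded_linear_imp_has_derivative[OF Suc.prems(1)]
          times_cont_differentiable_SucD(1)[OF Suc.prems(2)]])
    show "times_cont_differentiable k (\<lambda>x. frechet_derivative f (at (L x)) (L v))" for v
      by (intro Suc.IH[OF Suc.prems(1)] times_cont_differentiable_SucD(2)[OF Suc.prems(2)])
  qed
qed

lemma has_derivative_exp_complex:
  assumes "(f has_derivative f') (at x)"
  shows "((\<lambda>x. exp (f x :: complex)) has_derivative (\<lambda>h. exp (f x) * f' h)) (at x)"
  using has_derivative_compose[OF assms, of exp "\<lambda>h. exp (f x) * h"] DERIV_exp[of "f x"]
  by (simp add: has_field_derivative_def)

lemma times_cont_differentiable_exp:
  fixes f :: "'a::real_normed_vector \<Rightarrow> complex"
  shows "times_cont_differentiable k f \<Longrightarrow> times_cont_differentiable k (\<lambda>x. exp (f x))"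
proof (induction k)
  case (Suc k)
  show ?case
  proof (rule times_cont_differentiable_SucI)
    show "((\<lambda>x. exp (f x)) has_derivative (\<lambda>h. exp (f x) * frechet_derivative f (at x) h)) (at x)" for x
      by (rule has_derivative_exp_complex[OF times_cont_differentiable_SucD(1)[OF Suc.prems]])
    show "times_cont_differentiable k (\<lambda>x. exp (f x) * frechet_derivative f (at x) v)" for v
      by (intro times_cont_differentiable_mult Suc.IH times_cont_differentiable_lower[OF Suc.prems]
          times_cont_differentiable_SucD(2)[OF Suc.prems])
  qed
qed (auto intro: continuous_on_exp)

lemma times_cont_differentiable_prod:
  fixes f :: "'i \<Rightarrow> 'a::real_normed_vector \<Rightarrow> complex"
  shows "(\<And>i. i \<in> I \<Longrightarrow> times_cont_differentiable k (f i)) \<Longrightarrow> times_cont_differentiable k (\<lambda>x. \<Prod>i\<in>I. f i x)"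
  by (induction I rule: infinite_finite_induct) (auto intro: times_cont_differentiable_mult)

lemma smooth_const [intro]: "smooth (\<lambda>_. c)"
  by (auto simp: smooth_def)

lemma smooth_linear: "bounded_linear L \<Longrightarrow> smooth L"
  by (simp add: smooth_def times_cont_differentiable_linear)

lemma smooth_add [intro]: "smooth f \<Longrightarrow> smooth g \<Longrightarrow> smooth (\<lambda>x. f x + g x)"
  by (simp add: smooth_def times_cont_differentiable_add)

lemma smooth_mult [intro]:
  fixes f g :: "'a::real_normed_vector \<Rightarrow> 'b::real_normed_algebra"
  shows "smooth f \<Longrightarrow> smooth g \<Longrightarrow> smooth (\<lambda>x. f x * g x)"
  by (simp add: smooth_def times_cont_differentiable_mult)

lemma smooth_compose_linear: "bounded_linear L \<Longrightarrow> smooth f \<Longrightarrow> smooth (\<lambda>x. f (L x))"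
  by (simp add: smooth_def times_cont_differentiable_compose_linear)

lemma smooth_exp: "smooth f \<Longrightarrow> smooth (\<lambda>x. exp (f x :: complex))"
  by (simp add: smooth_def times_cont_differentiable_exp)

lemma smooth_sum [intro]: "(\<And>i. i \<in> I \<Longrightarrow> smooth (f i)) \<Longrightarrow> smooth (\<lambda>x. \<Sum>i\<in>I. f i x)"
  by (induction I rule: infinite_finite_induct) auto

lemma smooth_prod: "(\<And>i. i \<in> I \<Longrightarrow> smooth (f i)) \<Longrightarrow> smooth (\<lambda>x. \<Prod>i\<in>I. f i x :: complex)"
  by (simp add: smooth_def times_cont_differentiable_prod)

lemma smooth_power: "smooth f \<Longrightarrow> smooth (\<lambda>x. (f x :: complex) ^ n)"
  by (induction n) auto

lemma smooth_has_derivative: "smooth f \<Longrightarrow> (f has_derivative frechet_derivative f (at x)) (at x)"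
  unfolding smooth_def using times_cont_differentiable_SucD(1) by blast

lemma smooth_frechet_derivative: "smooth f \<Longrightarrow> smooth (\<lambda>x. frechet_derivative f (at x) v)"
  unfolding smooth_def using times_cont_differentiable_SucD(2) by blast

lemma smooth_continuous_on: "smooth f \<Longrightarrow> continuous_on S f"
  unfolding smooth_def using continuous_on_subset[of UNIV f S] times_cont_differentiable.simps(1) by blast

lemma smooth_measurable: "smooth f \<Longrightarrow> f \<in> borel_measurable borel" for f :: "'a::euclidean_space \<Rightarrow> complex"
  by (intro borel_measurable_continuous_onI smooth_continuous_on)

subsection \<open>Wirtinger derivatives\<close>

lemma wirtinger_bar_eqI:
  "(f has_derivative D) (at z) \<Longrightarrow> wirtinger_bar r f z = (D (axis r 1) + \<i> * D (axis r \<i>)) / 2"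
  unfolding wirtinger_bar_def using frechet_derivative_at by metis

lemma wirtinger_bar_add:
  assumes "(f has_derivative D) (at z)" "(g has_derivative E) (at z)"
  shows "wirtinger_bar r (\<lambda>z. f z + g z) z = wirtinger_bar r f z + wirtinger_bar r g z"
  by (simp add: wirtinger_bar_eqI[OF assms(1)] wirtinger_bar_eqI[OF assms(2)]
      wirtinger_bar_eqI[OF has_derivative_add[OF assms]] algebra_simps add_divide_distrib)

lemma wirtinger_bar_mult:
  assumes "(f has_derivative D) (at z)" "(g has_derivative E) (at z)"
  shows "wirtinger_bar r (\<lambda>z. f z * g z) z = f z * wirtinger_bar r g z + wirtinger_bar r f z * g z"
  by (simp add: wirtinger_bar_eqI[OF assms(1)] wirtinger_bar_eqI[OF assms(2)]
      wirtinger_bar_eqI[OF has_derivative_mult[OF assms]] algebra_simps add_divide_distrib)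

lemma wirtinger_bar_smooth: "smooth f \<Longrightarrow> smooth (wirtinger_bar r f)"
proof -
  assume "smooth f"
  then have "smooth (\<lambda>z. (frechet_derivative f (at z) (axis r 1) + \<i> * frechet_derivative f (at z) (axis r \<i>)) * (1 / 2))"
    by (intro smooth_mult smooth_add smooth_const smooth_frechet_derivative)
  then show ?thesis by (simp add: wirtinger_bar_def[abs_def])
qed

lemma wirtinger_bar_funpow_smooth: "smooth f \<Longrightarrow> smooth ((wirtinger_bar r ^^ n) f)"
  by (induction n) (auto intro: wirtinger_bar_smooth)

lemma wirtinger_bar_foldr_smooth: "smooth f \<Longrightarrow> smooth (foldr (\<lambda>r g. (wirtinger_bar r ^^ k r) g) rs f)"
  by (induction rs) (auto intro: wirtinger_bar_funpow_smooth)

lemma wirtinger_bar_scale: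
  assumes "smooth f"
  shows "wirtinger_bar r (\<lambda>z. f (c *\<^sub>R z)) = (\<lambda>z. complex_of_real c * wirtinger_bar r f (c *\<^sub>R z))"
proof
  fix z
  have "((\<lambda>z. f (c *\<^sub>R z)) has_derivative (\<lambda>h. frechet_derivative f (at (c *\<^sub>R z)) (c *\<^sub>R h))) (at z)"
    by (rule has_derivative_compose[OF _ smooth_has_derivative[OF assms]]) (auto intro!: derivative_eq_intros)
  moreover have "frechet_derivative f (at (c *\<^sub>R z)) (c *\<^sub>R h) = c *\<^sub>R frechet_derivative f (at (c *\<^sub>R z)) h" for h
    by (rule linear_cmul[OF has_derivative_linear[OF smooth_has_derivative[OF assms]]])
  ultimately show "wirtinger_bar r (\<lambda>z. f (c *\<^sub>R z)) z = complex_of_real c * wirtinger_bar r f (c *\<^sub>R z)"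
    by (simp add: wirtinger_bar_eqI scaleR_conv_of_real)
      (simp add: wirtinger_bar_def algebra_simps)
qed

lemma smooth_scale: "smooth f \<Longrightarrow> smooth (\<lambda>z. f (c *\<^sub>R z))"
  by (rule smooth_compose_linear[OF bounded_linear_scaleR_right])

lemma wirtinger_bar_cmult:
  assumes "smooth f"
  shows "wirtinger_bar r (\<lambda>z. c * f z) = (\<lambda>z. c * wirtinger_bar r f z)"
proof
  fix z
  show "wirtinger_bar r (\<lambda>z. c * f z) z = c * wirtinger_bar r f z"
    using wirtinger_bar_mult[OF has_derivative_const smooth_has_derivative[OF assms], of r c z]
      wirtinger_bar_eqI[OF has_derivative_const, of r c z] by simp
qed

lemma wirtinger_bar_funpow_scale:
  assumes "smooth f"
  shows "(wirtinger_bar r ^^ n) (\<lambda>z. e * f (c *\<^sub>R z)) = (\<lambda>z. complex_of_real c ^ n * e * (wirtinger_bar r ^^ n) f (c *\<^sub>R z))"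
proof (induction n)
  case (Suc n)
  have "(wirtinger_bar r ^^ Suc n) (\<lambda>z. e * f (c *\<^sub>R z)) =
      wirtinger_bar r (\<lambda>z. complex_of_real c ^ n * e * (wirtinger_bar r ^^ n) f (c *\<^sub>R z))"
    by (simp add: Suc)
  also have "\<dots> = (\<lambda>z. complex_of_real c ^ n * e * wirtinger_bar r (\<lambda>z. (wirtinger_bar r ^^ n) f (c *\<^sub>R z)) z)"
    by (intro wirtinger_bar_cmult smooth_scale wirtinger_bar_funpow_smooth assms)
  finally show ?case
    by (simp add: wirtinger_bar_scale wirtinger_bar_funpow_smooth assms mult_ac)
qed simp

lemma D_bar_scale:
  fixes f :: "'n::{finite,linorder} cvec \<Rightarrow> complex"
  assumes "smooth f"
  shows "\<exists>e. D_bar k (\<lambda>z. f (c *\<^sub>R z)) = (\<lambda>z. e * D_bar k f (c *\<^sub>R z))"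
proof -
  have "\<exists>e. foldr (\<lambda>r g. (wirtinger_bar r ^^ k r) g) rs (\<lambda>z. f (c *\<^sub>R z)) =
      (\<lambda>z. e * foldr (\<lambda>r g. (wirtinger_bar r ^^ k r) g) rs f (c *\<^sub>R z))" for rs
  proof (induction rs)
    case Nil
    show ?case by (intro exI[of _ 1]) simp
  next
    case (Cons r rs)
    then obtain e where e: "foldr (\<lambda>r g. (wirtinger_bar r ^^ k r) g) rs (\<lambda>z. f (c *\<^sub>R z)) =
      (\<lambda>z. e * foldr (\<lambda>r g. (wirtinger_bar r ^^ k r) g) rs f (c *\<^sub>R z))" by blast
    show ?case
      unfolding foldr.simps comp_apply e
      by (rule exI) (rule wirtinger_bar_funpow_scale[OF wirtinger_bar_foldr_smooth[OF assms]])
  qed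
  then show ?thesis by (simp add: D_bar_def)
qed

text \<open>Dilations only multiply the Wirtinger derivatives by constants. This reduces the weight
  to the case \<alpha> = 1 and carries functions built for that case back.\<close>

lemma polyanalytic_scale:
  fixes f :: "'n::{finite,linorder} cvec \<Rightarrow> complex"
  shows "polyanalytic m f \<Longrightarrow> polyanalytic m (\<lambda>z. f (c *\<^sub>R z))"
  unfolding polyanalytic_def
proof (intro conjI allI impI; elim conjE)
  fix k :: "'n \<Rightarrow> nat" and z :: "'n cvec"
  assume f: "smooth f" "\<forall>k. (\<Sum>r\<in>UNIV. k r) = m \<longrightarrow> (\<forall>z. D_bar k f z = 0)" "(\<Sum>r\<in>UNIV. k r) = m"
  obtain e where "D_bar k (\<lambda>z. f (c *\<^sub>R z)) = (\<lambda>z. e * D_bar k f (c *\<^sub>R z))"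
    using D_bar_scale[OF f(1)] by blast
  then show "D_bar k (\<lambda>z. f (c *\<^sub>R z)) z = 0" using f(2,3) by simp
qed (rule smooth_scale)

subsection \<open>Integration by parts\<close>

lemma integrable_continuous_compact_support:
  fixes f :: "'a::euclidean_space \<Rightarrow> complex"
  assumes "continuous_on UNIV f" and 0: "\<And>x. norm x > B \<Longrightarrow> f x = 0"
  shows "integrable lborel f"
proof -
  have "integrable lborel (\<lambda>x. indicator (cball 0 B) x *\<^sub>R f x)"
    by (rule borel_integrable_compact) (use assms in \<open>auto intro: continuous_on_subset\<close>)
  moreover have "(\<lambda>x. indicator (cball 0 B) x *\<^sub>R f x) = f"
    using 0 by (auto simp: fun_eq_iff indicator_def not_le)
  ultimately show ?thesis by simp
qed

lemma frechet_derivative_compact_support: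
  fixes f :: "'a::euclidean_space \<Rightarrow> complex"
  assumes 0: "\<And>x. norm x > B \<Longrightarrow> f x = 0" and x: "norm x > B"
  shows "frechet_derivative f (at x) v = 0"
proof -
  have "(f has_derivative (\<lambda>_. 0)) (at x)"
  proof (rule has_derivative_transform_within_open[of "\<lambda>_. 0" _ _ _ "- cball 0 B"])
    show "((\<lambda>_. 0) has_derivative (\<lambda>_. 0)) (at x)" by simp
    show "open (- cball (0 :: 'a) B)" by (simp add: open_Compl)
  qed (use x 0 in auto)
  then show ?thesis
    using frechet_derivative_at[of f "\<lambda>_. 0" x] by (metis)
qed

text \<open>Translation invariance makes every difference quotient integrate to \<open>0\<close>;
  compact support and a bound on the derivative allow dominated convergence. All directions are
  treated alike, without splitting off a coordinate.\<close>

lemma integral_frechet_derivative_eq_0: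
  fixes H :: "'a::euclidean_space \<Rightarrow> complex"
  assumes H: "times_cont_differentiable 1 H" and 0: "\<And>x. norm x > B \<Longrightarrow> H x = 0" and B: "B \<ge> 0"
  shows "integral\<^sup>L lborel (\<lambda>x. frechet_derivative H (at x) v) = 0"
proof -
  let ?D = "\<lambda>x. frechet_derivative H (at x) v"
  have Hd: "(H has_derivative frechet_derivative H (at x)) (at x)" for x
    using times_cont_differentiable_SucD(1)[of 0 H] H by simp
  have contD: "continuous_on UNIV ?D"
    using times_cont_differentiable_SucD(2)[of 0 H v] H by simp
  have contH: "continuous_on UNIV H"
    using times_cont_differentiable_lower[of 0 H] H by simp
  have [measurable]: "H \<in> borel_measurable borel" "?D \<in> borel_measurable borel"
    using contD contH by (auto intro: borel_measurable_continuous_onI)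
  have intH: "integrable lborel H"
    by (rule integrable_continuous_compact_support[OF contH 0])
  have "bounded (?D ` cball 0 (B + 1))"
    by (intro compact_imp_bounded compact_continuous_image continuous_on_subset[OF contD]) auto
  then obtain M where M: "\<And>x. x \<in> cball 0 (B + 1) \<Longrightarrow> cmod (?D x) \<le> M"
    unfolding bounded_iff by blast
  have M0: "M \<ge> 0" using order_trans[OF norm_ge_zero M[of 0]] B by simp
  have DM: "cmod (?D x) \<le> M" for x
  proof (cases "norm x > B")
    case True
    then show ?thesis using frechet_derivative_compact_support[of B H x v] 0 M0 by simp
  qed (use M in auto)
  have line: "((\<lambda>t. H (x + t *\<^sub>R v)) has_vector_derivative ?D (x + t *\<^sub>R v)) (at t)" for x t
  proof -
    have "((\<lambda>t. x + t *\<^sub>R v) has_derivative (\<lambda>h. h *\<^sub>R v)) (at t)"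
      by (auto intro!: derivative_eq_intros)
    from has_derivative_compose[OF this Hd]
    have "((\<lambda>t. H (x + t *\<^sub>R v)) has_derivative (\<lambda>h. frechet_derivative H (at (x + t *\<^sub>R v)) (h *\<^sub>R v))) (at t)" .
    moreover have "frechet_derivative H (at y) (h *\<^sub>R v) = h *\<^sub>R ?D y" for y h
      by (rule linear_cmul[OF has_derivative_linear[OF Hd]])
    ultimately show ?thesis by (simp add: has_vector_derivative_def)
  qed
  have lip: "cmod (H (x + t *\<^sub>R v) - H x) \<le> M * \<bar>t\<bar>" for x t
  proof -
    have "norm (H (x + t *\<^sub>R v) - H (x + 0 *\<^sub>R v)) \<le> M * norm (t - 0)"
    proof (rule differentiable_bound[of UNIV "\<lambda>t. H (x + t *\<^sub>R v)" "\<lambda>t h. h *\<^sub>R ?D (x + t *\<^sub>R v)"])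
      show "((\<lambda>t. H (x + t *\<^sub>R v)) has_derivative (\<lambda>h. h *\<^sub>R ?D (x + t *\<^sub>R v))) (at t within UNIV)" for t
        using line[of x t] by (simp add: has_vector_derivative_def)
      show "onorm (\<lambda>h. h *\<^sub>R ?D (x + t *\<^sub>R v)) \<le> M" for t
      proof (rule onorm_bound[OF M0])
        show "norm (h *\<^sub>R ?D (x + t *\<^sub>R v)) \<le> M * norm h" for h
          using mult_right_mono[OF DM[of "x + t *\<^sub>R v"] norm_ge_zero[of h]] by (simp add: mult.commute)
      qed
    qed auto
    then show ?thesis by simp
  qed
  let ?e = "\<lambda>n. 1 / real (Suc n)"
  \<comment> \<open>The increments are at most \<open>1\<close>, so the quotients are supported
    within radius \<open>B + norm v\<close>, and the Lipschitz constant \<open>M\<close> bounds them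
    there.\<close>
  have "(\<lambda>n. integral\<^sup>L lborel (\<lambda>x. (H (x + ?e n *\<^sub>R v) - H x) /\<^sub>R ?e n)) \<longlonglongrightarrow> integral\<^sup>L lborel ?D"
  proof (rule integral_dominated_convergence[where w="\<lambda>x. M * indicator (cball 0 (B + norm v)) x"])
    show "integrable lborel (\<lambda>x. M * indicator (cball (0 :: 'a) (B + norm v)) x)"
      using emeasure_lborel_cball_finite[of "0 :: 'a" "B + norm v"] by auto
    show "AE x in lborel. (\<lambda>n. (H (x + ?e n *\<^sub>R v) - H x) /\<^sub>R ?e n) \<longlonglongrightarrow> ?D x"
    proof (rule AE_I2)
      fix x
      have "((\<lambda>t. (H (x + t *\<^sub>R v) - H x) /\<^sub>R t) \<longlongrightarrow> ?D x) (at 0)"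
      proof -
        have "((\<lambda>y. norm (H (x + y *\<^sub>R v) - H x - y *\<^sub>R ?D x) / norm y) \<longlongrightarrow> 0) (at 0)"
          using line[of x 0] unfolding has_vector_derivative_def has_derivative_iff_norm by simp
        moreover have "\<forall>\<^sub>F y in at 0. norm (H (x + y *\<^sub>R v) - H x - y *\<^sub>R ?D x) / norm y =
            norm ((H (x + y *\<^sub>R v) - H x) /\<^sub>R y - ?D x)"
          unfolding eventually_at_filter
        proof (rule always_eventually, intro allI impI)
          fix y :: real assume "y \<noteq> 0"
          then have "(H (x + y *\<^sub>R v) - H x) /\<^sub>R y - ?D x = (H (x + y *\<^sub>R v) - H x - y *\<^sub>R ?D x) /\<^sub>R y"
            by (simp add: scaleR_diff_right)
          then show "norm (H (x + y *\<^sub>R v) - H x - y *\<^sub>R ?D x) / norm y =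
            norm ((H (x + y *\<^sub>R v) - H x) /\<^sub>R y - ?D x)"
            by (simp only: norm_scaleR) (simp add: divide_inverse mult.commute)
        qed
        ultimately have "((\<lambda>y. norm ((H (x + y *\<^sub>R v) - H x) /\<^sub>R y - ?D x)) \<longlongrightarrow> 0) (at 0)"
          by (rule Lim_transform_eventually)
        then show ?thesis by (simp only: tendsto_norm_zero_iff LIM_zero_iff)
      qed
      moreover have "filterlim ?e (at 0) sequentially"
        by real_asymp
      ultimately show "(\<lambda>n. (H (x + ?e n *\<^sub>R v) - H x) /\<^sub>R ?e n) \<longlonglongrightarrow> ?D x"
        by (rule filterlim_compose)
    qed
    show "AE x in lborel. norm ((H (x + ?e n *\<^sub>R v) - H x) /\<^sub>R ?e n) \<le> M * indicator (cball 0 (B + norm v)) x" for n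
    proof (rule AE_I2)
      fix x
      have e: "0 < ?e n" "?e n \<le> 1" by auto
      show "norm ((H (x + ?e n *\<^sub>R v) - H x) /\<^sub>R ?e n) \<le> M * indicator (cball 0 (B + norm v)) x"
      proof (cases "x \<in> cball 0 (B + norm v)")
        case True
        have "inverse (?e n) * cmod (H (x + ?e n *\<^sub>R v) - H x) \<le> inverse (?e n) * (M * \<bar>?e n\<bar>)"
          by (intro mult_left_mono lip) auto
        also have "\<dots> = M" by simp
        finally show ?thesis using True by simp
      next
        case False
        then have x: "norm x > B + norm v" by simp
        have "norm (?e n *\<^sub>R v) \<le> norm v"
          using e by (simp add: divide_le_eq mult_le_cancel_left1)
        then have "norm (x + ?e n *\<^sub>R v) > B"
          using norm_diff_ineq[of x "?e n *\<^sub>R v"] x by linarith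
        moreover have "norm x > B" using x norm_ge_zero[of v] by linarith
        ultimately show ?thesis using False 0 by simp
      qed
    qed
  qed measurable
  moreover have "integral\<^sup>L lborel (\<lambda>x. (H (x + ?e n *\<^sub>R v) - H x) /\<^sub>R ?e n) = 0" for n
  proof -
    have "integrable mu_tilde H" using intH by (simp add: integrable_mu_tilde_iff)
    then have "integrable lborel (\<lambda>x. H (x + ?e n *\<^sub>R v))"
      using integrable_mu_translate[of H "?e n *\<^sub>R v"] by (simp add: integrable_mu_tilde_iff)
    moreover have "integral\<^sup>L lborel (\<lambda>x. H (x + ?e n *\<^sub>R v)) = integral\<^sup>L lborel H"
      using integral_mu_translate[of H "?e n *\<^sub>R v"] by (simp add: integral_mu_tilde)
    ultimately show ?thesis
      using intH by simp
  qed
  ultimately show ?thesis by (simp add: LIMSEQ_const_iff)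
qed

lemma wirtinger_bar_by_parts:
  fixes F W :: "'n::finite cvec \<Rightarrow> complex"
  assumes F: "smooth F" and W: "times_cont_differentiable 1 W"
    and 0: "\<And>x. norm x > B \<Longrightarrow> W x = 0" and B: "B \<ge> 0"
  shows "integral\<^sup>L lborel (\<lambda>z. wirtinger_bar r F z * W z) = - integral\<^sup>L lborel (\<lambda>z. F z * wirtinger_bar r W z)"
proof -
  let ?H = "\<lambda>z. F z * W z"
  have F1: "times_cont_differentiable 1 F" using F by (simp add: smooth_def)
  have H: "times_cont_differentiable 1 ?H" by (rule times_cont_differentiable_mult[OF F1 W])
  have H0: "?H z = 0" if "norm z > B" for z using 0[OF that] by simp
  have contD: "continuous_on UNIV (\<lambda>x. frechet_derivative G (at x) v)" if "times_cont_differentiable 1 G" for G :: "'n cvec \<Rightarrow> complex" and v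
    using times_cont_differentiable_SucD(2)[of 0 G v] that by simp
  have cont: "continuous_on UNIV G" if "times_cont_differentiable 1 G" for G :: "'n cvec \<Rightarrow> complex"
    using times_cont_differentiable_lower[of 0 G] that by simp
  have int: "integrable lborel (\<lambda>x. frechet_derivative ?H (at x) v)" for v
    by (rule integrable_continuous_compact_support[OF contD[OF H]])
      (rule frechet_derivative_compact_support[OF H0])
  have "integral\<^sup>L lborel (wirtinger_bar r ?H) = 0"
    unfolding wirtinger_bar_def
    using int integral_frechet_derivative_eq_0[OF H H0 B] by simp
  moreover have "wirtinger_bar r ?H = (\<lambda>z. F z * wirtinger_bar r W z + wirtinger_bar r F z * W z)"
  proof
    fix z
    show "wirtinger_bar r ?H z = F z * wirtinger_bar r W z + wirtinger_bar r F z * W z"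
      using times_cont_differentiable_SucD(1)[of 0] F1 W by (intro wirtinger_bar_mult) auto
  qed
  moreover have "integrable lborel (\<lambda>z. F z * wirtinger_bar r W z)"
  proof (rule integrable_continuous_compact_support)
    show "continuous_on UNIV (\<lambda>z. F z * wirtinger_bar r W z)"
      unfolding wirtinger_bar_def by (intro continuous_intros cont[OF F1] contD[OF W]) auto
    show "F z * wirtinger_bar r W z = 0" if "norm z > B" for z
      by (simp add: wirtinger_bar_def frechet_derivative_compact_support[OF 0 that])
  qed
  moreover have "integrable lborel (\<lambda>z. wirtinger_bar r F z * W z)"
  proof (rule integrable_continuous_compact_support)
    show "continuous_on UNIV (\<lambda>z. wirtinger_bar r F z * W z)"
      by (intro continuous_intros cont[OF W] smooth_continuous_on wirtinger_bar_smooth F)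
    show "wirtinger_bar r F z * W z = 0" if "norm z > B" for z
      using 0[OF that] by simp
  qed
  ultimately show ?thesis by (simp add: add_eq_0_iff2 add.commute)
qed

subsection \<open>Cut-off functions of one complex variable\<close>

text \<open>The Wirtinger derivative \<open>b\<close> is kept explicit so that products can be
  differentiated by rule. Continuous differentiability is the amount of smoothness that one
  integration by parts consumes.\<close>

definition c1_dbar :: "(complex \<Rightarrow> complex) \<Rightarrow> (complex \<Rightarrow> complex) \<Rightarrow> bool" where
  "c1_dbar u b \<longleftrightarrow> times_cont_differentiable 1 u \<and>
     (\<forall>\<zeta>. (frechet_derivative u (at \<zeta>) 1 + \<i> * frechet_derivative u (at \<zeta>) \<i>) / 2 = b \<zeta>)"

lemma c1_dbarI:
  assumes "\<And>\<zeta>. (u has_derivative D \<zeta>) (at \<zeta>)" "\<And>v. continuous_on UNIV (\<lambda>\<zeta>. D \<zeta> v)"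
    "\<And>\<zeta>. (D \<zeta> 1 + \<i> * D \<zeta> \<i>) / 2 = b \<zeta>"
  shows "c1_dbar u b"
proof -
  have "times_cont_differentiable (Suc 0) u"
    by (rule times_cont_differentiable_SucI[of u D]) (use assms in auto)
  moreover have "frechet_derivative u (at \<zeta>) = D \<zeta>" for \<zeta>
    using frechet_derivative_at[OF assms(1)] by simp
  ultimately show ?thesis using assms(3) by (simp add: c1_dbar_def)
qed

lemma c1_dbar_has_derivative: "c1_dbar u b \<Longrightarrow> (u has_derivative frechet_derivative u (at \<zeta>)) (at \<zeta>)"
  unfolding c1_dbar_def using times_cont_differentiable_SucD(1)[of 0 u] by simp

lemma c1_dbar_continuous:
  assumes "c1_dbar u b"
  shows "continuous_on UNIV u" "continuous_on UNIV (\<lambda>\<zeta>. frechet_derivative u (at \<zeta>) v)"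
  using assms times_cont_differentiable_lower[of 0 u] times_cont_differentiable_SucD(2)[of 0 u v]
  by (auto simp: c1_dbar_def)

lemma c1_dbar_cong: "c1_dbar u b \<Longrightarrow> (\<And>\<zeta>. b \<zeta> = c \<zeta>) \<Longrightarrow> c1_dbar u c"
  by (simp add: c1_dbar_def)

lemma c1_dbar_const: "c1_dbar (\<lambda>_. c) (\<lambda>_. 0)"
  by (rule c1_dbarI[where D="\<lambda>_ _. 0"]) auto

lemma c1_dbar_ident: "c1_dbar (\<lambda>\<zeta>. \<zeta>) (\<lambda>_. 0)"
  by (rule c1_dbarI[where D="\<lambda>_ h. h"]) auto

lemma c1_dbar_diff:
  assumes "c1_dbar u b" "c1_dbar v c"
  shows "c1_dbar (\<lambda>\<zeta>. u \<zeta> - v \<zeta>) (\<lambda>\<zeta>. b \<zeta> - c \<zeta>)"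
proof (rule c1_dbarI)
  show "((\<lambda>\<zeta>. u \<zeta> - v \<zeta>) has_derivative (\<lambda>h. frechet_derivative u (at \<zeta>) h - frechet_derivative v (at \<zeta>) h)) (at \<zeta>)" for \<zeta>
    by (intro has_derivative_diff c1_dbar_has_derivative[OF assms(1)] c1_dbar_has_derivative[OF assms(2)])
  show "continuous_on UNIV (\<lambda>\<zeta>. frechet_derivative u (at \<zeta>) h - frechet_derivative v (at \<zeta>) h)" for h
    by (intro continuous_on_diff c1_dbar_continuous[OF assms(1)] c1_dbar_continuous[OF assms(2)])
  show "(frechet_derivative u (at \<zeta>) 1 - frechet_derivative v (at \<zeta>) 1 + \<i> * (frechet_derivative u (at \<zeta>) \<i> - frechet_derivative v (at \<zeta>) \<i>)) / 2 =
      b \<zeta> - c \<zeta>" for \<zeta>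
  proof -
    have "(frechet_derivative u (at \<zeta>) 1 + \<i> * frechet_derivative u (at \<zeta>) \<i>) / 2 = b \<zeta>"
      "(frechet_derivative v (at \<zeta>) 1 + \<i> * frechet_derivative v (at \<zeta>) \<i>) / 2 = c \<zeta>"
      using assms by (auto simp: c1_dbar_def)
    then show ?thesis by (auto simp: algebra_simps diff_divide_distrib add_divide_distrib)
  qed
qed

lemma c1_dbar_mult:
  assumes "c1_dbar u b" "c1_dbar v c"
  shows "c1_dbar (\<lambda>\<zeta>. u \<zeta> * v \<zeta>) (\<lambda>\<zeta>. u \<zeta> * c \<zeta> + b \<zeta> * v \<zeta>)"
proof (rule c1_dbarI)
  show "((\<lambda>\<zeta>. u \<zeta> * v \<zeta>) has_derivative (\<lambda>h. u \<zeta> * frechet_derivative v (at \<zeta>) h + frechet_derivative u (at \<zeta>) h * v \<zeta>)) (at \<zeta>)" for \<zeta>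
    by (intro has_derivative_mult c1_dbar_has_derivative[OF assms(1)] c1_dbar_has_derivative[OF assms(2)])
  show "continuous_on UNIV (\<lambda>\<zeta>. u \<zeta> * frechet_derivative v (at \<zeta>) h + frechet_derivative u (at \<zeta>) h * v \<zeta>)" for h
    by (intro continuous_on_add continuous_on_mult c1_dbar_continuous[OF assms(1)] c1_dbar_continuous[OF assms(2)])
  show "(u \<zeta> * frechet_derivative v (at \<zeta>) 1 + frechet_derivative u (at \<zeta>) 1 * v \<zeta> +
      \<i> * (u \<zeta> * frechet_derivative v (at \<zeta>) \<i> + frechet_derivative u (at \<zeta>) \<i> * v \<zeta>)) / 2 = u \<zeta> * c \<zeta> + b \<zeta> * v \<zeta>" for \<zeta>
  proof -
    have "(frechet_derivative u (at \<zeta>) 1 + \<i> * frechet_derivative u (at \<zeta>) \<i>) / 2 = b \<zeta>"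
      "(frechet_derivative v (at \<zeta>) 1 + \<i> * frechet_derivative v (at \<zeta>) \<i>) / 2 = c \<zeta>"
      using assms by (auto simp: c1_dbar_def)
    then have eq: "u \<zeta> * c \<zeta> + b \<zeta> * v \<zeta> = u \<zeta> * ((frechet_derivative v (at \<zeta>) 1 + \<i> * frechet_derivative v (at \<zeta>) \<i>) / 2) +
        (frechet_derivative u (at \<zeta>) 1 + \<i> * frechet_derivative u (at \<zeta>) \<i>) / 2 * v \<zeta>"
      by simp
    show ?thesis unfolding eq by (simp add: field_simps)
  qed
qed

lemma c1_dbar_diff_power: "c1_dbar (\<lambda>\<zeta>. (\<zeta> - w) ^ a) (\<lambda>_. 0)"
proof (induction a)
  case 0
  show ?case using c1_dbar_const[of 1] by simp
next
  case (Suc a)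
  have "c1_dbar (\<lambda>\<zeta>. \<zeta> - w) (\<lambda>_. 0)"
    using c1_dbar_diff[OF c1_dbar_ident c1_dbar_const, of w] by simp
  from c1_dbar_mult[OF this Suc] show ?case by simp
qed

text \<open>The Gaussian weight times the conjugate of the reproducing kernel
  \<open>exp (\<zeta> * cnj w)\<close>. The Wirtinger derivative merely multiplies it by the
  holomorphic factor \<open>w - \<zeta>\<close>; that is how powers of \<open>\<zeta> - w\<close>
  are produced.\<close>

definition fock_weight :: "complex \<Rightarrow> complex \<Rightarrow> complex" where
  "fock_weight w \<zeta> = exp (- \<zeta> * cnj \<zeta> + w * cnj \<zeta>)"

lemma c1_dbar_fock_weight: "c1_dbar (fock_weight w) (\<lambda>\<zeta>. (w - \<zeta>) * fock_weight w \<zeta>)"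
proof (rule c1_dbarI)
  show "(fock_weight w has_derivative (\<lambda>h. fock_weight w \<zeta> * (- (\<zeta> * cnj h + h * cnj \<zeta>) + w * cnj h))) (at \<zeta>)" for \<zeta>
    unfolding fock_weight_def
    by (rule has_derivative_exp_complex) (auto intro!: derivative_eq_intros simp: algebra_simps)
  show "continuous_on UNIV (\<lambda>\<zeta>. fock_weight w \<zeta> * (- (\<zeta> * cnj h + h * cnj \<zeta>) + w * cnj h))" for h
    unfolding fock_weight_def by (intro continuous_intros)
  show "(fock_weight w \<zeta> * (- (\<zeta> * cnj 1 + 1 * cnj \<zeta>) + w * cnj 1) +
      \<i> * (fock_weight w \<zeta> * (- (\<zeta> * cnj \<i> + \<i> * cnj \<zeta>) + w * cnj \<i>))) / 2 = (w - \<zeta>) * fock_weight w \<zeta>" for \<zeta>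
    by (simp add: field_simps)
qed

text \<open>Quadratic inside the disc, so that its powers have explicit derivatives; from the second
  power on they are continuously differentiable across the circle. Each derivative lowers the
  exponent by one and brings a factor \<open>1 / R^2\<close>.\<close>

definition cutoff :: "real \<Rightarrow> complex \<Rightarrow> real" where
  "cutoff R \<zeta> = max 0 (1 - (cmod \<zeta>)\<^sup>2 / R\<^sup>2)"

lemma cutoff_bounds: "0 \<le> cutoff R \<zeta>" "cutoff R \<zeta> \<le> 1"
  by (auto simp: cutoff_def)

lemma cutoff_eq_0: "R > 0 \<Longrightarrow> cmod \<zeta> \<ge> R \<Longrightarrow> cutoff R \<zeta> = 0"
  by (auto simp: cutoff_def max_def field_simps power_mono)

lemma max_power_has_derivative:
  assumes "q \<ge> 2"
  shows "((\<lambda>t :: real. max 0 t ^ q) has_real_derivative real q * max 0 t ^ (q - 1)) (at t)"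
proof -
  consider "t > 0" | "t < 0" | "t = 0" by linarith
  then show ?thesis
  proof cases
    case 1
    have "((\<lambda>t. t ^ q) has_real_derivative real q * max 0 t ^ (q - 1)) (at t)"
      using 1 by (auto intro!: derivative_eq_intros)
    then show ?thesis
      by (rule has_field_derivative_transform_within_open[where S="{0<..}"]) (use 1 in auto)
  next
    case 2
    have "((\<lambda>t. 0) has_real_derivative real q * max 0 t ^ (q - 1)) (at t)"
      using 2 assms by (simp add: max_def zero_power)
    then show ?thesis
      by (rule has_field_derivative_transform_within_open[where S="{..<0}"]) (use 2 assms in auto)
  next
    case 3
    have "((\<lambda>h :: real. max 0 h ^ (q - 1)) \<longlongrightarrow> max 0 0 ^ (q - 1)) (at 0)"
      by (intro tendsto_intros)
    then have "((\<lambda>h :: real. (max 0 h ^ q - max 0 0 ^ q) / h) \<longlongrightarrow> max 0 0 ^ (q - 1)) (at 0)"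
    proof (rule Lim_transform_eventually)
      show "\<forall>\<^sub>F h :: real in at 0. max 0 h ^ (q - 1) = (max 0 h ^ q - max 0 0 ^ q) / h"
        unfolding eventually_at_filter
      proof (rule always_eventually, intro allI impI)
        fix h :: real assume "h \<noteq> 0"
        then show "max 0 h ^ (q - 1) = (max 0 h ^ q - max 0 0 ^ q) / h"
          using assms by (cases q) (auto simp: max_def)
      qed
    qed
    then show ?thesis
      using 3 assms by (simp add: DERIV_def zero_power)
  qed
qed

lemma c1_dbar_cutoff:
  assumes q: "q \<ge> 2"
  shows "c1_dbar (\<lambda>\<zeta>. complex_of_real (cutoff R \<zeta> ^ q))
    (\<lambda>\<zeta>. - complex_of_real (real q / R\<^sup>2) * \<zeta> * complex_of_real (cutoff R \<zeta> ^ (q - 1)))"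
proof (rule c1_dbarI)
  have cont: "continuous_on UNIV (cutoff R)"
    unfolding cutoff_def[abs_def] divide_inverse by (intro continuous_intros)
  show "((\<lambda>\<zeta>. complex_of_real (cutoff R \<zeta> ^ q)) has_derivative
      (\<lambda>h. complex_of_real (real q * cutoff R \<zeta> ^ (q - 1) * (- 2 * (\<zeta> \<bullet> h) / R\<^sup>2)))) (at \<zeta>)" for \<zeta>
  proof -
    have "((\<lambda>\<zeta> :: complex. 1 - (\<zeta> \<bullet> \<zeta>) * inverse (R\<^sup>2)) has_derivative (\<lambda>h. - 2 * (\<zeta> \<bullet> h) / R\<^sup>2)) (at \<zeta>)"
      by (auto intro!: derivative_eq_intros simp: inner_commute divide_inverse algebra_simps)
    then have 1: "((\<lambda>\<zeta> :: complex. 1 - (cmod \<zeta>)\<^sup>2 / R\<^sup>2) has_derivative (\<lambda>h. - 2 * (\<zeta> \<bullet> h) / R\<^sup>2)) (at \<zeta>)"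
      by (simp add: power2_norm_eq_inner divide_inverse)
    have "((\<lambda>\<zeta>. cutoff R \<zeta> ^ q) has_derivative (\<lambda>h. real q * cutoff R \<zeta> ^ (q - 1) * (- 2 * (\<zeta> \<bullet> h) / R\<^sup>2))) (at \<zeta>)"
      using has_derivative_compose[OF 1, of "\<lambda>t. max 0 t ^ q"] max_power_has_derivative[OF q]
      unfolding has_field_derivative_def cutoff_def by blast
    then show ?thesis by (rule has_derivative_of_real)
  qed
  show "continuous_on UNIV (\<lambda>\<zeta>. complex_of_real (real q * cutoff R \<zeta> ^ (q - 1) * (- 2 * (\<zeta> \<bullet> h) / R\<^sup>2)))" for h
    unfolding divide_inverse by (intro continuous_intros cont)
  show "(complex_of_real (real q * cutoff R \<zeta> ^ (q - 1) * (- 2 * (\<zeta> \<bullet> 1) / R\<^sup>2)) +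
      \<i> * complex_of_real (real q * cutoff R \<zeta> ^ (q - 1) * (- 2 * (\<zeta> \<bullet> \<i>) / R\<^sup>2))) / 2 =
      - complex_of_real (real q / R\<^sup>2) * \<zeta> * complex_of_real (cutoff R \<zeta> ^ (q - 1))" for \<zeta>
    by (cases \<zeta>) (simp add: complex_eq_iff inner_complex_def mult_ac)
qed

text \<open>For large \<open>p\<close> this is the \<open>j\<close>-th Wirtinger derivative of the
  function at index \<open>0\<close>. The derivative falls either on the weight, giving
  \<open>w - \<zeta>\<close>, or on the cut-off, giving \<open>- p \<zeta> / R^2\<close> and the
  exponent \<open>p - 1\<close>. Both factors are holomorphic and pass through all further
  derivatives.\<close>

primrec cut_test :: "real \<Rightarrow> complex \<Rightarrow> nat \<Rightarrow> nat \<Rightarrow> nat \<Rightarrow> complex \<Rightarrow> complex" where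
  "cut_test R w a 0 = (\<lambda>p \<zeta>. complex_of_real (cutoff R \<zeta> ^ p) * ((\<zeta> - w) ^ a * fock_weight w \<zeta>))"
| "cut_test R w a (Suc j) = (\<lambda>p \<zeta>. (w - \<zeta>) * cut_test R w a j p \<zeta> -
     complex_of_real (real p / R\<^sup>2) * \<zeta> * cut_test R w a j (p - 1) \<zeta>)"

text \<open>At most \<open>j\<close> derivatives have fallen on the cut-off, so its exponent is
  still at least \<open>p - j\<close>, and an exponent of at least \<open>2\<close> allows one
  more.\<close>

lemma c1_dbar_cut_test: "p \<ge> j + 2 \<Longrightarrow> c1_dbar (cut_test R w a j p) (cut_test R w a (Suc j) p)"
proof (induction j arbitrary: p)
  case 0
  have "c1_dbar (\<lambda>\<zeta>. complex_of_real (cutoff R \<zeta> ^ p) * ((\<zeta> - w) ^ a * fock_weight w \<zeta>))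
    (\<lambda>\<zeta>. complex_of_real (cutoff R \<zeta> ^ p) * ((\<zeta> - w) ^ a * ((w - \<zeta>) * fock_weight w \<zeta>) + 0 * fock_weight w \<zeta>) +
      (- complex_of_real (real p / R\<^sup>2) * \<zeta> * complex_of_real (cutoff R \<zeta> ^ (p - 1))) * ((\<zeta> - w) ^ a * fock_weight w \<zeta>))"
    using 0 by (intro c1_dbar_mult c1_dbar_cutoff c1_dbar_diff_power c1_dbar_fock_weight) simp
  then show ?case unfolding cut_test.simps by (rule c1_dbar_cong) (simp add: algebra_simps)
next
  case (Suc j)
  have 1: "c1_dbar (\<lambda>\<zeta>. w - \<zeta>) (\<lambda>_. 0)"
    using c1_dbar_diff[OF c1_dbar_const c1_dbar_ident, of w] by simp
  have 2: "c1_dbar (\<lambda>\<zeta>. complex_of_real (real p / R\<^sup>2) * \<zeta>) (\<lambda>_. 0)"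
  proof -
    have "c1_dbar (\<lambda>\<zeta>. c * \<zeta>) (\<lambda>_. 0)" for c
      using c1_dbar_mult[OF c1_dbar_const[of c] c1_dbar_ident] by simp
    then show ?thesis .
  qed
  have "c1_dbar (\<lambda>\<zeta>. (w - \<zeta>) * cut_test R w a j p \<zeta> - complex_of_real (real p / R\<^sup>2) * \<zeta> * cut_test R w a j (p - 1) \<zeta>)
     (\<lambda>\<zeta>. ((w - \<zeta>) * cut_test R w a (Suc j) p \<zeta> + 0 * cut_test R w a j p \<zeta>) -
       (complex_of_real (real p / R\<^sup>2) * \<zeta> * cut_test R w a (Suc j) (p - 1) \<zeta> + 0 * cut_test R w a j (p - 1) \<zeta>))"
    using Suc.prems by (intro c1_dbar_diff c1_dbar_mult 1 2 Suc.IH) auto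
  then show ?case
    unfolding cut_test.simps(2)[of R w a j] by (rule c1_dbar_cong) simp
qed

lemma cut_test_eq_0: "R > 0 \<Longrightarrow> cmod \<zeta> \<ge> R \<Longrightarrow> p \<ge> j + 1 \<Longrightarrow> cut_test R w a j p \<zeta> = 0"
  by (induction j arbitrary: p) (auto simp: cutoff_eq_0)

text \<open>The bound is uniform in \<open>R\<close>, as \<open>1 / R^2 \<le> 1\<close>; this is
  what lets the cut-off be removed by dominated convergence.\<close>

lemma cut_test_bound:
  assumes R: "R \<ge> 1"
  shows "cmod (cut_test R w a j p \<zeta>) \<le> ((1 + real p) * (1 + cmod w + cmod \<zeta>)) ^ j * cmod ((\<zeta> - w) ^ a * fock_weight w \<zeta>)"
proof (induction j arbitrary: p)
  case 0
  have "\<bar>cutoff R \<zeta> ^ p\<bar> \<le> 1"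
    using cutoff_bounds[of R \<zeta>] by (simp add: power_le_one)
  then have "\<bar>cutoff R \<zeta> ^ p\<bar> * cmod ((\<zeta> - w) ^ a * fock_weight w \<zeta>) \<le> 1 * cmod ((\<zeta> - w) ^ a * fock_weight w \<zeta>)"
    by (intro mult_right_mono) auto
  then show ?case
    by (simp only: cut_test.simps norm_mult[of "complex_of_real _"] norm_of_real power_0)
next
  case (Suc j)
  define G where "G = cmod ((\<zeta> - w) ^ a * fock_weight w \<zeta>)"
  define B where "B = ((1 + real p) * (1 + cmod w + cmod \<zeta>)) ^ j * G"
  have G: "G \<ge> 0" by (simp add: G_def)
  then have B: "B \<ge> 0" by (simp add: B_def)
  have 1: "cmod (cut_test R w a j p \<zeta>) \<le> B" unfolding B_def G_def by (rule Suc)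
  have "((1 + real (p - 1)) * (1 + cmod w + cmod \<zeta>)) ^ j * G \<le> B"
    unfolding B_def using G by (intro mult_right_mono power_mono) auto
  then have 2: "cmod (cut_test R w a j (p - 1) \<zeta>) \<le> B"
    using Suc[of "p - 1"] unfolding G_def by linarith
  have R2: "1 / R\<^sup>2 \<le> 1" using R by (simp add: power_le_one_iff field_simps)
  have "cmod (cut_test R w a (Suc j) p \<zeta>) \<le> cmod ((w - \<zeta>) * cut_test R w a j p \<zeta>) +
      cmod (complex_of_real (real p / R\<^sup>2) * \<zeta> * cut_test R w a j (p - 1) \<zeta>)"
    unfolding cut_test.simps by (rule norm_triangle_ineq4)
  also have "\<dots> \<le> (cmod w + cmod \<zeta>) * B + (real p * cmod \<zeta>) * B"
  proof (rule add_mono)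
    show "cmod ((w - \<zeta>) * cut_test R w a j p \<zeta>) \<le> (cmod w + cmod \<zeta>) * B"
      unfolding norm_mult using B by (intro mult_mono 1 norm_triangle_ineq4) auto
    have "real p / R\<^sup>2 \<le> real p"
      using mult_left_mono[OF R2, of "real p"] by simp
    then show "cmod (complex_of_real (real p / R\<^sup>2) * \<zeta> * cut_test R w a j (p - 1) \<zeta>) \<le> (real p * cmod \<zeta>) * B"
      unfolding norm_mult norm_of_real using B by (intro mult_mono 2) auto
  qed
  also have "\<dots> = (cmod w + cmod \<zeta> + real p * cmod \<zeta>) * B"
    by (simp add: distrib_right)
  also have "\<dots> \<le> ((1 + real p) * (1 + cmod w + cmod \<zeta>)) * B"
    by (intro mult_right_mono B) (simp add: algebra_simps)
  finally show ?case by (simp only: B_def G_def power_Suc mult.assoc)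
qed

lemma cut_test_limit:
  "(\<lambda>n. cut_test (real (Suc n)) w a j p \<zeta>) \<longlonglongrightarrow> (w - \<zeta>) ^ j * ((\<zeta> - w) ^ a * fock_weight w \<zeta>)"
proof (induction j arbitrary: p)
  case 0
  have "(\<lambda>n. (cmod \<zeta>)\<^sup>2 / (real (Suc n))\<^sup>2) \<longlonglongrightarrow> 0" by real_asymp
  then have "(\<lambda>n. max 0 (1 - (cmod \<zeta>)\<^sup>2 / (real (Suc n))\<^sup>2)) \<longlonglongrightarrow> max 0 (1 - 0)"
    by (intro tendsto_max tendsto_diff tendsto_const)
  then have "(\<lambda>n. complex_of_real (cutoff (real (Suc n)) \<zeta> ^ p) * ((\<zeta> - w) ^ a * fock_weight w \<zeta>)) \<longlonglongrightarrow>
      complex_of_real (1 ^ p) * ((\<zeta> - w) ^ a * fock_weight w \<zeta>)"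
    unfolding cutoff_def by (intro tendsto_intros) simp
  then show ?case by simp
next
  case (Suc j)
  have "(\<lambda>n. real p / (real (Suc n))\<^sup>2) \<longlonglongrightarrow> 0" by real_asymp
  then have "(\<lambda>n. (w - \<zeta>) * cut_test (real (Suc n)) w a j p \<zeta> -
      complex_of_real (real p / (real (Suc n))\<^sup>2) * \<zeta> * cut_test (real (Suc n)) w a j (p - 1) \<zeta>) \<longlonglongrightarrow>
      (w - \<zeta>) * ((w - \<zeta>) ^ j * ((\<zeta> - w) ^ a * fock_weight w \<zeta>)) -
      complex_of_real 0 * \<zeta> * ((w - \<zeta>) ^ j * ((\<zeta> - w) ^ a * fock_weight w \<zeta>))"
    by (intro tendsto_intros Suc.IH)
  then show ?case by (simp add: mult.assoc)
qed

text \<open>A quarter of the exponent \<open>- |\<zeta>|^2\<close> absorbs the polynomial and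
  exponential factors. Of the remaining \<open>3 / 4\<close>, a half pairs with the weighted
  square-integrability of \<open>f\<close>, and a quarter is square-integrable by itself.\<close>

lemma cut_test_gauss_bound:
  obtains C where "C \<ge> 0" "\<And>R \<zeta>. R \<ge> 1 \<Longrightarrow> cmod (cut_test R w a j p \<zeta>) \<le> C * exp (- (3 / 4) * (cmod \<zeta>)\<^sup>2)"
proof -
  have abs: "exp_growth (\<lambda>t. complex_of_real \<bar>t\<bar>)"
  proof (rule exp_growthI)
    show "cmod (complex_of_real \<bar>x\<bar>) \<le> 1 * exp (1 * \<bar>x\<bar>)" for x
    proof -
      have "\<bar>x\<bar> \<le> exp \<bar>x\<bar>" using exp_ge_add_one_self[of "\<bar>x\<bar>"] by linarith
      then show ?thesis by simp
    qed
  qed simp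
  have e: "exp_growth (\<lambda>t. complex_of_real (exp (cmod w * \<bar>t\<bar>)))"
    by (rule exp_growthI[where C=1 and a="cmod w"]) auto
  let ?u = "\<lambda>t. (complex_of_real (1 + real p) * (complex_of_real (1 + cmod w) + complex_of_real \<bar>t\<bar>)) ^ j *
    ((complex_of_real \<bar>t\<bar> + complex_of_real (cmod w)) ^ a * complex_of_real (exp (cmod w * \<bar>t\<bar>)))"
  have "exp_growth ?u"
    by (intro exp_growth_mult exp_growth_power exp_growth_add exp_growth_const abs e)
  then obtain C where C: "C \<ge> 0" "\<And>t. cmod (?u t) \<le> C * exp (1 / 4 * t\<^sup>2)"
    using exp_growth_gauss_bound[of ?u "1 / 4"] by auto
  have u_eq: "cmod (?u t) = ((1 + real p) * (1 + cmod w + \<bar>t\<bar>)) ^ j * ((\<bar>t\<bar> + cmod w) ^ a * exp (cmod w * \<bar>t\<bar>))" for t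
  proof -
    have "?u t = complex_of_real (((1 + real p) * (1 + cmod w + \<bar>t\<bar>)) ^ j * ((\<bar>t\<bar> + cmod w) ^ a * exp (cmod w * \<bar>t\<bar>)))"
      by simp
    then show ?thesis by (simp only: norm_of_real) (simp add: abs_mult power_abs)
  qed
  have "cmod (cut_test R w a j p \<zeta>) \<le> C * exp (- (3 / 4) * (cmod \<zeta>)\<^sup>2)" if R: "R \<ge> 1" for R \<zeta>
  proof -
    have w1: "cmod (fock_weight w \<zeta>) \<le> exp (cmod w * cmod \<zeta>) * exp (- (cmod \<zeta>)\<^sup>2)"
    proof -
      have "Re (w * cnj \<zeta>) \<le> cmod w * cmod \<zeta>"
        using complex_Re_le_cmod[of "w * cnj \<zeta>"] by (simp add: norm_mult)
      then have "Re (- \<zeta> * cnj \<zeta> + w * cnj \<zeta>) \<le> cmod w * cmod \<zeta> - (cmod \<zeta>)\<^sup>2"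
      proof -
        have "- \<zeta> * cnj \<zeta> = - complex_of_real ((cmod \<zeta>)\<^sup>2)"
          by (simp only: complex_norm_square minus_mult_left)
        then have "Re (- \<zeta> * cnj \<zeta> + w * cnj \<zeta>) = Re (w * cnj \<zeta>) - (cmod \<zeta>)\<^sup>2"
          by (simp only: plus_complex.simps uminus_complex.simps Re_complex_of_real)
        then show ?thesis using \<open>Re (w * cnj \<zeta>) \<le> cmod w * cmod \<zeta>\<close> by linarith
      qed
      then show ?thesis by (simp add: fock_weight_def norm_exp_eq_Re exp_add[symmetric])
    qed
    have "cmod ((\<zeta> - w) ^ a * fock_weight w \<zeta>) \<le> (cmod \<zeta> + cmod w) ^ a * (exp (cmod w * cmod \<zeta>) * exp (- (cmod \<zeta>)\<^sup>2))"
      unfolding norm_mult norm_power by (intro mult_mono power_mono norm_triangle_ineq4 w1) auto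
    then have "((1 + real p) * (1 + cmod w + cmod \<zeta>)) ^ j * cmod ((\<zeta> - w) ^ a * fock_weight w \<zeta>) \<le>
        ((1 + real p) * (1 + cmod w + cmod \<zeta>)) ^ j * ((cmod \<zeta> + cmod w) ^ a * (exp (cmod w * cmod \<zeta>) * exp (- (cmod \<zeta>)\<^sup>2)))"
      by (intro mult_left_mono) auto
    also have "\<dots> = cmod (?u (cmod \<zeta>)) * exp (- (cmod \<zeta>)\<^sup>2)"
      unfolding u_eq by simp
    also have "\<dots> \<le> C * exp (1 / 4 * (cmod \<zeta>)\<^sup>2) * exp (- (cmod \<zeta>)\<^sup>2)"
      by (intro mult_right_mono C) auto
    also have "\<dots> = C * exp (- (3 / 4) * (cmod \<zeta>)\<^sup>2)"
      by (simp add: exp_add[symmetric] mult.assoc)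
    finally show ?thesis using cut_test_bound[OF R, of w a j p \<zeta>] by linarith
  qed
  then show ?thesis using that C(1) by blast
qed

subsection \<open>Orthogonality of the Fock space to the higher test functions\<close>

definition cut_prod :: "real \<Rightarrow> 'n::finite rvec \<Rightarrow> ('n \<Rightarrow> nat) \<Rightarrow> nat \<Rightarrow> ('n \<Rightarrow> nat) \<Rightarrow> 'n cvec \<Rightarrow> complex" where
  "cut_prod R w a p j z = (\<Prod>r\<in>UNIV. cut_test R (complex_of_real (w $ r)) (a r) (j r) p (z $ r))"

lemma cut_prod_C1:
  assumes p: "\<And>r. p \<ge> j r + 2"
  shows "times_cont_differentiable 1 (cut_prod R w a p j)"
  unfolding cut_prod_def[abs_def]
proof (intro times_cont_differentiable_prod times_cont_differentiable_compose_linear[OF bounded_linear_vec_nth])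
  show "times_cont_differentiable 1 (cut_test R (complex_of_real (w $ r)) (a r) (j r) p)" for r
    using c1_dbar_cut_test[OF p] unfolding c1_dbar_def by blast
qed

lemma wirtinger_bar_prod:
  fixes u :: "'n::finite \<Rightarrow> complex \<Rightarrow> complex"
  assumes c1: "\<And>r. c1_dbar (u r) (b r)"
  shows "wirtinger_bar s (\<lambda>z. \<Prod>r\<in>UNIV. u r (z $ r)) z = b s (z $ s) * (\<Prod>r\<in>UNIV - {s}. u r (z $ r))"
proof -
  let ?D = "\<lambda>r. frechet_derivative (u r) (at (z $ r))"
  have D: "((\<lambda>z. u r (z $ r)) has_derivative (\<lambda>h. ?D r (h $ r))) (at z)" for r
    by (rule has_derivative_compose[OF bounded_linear_imp_has_derivative[OF bounded_linear_vec_nth] c1_dbar_has_derivative[OF c1]])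
  have D0: "?D r 0 = 0" for r
    using has_derivative_linear[OF c1_dbar_has_derivative[OF c1]] by (rule linear_0)
  have "((\<lambda>z. \<Prod>r\<in>UNIV. u r (z $ r)) has_derivative (\<lambda>h. \<Sum>r\<in>UNIV. ?D r (h $ r) * (\<Prod>i\<in>UNIV - {r}. u i (z $ i)))) (at z)"
    by (rule has_derivative_prod) (rule D)
  moreover have "(\<Sum>r\<in>UNIV. ?D r (axis s c $ r) * (\<Prod>i\<in>UNIV - {r}. u i (z $ i))) =
      ?D s c * (\<Prod>i\<in>UNIV - {s}. u i (z $ i))" for c
  proof -
    have "(\<Sum>r\<in>UNIV. ?D r (axis s c $ r) * (\<Prod>i\<in>UNIV - {r}. u i (z $ i))) =
        (\<Sum>r\<in>UNIV. if r = s then ?D s c * (\<Prod>i\<in>UNIV - {s}. u i (z $ i)) else 0)"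
      by (intro sum.cong refl) (auto simp: axis_def D0)
    then show ?thesis by simp
  qed
  ultimately have "wirtinger_bar s (\<lambda>z. \<Prod>r\<in>UNIV. u r (z $ r)) z = (?D s 1 + \<i> * ?D s \<i>) / 2 * (\<Prod>i\<in>UNIV - {s}. u i (z $ i))"
    by (simp add: wirtinger_bar_eqI algebra_simps add_divide_distrib)
  also have "(?D s 1 + \<i> * ?D s \<i>) / 2 = b s (z $ s)"
    using c1[of s] unfolding c1_dbar_def by blast
  finally show ?thesis .
qed

lemma wirtinger_bar_cut_prod:
  assumes p: "\<And>r. p \<ge> j r + 2"
  shows "wirtinger_bar s (cut_prod R w a p j) = cut_prod R w a p (j(s := Suc (j s)))"
proof
  fix z
  show "wirtinger_bar s (cut_prod R w a p j) z = cut_prod R w a p (j(s := Suc (j s))) z"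
    unfolding cut_prod_def[abs_def] wirtinger_bar_prod[OF c1_dbar_cut_test[OF p]]
    by (simp add: prod.remove[of UNIV s] del: cut_test.simps)
qed

lemma cut_prod_eq_0:
  fixes z :: "'n::finite cvec"
  assumes R: "R > 0" and p: "\<And>r. p \<ge> j r + 1" and z: "norm z > real CARD('n) * R"
  shows "cut_prod R w a p j z = 0"
proof -
  have "\<exists>r. cmod (z $ r) \<ge> R"
  proof (rule ccontr)
    assume "\<not> ?thesis"
    then have "cmod (z $ r) \<le> R" for r by (meson less_imp_le not_le)
    then have "(\<Sum>r\<in>UNIV. cmod (z $ r)) \<le> real CARD('n) * R"
      using sum_bounded_above[of UNIV "\<lambda>r. cmod (z $ r)" R] by simp
    moreover have "norm z \<le> (\<Sum>r\<in>UNIV. cmod (z $ r))"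
      by (simp add: norm_vec_def L2_set_le_sum)
    ultimately show False using z by linarith
  qed
  then obtain r where "cmod (z $ r) \<ge> R" by blast
  then have "cut_test R (complex_of_real (w $ r)) (a r) (j r) p (z $ r) = 0"
    using R p by (intro cut_test_eq_0)
  then show ?thesis by (auto simp: cut_prod_def)
qed

text \<open>The derivatives move one at a time from \<open>g\<close> to the cut-off product, each
  raising the entry of \<open>j\<close> at \<open>r\<close>. The assumption on \<open>p\<close>
  keeps the product continuously differentiable at every stage.\<close>

lemma wirtinger_funpow_by_parts:
  fixes g :: "'n::finite cvec \<Rightarrow> complex"
  assumes g: "smooth g" and R: "R > 0"
  shows "(\<And>s. p \<ge> j s + 2) \<Longrightarrow> p \<ge> j r + n + 2 \<Longrightarrow>
    integral\<^sup>L lborel (\<lambda>z. (wirtinger_bar r ^^ n) g z * cut_prod R w a p j z) =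
    (-1) ^ n * integral\<^sup>L lborel (\<lambda>z. g z * cut_prod R w a p (j(r := j r + n)) z)"
proof (induction n arbitrary: j)
  case (Suc n)
  have "integral\<^sup>L lborel (\<lambda>z. (wirtinger_bar r ^^ Suc n) g z * cut_prod R w a p j z) =
      - integral\<^sup>L lborel (\<lambda>z. (wirtinger_bar r ^^ n) g z * wirtinger_bar r (cut_prod R w a p j) z)"
    unfolding funpow.simps comp_apply
  proof (rule wirtinger_bar_by_parts[where B="real CARD('n) * R"])
    show "cut_prod R w a p j x = 0" if "norm x > real CARD('n) * R" for x
    proof (rule cut_prod_eq_0[OF R _ that])
      show "j r + 1 \<le> p" for r using Suc.prems(1)[of r] by simp
    qed
    show "times_cont_differentiable 1 (cut_prod R w a p j)"
      by (rule cut_prod_C1[OF Suc.prems(1)])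
    show "smooth ((wirtinger_bar r ^^ n) g)"
      by (rule wirtinger_bar_funpow_smooth[OF g])
  qed (use R in simp)
  also have "\<dots> = - integral\<^sup>L lborel (\<lambda>z. (wirtinger_bar r ^^ n) g z * cut_prod R w a p (j(r := Suc (j r))) z)"
    by (simp only: wirtinger_bar_cut_prod[OF Suc.prems(1)])
  also have "\<dots> = - ((-1) ^ n * integral\<^sup>L lborel (\<lambda>z. g z * cut_prod R w a p ((j(r := Suc (j r)))(r := (j(r := Suc (j r))) r + n)) z))"
    using Suc.prems by (subst Suc.IH) auto
  also have "(j(r := Suc (j r)))(r := (j(r := Suc (j r))) r + n) = j(r := j r + Suc n)"
    by auto
  finally show ?case by (simp only: power_Suc mult_minus_left mult_1_left)
qed simp

text \<open>The constant is a sign. It is only recorded to be nonzero, so that vanishing of the left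
  integral forces vanishing of the right one.\<close>

lemma wirtinger_foldr_by_parts:
  fixes f :: "'n::finite cvec \<Rightarrow> complex"
  assumes f: "smooth f" and R: "R > 0"
  shows "distinct rs \<Longrightarrow> (\<And>s. p \<ge> j s + (if s \<in> set rs then k s else 0) + 2) \<Longrightarrow>
    \<exists>c \<noteq> 0. integral\<^sup>L lborel (\<lambda>z. foldr (\<lambda>r g. (wirtinger_bar r ^^ k r) g) rs f z * cut_prod R w a p j z) =
    c * integral\<^sup>L lborel (\<lambda>z. f z * cut_prod R w a p (\<lambda>s. j s + (if s \<in> set rs then k s else 0)) z)"
proof (induction rs arbitrary: j)
  case Nil
  show ?case by (intro exI[of _ 1]) simp
next
  case (Cons r rs)
  let ?F = "foldr (\<lambda>r g. (wirtinger_bar r ^^ k r) g) rs f"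
  let ?j = "j(r := j r + k r)"
  have p: "p \<ge> j s + 2" for s using Cons.prems(2)[of s] by simp
  have pr: "p \<ge> j r + k r + 2" using Cons.prems(2)[of r] by simp
  have 1: "integral\<^sup>L lborel (\<lambda>z. (wirtinger_bar r ^^ k r) ?F z * cut_prod R w a p j z) =
      (-1) ^ k r * integral\<^sup>L lborel (\<lambda>z. ?F z * cut_prod R w a p ?j z)"
    by (rule wirtinger_funpow_by_parts[where p=p and j=j and r=r and n="k r" and w=w and a=a,
          OF wirtinger_bar_foldr_smooth[OF f] R p pr])
  have d: "distinct rs" using Cons.prems(1) by simp
  have pj: "p \<ge> ?j s + (if s \<in> set rs then k s else 0) + 2" for s
    using Cons.prems(2)[of s] Cons.prems(1) by auto
  from Cons.IH[OF d pj]
  obtain c where c: "c \<noteq> 0" "integral\<^sup>L lborel (\<lambda>z. ?F z * cut_prod R w a p ?j z) =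
      c * integral\<^sup>L lborel (\<lambda>z. f z * cut_prod R w a p (\<lambda>s. ?j s + (if s \<in> set rs then k s else 0)) z)"
    by blast
  have "(\<lambda>s. ?j s + (if s \<in> set rs then k s else 0)) = (\<lambda>s. j s + (if s \<in> set (r # rs) then k s else 0))"
    using Cons.prems(1) by (auto simp: fun_eq_iff)
  then show ?case
    using 1 c by (intro exI[of _ "(-1) ^ k r * c"]) (simp only: foldr.simps comp_apply mult.assoc, simp)
qed

text \<open>Being m-analytic concerns derivatives of order exactly \<open>m\<close>, so from a
  multi-index of order at least \<open>m\<close> a part of that order is split off.\<close>

lemma exists_sub_multi_index:
  fixes l :: "'n::finite \<Rightarrow> nat"
  shows "m \<le> (\<Sum>r\<in>UNIV. l r) \<Longrightarrow> \<exists>k. (\<forall>r. k r \<le> l r) \<and> (\<Sum>r\<in>UNIV. k r) = m"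
proof (induction m)
  case 0
  show ?case by (intro exI[of _ "\<lambda>_. 0"]) simp
next
  case (Suc m)
  then obtain k where k: "\<And>r. k r \<le> l r" "(\<Sum>r\<in>UNIV. k r) = m" by auto
  obtain s where s: "k s < l s"
  proof (rule ccontr)
    assume "\<not> thesis"
    then have "l r \<le> k r" for r using that by (meson not_le)
    then have "(\<Sum>r\<in>UNIV. l r) \<le> (\<Sum>r\<in>UNIV. k r)" by (intro sum_mono)
    then show False using k(2) Suc.prems by simp
  qed
  have "(\<Sum>r\<in>UNIV. (k(s := Suc (k s))) r) = Suc m"
    using k(2) by (simp add: sum.remove[of UNIV s])
  then show ?case using k s by (intro exI[of _ "k(s := Suc (k s))"]) auto
qed

lemma integrable_gauss_lborel: "integrable lborel (gauss :: 'a::euclidean_space \<Rightarrow> real)"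
  using integrable_gauss by (simp add: integrable_mu_tilde_iff)

lemma norm_vec_sq: "(norm z)\<^sup>2 = (\<Sum>r\<in>UNIV. (norm (z $ r))\<^sup>2)"
  by (simp add: norm_vec_def L2_set_def sum_nonneg)

text \<open>With the cut-off in place, the derivative of order \<open>m\<close> can be shifted back
  onto \<open>f\<close>, so the integral is \<open>0\<close> for every \<open>R\<close>. As
  \<open>R\<close> grows, the terms in which the cut-off was differentiated die out and the one with
  all derivatives on the weight remains.\<close>

theorem polyanalytic_orthogonal:
  fixes f :: "'n::{finite,linorder} cvec \<Rightarrow> complex" and w :: "'n rvec"
  assumes f: "polyanalytic m f" and int: "integrable lborel (\<lambda>z. (cmod (f z))\<^sup>2 * exp (- (norm z)\<^sup>2))"
    and l: "(\<Sum>r\<in>UNIV. l r) \<ge> m"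
  shows "integral\<^sup>L lborel (\<lambda>z. f z * (\<Prod>r\<in>UNIV. (z $ r - complex_of_real (w $ r)) ^ l r *
    fock_weight (complex_of_real (w $ r)) (z $ r))) = 0"
proof -
  have sm: "smooth f" using f by (simp add: polyanalytic_def)
  have [measurable]: "f \<in> borel_measurable borel" using smooth_measurable[OF sm] .
  obtain k where k: "\<And>r. k r \<le> l r" "(\<Sum>r\<in>UNIV. k r) = m"
    using exists_sub_multi_index[OF l] by blast
  \<comment> \<open>The powers that are present before differentiation; \<open>k\<close> derivatives
    of the weight raise them to \<open>l\<close>, up to the sign \<open>(-1) ^ m\<close>.\<close>
  define a where "a r = l r - k r" for r
  \<comment> \<open>Every \<open>k r\<close> is at most \<open>m\<close>, and \<open>k r + 2\<close>
    suffices as exponent for all the integrations by parts.\<close>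
  define p where "p = m + 2"
  have "k r \<le> m" for r
    using k(2) member_le_sum[of r UNIV k] by simp
  then have p: "p \<ge> k r + 2" for r by (simp add: p_def)
  have zero: "integral\<^sup>L lborel (\<lambda>z. f z * cut_prod R w a p k z) = 0" if R: "R > 0" for R
  proof -
    obtain c where c: "c \<noteq> 0"
      "integral\<^sup>L lborel (\<lambda>z. foldr (\<lambda>r g. (wirtinger_bar r ^^ k r) g) (sorted_list_of_set UNIV) f z * cut_prod R w a p (\<lambda>_. 0) z) =
        c * integral\<^sup>L lborel (\<lambda>z. f z * cut_prod R w a p k z)"
      using wirtinger_foldr_by_parts[OF sm R, of "sorted_list_of_set UNIV" "\<lambda>_. 0" k p w a] p by auto
    have "foldr (\<lambda>r g. (wirtinger_bar r ^^ k r) g) (sorted_list_of_set UNIV) f z = 0" for z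
      using f k(2) by (simp add: polyanalytic_def D_bar_def)
    then show ?thesis using c by simp
  qed
  have "\<exists>C. C \<ge> 0 \<and> (\<forall>R \<zeta>. R \<ge> 1 \<longrightarrow> cmod (cut_test R (complex_of_real (w $ r)) (a r) (k r) p \<zeta>) \<le> C * exp (- (3 / 4) * (cmod \<zeta>)\<^sup>2))" for r
    using cut_test_gauss_bound[of "complex_of_real (w $ r)" "a r" "k r" p] by metis
  then obtain C where C: "\<And>r. C r \<ge> 0"
    "\<And>r R \<zeta>. R \<ge> 1 \<Longrightarrow> cmod (cut_test R (complex_of_real (w $ r)) (a r) (k r) p \<zeta>) \<le> C r * exp (- (3 / 4) * (cmod \<zeta>)\<^sup>2)"
    by metis
  define K where "K = (\<Prod>r\<in>UNIV. C r)"
  have K: "K \<ge> 0" using C(1) by (simp add: K_def prod_nonneg)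
  have cp_bound: "cmod (cut_prod R w a p k z) \<le> K * exp (- (3 / 4) * (norm z)\<^sup>2)" if R: "R \<ge> 1" for R z
  proof -
    have "cmod (cut_prod R w a p k z) \<le> (\<Prod>r\<in>UNIV. C r * exp (- (3 / 4) * (cmod (z $ r))\<^sup>2))"
      unfolding cut_prod_def prod_norm[symmetric] using C(2)[OF R] by (intro prod_mono) auto
    also have "\<dots> = K * exp (- (3 / 4) * (norm z)\<^sup>2)"
      by (simp add: prod.distrib K_def norm_vec_sq exp_sum[symmetric] sum_distrib_left sum_negf)
    finally show ?thesis .
  qed
  define L where "L z = f z * (\<Prod>r\<in>UNIV. (complex_of_real (w $ r) - z $ r) ^ k r * ((z $ r - complex_of_real (w $ r)) ^ a r *
    fock_weight (complex_of_real (w $ r)) (z $ r)))" for z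
  have fw [measurable]: "fock_weight c \<in> borel_measurable borel" for c
    using c1_dbar_continuous(1)[OF c1_dbar_fock_weight, of c] by (rule borel_measurable_continuous_onI)
  have "(\<lambda>n. integral\<^sup>L lborel (\<lambda>z. f z * cut_prod (real (Suc n)) w a p k z)) \<longlonglongrightarrow> integral\<^sup>L lborel L"
  proof (rule integral_dominated_convergence[where w="\<lambda>z. K * ((cmod (f z))\<^sup>2 * exp (- (norm z)\<^sup>2) + gauss z)"])
    show "integrable lborel (\<lambda>z. K * ((cmod (f z))\<^sup>2 * exp (- (norm z)\<^sup>2) + gauss z))"
      by (intro integrable_mult_right Bochner_Integration.integrable_add int integrable_gauss_lborel)
    show "L \<in> borel_measurable lborel"
    proof -
      have [measurable]: "(\<lambda>z :: 'n cvec. z $ r) \<in> borel_measurable borel" for r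
        by (intro borel_measurable_continuous_onI continuous_intros)
      show ?thesis
        unfolding L_def[abs_def] by (intro borel_measurable_times borel_measurable_prod) measurable
    qed
    show "(\<lambda>z. f z * cut_prod (real (Suc n)) w a p k z) \<in> borel_measurable lborel" for n
    proof -
      have "continuous_on UNIV (cut_prod (real (Suc n)) w a p k)"
      proof -
        have "times_cont_differentiable (Suc 0) (cut_prod (real (Suc n)) w a p k)"
          using cut_prod_C1[OF p] by (simp only: One_nat_def)
        from times_cont_differentiable_lower[OF this] show ?thesis
          by (simp only: times_cont_differentiable.simps(1))
      qed
      then have [measurable]: "cut_prod (real (Suc n)) w a p k \<in> borel_measurable borel"
        by (rule borel_measurable_continuous_onI)
      show ?thesis by measurable
    qed
    show "AE z in lborel. (\<lambda>n. f z * cut_prod (real (Suc n)) w a p k z) \<longlonglongrightarrow> L z"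
      unfolding L_def cut_prod_def by (intro AE_I2 tendsto_mult tendsto_const tendsto_prod cut_test_limit)
    show "AE z in lborel. norm (f z * cut_prod (real (Suc n)) w a p k z) \<le> K * ((cmod (f z))\<^sup>2 * exp (- (norm z)\<^sup>2) + gauss z)" for n
    proof (rule AE_I2)
      fix z
      define x where "x = cmod (f z) * exp (- (norm z)\<^sup>2 / 2)"
      define y where "y = exp (- (norm z)\<^sup>2 / 4)"
      have "norm (f z * cut_prod (real (Suc n)) w a p k z) \<le> cmod (f z) * (K * exp (- (3 / 4) * (norm z)\<^sup>2))"
        unfolding norm_mult by (intro mult_left_mono cp_bound) auto
      also have "\<dots> = K * (x * y)"
        by (simp add: x_def y_def exp_add[symmetric] mult_ac) 
      also have "\<dots> \<le> K * (x\<^sup>2 + y\<^sup>2)"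
      proof (rule mult_left_mono[OF _ K])
        have "0 \<le> x" "0 \<le> y" by (simp_all add: x_def y_def)
        then show "x * y \<le> x\<^sup>2 + y\<^sup>2"
          using sum_squares_bound[of x y] mult_nonneg_nonneg[of x y] by linarith
      qed
      also have "x\<^sup>2 + y\<^sup>2 = (cmod (f z))\<^sup>2 * exp (- (norm z)\<^sup>2) + gauss z"
        by (simp add: x_def y_def gauss_def power_mult_distrib exp_double[symmetric])
      finally show "norm (f z * cut_prod (real (Suc n)) w a p k z) \<le> K * ((cmod (f z))\<^sup>2 * exp (- (norm z)\<^sup>2) + gauss z)" .
    qed
  qed
  then have L0: "integral\<^sup>L lborel (\<lambda>z. L z) = 0"
    using zero by (simp add: LIMSEQ_const_iff)
  have L_eq: "L z = (-1) ^ m * (f z * (\<Prod>r\<in>UNIV. (z $ r - complex_of_real (w $ r)) ^ l r *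
    fock_weight (complex_of_real (w $ r)) (z $ r)))" for z
  proof -
    have eq: "(complex_of_real (w $ r) - z $ r) ^ k r * ((z $ r - complex_of_real (w $ r)) ^ a r * fock_weight (complex_of_real (w $ r)) (z $ r)) =
        (-1) ^ k r * ((z $ r - complex_of_real (w $ r)) ^ l r * fock_weight (complex_of_real (w $ r)) (z $ r))" for r
    proof -
      have "(complex_of_real (w $ r) - z $ r) ^ k r = (-1) ^ k r * (z $ r - complex_of_real (w $ r)) ^ k r"
        by (simp add: power_mult_distrib[symmetric])
      moreover have "l r = k r + a r" using k(1)[of r] by (simp add: a_def)
      ultimately show ?thesis by (simp add: power_add mult_ac)
    qed
    show ?thesis
      unfolding L_def eq prod.distrib[of "\<lambda>r. (-1) ^ k r"] power_sum[symmetric] k(2) by (simp only: mult_ac)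
  qed
  show ?thesis
    using L0 unfolding L_eq integral_mult_right_zero by simp
qed

section \<open>Transfer to the Fock space and vanishing of the higher coefficients\<close>

subsection \<open>Identification of \<open>\<complex>\<^sup>n\<close> with \<open>\<real>\<^sup>2\<^sup>n\<close>\<close>

lemma complex_vec_nth [simp]: "complex_vec x y $ r = Complex (x $ r) (y $ r)"
  by (simp add: complex_vec_def)

lemma complex_vec_eq: "complex_vec x y $ r = complex_of_real (x $ r) + \<i> * complex_of_real (y $ r)"
  by (simp add: complex_eq_iff)

lemma norm_complex_vec: "(norm (complex_vec x y))\<^sup>2 = (norm x)\<^sup>2 + (norm y)\<^sup>2"
  by (simp add: norm_vec_sq cmod_power2 sum.distrib)

lemma complex_vec_measurable [measurable]:
  "(\<lambda>p :: 'n::finite rvec \<times> 'n rvec. complex_vec (fst p) (snd p)) \<in> borel_measurable borel"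
proof -
  have "continuous_on UNIV (\<lambda>p :: 'n rvec \<times> 'n rvec. complex_vec (fst p) (snd p))"
    unfolding complex_vec_def Complex_eq by (intro continuous_on_vec_lambda continuous_intros)
  then show ?thesis by (rule borel_measurable_continuous_onI)
qed

lemma prod_Basis_cvec:
  fixes F :: "'n::finite cvec \<Rightarrow> real"
  shows "(\<Prod>b\<in>Basis. F b) = (\<Prod>r\<in>UNIV. F (axis r 1) * F (axis r \<i>))"
proof -
  have B: "(Basis :: 'n cvec set) = (\<lambda>(r, c). axis r c) ` (UNIV \<times> {1, \<i>})"
    by (auto simp: Basis_vec_def Basis_complex_def image_iff)
  have "inj_on (\<lambda>(r, c). axis r c :: 'n cvec) (UNIV \<times> {1, \<i>})"
    by (auto simp: inj_on_def axis_eq_axis)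
  then have "(\<Prod>b\<in>Basis. F b) = (\<Prod>(r, c)\<in>UNIV \<times> {1, \<i>}. F (axis r c))"
    unfolding B by (subst prod.reindex) (auto simp: split_def comp_def)
  also have "\<dots> = (\<Prod>r\<in>UNIV. \<Prod>c\<in>{1, \<i>}. F (axis r c))"
    by (subst prod.cartesian_product) simp
  finally show ?thesis by (simp add: complex_eq_iff)
qed

lemma prod_Basis_rvec:
  fixes F :: "'n::finite rvec \<Rightarrow> real"
  shows "(\<Prod>b\<in>Basis. F b) = (\<Prod>r\<in>UNIV. F (axis r 1))"
proof -
  have B: "(Basis :: 'n rvec set) = range (\<lambda>r. axis r 1)"
    by (auto simp: Basis_vec_def)
  have inj: "inj (\<lambda>r. axis r 1 :: 'n rvec)"
    by (auto simp: inj_def axis_eq_axis)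
  show ?thesis
    unfolding B prod.reindex[OF inj] comp_def ..
qed

text \<open>Box volumes determine Lebesgue measure, and a complex box corresponds to the product of
  the boxes of its real and imaginary parts.\<close>

lemma lborel_complex_vec:
  "lborel = distr (lborel :: ('n::finite rvec \<times> 'n rvec) measure) borel (\<lambda>p. complex_vec (fst p) (snd p))"
proof (rule lborel_eqI)
  fix l u :: "'n cvec" assume le: "\<And>b. b \<in> Basis \<Longrightarrow> l \<bullet> b \<le> u \<bullet> b"
  let ?re = "\<lambda>z :: 'n cvec. (\<chi> r. Re (z $ r)) :: 'n rvec" and ?im = "\<lambda>z :: 'n cvec. (\<chi> r. Im (z $ r)) :: 'n rvec"
  have le1: "Re (l $ r) \<le> Re (u $ r)" and le2: "Im (l $ r) \<le> Im (u $ r)" for r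
    using le[of "axis r 1"] le[of "axis r \<i>"]
    by (auto simp: inner_axis inner_complex_def axis_in_Basis_iff Basis_complex_def)
  have vim: "(\<lambda>p. complex_vec (fst p) (snd p)) -` box l u = box (?re l) (?re u) \<times> box (?im l) (?im u)"
  proof (intro set_eqI)
    fix p :: "'n rvec \<times> 'n rvec"
    have "complex_vec (fst p) (snd p) \<in> box l u \<longleftrightarrow>
        (\<forall>r. Re (l $ r) < fst p $ r \<and> fst p $ r < Re (u $ r)) \<and> (\<forall>r. Im (l $ r) < snd p $ r \<and> snd p $ r < Im (u $ r))"
      by (auto simp: mem_box Basis_vec_def Basis_complex_def inner_axis inner_complex_def)
    then show "p \<in> (\<lambda>p. complex_vec (fst p) (snd p)) -` box l u \<longleftrightarrow> p \<in> box (?re l) (?re u) \<times> box (?im l) (?im u)"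
      by (auto simp: mem_box_cart mem_Times_iff)
  qed
  have 1: "emeasure lborel (box (?re l) (?re u)) = ennreal (\<Prod>r\<in>UNIV. Re (u $ r) - Re (l $ r))"
  proof -
    have "emeasure lborel (box (?re l) (?re u)) = ennreal (\<Prod>b\<in>Basis. (?re u - ?re l) \<bullet> b)"
      by (rule emeasure_lborel_box) (auto simp: Basis_vec_def inner_axis le1)
    then show ?thesis by (simp add: prod_Basis_rvec inner_axis)
  qed
  have 2: "emeasure lborel (box (?im l) (?im u)) = ennreal (\<Prod>r\<in>UNIV. Im (u $ r) - Im (l $ r))"
  proof -
    have "emeasure lborel (box (?im l) (?im u)) = ennreal (\<Prod>b\<in>Basis. (?im u - ?im l) \<bullet> b)"
      by (rule emeasure_lborel_box) (auto simp: Basis_vec_def inner_axis le2)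
    then show ?thesis by (simp add: prod_Basis_rvec inner_axis)
  qed
  have "emeasure (distr lborel borel (\<lambda>p. complex_vec (fst p) (snd p))) (box l u) =
      emeasure (lborel \<Otimes>\<^sub>M lborel) (box (?re l) (?re u) \<times> box (?im l) (?im u))"
    by (subst emeasure_distr) (auto simp: vim lborel_prod)
  also have "\<dots> = ennreal (\<Prod>r\<in>UNIV. Re (u $ r) - Re (l $ r)) * ennreal (\<Prod>r\<in>UNIV. Im (u $ r) - Im (l $ r))"
    by (subst lborel.emeasure_pair_measure_Times) (auto simp: 1 2)
  also have "\<dots> = ennreal (\<Prod>b\<in>Basis. (u - l) \<bullet> b)"
    by (simp add: prod_Basis_cvec inner_axis inner_complex_def prod.distrib ennreal_mult prod_nonneg le1 le2)
  finally show "emeasure (distr lborel borel (\<lambda>p. complex_vec (fst p) (snd p))) (box l u) = ennreal (\<Prod>b\<in>Basis. (u - l) \<bullet> b)" .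
qed simp

lemma integral_complex_vec:
  fixes F :: "'n::finite cvec \<Rightarrow> 'b::{banach, second_countable_topology}"
  assumes [measurable]: "F \<in> borel_measurable borel"
  shows "integral\<^sup>L lborel (\<lambda>p. F (complex_vec (fst p) (snd p))) = integral\<^sup>L lborel F"
    and "integrable lborel (\<lambda>p. F (complex_vec (fst p) (snd p))) \<longleftrightarrow> integrable lborel F"
  by (simp_all add: lborel_complex_vec integral_distr integrable_distr_eq)

subsection \<open>The unitary operator \<open>U_fock\<close>\<close>

lemma U_fock_eq: "U_fock \<alpha> f (x, y) = complex_of_real (2 powr (real CARD('n) / 2)) *
     exp (complex_of_real (- (1/2) * (norm x)\<^sup>2 - (1/2) * (norm y)\<^sup>2) - \<i> * complex_of_real (x \<bullet> y)) *
     f ((1 / sqrt \<alpha>) *\<^sub>R complex_vec x y)" for x :: "'n::finite rvec"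
  by (simp add: U_fock_def)

lemma cmod_U_fock:
  fixes x :: "'n::finite rvec"
  shows "cmod (U_fock \<alpha> f (x, y)) = 2 powr (real CARD('n) / 2) *
    (exp (- (1/2) * (norm (complex_vec x y))\<^sup>2) * cmod (f ((1 / sqrt \<alpha>) *\<^sub>R complex_vec x y)))"
  by (simp add: U_fock_eq norm_mult norm_exp_eq_Re norm_complex_vec algebra_simps)

lemma fock_spaceD:
  assumes "f \<in> fock_space \<alpha> m"
  shows "polyanalytic m f" "smooth f" "f \<in> borel_measurable borel"
    "integrable lborel (\<lambda>z. (cmod (f z))\<^sup>2 * exp (- \<alpha> * (norm z)\<^sup>2))"
  using assms by (auto simp: fock_space_def polyanalytic_def intro: smooth_measurable)

text \<open>Substitution of \<open>z / sqrt \<alpha>\<close>. The real dimension is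
  \<open>2 * CARD('n)\<close>, so the Jacobian contributes the power \<open>CARD('n)\<close> of
  \<open>\<alpha>\<close> that stands in \<open>fock_norm\<close>.\<close>

lemma fock_rescale:
  fixes f :: "'n::finite cvec \<Rightarrow> complex"
  assumes \<alpha>: "\<alpha> > 0" and f: "f \<in> borel_measurable borel"
  shows "integrable lborel (\<lambda>z. (cmod (f z))\<^sup>2 * exp (- \<alpha> * (norm z)\<^sup>2)) \<longleftrightarrow>
      integrable lborel (\<lambda>z. (cmod (f ((1 / sqrt \<alpha>) *\<^sub>R z)))\<^sup>2 * exp (- (norm z)\<^sup>2))"
    and "\<alpha> ^ CARD('n) * integral\<^sup>L lborel (\<lambda>z. (cmod (f z))\<^sup>2 * exp (- \<alpha> * (norm z)\<^sup>2)) =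
      integral\<^sup>L lborel (\<lambda>z. (cmod (f ((1 / sqrt \<alpha>) *\<^sub>R z)))\<^sup>2 * exp (- (norm z)\<^sup>2))"
proof -
  have [measurable]: "f \<in> borel_measurable borel" by (rule f)
  let ?F = "\<lambda>z. (cmod (f z))\<^sup>2 * exp (- \<alpha> * (norm z)\<^sup>2)"
  have c: "1 / sqrt \<alpha> > 0" using \<alpha> by simp
  have m: "?F \<in> borel_measurable borel" by measurable
  have eq: "?F ((1 / sqrt \<alpha>) *\<^sub>R z) = (cmod (f ((1 / sqrt \<alpha>) *\<^sub>R z)))\<^sup>2 * exp (- (norm z)\<^sup>2)" for z
    using \<alpha> by (simp add: power_divide)
  show "integrable lborel ?F \<longleftrightarrow> integrable lborel (\<lambda>z. (cmod (f ((1 / sqrt \<alpha>) *\<^sub>R z)))\<^sup>2 * exp (- (norm z)\<^sup>2))"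
    using mu_scale(2)[OF m c] unfolding eq integrable_mu_tilde_iff .
  have "(1 / sqrt \<alpha>) ^ DIM('n cvec) = inverse (\<alpha> ^ CARD('n))"
  proof -
    have "DIM('n cvec) = 2 * CARD('n)" by simp
    moreover have "(1 / sqrt \<alpha>)\<^sup>2 = inverse \<alpha>" using \<alpha> by (simp add: power_divide inverse_eq_divide)
    ultimately show ?thesis by (simp only: power_mult power_inverse)
  qed
  then show "\<alpha> ^ CARD('n) * integral\<^sup>L lborel ?F = integral\<^sup>L lborel (\<lambda>z. (cmod (f ((1 / sqrt \<alpha>) *\<^sub>R z)))\<^sup>2 * exp (- (norm z)\<^sup>2))"
    using mu_scale(1)[OF m c] \<alpha> unfolding eq integral_mu_tilde by (simp add: field_simps)
qed

lemma U_fock_measurable: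
  fixes f :: "'n::finite cvec \<Rightarrow> complex"
  assumes f [measurable]: "f \<in> borel_measurable borel"
  shows "U_fock \<alpha> f \<in> borel_measurable borel"
proof -
  have "(\<lambda>p :: 'n rvec \<times> 'n rvec. exp (complex_of_real (- (1/2) * (norm (fst p))\<^sup>2 - (1/2) * (norm (snd p))\<^sup>2) -
      \<i> * complex_of_real (fst p \<bullet> snd p))) \<in> borel_measurable borel"
    by (intro borel_measurable_continuous_onI continuous_intros)
  moreover have "(\<lambda>p :: 'n rvec \<times> 'n rvec. f ((1 / sqrt \<alpha>) *\<^sub>R complex_vec (fst p) (snd p))) \<in> borel_measurable borel"
    by (rule measurable_compose[OF borel_measurable_scaleR[OF borel_measurable_const complex_vec_measurable] f])
  ultimately show ?thesis
    unfolding U_fock_def[abs_def] split_def by (intro borel_measurable_times borel_measurable_const)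
qed

lemma cmod_U_fock_sq:
  fixes f :: "'n::finite cvec \<Rightarrow> complex"
  shows "(cmod (U_fock \<alpha> f p))\<^sup>2 = 2 ^ CARD('n) * ((cmod (f ((1 / sqrt \<alpha>) *\<^sub>R complex_vec (fst p) (snd p))))\<^sup>2 *
    exp (- (norm (complex_vec (fst p) (snd p)))\<^sup>2))"
proof -
  have "(2 powr (real CARD('n) / 2))\<^sup>2 = 2 ^ CARD('n)"
    unfolding power2_eq_square powr_add[symmetric] by (simp add: powr_realpow)
  then show ?thesis
    by (cases p) (simp add: cmod_U_fock power_mult_distrib exp_double[symmetric])
qed

lemma square_integrable_U_fock_iff:
  fixes f :: "'n::finite cvec \<Rightarrow> complex"
  assumes \<alpha>: "\<alpha> > 0" and f: "f \<in> borel_measurable borel"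
  shows "square_integrable (U_fock \<alpha> f) \<longleftrightarrow> integrable lborel (\<lambda>z. (cmod (f z))\<^sup>2 * exp (- \<alpha> * (norm z)\<^sup>2))"
proof -
  have [measurable]: "f \<in> borel_measurable borel" by (rule f)
  let ?F = "\<lambda>z. (cmod (f ((1 / sqrt \<alpha>) *\<^sub>R z)))\<^sup>2 * exp (- (norm z)\<^sup>2)"
  have "square_integrable (U_fock \<alpha> f) \<longleftrightarrow> integrable lborel (\<lambda>p. 2 ^ CARD('n) * ?F (complex_vec (fst p) (snd p)))"
    using U_fock_measurable[OF f, of \<alpha>]
    by (auto simp: square_integrable_def integrable_mu_tilde_iff cmod_U_fock_sq measurable_cong_sets[OF sets_mu_tilde refl])
  also have "\<dots> \<longleftrightarrow> integrable lborel (\<lambda>p. ?F (complex_vec (fst p) (snd p)))"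
    using integrable_mult_right[of "1 / 2 ^ CARD('n)" lborel "\<lambda>p. 2 ^ CARD('n) * ?F (complex_vec (fst p) (snd p))"] by auto
  also have "\<dots> \<longleftrightarrow> integrable lborel ?F"
    by (rule integral_complex_vec(2)) measurable
  finally show ?thesis unfolding fock_rescale(1)[OF \<alpha> f] .
qed

text \<open>The squared prefactor \<open>2 ^ CARD('n)\<close> of \<open>U_fock\<close> reduces the
  constant of \<open>mu_tilde\<close>, the inverse of \<open>(2 * pi) ^ CARD('n)\<close>, to the
  power of \<open>pi\<close> in the Fock norm.\<close>

lemma norm_U_fock:
  fixes f :: "'n::finite cvec \<Rightarrow> complex"
  assumes \<alpha>: "\<alpha> > 0" and f: "f \<in> borel_measurable borel" and si: "square_integrable (U_fock \<alpha> f)"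
  shows "norm (abs_l2 (U_fock \<alpha> f)) = fock_norm \<alpha> f"
proof -
  have [measurable]: "f \<in> borel_measurable borel" by (rule f)
  let ?F = "\<lambda>z. (cmod (f ((1 / sqrt \<alpha>) *\<^sub>R z)))\<^sup>2 * exp (- (norm z)\<^sup>2)"
  have "mu_const TYPE('n rvec \<times> 'n rvec) = 1 / (2 ^ CARD('n) * pi ^ CARD('n))"
  proof -
    have "mu_const TYPE('n rvec \<times> 'n rvec) = (2 * pi) powr (- real CARD('n))"
      unfolding mu_const_prod mu_const_rvec powr_add[symmetric] by simp
    also have "\<dots> = inverse ((2 * pi) ^ CARD('n))"
      by (simp only: powr_minus) (simp add: powr_realpow)
    finally show ?thesis by (simp add: power_mult_distrib inverse_eq_divide)
  qed
  moreover have "integral\<^sup>L lborel (\<lambda>p. ?F (complex_vec (fst p) (snd p))) = integral\<^sup>L lborel ?F"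
    by (rule integral_complex_vec(1)) measurable
  ultimately have "integral\<^sup>L mu_tilde (\<lambda>p. (cmod (U_fock \<alpha> f p))\<^sup>2) = integral\<^sup>L lborel ?F / pi ^ CARD('n)"
    unfolding cmod_U_fock_sq integral_mu_tilde integral_mult_right_zero by simp
  then show ?thesis
    unfolding norm_abs_l2[OF si] fock_norm_def fock_rescale(2)[OF \<alpha> f, symmetric] by simp
qed

lemma square_integrable_U_fock: "\<alpha> > 0 \<Longrightarrow> f \<in> fock_space \<alpha> m \<Longrightarrow> square_integrable (U_fock \<alpha> f)"
  using square_integrable_U_fock_iff fock_spaceD by blast

text \<open>The inner product with a test tensor is pulled back through the isometry
  \<open>fourier_tensor_id\<close>. There it pairs \<open>U_fock \<alpha> f\<close> with the inverse
  transform of the tensor and becomes, up to a constant, the integral that vanishes for m-analytic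
  functions.\<close>

theorem q_coeff_fock_eq_0:
  fixes f :: "'n::{finite,linorder} cvec \<Rightarrow> complex"
  assumes m: "m \<ge> 1" and \<alpha>: "\<alpha> > 0" and f: "f \<in> fock_space \<alpha> m"
    and g: "square_integrable g" "abs_l2 g = fourier_tensor_id (abs_l2 (U_fock \<alpha> f))"
    and l: "l \<notin> multi_indices m"
  shows "AE \<xi> in lborel. q_coeff l g \<xi> = 0"
proof (rule q_coeff_eq_0[OF g(1)])
  fix w :: "'n rvec"
  let ?Q = "q_tensor l (test_fun w)" and ?V = "inverse_partial_fourier (q_tensor l (test_fun w))"
  have slQ: "slice_integrable ?Q" by (rule slice_integrable_q_tensor[OF square_integrable_test_fun])
  have siQ: "square_integrable ?Q" using slQ by (simp add: slice_integrable_def)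
  note V = fourier_tensor_id_inverse[OF slQ]
  have siU: "square_integrable (U_fock \<alpha> f)" by (rule square_integrable_U_fock[OF \<alpha> f])
  have sum_l: "(\<Sum>r\<in>UNIV. l r) \<ge> m" using l m by (simp add: multi_indices_def)
  let ?g = "\<lambda>z. f ((1 / sqrt \<alpha>) *\<^sub>R z)"
  have orth: "integral\<^sup>L lborel (\<lambda>z. ?g z * (\<Prod>r\<in>UNIV. (z $ r - complex_of_real (w $ r)) ^ l r *
      fock_weight (complex_of_real (w $ r)) (z $ r))) = 0"
    by (rule polyanalytic_orthogonal[OF polyanalytic_scale[OF fock_spaceD(1)[OF f]] _ sum_l])
      (use fock_rescale(1)[OF \<alpha> fock_spaceD(3)[OF f]] fock_spaceD(4)[OF f] in simp)
  obtain C where C: "\<And>w x v. inverse_partial_fourier (q_tensor l (test_fun w)) (x, v) =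
    C * (\<Prod>r\<in>UNIV. (complex_of_real (x $ r - w $ r) - \<i> * complex_of_real (v $ r)) ^ l r *
      exp (complex_of_real (- (v $ r)\<^sup>2 / 2 - (x $ r - w $ r)\<^sup>2 / 2) - \<i> * complex_of_real ((x $ r - w $ r) * v $ r)))"
    using inverse_partial_fourier_test by blast
  define K where "K = complex_of_real (2 powr (real CARD('n) / 2)) * cnj C * (\<Prod>r\<in>UNIV. complex_of_real (exp (- (w $ r)\<^sup>2 / 2)))"
  have "U_fock \<alpha> f p * cnj (?V p) = K * (?g (complex_vec (fst p) (snd p)) * (\<Prod>r\<in>UNIV. (complex_vec (fst p) (snd p) $ r - complex_of_real (w $ r)) ^ l r *
      fock_weight (complex_of_real (w $ r)) (complex_vec (fst p) (snd p) $ r)))" for p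
  proof -
    obtain x v where p: "p = (x, v)" by (cases p)
    have e: "exp (complex_of_real (- (1/2) * (norm x)\<^sup>2 - (1/2) * (norm v)\<^sup>2) - \<i> * complex_of_real (x \<bullet> v)) =
        (\<Prod>r\<in>UNIV. exp (complex_of_real (- (1/2) * (x $ r)\<^sup>2 - (1/2) * (v $ r)\<^sup>2) - \<i> * complex_of_real (x $ r * v $ r)))"
      unfolding exp_sum[OF finite, symmetric]
      by (rule arg_cong[where f=exp])
        (simp add: norm_vec_sq inner_vec_def sum.distrib sum_subtractf sum_negf sum_divide_distrib sum_distrib_left algebra_simps)
    \<comment> \<open>In each coordinate the exponents add up to
      \<open>- w^2 / 2 - |z|^2 + w * cnj z\<close>: the last two terms are those of
      \<open>fock_weight\<close>, the first goes into \<open>K\<close>.\<close>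
    have factor: "exp (complex_of_real (- (1/2) * (x $ r)\<^sup>2 - (1/2) * (v $ r)\<^sup>2) - \<i> * complex_of_real (x $ r * v $ r)) *
        cnj ((complex_of_real (x $ r - w $ r) - \<i> * complex_of_real (v $ r)) ^ l r *
          exp (complex_of_real (- (v $ r)\<^sup>2 / 2 - (x $ r - w $ r)\<^sup>2 / 2) - \<i> * complex_of_real ((x $ r - w $ r) * v $ r))) =
        complex_of_real (exp (- (w $ r)\<^sup>2 / 2)) * ((complex_vec x v $ r - complex_of_real (w $ r)) ^ l r *
          fock_weight (complex_of_real (w $ r)) (complex_vec x v $ r))" for r
    proof -
      have "cnj (complex_of_real (x $ r - w $ r) - \<i> * complex_of_real (v $ r)) = complex_vec x v $ r - complex_of_real (w $ r)"
        by (simp add: complex_eq_iff)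
      moreover have "exp (complex_of_real (- (1/2) * (x $ r)\<^sup>2 - (1/2) * (v $ r)\<^sup>2) - \<i> * complex_of_real (x $ r * v $ r)) *
          cnj (exp (complex_of_real (- (v $ r)\<^sup>2 / 2 - (x $ r - w $ r)\<^sup>2 / 2) - \<i> * complex_of_real ((x $ r - w $ r) * v $ r))) =
          complex_of_real (exp (- (w $ r)\<^sup>2 / 2)) * fock_weight (complex_of_real (w $ r)) (complex_vec x v $ r)"
        unfolding fock_weight_def exp_cnj exp_of_real[symmetric] exp_add[symmetric]
        by (rule arg_cong[where f=exp]) (simp add: complex_eq_iff power2_eq_square field_simps)
      ultimately show ?thesis
        by (simp only: complex_cnj_mult complex_cnj_power) (simp only: mult_ac)
    qed
    have prods: "(\<Prod>r\<in>UNIV. exp (complex_of_real (- (1/2) * (x $ r)\<^sup>2 - (1/2) * (v $ r)\<^sup>2) - \<i> * complex_of_real (x $ r * v $ r))) *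
        cnj (\<Prod>r\<in>UNIV. (complex_of_real (x $ r - w $ r) - \<i> * complex_of_real (v $ r)) ^ l r *
          exp (complex_of_real (- (v $ r)\<^sup>2 / 2 - (x $ r - w $ r)\<^sup>2 / 2) - \<i> * complex_of_real ((x $ r - w $ r) * v $ r))) =
        (\<Prod>r\<in>UNIV. complex_of_real (exp (- (w $ r)\<^sup>2 / 2))) * (\<Prod>r\<in>UNIV. (complex_vec x v $ r - complex_of_real (w $ r)) ^ l r *
          fock_weight (complex_of_real (w $ r)) (complex_vec x v $ r))"
      unfolding cnj_prod prod.distrib[symmetric] factor ..
    have rearrange: "b * A * F * (c * B) = b * c * E * (F * G)" if "A * B = E * G" for b A F c B E G :: complex
      using arg_cong[OF that, of "\<lambda>t. b * c * F * t"] by (simp only: mult_ac)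
    show ?thesis
      unfolding p fst_conv snd_conv U_fock_eq C e K_def complex_cnj_mult[of C]
      by (rule rearrange[OF prods])
  qed
  note UV = this
  have [measurable]: "f \<in> borel_measurable borel" by (rule fock_spaceD(3)[OF f])
  have "(\<lambda>z. ?g z * (\<Prod>r\<in>UNIV. (z $ r - complex_of_real (w $ r)) ^ l r *
      fock_weight (complex_of_real (w $ r)) (z $ r))) \<in> borel_measurable borel"
  proof -
    have [measurable]: "(\<lambda>z :: 'n cvec. z $ r) \<in> borel_measurable borel" for r
      by (intro borel_measurable_continuous_onI continuous_intros)
    have [measurable]: "fock_weight c \<in> borel_measurable borel" for c
      using c1_dbar_continuous(1)[OF c1_dbar_fock_weight, of c] by (rule borel_measurable_continuous_onI)
    show ?thesis
      by (intro borel_measurable_times borel_measurable_prod) measurable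
  qed
  from integral_complex_vec(1)[OF this] have "integral\<^sup>L mu_tilde (\<lambda>p. U_fock \<alpha> f p * cnj (?V p)) = 0"
    unfolding UV integral_mu_tilde integral_mult_right_zero orth by simp
  \<comment> \<open>All complex multiples are included because the inner product of
    \<open>l2\<close> keeps the real part only.\<close>
  then have inner0: "abs_l2 (U_fock \<alpha> f) \<bullet> scaleC_l2 c (abs_l2 ?V) = 0" for c
    by (simp add: abs_l2_scaleC V(1) inner_abs_l2 siU square_integrable_scale mult.left_commute)
  show "integral\<^sup>L mu_tilde (\<lambda>p. g p * cnj (?Q p)) = 0"
  proof (rule inner_scaleC_left_all_zero[OF g(1) siQ])
    fix c
    have "abs_l2 g \<bullet> scaleC_l2 c (abs_l2 ?Q) = fourier_tensor_id (abs_l2 (U_fock \<alpha> f)) \<bullet> fourier_tensor_id (scaleC_l2 c (abs_l2 ?V))"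
      by (simp add: g(2) V(2) fourier_tensor_id_properties(2))
    then show "abs_l2 g \<bullet> scaleC_l2 c (abs_l2 ?Q) = 0"
      by (simp add: inner_fourier_tensor_id inner0)
  qed
qed

section \<open>Construction of preimages from entire functions\<close>

subsection \<open>Entire functions given by Laplace integrals\<close>

text \<open>Bilinear, without conjugation, so that the dependence on \<open>z\<close> is
  holomorphic.\<close>

definition cdot :: "'n::finite cvec \<Rightarrow> 'n rvec \<Rightarrow> complex" where
  "cdot z \<xi> = (\<Sum>r\<in>UNIV. z $ r * complex_of_real (\<xi> $ r))"

lemma cdot_add: "cdot (z + w) \<xi> = cdot z \<xi> + cdot w \<xi>"
  by (simp add: cdot_def distrib_right sum.distrib)

lemma cdot_measurable [measurable]: "(\<lambda>\<xi>. cdot z \<xi>) \<in> borel_measurable borel"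
  unfolding cdot_def by (intro borel_measurable_continuous_onI continuous_intros)

lemma cdot_bound:
  fixes z :: "'n::finite cvec"
  shows "cmod (cdot z \<xi>) \<le> real CARD('n) * norm z * norm \<xi>"
proof -
  have "cmod (cdot z \<xi>) \<le> (\<Sum>r\<in>(UNIV :: 'n set). norm z * norm \<xi>)"
    unfolding cdot_def
  proof (rule order_trans[OF norm_sum sum_mono])
    fix r
    show "cmod (z $ r * complex_of_real (\<xi> $ r)) \<le> norm z * norm \<xi>"
      unfolding norm_mult norm_of_real using Finite_Cartesian_Product.norm_nth_le[of \<xi> r]
      by (intro mult_mono Finite_Cartesian_Product.norm_nth_le) auto
  qed
  then show ?thesis by (simp add: mult.assoc)
qed

text \<open>Decay against every exponential makes the Laplace integral converge at all complex
  points. The class is stable under multiplication by coordinates, that is, under differentiation of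
  the integral.\<close>

definition rapid :: "('n::finite rvec \<Rightarrow> complex) \<Rightarrow> bool" where
  "rapid \<eta> \<longleftrightarrow> \<eta> \<in> borel_measurable borel \<and> (\<forall>c. integrable mu_tilde (\<lambda>\<xi>. cmod (\<eta> \<xi>) * exp (c * norm \<xi>)))"

lemma rapid_mult:
  assumes \<eta>: "rapid \<eta>" and [measurable]: "g \<in> borel_measurable borel"
    and g: "\<And>\<xi>. cmod (g \<xi>) \<le> C * exp (a * norm \<xi>)"
  shows "rapid (\<lambda>\<xi>. \<eta> \<xi> * g \<xi>)"
proof -
  have [measurable]: "\<eta> \<in> borel_measurable borel" using \<eta> by (simp add: rapid_def)
  have "integrable mu_tilde (\<lambda>\<xi>. cmod (\<eta> \<xi> * g \<xi>) * exp (c * norm \<xi>))" for c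
  proof (rule Bochner_Integration.integrable_bound)
    show "integrable mu_tilde (\<lambda>\<xi>. C * (cmod (\<eta> \<xi>) * exp ((a + c) * norm \<xi>)))"
      using \<eta> by (intro integrable_mult_right) (simp add: rapid_def)
    show "AE \<xi> in mu_tilde. norm (cmod (\<eta> \<xi> * g \<xi>) * exp (c * norm \<xi>)) \<le> norm (C * (cmod (\<eta> \<xi>) * exp ((a + c) * norm \<xi>)))"
    proof (rule AE_I2)
      fix \<xi>
      have "cmod (\<eta> \<xi>) * (cmod (g \<xi>) * exp (c * norm \<xi>)) \<le> cmod (\<eta> \<xi>) * (C * exp (a * norm \<xi>) * exp (c * norm \<xi>))"
        using g by (intro mult_left_mono mult_right_mono) auto
      also have "\<dots> = C * (cmod (\<eta> \<xi>) * exp ((a + c) * norm \<xi>))"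
        by (simp add: distrib_right exp_add)
      also have "\<dots> \<le> norm (C * (cmod (\<eta> \<xi>) * exp ((a + c) * norm \<xi>)))" by simp
      finally show "norm (cmod (\<eta> \<xi> * g \<xi>) * exp (c * norm \<xi>)) \<le> norm (C * (cmod (\<eta> \<xi>) * exp ((a + c) * norm \<xi>)))"
        by (simp add: norm_mult mult.assoc)
    qed
  qed measurable
  then show ?thesis by (simp add: rapid_def)
qed

lemma rapid_coordinate:
  assumes "rapid \<eta>"
  shows "rapid (\<lambda>\<xi>. \<eta> \<xi> * (\<i> * complex_of_real (\<xi> $ r)))"
proof (rule rapid_mult[OF assms])
  show "(\<lambda>\<xi>. \<i> * complex_of_real (\<xi> $ r)) \<in> borel_measurable borel"
    by (intro borel_measurable_continuous_onI continuous_intros)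
  show "cmod (\<i> * complex_of_real (\<xi> $ r)) \<le> 1 * exp (1 * norm \<xi>)" for \<xi>
  proof -
    have "\<bar>\<xi> $ r\<bar> \<le> norm \<xi>" using Finite_Cartesian_Product.norm_nth_le[of \<xi> r] by simp
    moreover have "norm \<xi> \<le> exp (norm \<xi>)" using exp_ge_add_one_self[of "norm \<xi>"] by linarith
    ultimately show ?thesis by (simp add: norm_mult)
  qed
qed

definition laplace :: "('n::finite rvec \<Rightarrow> complex) \<Rightarrow> 'n cvec \<Rightarrow> complex" where
  "laplace \<eta> z = integral\<^sup>L mu_tilde (\<lambda>\<xi>. \<eta> \<xi> * exp (\<i> * cdot z \<xi>))"

lemma cmod_exp_cdot: "cmod (exp (\<i> * cdot z \<xi>)) \<le> exp (real CARD('n) * norm z * norm \<xi>)"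
  for z :: "'n::finite cvec"
proof -
  have "Re (\<i> * cdot z \<xi>) \<le> cmod (cdot z \<xi>)"
    using complex_Re_le_cmod[of "\<i> * cdot z \<xi>"] by (simp add: norm_mult)
  then show ?thesis
    unfolding norm_exp_eq_Re using cdot_bound[of z \<xi>] by simp
qed

lemma integrable_laplace:
  fixes \<eta> :: "'n::finite rvec \<Rightarrow> complex"
  assumes \<eta>: "rapid \<eta>"
  shows "integrable mu_tilde (\<lambda>\<xi>. \<eta> \<xi> * exp (\<i> * cdot z \<xi>))"
proof (rule Bochner_Integration.integrable_bound)
  have [measurable]: "\<eta> \<in> borel_measurable borel" using \<eta> by (simp add: rapid_def)
  show "integrable mu_tilde (\<lambda>\<xi>. cmod (\<eta> \<xi>) * exp (real CARD('n) * norm z * norm \<xi>))"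
    using \<eta> by (simp add: rapid_def)
  show "(\<lambda>\<xi>. \<eta> \<xi> * exp (\<i> * cdot z \<xi>)) \<in> borel_measurable mu_tilde" by measurable
  show "AE \<xi> in mu_tilde. norm (\<eta> \<xi> * exp (\<i> * cdot z \<xi>)) \<le> norm (cmod (\<eta> \<xi>) * exp (real CARD('n) * norm z * norm \<xi>))"
    unfolding norm_mult[of "_ :: complex"]
    by (rule AE_I2, rule order_trans[OF mult_left_mono[OF cmod_exp_cdot norm_ge_zero]]) simp
qed

text \<open>Differentiation under the integral with a quadratic remainder:
  \<open>|exp u - 1 - u| \<le> exp |Re u| * |u|^2\<close>, integrated against
  \<open>\<eta>\<close>.\<close>

lemma laplace_has_derivative:
  fixes \<eta> :: "'n::finite rvec \<Rightarrow> complex"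
  assumes \<eta>: "rapid \<eta>"
  shows "(laplace \<eta> has_derivative (\<lambda>h. \<Sum>r\<in>UNIV. h $ r * laplace (\<lambda>\<xi>. \<eta> \<xi> * (\<i> * complex_of_real (\<xi> $ r))) z)) (at z)"
proof -
  let ?N = "real CARD('n)"
  let ?D = "\<lambda>h. \<Sum>r\<in>UNIV. h $ r * laplace (\<lambda>\<xi>. \<eta> \<xi> * (\<i> * complex_of_real (\<xi> $ r))) z"
  \<comment> \<open>The three summands pay for \<open>exp (\<i> * cdot z \<xi>)\<close>, for
    \<open>exp |Re u|\<close> with \<open>norm h \<le> 1\<close>, and for
    \<open>(norm \<xi>)^2 \<le> exp (2 * norm \<xi>)\<close>.\<close>
  define c where "c = ?N * norm z + ?N + 2"
  define K where "K = integral\<^sup>L mu_tilde (\<lambda>\<xi>. ?N\<^sup>2 * (cmod (\<eta> \<xi>) * exp (c * norm \<xi>)))"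
  have intK: "integrable mu_tilde (\<lambda>\<xi>. ?N\<^sup>2 * (cmod (\<eta> \<xi>) * exp (c * norm \<xi>)))"
    using \<eta> by (intro integrable_mult_right) (simp add: rapid_def)
  show ?thesis
  proof (rule has_derivativeI_sandwich[where e=1 and H="\<lambda>y. K * norm (y - z)"])
    show "bounded_linear ?D"
      by (intro bounded_linear_sum bounded_linear_mult_left[THEN bounded_linear_compose] bounded_linear_vec_nth)
    show "((\<lambda>y. K * norm (y - z)) \<longlongrightarrow> 0) (at z within UNIV)"
    proof -
      have "((\<lambda>y. K * norm (y - z)) \<longlongrightarrow> K * norm (z - z)) (at z)"
        by (intro tendsto_intros)
      then show ?thesis by simp
    qed
    fix y assume y: "y \<noteq> z" "dist y z < 1"
    define h where "h = y - z"
    have h: "norm h \<le> 1" "h \<noteq> 0" using y by (auto simp: h_def dist_norm)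
    let ?u = "\<lambda>\<xi>. \<i> * cdot h \<xi>"
    have D_u: "(\<Sum>r\<in>UNIV. h $ r * (\<eta> \<xi> * (\<i> * complex_of_real (\<xi> $ r)) * exp (\<i> * cdot z \<xi>))) = \<eta> \<xi> * exp (\<i> * cdot z \<xi>) * ?u \<xi>" for \<xi>
      unfolding cdot_def[of h] sum_distrib_left by (intro sum.cong refl) (simp only: mult_ac)
    have D_eq: "?D h = integral\<^sup>L mu_tilde (\<lambda>\<xi>. \<eta> \<xi> * exp (\<i> * cdot z \<xi>) * ?u \<xi>)"
    proof -
      have "?D h = (\<Sum>r\<in>UNIV. integral\<^sup>L mu_tilde (\<lambda>\<xi>. h $ r * (\<eta> \<xi> * (\<i> * complex_of_real (\<xi> $ r)) * exp (\<i> * cdot z \<xi>))))"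
        by (simp add: laplace_def)
      also have "\<dots> = integral\<^sup>L mu_tilde (\<lambda>\<xi>. \<Sum>r\<in>UNIV. h $ r * (\<eta> \<xi> * (\<i> * complex_of_real (\<xi> $ r)) * exp (\<i> * cdot z \<xi>)))"
        by (rule Bochner_Integration.integral_sum[symmetric])
          (intro integrable_mult_right integrable_laplace rapid_coordinate \<eta>)
      also have "\<dots> = integral\<^sup>L mu_tilde (\<lambda>\<xi>. \<eta> \<xi> * exp (\<i> * cdot z \<xi>) * ?u \<xi>)"
        by (simp only: D_u)
      finally show ?thesis .
    qed
    have intu: "integrable mu_tilde (\<lambda>\<xi>. \<eta> \<xi> * exp (\<i> * cdot z \<xi>) * ?u \<xi>)"
    proof -
      have "integrable mu_tilde (\<lambda>\<xi>. \<Sum>r\<in>UNIV. h $ r * (\<eta> \<xi> * (\<i> * complex_of_real (\<xi> $ r)) * exp (\<i> * cdot z \<xi>)))"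
        by (intro Bochner_Integration.integrable_sum integrable_mult_right integrable_laplace rapid_coordinate \<eta>)
      then show ?thesis by (simp only: D_u)
    qed
    have "laplace \<eta> y - laplace \<eta> z - ?D h = integral\<^sup>L mu_tilde (\<lambda>\<xi>. \<eta> \<xi> * exp (\<i> * cdot z \<xi>) * (exp (?u \<xi>) - 1 - ?u \<xi>))"
    proof -
      have "y = z + h" by (simp add: h_def)
      then have "\<eta> \<xi> * exp (\<i> * cdot z \<xi>) * (exp (?u \<xi>) - 1 - ?u \<xi>) =
          (\<eta> \<xi> * exp (\<i> * cdot y \<xi>) - \<eta> \<xi> * exp (\<i> * cdot z \<xi>)) - \<eta> \<xi> * exp (\<i> * cdot z \<xi>) * ?u \<xi>" for \<xi>
        by (simp add: cdot_add distrib_left exp_add algebra_simps)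
      then show ?thesis
        unfolding D_eq unfolding laplace_def
        by (simp only: Bochner_Integration.integral_diff integrable_laplace[OF \<eta>] intu Bochner_Integration.integrable_diff)
    qed
    also have "cmod \<dots> \<le> integral\<^sup>L mu_tilde (\<lambda>\<xi>. (norm h)\<^sup>2 * (?N\<^sup>2 * (cmod (\<eta> \<xi>) * exp (c * norm \<xi>))))"
    proof (rule Bochner_Integration.integral_norm_bound_integral)
      have [measurable]: "\<eta> \<in> borel_measurable borel" using \<eta> by (simp add: rapid_def)
      show "integrable mu_tilde (\<lambda>\<xi>. (norm h)\<^sup>2 * (?N\<^sup>2 * (cmod (\<eta> \<xi>) * exp (c * norm \<xi>))))"
        by (rule integrable_mult_right[OF intK])
      have bound: "norm (\<eta> \<xi> * exp (\<i> * cdot z \<xi>) * (exp (?u \<xi>) - 1 - ?u \<xi>)) \<le> (norm h)\<^sup>2 * (?N\<^sup>2 * (cmod (\<eta> \<xi>) * exp (c * norm \<xi>)))" for \<xi>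
      proof -
        have u: "cmod (?u \<xi>) \<le> ?N * norm h * norm \<xi>"
          using cdot_bound[of h \<xi>] by (simp add: norm_mult)
        have "?N * norm h * norm \<xi> \<le> ?N * norm \<xi>"
          using h(1) by (simp add: mult_right_mono mult_left_le)
        then have Re: "\<bar>Re (?u \<xi>)\<bar> \<le> ?N * norm \<xi>"
          using u abs_Re_le_cmod[of "?u \<xi>"] by linarith
        have "cmod (exp (?u \<xi>) - (\<Sum>k\<le>1. ?u \<xi> ^ k / fact k)) \<le> exp \<bar>Re (?u \<xi>)\<bar> * cmod (?u \<xi>) ^ Suc 1 / fact 1"
          by (rule Taylor_exp)
        then have "cmod (exp (?u \<xi>) - 1 - ?u \<xi>) \<le> exp \<bar>Re (?u \<xi>)\<bar> * (cmod (?u \<xi>))\<^sup>2"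
          by (simp add: power2_eq_square algebra_simps)
        also have "\<dots> \<le> exp (?N * norm \<xi>) * (?N * norm h * norm \<xi>)\<^sup>2"
          using u Re by (intro mult_mono power_mono) auto
        also have "\<dots> = (norm h)\<^sup>2 * (?N\<^sup>2 * (exp (?N * norm \<xi>) * (norm \<xi>)\<^sup>2))"
          by (simp add: power_mult_distrib)
        also have "\<dots> \<le> (norm h)\<^sup>2 * (?N\<^sup>2 * (exp (?N * norm \<xi>) * exp (2 * norm \<xi>)))"
        proof (intro mult_left_mono)
          have "norm \<xi> \<le> exp (norm \<xi>)" using exp_ge_add_one_self[of "norm \<xi>"] by linarith
          then have "(norm \<xi>)\<^sup>2 \<le> (exp (norm \<xi>))\<^sup>2" by (intro power_mono) auto
          then show "(norm \<xi>)\<^sup>2 \<le> exp (2 * norm \<xi>)" by (simp add: exp_double)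
        qed auto
        finally have R: "cmod (exp (?u \<xi>) - 1 - ?u \<xi>) \<le> (norm h)\<^sup>2 * (?N\<^sup>2 * (exp (?N * norm \<xi>) * exp (2 * norm \<xi>)))" .
        have "cmod (\<eta> \<xi>) * cmod (exp (\<i> * cdot z \<xi>)) * cmod (exp (?u \<xi>) - 1 - ?u \<xi>) \<le>
            cmod (\<eta> \<xi>) * exp (?N * norm z * norm \<xi>) * ((norm h)\<^sup>2 * (?N\<^sup>2 * (exp (?N * norm \<xi>) * exp (2 * norm \<xi>))))"
          by (intro mult_mono R cmod_exp_cdot) auto
        also have "\<dots> = (norm h)\<^sup>2 * (?N\<^sup>2 * (cmod (\<eta> \<xi>) * exp (c * norm \<xi>)))"
          by (simp add: c_def distrib_right exp_add)
        finally show ?thesis by (simp only: norm_mult)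
      qed
      then show "norm (\<eta> \<xi> * exp (\<i> * cdot z \<xi>) * (exp (?u \<xi>) - 1 - ?u \<xi>)) \<le> (norm h)\<^sup>2 * (?N\<^sup>2 * (cmod (\<eta> \<xi>) * exp (c * norm \<xi>)))" for \<xi> .
      have meas: "(\<lambda>\<xi>. \<eta> \<xi> * exp (\<i> * cdot z \<xi>) * (exp (?u \<xi>) - 1 - ?u \<xi>)) \<in> borel_measurable mu_tilde"
        by measurable
      show "integrable mu_tilde (\<lambda>\<xi>. \<eta> \<xi> * exp (\<i> * cdot z \<xi>) * (exp (?u \<xi>) - 1 - ?u \<xi>))"
      proof (rule Bochner_Integration.integrable_bound[OF integrable_mult_right[OF intK] meas])
        show "AE \<xi> in mu_tilde. norm (\<eta> \<xi> * exp (\<i> * cdot z \<xi>) * (exp (?u \<xi>) - 1 - ?u \<xi>)) \<le> norm ((norm h)\<^sup>2 * (?N\<^sup>2 * (cmod (\<eta> \<xi>) * exp (c * norm \<xi>))))"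
          using bound by (intro AE_I2) (simp only: real_norm_def abs_of_nonneg mult_nonneg_nonneg zero_le_power2 norm_ge_zero exp_ge_zero)
      qed
    qed
    also have "\<dots> = K * (norm h)\<^sup>2"
      by (simp add: K_def)
    finally have "cmod (laplace \<eta> y - laplace \<eta> z - ?D h) \<le> K * (norm h)\<^sup>2" .
    then have "cmod (laplace \<eta> y - laplace \<eta> z - ?D h) / norm h \<le> K * norm h"
      using h(2) by (simp add: divide_le_eq power2_eq_square mult.assoc)
    then show "norm (laplace \<eta> y - laplace \<eta> z - ?D (y - z)) / norm (y - z) \<le> K * norm (y - z)"
      by (simp only: h_def)
  qed simp
qed

definition holomorphic_vec :: "('n::finite cvec \<Rightarrow> complex) \<Rightarrow> bool" where
  "holomorphic_vec G \<longleftrightarrow> smooth G \<and> (\<forall>r z. wirtinger_bar r G z = 0)"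

lemma times_cont_differentiable_sum:
  "(\<And>i. i \<in> I \<Longrightarrow> times_cont_differentiable k (f i)) \<Longrightarrow> times_cont_differentiable k (\<lambda>x. \<Sum>i\<in>I. f i x)"
  by (induction I rule: infinite_finite_induct) (auto intro: times_cont_differentiable_add)

text \<open>The partial derivatives are Laplace integrals of \<open>\<eta>\<close> times a
  coordinate, which is rapid again; so smoothness follows by induction. The derivative is complex
  linear, and this kills the Wirtinger derivatives.\<close>

lemma holomorphic_vec_laplace:
  fixes \<eta> :: "'n::finite rvec \<Rightarrow> complex"
  assumes "rapid \<eta>"
  shows "holomorphic_vec (laplace \<eta>)"
proof -
  have "times_cont_differentiable k (laplace \<eta>)" if "rapid \<eta>" for k and \<eta> :: "'n rvec \<Rightarrow> complex"
    using that
  proof (induction k arbitrary: \<eta>)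
    case 0
    then show ?case
      using laplace_has_derivative has_derivative_continuous by (fastforce simp: continuous_on_eq_continuous_within)
  next
    case (Suc k)
    show ?case
      by (rule times_cont_differentiable_SucI[OF laplace_has_derivative[OF Suc.prems]])
        (intro times_cont_differentiable_sum times_cont_differentiable_mult times_cont_differentiable_const Suc.IH rapid_coordinate Suc.prems)
  qed
  then have "smooth (laplace \<eta>)" using assms by (simp add: smooth_def)
  moreover have "wirtinger_bar r (laplace \<eta>) z = 0" for r z
  proof -
    have "(\<Sum>s\<in>UNIV. axis r c $ s * laplace (\<lambda>\<xi>. \<eta> \<xi> * (\<i> * complex_of_real (\<xi> $ s))) z) =
        c * laplace (\<lambda>\<xi>. \<eta> \<xi> * (\<i> * complex_of_real (\<xi> $ r))) z" for c
      by (simp add: axis_def if_distrib[of "\<lambda>t. t * _"] cong: if_cong)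
    then show ?thesis
      by (simp add: wirtinger_bar_eqI[OF laplace_has_derivative[OF assms]] mult.assoc[symmetric])
  qed
  ultimately show ?thesis by (simp add: holomorphic_vec_def)
qed

lemma holomorphic_vec_mult:
  assumes F: "holomorphic_vec F" and G: "holomorphic_vec G"
  shows "holomorphic_vec (\<lambda>z. F z * G z)"
proof -
  have sm: "smooth F" "smooth G" using F G by (auto simp: holomorphic_vec_def)
  have "wirtinger_bar r (\<lambda>z. F z * G z) z = 0" for r z
    using wirtinger_bar_mult[OF smooth_has_derivative[OF sm(1)] smooth_has_derivative[OF sm(2)], of r z] F G
    by (simp add: holomorphic_vec_def)
  then show ?thesis using sm by (auto simp: holomorphic_vec_def)
qed

lemma holomorphic_vec_const: "holomorphic_vec (\<lambda>_. c)"
  using wirtinger_bar_eqI[OF has_derivative_const] by (auto simp: holomorphic_vec_def)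

text \<open>This entire function undoes the holomorphic part of the factor in \<open>U_fock\<close>;
  what is left of that factor is a constant times \<open>exp (- |v|^2)\<close>.\<close>

lemma holomorphic_vec_exp_square: "holomorphic_vec (\<lambda>z :: 'n::finite cvec. exp ((\<Sum>r\<in>UNIV. (z $ r)\<^sup>2) / 2))"
proof -
  have sq: "smooth (\<lambda>z :: 'n cvec. (\<Sum>r\<in>UNIV. (z $ r)\<^sup>2) * (1 / 2))"
    by (intro smooth_mult smooth_sum smooth_power smooth_const smooth_linear bounded_linear_vec_nth)
  have D: "((\<lambda>z :: 'n cvec. exp ((\<Sum>r\<in>UNIV. (z $ r)\<^sup>2) / 2)) has_derivative
      (\<lambda>h. exp ((\<Sum>r\<in>UNIV. (z $ r)\<^sup>2) / 2) * (\<Sum>r\<in>UNIV. z $ r * h $ r))) (at z)" for z :: "'n cvec"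
  proof (rule has_derivative_exp_complex)
    have "((\<lambda>z :: 'n cvec. (\<Sum>r\<in>UNIV. (z $ r)\<^sup>2) * (1 / 2)) has_derivative
        (\<lambda>h. (\<Sum>r\<in>UNIV. 2 * z $ r * h $ r) * (1 / 2))) (at z)"
      by (intro has_derivative_mult_left has_derivative_sum)
        (auto intro!: derivative_eq_intros bounded_linear_imp_has_derivative bounded_linear_vec_nth simp: mult_ac)
    then show "((\<lambda>z :: 'n cvec. (\<Sum>r\<in>UNIV. (z $ r)\<^sup>2) / 2) has_derivative (\<lambda>h. \<Sum>r\<in>UNIV. z $ r * h $ r)) (at z)"
      by (simp add: sum_distrib_left[symmetric] mult.assoc)
  qed
  have "(\<Sum>s\<in>UNIV. z $ s * axis r c $ s) = z $ r * c" for z :: "'n cvec" and r c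
    by (simp add: axis_def if_distrib[of "\<lambda>t. _ * t"] cong: if_cong)
  then have "wirtinger_bar r (\<lambda>z :: 'n cvec. exp ((\<Sum>r\<in>UNIV. (z $ r)\<^sup>2) / 2)) z = 0" for r z
    by (simp add: wirtinger_bar_eqI[OF D] algebra_simps)
  then show ?thesis
    using smooth_exp[OF sq] by (simp add: holomorphic_vec_def)
qed

subsection \<open>Polynomials in the imaginary parts with holomorphic coefficients\<close>

definition im_monom :: "('n::finite \<Rightarrow> nat) \<Rightarrow> 'n cvec \<Rightarrow> complex" where
  "im_monom l z = (\<Prod>r\<in>UNIV. complex_of_real (Im (z $ r)) ^ l r)"

lemma smooth_im_monom: "smooth (im_monom l)"
  unfolding im_monom_def[abs_def]
  by (intro smooth_prod smooth_power smooth_linear)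
    (intro bounded_linear_compose[OF bounded_linear_of_real] bounded_linear_compose[OF bounded_linear_Im] bounded_linear_vec_nth)

text \<open>Since \<open>Im \<zeta> = (\<zeta> - cnj \<zeta>) / (2 \<i>)\<close>, its Wirtinger
  derivative is the constant \<open>\<i> / 2\<close>.\<close>

lemma c1_dbar_im_power: "c1_dbar (\<lambda>\<zeta>. complex_of_real (Im \<zeta>) ^ j) (\<lambda>\<zeta>. \<i> / 2 * of_nat j * complex_of_real (Im \<zeta>) ^ (j - 1))"
proof (rule c1_dbarI)
  show "((\<lambda>\<zeta>. complex_of_real (Im \<zeta>) ^ j) has_derivative (\<lambda>h. of_nat j * complex_of_real (Im \<zeta>) ^ (j - 1) * complex_of_real (Im h))) (at \<zeta>)" for \<zeta>
    by (auto intro!: derivative_eq_intros simp: mult_ac)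
  show "continuous_on UNIV (\<lambda>\<zeta>. of_nat j * complex_of_real (Im \<zeta>) ^ (j - 1) * complex_of_real (Im h))" for h
    by (intro continuous_intros)
qed simp

lemma wirtinger_bar_im_monom:
  assumes G: "holomorphic_vec G"
  shows "wirtinger_bar s (\<lambda>z. im_monom l z * G z) = (\<lambda>z. \<i> / 2 * of_nat (l s) * (im_monom (l(s := l s - 1)) z * G z))"
proof
  fix z
  have "wirtinger_bar s (im_monom l) z = \<i> / 2 * of_nat (l s) * complex_of_real (Im (z $ s)) ^ (l s - 1) *
      (\<Prod>r\<in>UNIV - {s}. complex_of_real (Im (z $ r)) ^ l r)"
    unfolding im_monom_def[abs_def] by (rule wirtinger_bar_prod[OF c1_dbar_im_power])
  also have "\<dots> = \<i> / 2 * of_nat (l s) * im_monom (l(s := l s - 1)) z"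
    by (simp add: im_monom_def prod.remove[of UNIV s])
  finally have "wirtinger_bar s (im_monom l) z = \<i> / 2 * of_nat (l s) * im_monom (l(s := l s - 1)) z" .
  then show "wirtinger_bar s (\<lambda>z. im_monom l z * G z) z = \<i> / 2 * of_nat (l s) * (im_monom (l(s := l s - 1)) z * G z)"
    using wirtinger_bar_mult[OF smooth_has_derivative[OF smooth_im_monom] smooth_has_derivative, of G s l z] G
    by (simp add: holomorphic_vec_def)
qed

lemma smooth_im_monom_mult: "holomorphic_vec G \<Longrightarrow> smooth (\<lambda>z. im_monom l z * G z)"
  by (auto simp: holomorphic_vec_def intro: smooth_im_monom)

text \<open>Truncated subtraction does the bookkeeping: as soon as \<open>n\<close> exceeds
  \<open>l s\<close>, the factor with \<open>i = l s\<close> is zero, and with it the whole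
  derivative.\<close>

lemma wirtinger_bar_funpow_im_monom:
  assumes G: "holomorphic_vec G"
  shows "(wirtinger_bar s ^^ n) (\<lambda>z. im_monom l z * G z) =
    (\<lambda>z. (\<Prod>i<n. \<i> / 2 * of_nat (l s - i)) * (im_monom (l(s := l s - n)) z * G z))"
proof (induction n)
  case (Suc n)
  have l: "(l(s := l s - n))(s := l s - n - 1) = l(s := l s - Suc n)" "(l(s := l s - n)) s = l s - n"
    by auto
  show ?case
    unfolding funpow.simps comp_apply Suc.IH wirtinger_bar_cmult[OF smooth_im_monom_mult[OF G]] wirtinger_bar_im_monom[OF G] l
    by (simp only: prod.lessThan_Suc mult_ac)
qed simp

lemma wirtinger_bar_foldr_im_monom:
  assumes G: "holomorphic_vec G"
  shows "distinct rs \<Longrightarrow> foldr (\<lambda>r g. (wirtinger_bar r ^^ k r) g) rs (\<lambda>z. im_monom l z * G z) =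
    (\<lambda>z. (\<Prod>r\<in>set rs. \<Prod>i<k r. \<i> / 2 * of_nat (l r - i)) * (im_monom (\<lambda>r. if r \<in> set rs then l r - k r else l r) z * G z))"
proof (induction rs)
  case (Cons s rs)
  let ?l = "\<lambda>r. if r \<in> set rs then l r - k r else l r"
  let ?c = "\<Prod>r\<in>set rs. \<Prod>i<k r. \<i> / 2 * of_nat (l r - i)"
  \<comment> \<open>The dilation by \<open>1\<close> is inserted so that the scaling rule, which
    also carries a constant factor, applies.\<close>
  have "foldr (\<lambda>r g. (wirtinger_bar r ^^ k r) g) (s # rs) (\<lambda>z. im_monom l z * G z) =
      (wirtinger_bar s ^^ k s) (\<lambda>z. ?c * (im_monom ?l (1 *\<^sub>R z) * G (1 *\<^sub>R z)))"
    using Cons by simp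
  also have "\<dots> = (\<lambda>z. ?c * (wirtinger_bar s ^^ k s) (\<lambda>z. im_monom ?l z * G z) z)"
    using wirtinger_bar_funpow_scale[OF smooth_im_monom_mult[OF G, of ?l], where r=s and n="k s" and e="?c" and c=1] by simp
  also have "\<dots> = (\<lambda>z. ?c * ((\<Prod>i<k s. \<i> / 2 * of_nat (?l s - i)) * (im_monom (?l(s := ?l s - k s)) z * G z)))"
    by (simp only: wirtinger_bar_funpow_im_monom[OF G])
  also have "?l(s := ?l s - k s) = (\<lambda>r. if r \<in> set (s # rs) then l r - k r else l r)"
    using Cons.prems by auto
  finally show ?case
    using Cons.prems by (simp add: mult_ac)
qed simp

lemma wirtinger_bar_sum:
  assumes "finite I" "\<And>i. i \<in> I \<Longrightarrow> smooth (f i)"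
  shows "wirtinger_bar r (\<lambda>z. \<Sum>i\<in>I. f i z) = (\<lambda>z. \<Sum>i\<in>I. wirtinger_bar r (f i) z)"
  using assms
proof (induction I rule: finite_induct)
  case empty
  show ?case using wirtinger_bar_eqI[OF has_derivative_const, of r 0] by auto
next
  case (insert i I)
  have "wirtinger_bar r (\<lambda>z. f i z + (\<Sum>i\<in>I. f i z)) z = wirtinger_bar r (f i) z + wirtinger_bar r (\<lambda>z. \<Sum>i\<in>I. f i z) z" for z
    using insert.prems by (intro wirtinger_bar_add[OF smooth_has_derivative smooth_has_derivative] smooth_sum) auto
  then show ?case using insert by auto
qed

lemma wirtinger_bar_funpow_sum:
  assumes "finite I" "\<And>i. i \<in> I \<Longrightarrow> smooth (f i)"
  shows "(wirtinger_bar r ^^ n) (\<lambda>z. \<Sum>i\<in>I. f i z) = (\<lambda>z. \<Sum>i\<in>I. (wirtinger_bar r ^^ n) (f i) z)"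
proof (induction n)
  case (Suc n)
  then show ?case
    using wirtinger_bar_sum[OF assms(1), of "\<lambda>i. (wirtinger_bar r ^^ n) (f i)"] assms(2)
    by (simp add: wirtinger_bar_funpow_smooth)
qed simp

lemma wirtinger_bar_foldr_sum:
  assumes "finite I" "\<And>i. i \<in> I \<Longrightarrow> smooth (f i)"
  shows "foldr (\<lambda>r g. (wirtinger_bar r ^^ k r) g) rs (\<lambda>z. \<Sum>i\<in>I. f i z) =
    (\<lambda>z. \<Sum>i\<in>I. foldr (\<lambda>r g. (wirtinger_bar r ^^ k r) g) rs (f i) z)"
proof (induction rs)
  case (Cons s rs)
  then show ?case
    using wirtinger_bar_funpow_sum[OF assms(1), of "\<lambda>i. foldr (\<lambda>r g. (wirtinger_bar r ^^ k r) g) rs (f i)"] assms(2)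
    by (simp add: wirtinger_bar_foldr_smooth)
qed simp

text \<open>A multi-index of order \<open>m\<close> exceeds one of smaller order in some coordinate,
  and the derivatives in that coordinate annihilate the monomial.\<close>

lemma polyanalytic_im_monom_sum:
  fixes G :: "'i \<Rightarrow> 'n::{finite,linorder} cvec \<Rightarrow> complex"
  assumes I: "finite I" and G: "\<And>i. i \<in> I \<Longrightarrow> holomorphic_vec (G i)"
    and l: "\<And>i. i \<in> I \<Longrightarrow> (\<Sum>r\<in>UNIV. l i r) < m"
  shows "polyanalytic m (\<lambda>z. \<Sum>i\<in>I. im_monom (l i) z * G i z)"
  unfolding polyanalytic_def
proof (intro conjI allI impI)
  show "smooth (\<lambda>z. \<Sum>i\<in>I. im_monom (l i) z * G i z)"
    by (intro smooth_sum smooth_im_monom_mult G)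
  fix k :: "'n \<Rightarrow> nat" and z assume k: "(\<Sum>r\<in>UNIV. k r) = m"
  have "D_bar k (\<lambda>z. im_monom (l i) z * G i z) z = 0" if i: "i \<in> I" for i
  proof -
    obtain s where s: "k s > l i s"
    proof (rule ccontr)
      assume "\<not> thesis"
      then have "k r \<le> l i r" for r using that by (meson not_le)
      then have "(\<Sum>r\<in>UNIV. k r) \<le> (\<Sum>r\<in>UNIV. l i r)" by (intro sum_mono)
      then show False using k l[OF i] by simp
    qed
    have "(\<Prod>j<k s. \<i> / 2 * of_nat (l i s - j)) = (0 :: complex)"
      using s by (intro prod_zero) auto
    then have "(\<Prod>r\<in>UNIV. \<Prod>j<k r. \<i> / 2 * of_nat (l i r - j)) = (0 :: complex)"
      by (intro prod_zero) auto
    then show ?thesis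
      by (simp add: D_bar_def wirtinger_bar_foldr_im_monom[OF G[OF i]])
  qed
  then show "D_bar k (\<lambda>z. \<Sum>i\<in>I. im_monom (l i) z * G i z) z = 0"
    by (simp add: D_bar_def wirtinger_bar_foldr_sum[OF I smooth_im_monom_mult[OF G]])
qed

subsection \<open>Surjectivity\<close>

text \<open>By the three-term recurrence, in powers of \<open>v\<close>. The upper limit
  \<open>N\<close> is left free so that expansions of different degree can be added termwise;
  coefficients beyond the degree are zero.\<close>

lemma hermite_shift_expansion:
  "\<exists>p :: nat \<Rightarrow> real \<Rightarrow> real. (\<forall>i. exp_growth (\<lambda>\<xi>. complex_of_real (p i \<xi>))) \<and>
     (\<forall>N\<ge>j. \<forall>\<xi> v. hermite j ((\<xi> + 2 * v) / sqrt 2) = (\<Sum>i\<le>N. p i \<xi> * v ^ i))"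
proof (induction j rule: less_induct)
  case (less j)
  show ?case
  proof (cases j)
    case 0
    show ?thesis
      by (rule exI[where x="\<lambda>i _. if i = 0 then 1 else 0"])
        (auto simp: 0 if_distrib[of complex_of_real] if_distrib[of "\<lambda>t. t * _"] cong: if_cong)
  next
    case (Suc j')
    have less_j: "j' < j" "j' - 1 < j" using Suc by auto
    obtain p where p: "\<And>i. exp_growth (\<lambda>\<xi>. complex_of_real (p i \<xi>))"
      "\<And>N \<xi> v. N \<ge> j' \<Longrightarrow> hermite j' ((\<xi> + 2 * v) / sqrt 2) = (\<Sum>i\<le>N. p i \<xi> * v ^ i)"
      using less[OF less_j(1)] by blast
    obtain q where q: "\<And>i. exp_growth (\<lambda>\<xi>. complex_of_real (q i \<xi>))"
      "\<And>N \<xi> v. N \<ge> j' - 1 \<Longrightarrow> hermite (j' - 1) ((\<xi> + 2 * v) / sqrt 2) = (\<Sum>i\<le>N. q i \<xi> * v ^ i)"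
      using less[OF less_j(2)] by blast
    \<comment> \<open>Multiplication by \<open>v\<close> shifts the coefficients by one place, with
      \<open>0\<close> entering at the bottom.\<close>
    define s where "s i \<xi> = (case i of 0 \<Rightarrow> 0 | Suc i' \<Rightarrow> p i' \<xi>)" for i \<xi>
    define P where "P i \<xi> = sqrt 2 * \<xi> * p i \<xi> + 2 * sqrt 2 * s i \<xi> - 2 * real j' * q i \<xi>" for i \<xi>
    have s: "exp_growth (\<lambda>\<xi>. complex_of_real (s i \<xi>))" for i
      by (cases i) (auto simp: s_def p)
    have "exp_growth (\<lambda>\<xi>. complex_of_real (P i \<xi>))" for i
      unfolding P_def of_real_add of_real_mult of_real_diff
      by (intro exp_growth_diff exp_growth_add exp_growth_mult exp_growth_const exp_growth_of_real p q s)
    moreover have "hermite j ((\<xi> + 2 * v) / sqrt 2) = (\<Sum>i\<le>N. P i \<xi> * v ^ i)" if N: "N \<ge> j" for N \<xi> v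
    proof -
      obtain N' where N': "N = Suc N'" "N' \<ge> j'" using N Suc by (cases N) auto
      have t: "2 * ((\<xi> + 2 * v) / sqrt 2) = sqrt 2 * \<xi> + 2 * sqrt 2 * v"
        by (simp add: field_simps)
      have shift: "(\<Sum>i\<le>N. s i \<xi> * v ^ i) = v * hermite j' ((\<xi> + 2 * v) / sqrt 2)"
        unfolding N' p(2)[OF N'(2)] sum.atMost_Suc_shift by (simp add: s_def sum_distrib_left mult_ac)
      have "(\<Sum>i\<le>N. P i \<xi> * v ^ i) = sqrt 2 * \<xi> * (\<Sum>i\<le>N. p i \<xi> * v ^ i) +
          2 * sqrt 2 * (\<Sum>i\<le>N. s i \<xi> * v ^ i) - 2 * real j' * (\<Sum>i\<le>N. q i \<xi> * v ^ i)"
        by (simp add: P_def sum_distrib_left sum.distrib sum_subtractf algebra_simps)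
      also have "\<dots> = hermite j ((\<xi> + 2 * v) / sqrt 2)"
        using p(2)[of N \<xi> v] q(2)[of N \<xi> v] N' unfolding shift Suc hermite_Suc t
        by (simp add: algebra_simps)
      finally show ?thesis by simp
    qed
    ultimately show ?thesis by blast
  qed
qed

lemma square_integrable_gauss_half: "square_integrable (\<lambda>\<xi> :: 'a::euclidean_space. complex_of_real (exp (- (norm \<xi>)\<^sup>2 / 8)))"
proof (rule square_integrableI)
  have "integrable mu_tilde (\<lambda>\<xi> :: 'a. gauss ((1 / sqrt 2) *\<^sub>R \<xi>))"
    using mu_scale(2)[of "gauss :: 'a \<Rightarrow> real" "1 / sqrt 2"] by (simp add: integrable_gauss)
  also have "(\<lambda>\<xi> :: 'a. gauss ((1 / sqrt 2) *\<^sub>R \<xi>)) = (\<lambda>\<xi>. (cmod (complex_of_real (exp (- (norm \<xi>)\<^sup>2 / 8))))\<^sup>2)"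
    by (auto simp: gauss_def power_divide exp_double[symmetric])
  finally show "integrable mu_tilde (\<lambda>\<xi> :: 'a. (cmod (complex_of_real (exp (- (norm \<xi>)\<^sup>2 / 8))))\<^sup>2)" .
qed measurable

lemma rapid_gauss_mult:
  fixes h :: "'n::finite rvec \<Rightarrow> complex"
  assumes h: "square_integrable h"
  shows "rapid (\<lambda>\<xi>. h \<xi> * complex_of_real (exp (- (norm \<xi>)\<^sup>2 / 4)))"
proof -
  have [measurable]: "h \<in> borel_measurable borel" using h by auto
  have "integrable mu_tilde (\<lambda>\<xi>. cmod (h \<xi> * complex_of_real (exp (- (norm \<xi>)\<^sup>2 / 4))) * exp (c * norm \<xi>))" for c
  proof (rule Bochner_Integration.integrable_bound)
    show "integrable mu_tilde (\<lambda>\<xi>. exp (2 * c\<^sup>2) * cmod (h \<xi> * complex_of_real (exp (- (norm \<xi>)\<^sup>2 / 8))))"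
      by (intro integrable_mult_right integrable_norm integrable_mult_square_integrable h square_integrable_gauss_half)
    show "AE \<xi> in mu_tilde. norm (cmod (h \<xi> * complex_of_real (exp (- (norm \<xi>)\<^sup>2 / 4))) * exp (c * norm \<xi>)) \<le>
        norm (exp (2 * c\<^sup>2) * cmod (h \<xi> * complex_of_real (exp (- (norm \<xi>)\<^sup>2 / 8))))"
    proof (rule AE_I2)
      fix \<xi> :: "'n rvec"
      \<comment> \<open>Half of the Gaussian exponent absorbs the exponential, as
        \<open>c t \<le> t^2 / 8 + 2 c^2\<close>; the other half stays as a square-integrable
        partner of \<open>h\<close>.\<close>
      have "(norm \<xi> - 4 * c)\<^sup>2 / 8 = (norm \<xi>)\<^sup>2 / 8 - c * norm \<xi> + 2 * c\<^sup>2"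
        by (simp add: power2_diff field_simps)
      then have "- (norm \<xi>)\<^sup>2 / 4 + c * norm \<xi> \<le> 2 * c\<^sup>2 + - (norm \<xi>)\<^sup>2 / 8"
        using zero_le_power2[of "norm \<xi> - 4 * c"] by linarith
      then have "exp (- (norm \<xi>)\<^sup>2 / 4) * exp (c * norm \<xi>) \<le> exp (2 * c\<^sup>2) * exp (- (norm \<xi>)\<^sup>2 / 8)"
        unfolding exp_add[symmetric] by simp
      then have "cmod (h \<xi>) * (exp (- (norm \<xi>)\<^sup>2 / 4) * exp (c * norm \<xi>)) \<le> cmod (h \<xi>) * (exp (2 * c\<^sup>2) * exp (- (norm \<xi>)\<^sup>2 / 8))"
        by (rule mult_left_mono) simp
      then show "norm (cmod (h \<xi> * complex_of_real (exp (- (norm \<xi>)\<^sup>2 / 4))) * exp (c * norm \<xi>)) \<le>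
          norm (exp (2 * c\<^sup>2) * cmod (h \<xi> * complex_of_real (exp (- (norm \<xi>)\<^sup>2 / 8))))"
        by (simp add: norm_mult mult_ac)
    qed
  qed measurable
  then show ?thesis by (simp add: rapid_def)
qed

lemma rapid_prod_coordinate:
  fixes \<eta> :: "'n::finite rvec \<Rightarrow> complex"
  assumes \<eta>: "rapid \<eta>" and u: "\<And>r. exp_growth (u r)"
  shows "rapid (\<lambda>\<xi>. \<eta> \<xi> * (\<Prod>r\<in>S. u r (\<xi> $ r)))"
  using finite[of S]
proof (induction S rule: finite_induct)
  case empty
  then show ?case using \<eta> by simp
next
  case (insert s S)
  obtain C a where C: "C \<ge> 0" "a \<ge> 0" "\<And>x. cmod (u s x) \<le> C * exp (a * \<bar>x\<bar>)"
    using exp_growthE[OF u[of s]] by blast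
  have [measurable]: "u s \<in> borel_measurable borel" using u by auto
  have "rapid (\<lambda>\<xi>. \<eta> \<xi> * (\<Prod>r\<in>S. u r (\<xi> $ r)) * u s (\<xi> $ s))"
  proof (rule rapid_mult[OF insert.IH])
    have "(\<lambda>\<xi> :: 'n rvec. \<xi> $ s) \<in> borel_measurable borel"
      by (intro borel_measurable_continuous_onI continuous_intros)
    then show "(\<lambda>\<xi> :: 'n rvec. u s (\<xi> $ s)) \<in> borel_measurable borel" by measurable
    show "cmod (u s (\<xi> $ s)) \<le> C * exp (a * norm \<xi>)" for \<xi> :: "'n rvec"
    proof -
      have "\<bar>\<xi> $ s\<bar> \<le> norm \<xi>" using Finite_Cartesian_Product.norm_nth_le[of \<xi> s] by simp
      then have "C * exp (a * \<bar>\<xi> $ s\<bar>) \<le> C * exp (a * norm \<xi>)"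
        using C by (intro mult_left_mono) (auto intro: mult_left_mono)
      then show ?thesis using C(3)[of "\<xi> $ s"] by linarith
    qed
  qed
  then show ?case using insert by (simp add: mult_ac)
qed

text \<open>The Gaussian and the phase combine to \<open>exp (- |v|^2)\<close> and a Laplace kernel
  at \<open>x + \<i> v\<close>. The Hermite polynomials, expanded in \<open>v\<close>, contribute
  monomials in the imaginary parts; their coefficients in \<open>\<xi>\<close> grow slowly enough to
  be absorbed into \<open>\<eta>\<close>.\<close>

lemma inverse_partial_fourier_q_tensor:
  fixes h :: "'n::finite rvec \<Rightarrow> complex"
  assumes h: "square_integrable h"
  obtains \<eta> where "\<And>l. rapid (\<eta> l)"
    and "\<And>x v. integrable mu_tilde (\<lambda>\<xi>. q_tensor k h (\<xi>, v) * exp (\<i> * complex_of_real (x \<bullet> \<xi>)))"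
    and "\<And>x v. inverse_partial_fourier (q_tensor k h) (x, v) = complex_of_real (exp (- (norm v)\<^sup>2)) *
      (\<Sum>l\<in>PiE UNIV (\<lambda>r. {..k r}). im_monom l (complex_vec x v) * laplace (\<eta> l) (complex_vec x v))"
proof -
  obtain p :: "nat \<Rightarrow> nat \<Rightarrow> real \<Rightarrow> real" where p: "\<And>j i. exp_growth (\<lambda>\<xi>. complex_of_real (p j i \<xi>))"
    "\<And>j N \<xi> v. N \<ge> j \<Longrightarrow> hermite j ((\<xi> + 2 * v) / sqrt 2) = (\<Sum>i\<le>N. p j i \<xi> * v ^ i)"
    using hermite_shift_expansion by metis
  define D where "D = 2 powr (real CARD('n) / 2) * pi powr (real CARD('n) / 4) *
      (\<Prod>r\<in>UNIV. (2 ^ k r * fact (k r) * sqrt pi) powr (- (1/2)))"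
  define \<eta> where "\<eta> l \<xi> = complex_of_real D * h \<xi> * complex_of_real (exp (- (norm \<xi>)\<^sup>2 / 4)) *
      (\<Prod>r\<in>UNIV. complex_of_real (p (k r) (l r) (\<xi> $ r)))" for l \<xi>
  let ?L = "PiE UNIV (\<lambda>r. {..k r})"
  have \<eta>: "rapid (\<eta> l)" for l
    unfolding \<eta>_def[abs_def]
    by (intro rapid_prod_coordinate rapid_gauss_mult p square_integrable_scale h)
  have eq: "q_tensor k h (\<xi>, v) * exp (\<i> * complex_of_real (x \<bullet> \<xi>)) = complex_of_real (exp (- (norm v)\<^sup>2)) *
      (\<Sum>l\<in>?L. im_monom l (complex_vec x v) * (\<eta> l \<xi> * exp (\<i> * cdot (complex_vec x v) \<xi>)))" for \<xi> x v
  proof -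
    have H: "(\<Prod>r\<in>UNIV. complex_of_real (hermite (k r) (hcoord \<xi> v r))) =
        (\<Sum>l\<in>?L. im_monom l (complex_vec x v) * (\<Prod>r\<in>UNIV. complex_of_real (p (k r) (l r) (\<xi> $ r))))"
    proof -
      have "(\<Prod>r\<in>UNIV. complex_of_real (hermite (k r) (hcoord \<xi> v r))) =
          (\<Prod>r\<in>UNIV. \<Sum>i\<le>k r. complex_of_real (v $ r) ^ i * complex_of_real (p (k r) i (\<xi> $ r)))"
        unfolding hcoord_def p(2)[OF order_refl] by (simp add: mult_ac)
      also have "\<dots> = (\<Sum>l\<in>?L. \<Prod>r\<in>UNIV. complex_of_real (v $ r) ^ l r * complex_of_real (p (k r) (l r) (\<xi> $ r)))"
        by (rule prod_sum_PiE) auto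
      also have "\<dots> = (\<Sum>l\<in>?L. im_monom l (complex_vec x v) * (\<Prod>r\<in>UNIV. complex_of_real (p (k r) (l r) (\<xi> $ r))))"
        by (simp add: im_monom_def prod.distrib)
      finally show ?thesis .
    qed
    have n: "complex_of_real (exp (- c * (norm w)\<^sup>2)) = (\<Prod>r\<in>UNIV. complex_of_real (exp (- c * (w $ r)\<^sup>2)))" for w :: "'n rvec" and c
      unfolding of_real_prod[symmetric] exp_sum[OF finite, symmetric] norm_vec_sq by (simp add: sum_distrib_left sum_negf)
    have e: "(\<Prod>r\<in>UNIV. complex_of_real (exp (- (hcoord \<xi> v r)\<^sup>2 / 2))) * exp (\<i> * complex_of_real (x \<bullet> \<xi>)) =
        complex_of_real (exp (- 1 * (norm v)\<^sup>2)) * (complex_of_real (exp (- (1 / 4) * (norm \<xi>)\<^sup>2)) * exp (\<i> * cdot (complex_vec x v) \<xi>))"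
    proof -
      have e2: "exp (\<i> * complex_of_real (x \<bullet> \<xi>)) = (\<Prod>r\<in>UNIV. exp (\<i> * complex_of_real (x $ r * \<xi> $ r)))"
        unfolding exp_sum[OF finite, symmetric] by (simp add: inner_vec_def sum_distrib_left)
      have e3: "exp (\<i> * cdot (complex_vec x v) \<xi>) = (\<Prod>r\<in>UNIV. exp (\<i> * (complex_vec x v $ r * complex_of_real (\<xi> $ r))))"
        unfolding exp_sum[OF finite, symmetric] by (simp add: cdot_def sum_distrib_left)
      have "complex_of_real (exp (- (hcoord \<xi> v r)\<^sup>2 / 2)) * exp (\<i> * complex_of_real (x $ r * \<xi> $ r)) =
          complex_of_real (exp (- 1 * (v $ r)\<^sup>2)) * (complex_of_real (exp (- (1 / 4) * (\<xi> $ r)\<^sup>2)) * exp (\<i> * (complex_vec x v $ r * complex_of_real (\<xi> $ r))))" for r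
        unfolding exp_of_real[symmetric] exp_add[symmetric] complex_vec_eq
        by (rule arg_cong[where f=exp]) (simp add: hcoord_def power_divide power2_eq_square field_simps)
      then show ?thesis
        unfolding n e2 e3 prod.distrib[symmetric] by simp
    qed
    have q: "complex_of_real (q_fun k \<xi> v) = complex_of_real D * ((\<Prod>r\<in>UNIV. complex_of_real (hermite (k r) (hcoord \<xi> v r))) *
        (\<Prod>r\<in>UNIV. complex_of_real (exp (- (hcoord \<xi> v r)\<^sup>2 / 2))))"
      by (simp add: D_def q_fun_eq hermite_fun_eq prod.distrib mult_ac)
    have "q_tensor k h (\<xi>, v) * exp (\<i> * complex_of_real (x \<bullet> \<xi>)) =
        complex_of_real D * h \<xi> * (\<Prod>r\<in>UNIV. complex_of_real (hermite (k r) (hcoord \<xi> v r))) *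
        ((\<Prod>r\<in>UNIV. complex_of_real (exp (- (hcoord \<xi> v r)\<^sup>2 / 2))) * exp (\<i> * complex_of_real (x \<bullet> \<xi>)))"
      unfolding q_tensor_def split_conv q by (simp only: mult_ac)
    also have "\<dots> = complex_of_real (exp (- (norm v)\<^sup>2)) *
      (\<Sum>l\<in>?L. im_monom l (complex_vec x v) * (\<eta> l \<xi> * exp (\<i> * cdot (complex_vec x v) \<xi>)))"
      unfolding H e by (simp add: \<eta>_def sum_distrib_left sum_distrib_right mult_ac)
    finally show ?thesis .
  qed
  have int: "integrable mu_tilde (\<lambda>\<xi>. im_monom l (complex_vec x v) * (\<eta> l \<xi> * exp (\<i> * cdot (complex_vec x v) \<xi>)))" for l x v
    by (intro integrable_mult_right integrable_laplace \<eta>)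
  show ?thesis
  proof (rule that[OF \<eta>])
    show "integrable mu_tilde (\<lambda>\<xi>. q_tensor k h (\<xi>, v) * exp (\<i> * complex_of_real (x \<bullet> \<xi>)))" for x v
      unfolding eq by (intro integrable_mult_right Bochner_Integration.integrable_sum int)
    show "inverse_partial_fourier (q_tensor k h) (x, v) = complex_of_real (exp (- (norm v)\<^sup>2)) *
      (\<Sum>l\<in>?L. im_monom l (complex_vec x v) * laplace (\<eta> l) (complex_vec x v))" for x v
      unfolding inverse_partial_fourier_def split_conv eq integral_mult_right_zero Bochner_Integration.integral_sum[OF int] laplace_def
      by simp
  qed
qed

text \<open>The preimage is read off from the explicit inverse transform. Its factor
  \<open>exp (- |v|^2)\<close> is the non-holomorphic part of the factor in \<open>U_fock\<close>,
  so dividing the latter out leaves polynomials in the imaginary parts with entire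
  coefficients.\<close>

theorem fock_space_surjective:
  fixes h :: "('n::{finite,linorder} \<Rightarrow> nat) \<Rightarrow> 'n rvec \<Rightarrow> complex"
  assumes m: "m \<ge> 1" and \<alpha>: "\<alpha> > 0" and h: "\<And>k. k \<in> multi_indices m \<Longrightarrow> square_integrable (h k)"
  obtains f where "f \<in> fock_space \<alpha> m"
    and "U_fock \<alpha> f = inverse_partial_fourier (\<lambda>p. \<Sum>k\<in>multi_indices m. q_tensor k (h k) p)"
proof -
  let ?J = "multi_indices m :: ('n \<Rightarrow> nat) set" and ?L = "\<lambda>k :: 'n \<Rightarrow> nat. PiE UNIV (\<lambda>r. {..k r})"
  have J: "finite ?J" by (rule card_multi_indices(1)[OF m])
  have "\<exists>\<eta>. (\<forall>l. rapid (\<eta> l)) \<and>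
      (\<forall>x v. integrable mu_tilde (\<lambda>\<xi>. q_tensor k (h k) (\<xi>, v) * exp (\<i> * complex_of_real (x \<bullet> \<xi>)))) \<and>
      (\<forall>x v. inverse_partial_fourier (q_tensor k (h k)) (x, v) = complex_of_real (exp (- (norm v)\<^sup>2)) *
      (\<Sum>l\<in>?L k. im_monom l (complex_vec x v) * laplace (\<eta> l) (complex_vec x v)))" if "k \<in> ?J" for k
    by (rule inverse_partial_fourier_q_tensor[OF h[OF that], of k]) blast
  then have "\<forall>k\<in>?J. \<exists>\<eta>. (\<forall>l. rapid (\<eta> l)) \<and>
      (\<forall>x v. integrable mu_tilde (\<lambda>\<xi>. q_tensor k (h k) (\<xi>, v) * exp (\<i> * complex_of_real (x \<bullet> \<xi>)))) \<and>
      (\<forall>x v. inverse_partial_fourier (q_tensor k (h k)) (x, v) = complex_of_real (exp (- (norm v)\<^sup>2)) *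
      (\<Sum>l\<in>?L k. im_monom l (complex_vec x v) * laplace (\<eta> l) (complex_vec x v)))" by blast
  from bchoice[OF this] obtain \<eta> where \<eta>: "\<And>k l. k \<in> ?J \<Longrightarrow> rapid (\<eta> k l)"
    and int: "\<And>k x v. k \<in> ?J \<Longrightarrow> integrable mu_tilde (\<lambda>\<xi>. q_tensor k (h k) (\<xi>, v) * exp (\<i> * complex_of_real (x \<bullet> \<xi>)))"
    and inv: "\<And>k x v. k \<in> ?J \<Longrightarrow> inverse_partial_fourier (q_tensor k (h k)) (x, v) = complex_of_real (exp (- (norm v)\<^sup>2)) *
      (\<Sum>l\<in>?L k. im_monom l (complex_vec x v) * laplace (\<eta> k l) (complex_vec x v))"
    by blast
  define c where "c = complex_of_real (2 powr (- real CARD('n) / 2))"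
  \<comment> \<open>The inverse of the factor of \<open>U_fock\<close> without
    \<open>exp (- |v|^2)\<close>, which the inverse transform supplies.\<close>
  define G where "G p z = c * (exp ((\<Sum>r\<in>UNIV. (z $ r)\<^sup>2) / 2) * laplace (\<eta> (fst p) (snd p)) z)" for p z
  define g where "g z = (\<Sum>p\<in>Sigma ?J ?L. im_monom (snd p) z * G p z)" for z
  define f where "f z = g (sqrt \<alpha> *\<^sub>R z)" for z
  have fin: "finite (Sigma ?J ?L)" by (intro finite_SigmaI J finite_PiE) auto
  have "polyanalytic m g"
    unfolding g_def[abs_def]
  proof (rule polyanalytic_im_monom_sum[OF fin])
    fix p assume p: "p \<in> Sigma ?J ?L"
    show "holomorphic_vec (G p)"
      unfolding G_def[abs_def]
      using p by (intro holomorphic_vec_mult holomorphic_vec_const holomorphic_vec_exp_square holomorphic_vec_laplace \<eta>) auto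
    have "(\<Sum>r\<in>UNIV. snd p r) \<le> (\<Sum>r\<in>UNIV. fst p r)" using p by (intro sum_mono) (auto simp: PiE_iff)
    then show "(\<Sum>r\<in>UNIV. snd p r) < m" using p m by (auto simp: multi_indices_def)
  qed
  then have poly: "polyanalytic m f" unfolding f_def[abs_def] by (rule polyanalytic_scale)
  then have meas: "f \<in> borel_measurable borel"
    by (intro smooth_measurable) (simp add: polyanalytic_def)
  have inv_sum: "inverse_partial_fourier (\<lambda>p. \<Sum>k\<in>?J. q_tensor k (h k) p) (x, v) =
      (\<Sum>k\<in>?J. inverse_partial_fourier (q_tensor k (h k)) (x, v))" for x v
    unfolding inverse_partial_fourier_def split_conv sum_distrib_right
    by (rule Bochner_Integration.integral_sum[OF int])
  have "U_fock \<alpha> f (x, v) = inverse_partial_fourier (\<lambda>p. \<Sum>k\<in>?J. q_tensor k (h k) p) (x, v)" for x v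
  proof -
    let ?z = "complex_vec x v"
    have fz: "f ((1 / sqrt \<alpha>) *\<^sub>R ?z) = g ?z" using \<alpha> by (simp add: f_def)
    have cc: "complex_of_real (2 powr (real CARD('n) / 2)) * c = 1"
      by (simp add: c_def powr_add[symmetric] flip: of_real_mult)
    have ee: "exp (complex_of_real (- (1/2) * (norm x)\<^sup>2 - (1/2) * (norm v)\<^sup>2) - \<i> * complex_of_real (x \<bullet> v)) *
        exp ((\<Sum>r\<in>UNIV. (?z $ r)\<^sup>2) / 2) = complex_of_real (exp (- (norm v)\<^sup>2))"
    proof -
      have "(\<Sum>r\<in>UNIV. (?z $ r)\<^sup>2) = complex_of_real ((norm x)\<^sup>2) - complex_of_real ((norm v)\<^sup>2) + 2 * \<i> * complex_of_real (x \<bullet> v)"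
        unfolding norm_vec_sq inner_vec_def complex_vec_eq of_real_sum sum_distrib_left sum_subtractf[symmetric] sum.distrib[symmetric]
        by (intro sum.cong refl) (simp add: power2_eq_square algebra_simps)
      then show ?thesis
        unfolding exp_of_real[symmetric] exp_add[symmetric]
        by (intro arg_cong[where f=exp]) (simp add: field_simps)
    qed
    have "U_fock \<alpha> f (x, v) = (\<Sum>p\<in>Sigma ?J ?L. (complex_of_real (2 powr (real CARD('n) / 2)) * c) *
        (exp (complex_of_real (- (1/2) * (norm x)\<^sup>2 - (1/2) * (norm v)\<^sup>2) - \<i> * complex_of_real (x \<bullet> v)) * exp ((\<Sum>r\<in>UNIV. (?z $ r)\<^sup>2) / 2)) *
        (im_monom (snd p) ?z * laplace (\<eta> (fst p) (snd p)) ?z))"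
      unfolding U_fock_eq fz g_def sum_distrib_left G_def by (intro sum.cong refl) (simp only: mult_ac)
    also have "\<dots> = (\<Sum>p\<in>Sigma ?J ?L. complex_of_real (exp (- (norm v)\<^sup>2)) * (im_monom (snd p) ?z * laplace (\<eta> (fst p) (snd p)) ?z))"
      unfolding cc ee by simp
    also have "\<dots> = (\<Sum>k\<in>?J. \<Sum>l\<in>?L k. complex_of_real (exp (- (norm v)\<^sup>2)) * (im_monom l ?z * laplace (\<eta> k l) ?z))"
      by (subst sum.Sigma) (auto intro: J finite_PiE simp: split_def)
    also have "\<dots> = inverse_partial_fourier (\<lambda>p. \<Sum>k\<in>?J. q_tensor k (h k) p) (x, v)"
      unfolding inv_sum by (intro sum.cong refl) (simp only: inv sum_distrib_left)
    finally show ?thesis .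
  qed
  then have U: "U_fock \<alpha> f = inverse_partial_fourier (\<lambda>p. \<Sum>k\<in>?J. q_tensor k (h k) p)" by auto
  \<comment> \<open>Finiteness of the Fock norm is inherited from the isometric inverse transform
    instead of being estimated from the formula for \<open>f\<close>.\<close>
  have "square_integrable (U_fock \<alpha> f)"
    unfolding U by (intro fourier_tensor_id_inverse(1) slice_integrable_sum slice_integrable_q_tensor h J)
  then have "f \<in> fock_space \<alpha> m"
    using poly by (simp add: fock_space_def square_integrable_U_fock_iff[OF \<alpha> meas])
  then show ?thesis using U by (rule that)
qed

section \<open>Isometric isomorphism and the integral formula\<close>

subsection \<open>The operator R on the Fock space\<close>

text \<open>The sum of two functions is treated as a finite sum over \<open>bool\<close>.\<close>

lemma D_bar_add: "smooth f \<Longrightarrow> smooth g \<Longrightarrow> D_bar k (\<lambda>z. f z + g z) z = D_bar k f z + D_bar k g z"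
  using wirtinger_bar_foldr_sum[of "UNIV :: bool set" "\<lambda>b. if b then f else g"]
  by (simp add: D_bar_def UNIV_bool add.commute)

lemma D_bar_cmult:
  assumes "smooth f"
  shows "D_bar k (\<lambda>z. c * f z) z = c * D_bar k f z"
proof -
  have "foldr (\<lambda>r g. (wirtinger_bar r ^^ k r) g) rs (\<lambda>z. c * f z) =
      (\<lambda>z. c * foldr (\<lambda>r g. (wirtinger_bar r ^^ k r) g) rs f z)" for rs
  proof (induction rs)
    case (Cons r rs)
    then show ?case
      using wirtinger_bar_funpow_scale[OF wirtinger_bar_foldr_smooth[OF assms], where c=1 and e=c] by simp
  qed simp
  then show ?thesis by (simp add: D_bar_def)
qed

lemma polyanalytic_add: "polyanalytic m f \<Longrightarrow> polyanalytic m g \<Longrightarrow> polyanalytic m (\<lambda>z. f z + g z)"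
  by (auto simp: polyanalytic_def D_bar_add)

lemma polyanalytic_cmult: "polyanalytic m f \<Longrightarrow> polyanalytic m (\<lambda>z. c * f z)"
  by (auto simp: polyanalytic_def D_bar_cmult)

lemma U_fock_add: "U_fock \<alpha> (\<lambda>z. f z + g z) = (\<lambda>p. U_fock \<alpha> f p + U_fock \<alpha> g p)"
  by (auto simp: U_fock_def algebra_simps)

lemma U_fock_cmult: "U_fock \<alpha> (\<lambda>z. c * f z) = (\<lambda>p. c * U_fock \<alpha> f p)"
  by (auto simp: U_fock_def)

lemma fock_space_iff:
  assumes "\<alpha> > 0"
  shows "f \<in> fock_space \<alpha> m \<longleftrightarrow> polyanalytic m f \<and> square_integrable (U_fock \<alpha> f)"
proof (cases "polyanalytic m f")
  case True
  then have "f \<in> borel_measurable borel" by (intro smooth_measurable) (simp add: polyanalytic_def)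
  then show ?thesis by (simp add: fock_space_def square_integrable_U_fock_iff[OF assms])
qed (simp add: fock_space_def)

lemma fock_space_add: "\<alpha> > 0 \<Longrightarrow> f \<in> fock_space \<alpha> m \<Longrightarrow> g \<in> fock_space \<alpha> m \<Longrightarrow> (\<lambda>z. f z + g z) \<in> fock_space \<alpha> m"
  by (simp add: fock_space_iff polyanalytic_add U_fock_add square_integrable_add)

lemma fock_space_cmult: "\<alpha> > 0 \<Longrightarrow> f \<in> fock_space \<alpha> m \<Longrightarrow> (\<lambda>z. c * f z) \<in> fock_space \<alpha> m"
  by (simp add: fock_space_iff polyanalytic_cmult U_fock_cmult square_integrable_scale)

lemma R_fock_eq:
  fixes f :: "'n::{finite,linorder} cvec \<Rightarrow> complex"
  assumes "square_integrable \<gamma>" "abs_l2 \<gamma> = fourier_tensor_id (abs_l2 (U_fock \<alpha> f))"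
    and "j \<in> {1..card (multi_indices m :: ('n \<Rightarrow> nat) set)}"
  shows "R_fock \<alpha> m f j = abs_l2 (q_coeff (lex_enum m j) \<gamma>)"
  unfolding R_fock_def R_H_def assms(2)[symmetric] by (rule N_op_abs_l2[OF assms(1,3)])

lemma R_fock_extensional:
  fixes f :: "'n::{finite,linorder} cvec \<Rightarrow> complex"
  shows "R_fock \<alpha> m f \<in> extensional {1..card (multi_indices m :: ('n \<Rightarrow> nat) set)}"
  by (simp add: R_fock_def R_H_def N_op_def)

lemma R_fock_add:
  fixes f g :: "'n::{finite,linorder} cvec \<Rightarrow> complex"
  assumes \<alpha>: "\<alpha> > 0" and fg: "f \<in> fock_space \<alpha> m" "g \<in> fock_space \<alpha> m"
    and j: "j \<in> {1..card (multi_indices m :: ('n \<Rightarrow> nat) set)}"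
  shows "R_fock \<alpha> m (\<lambda>z. f z + g z) j = R_fock \<alpha> m f j + R_fock \<alpha> m g j"
proof -
  let ?\<gamma> = "\<lambda>f. rep_l2 (fourier_tensor_id (abs_l2 (U_fock \<alpha> f)))"
  have si: "square_integrable (U_fock \<alpha> f)" "square_integrable (U_fock \<alpha> g)"
    using fg by (auto intro: square_integrable_U_fock[OF \<alpha>])
  have "abs_l2 (\<lambda>p. ?\<gamma> f p + ?\<gamma> g p) = fourier_tensor_id (abs_l2 (U_fock \<alpha> f)) + fourier_tensor_id (abs_l2 (U_fock \<alpha> g))"
    by (simp add: abs_l2_add[symmetric])
  also have "\<dots> = fourier_tensor_id (abs_l2 (U_fock \<alpha> (\<lambda>z. f z + g z)))"
    by (simp add: linear_add[OF bounded_linear.linear[OF fourier_tensor_id_properties(1)], symmetric] abs_l2_add[OF si] U_fock_add)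
  finally have "R_fock \<alpha> m (\<lambda>z. f z + g z) j = abs_l2 (q_coeff (lex_enum m j) (\<lambda>p. ?\<gamma> f p + ?\<gamma> g p))"
    by (intro R_fock_eq square_integrable_add square_integrable_rep j)
  also have "\<dots> = R_fock \<alpha> m f j + R_fock \<alpha> m g j"
    by (simp add: q_coeff_add R_fock_eq[OF square_integrable_rep abs_rep_l2 j])
  finally show ?thesis .
qed

lemma R_fock_cmult:
  fixes f :: "'n::{finite,linorder} cvec \<Rightarrow> complex"
  assumes \<alpha>: "\<alpha> > 0" and f: "f \<in> fock_space \<alpha> m"
    and j: "j \<in> {1..card (multi_indices m :: ('n \<Rightarrow> nat) set)}"
  shows "R_fock \<alpha> m (\<lambda>z. c * f z) j = scaleC_l2 c (R_fock \<alpha> m f j)"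
proof -
  let ?\<gamma> = "rep_l2 (fourier_tensor_id (abs_l2 (U_fock \<alpha> f)))"
  have "abs_l2 (\<lambda>p. c * ?\<gamma> p) = scaleC_l2 c (fourier_tensor_id (abs_l2 (U_fock \<alpha> f)))"
    by (simp add: abs_l2_scaleC[symmetric])
  also have "\<dots> = fourier_tensor_id (abs_l2 (U_fock \<alpha> (\<lambda>z. c * f z)))"
    by (simp add: fourier_tensor_id_properties(2)[symmetric] abs_l2_scaleC[OF square_integrable_U_fock[OF \<alpha> f]] U_fock_cmult)
  finally have "R_fock \<alpha> m (\<lambda>z. c * f z) j = abs_l2 (q_coeff (lex_enum m j) (\<lambda>p. c * ?\<gamma> p))"
    by (intro R_fock_eq square_integrable_scale square_integrable_rep j)
  also have "\<dots> = scaleC_l2 c (R_fock \<alpha> m f j)"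
    by (simp add: q_coeff_scale R_fock_eq[OF square_integrable_rep abs_rep_l2 j] abs_l2_scaleC square_integrable_q_coeff)
  finally show ?thesis .
qed

text \<open>Three isometries in a row: Parseval's identity restricted to
  \<open>multi_indices m\<close>, legitimate as the other coefficients vanish, then
  \<open>fourier_tensor_id\<close>, then \<open>U_fock\<close>.\<close>

lemma R_fock_norm:
  fixes f :: "'n::{finite,linorder} cvec \<Rightarrow> complex"
  assumes m: "m \<ge> 1" and \<alpha>: "\<alpha> > 0" and f: "f \<in> fock_space \<alpha> m"
  shows "l2_tuple_norm (card (multi_indices m :: ('n \<Rightarrow> nat) set)) (R_fock \<alpha> m f) = fock_norm \<alpha> f"
proof -
  let ?J = "multi_indices m :: ('n \<Rightarrow> nat) set"
  let ?\<gamma> = "rep_l2 (fourier_tensor_id (abs_l2 (U_fock \<alpha> f)))"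
  have "(\<Sum>j\<in>{1..card ?J}. (norm (R_fock \<alpha> m f j))\<^sup>2) = (\<Sum>j\<in>{1..card ?J}. (norm (abs_l2 (q_coeff (lex_enum m j) ?\<gamma>)))\<^sup>2)"
    by (intro sum.cong refl) (simp add: R_fock_eq[OF square_integrable_rep abs_rep_l2])
  also have "\<dots> = (\<Sum>k\<in>?J. (norm (abs_l2 (q_coeff k ?\<gamma>)))\<^sup>2)"
    by (rule sum.reindex_bij_betw[OF lex_enum_bij[OF m]])
  also have "\<dots> = (norm (abs_l2 ?\<gamma>))\<^sup>2"
    by (rule q_coeff_parseval[symmetric, OF square_integrable_rep card_multi_indices(1)[OF m]])
      (rule q_coeff_fock_eq_0[OF m \<alpha> f square_integrable_rep abs_rep_l2])
  also have "\<dots> = (fock_norm \<alpha> f)\<^sup>2"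
    by (simp add: fourier_tensor_id_properties(3) norm_U_fock[OF \<alpha> fock_spaceD(3)[OF f] square_integrable_U_fock[OF \<alpha> f]])
  finally show ?thesis
    using \<alpha> by (simp add: l2_tuple_norm_def fock_norm_def)
qed

text \<open>Elements of the Fock space are functions, not classes, so injectivity calls for a
  pointwise conclusion. Continuity provides it: the set where \<open>f\<close> is nonzero is open
  and negligible, hence empty.\<close>

lemma fock_norm_eq_0:
  fixes f :: "'n::{finite,linorder} cvec \<Rightarrow> complex"
  assumes \<alpha>: "\<alpha> > 0" and f: "f \<in> fock_space \<alpha> m" and 0: "fock_norm \<alpha> f = 0"
  shows "f z = 0"
proof -
  have "integral\<^sup>L lborel (\<lambda>z. (cmod (f z))\<^sup>2 * exp (- \<alpha> * (norm z)\<^sup>2)) = 0"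
    using 0 \<alpha> by (simp add: fock_norm_def)
  then have AE: "AE z in lborel. f z = 0"
    by (subst (asm) integral_nonneg_eq_0_iff_AE[OF fock_spaceD(4)[OF f]]) auto
  have cont: "continuous_on UNIV f" by (rule smooth_continuous_on[OF fock_spaceD(2)[OF f]])
  have op: "open {z. f z \<noteq> 0}"
    using open_Collect_neq[OF cont continuous_on_const[of UNIV 0]] .
  have "{z. f z \<noteq> 0} \<in> null_sets lborel"
    using AE op by (simp add: AE_iff_null_sets borel_open)
  then have "negligible {z. f z \<noteq> 0}"
    by (simp add: negligible_iff_null_sets null_sets_completionI)
  then show ?thesis using open_not_negligible[OF op] by blast
qed

theorem R_fock_bij_betw:
  assumes m: "m \<ge> 1" and \<alpha>: "\<alpha> > 0"
  shows "bij_betw (R_fock \<alpha> m :: ('n::{finite,linorder} cvec \<Rightarrow> complex) \<Rightarrow> nat \<Rightarrow> 'n rvec l2)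
    (fock_space \<alpha> m) (l2_tuples (card (multi_indices m :: ('n \<Rightarrow> nat) set)))"
  unfolding bij_betw_def
proof
  let ?J = "multi_indices m :: ('n \<Rightarrow> nat) set"
  let ?R = "R_fock \<alpha> m :: ('n cvec \<Rightarrow> complex) \<Rightarrow> nat \<Rightarrow> 'n rvec l2"
  show "inj_on ?R (fock_space \<alpha> m)"
  proof (rule inj_onI)
    fix f g :: "'n cvec \<Rightarrow> complex"
    assume fg: "f \<in> fock_space \<alpha> m" "g \<in> fock_space \<alpha> m" "?R f = ?R g"
    let ?u = "\<lambda>z. f z + (-1) * g z"
    have mg: "(\<lambda>z. (-1) * g z) \<in> fock_space \<alpha> m" by (rule fock_space_cmult[OF \<alpha> fg(2)])
    have u: "?u \<in> fock_space \<alpha> m" by (rule fock_space_add[OF \<alpha> fg(1) mg])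
    have "?R ?u j = 0" if j: "j \<in> {1..card ?J}" for j
      unfolding R_fock_add[OF \<alpha> fg(1) mg j] R_fock_cmult[OF \<alpha> fg(2) j] fg(3)
      by (simp add: uminus_scaleC_l2[symmetric])
    then have "fock_norm \<alpha> ?u = 0"
      unfolding R_fock_norm[OF m \<alpha> u, symmetric] by (simp add: l2_tuple_norm_def)
    then have "?u z = 0" for z by (rule fock_norm_eq_0[OF \<alpha> u])
    then show "f = g" by auto
  qed
  show "?R ` fock_space \<alpha> m = l2_tuples (card ?J)"
  proof
    show "?R ` fock_space \<alpha> m \<subseteq> l2_tuples (card ?J)"
      using R_fock_extensional by (auto simp: l2_tuples_def PiE_def)
    show "l2_tuples (card ?J) \<subseteq> ?R ` fock_space \<alpha> m"
    proof
      fix H :: "nat \<Rightarrow> 'n rvec l2" assume H: "H \<in> l2_tuples (card ?J)"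
      \<comment> \<open>The given tuple, reindexed by multi-indices and represented by functions,
        serves as the family of coefficients.\<close>
      define h where "h k = rep_l2 (H (inv_into {1..card ?J} (lex_enum m) k))" for k :: "'n \<Rightarrow> nat"
      let ?g = "\<lambda>p. \<Sum>k\<in>?J. q_tensor k (h k) p"
      have h: "square_integrable (h k)" for k by (simp add: h_def)
      have J: "finite ?J" by (rule card_multi_indices(1)[OF m])
      obtain f where f: "f \<in> fock_space \<alpha> m" "U_fock \<alpha> f = inverse_partial_fourier ?g"
        by (rule fock_space_surjective[OF m \<alpha> h])
      have sl: "slice_integrable ?g" by (intro slice_integrable_sum slice_integrable_q_tensor h J)
      have "?R f j = H j" for j
      proof (cases "j \<in> {1..card ?J}")
        case True
        have lex: "lex_enum m j \<in> ?J" by (rule bij_betwE[OF lex_enum_bij[OF m], rule_format, OF True])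
        have "?R f j = abs_l2 (q_coeff (lex_enum m j) ?g)"
        proof (rule R_fock_eq[OF _ _ True])
          show "square_integrable ?g" using sl by (simp add: slice_integrable_def)
          show "abs_l2 ?g = fourier_tensor_id (abs_l2 (U_fock \<alpha> f))"
            unfolding f(2) by (rule fourier_tensor_id_inverse(2)[OF sl, symmetric])
        qed
        also have "q_coeff (lex_enum m j) ?g = h (lex_enum m j)"
          using lex by (auto simp: q_coeff_sum_q_tensor[OF J])
        also have "abs_l2 (h (lex_enum m j)) = H j"
          using bij_betw_inv_into_left[OF lex_enum_bij[OF m] True] by (simp add: h_def)
        finally show ?thesis .
      next
        case False
        have "H \<in> extensional {1..card ?J}" using H by (simp add: l2_tuples_def PiE_def)
        then show ?thesis using False R_fock_extensional[of \<alpha> m f] by (simp add: extensional_def)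
      qed
      then show "H \<in> ?R ` fock_space \<alpha> m" using f(1) by (intro image_eqI[of _ _ f]) auto
    qed
  qed
qed

lemma integrable_U_fock:
  fixes f :: "'n::finite cvec \<Rightarrow> complex"
  assumes \<alpha>: "\<alpha> > 0" and f [measurable]: "f \<in> borel_measurable borel"
    and int: "integrable lborel (\<lambda>z. cmod (f z) * exp (- (\<alpha> / 2) * (norm z)\<^sup>2))"
  shows "integrable mu_tilde (U_fock \<alpha> f)"
proof (rule Bochner_Integration.integrable_bound)
  let ?F = "\<lambda>z. cmod (f z) * exp (- (\<alpha> / 2) * (norm z)\<^sup>2)"
  let ?G = "\<lambda>z :: 'n cvec. exp (- (1/2) * (norm z)\<^sup>2) * cmod (f ((1 / sqrt \<alpha>) *\<^sub>R z))"
  have F: "?F \<in> borel_measurable borel" and G: "?G \<in> borel_measurable borel" by measurable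
  have eq: "?F ((1 / sqrt \<alpha>) *\<^sub>R z) = ?G z" for z
    using \<alpha> by (simp add: power_divide mult_ac)
  have "integrable lborel ?G"
    using mu_scale(2)[OF F, of "1 / sqrt \<alpha>"] \<alpha> int unfolding eq integrable_mu_tilde_iff by simp
  then have "integrable lborel (\<lambda>p. ?G (complex_vec (fst p) (snd p)))"
    by (simp only: integral_complex_vec(2)[OF G])
  then show "integrable mu_tilde (\<lambda>p. 2 powr (real CARD('n) / 2) * ?G (complex_vec (fst p) (snd p)))"
    unfolding integrable_mu_tilde_iff by (rule integrable_mult_right)
  show "U_fock \<alpha> f \<in> borel_measurable mu_tilde"
    using U_fock_measurable[OF f] by (simp add: measurable_cong_sets[OF sets_mu_tilde refl])
  show "AE p in mu_tilde. norm (U_fock \<alpha> f p) \<le> norm (2 powr (real CARD('n) / 2) * ?G (complex_vec (fst p) (snd p)))"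
  proof (rule AE_I2)
    fix p :: "'n rvec \<times> 'n rvec"
    show "norm (U_fock \<alpha> f p) \<le> norm (2 powr (real CARD('n) / 2) * ?G (complex_vec (fst p) (snd p)))"
      using cmod_U_fock[of \<alpha> f "fst p" "snd p"] by simp
  qed
qed

text \<open>Integrability of \<open>U_fock \<alpha> f\<close> and boundedness of
  \<open>q_fun\<close> allow Fubini, so the iterated integral over \<open>u\<close> and then
  \<open>v\<close> is a single integral, and this for every \<open>\<xi>\<close>.\<close>

lemma q_coeff_partial_fourier_U_fock:
  fixes f :: "'n::finite cvec \<Rightarrow> complex"
  assumes int: "integrable mu_tilde (U_fock \<alpha> f)"
  shows "integrable lborel (R_integrand \<alpha> k f \<xi>)"
    and "q_coeff k (partial_fourier (U_fock \<alpha> f)) \<xi> =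
      complex_of_real (1 / pi powr (3 * real CARD('n) / 4)) * integral\<^sup>L lborel (R_integrand \<alpha> k f \<xi>)"
proof -
  define c where "c = 2 powr (real CARD('n) / 2) * (2 powr (real CARD('n) / 2) * pi powr (real CARD('n) / 4))"
  have c: "c \<noteq> 0" by (simp add: c_def)
  let ?W = "\<lambda>u v. U_fock \<alpha> f (u, v) * exp (- \<i> * complex_of_real (u \<bullet> \<xi>)) * complex_of_real (q_fun k \<xi> v)"
  have W: "?W u v = complex_of_real c * R_integrand \<alpha> k f \<xi> (u, v)" for u v
  proof -
    have "exp (complex_of_real (- (1/2) * (norm u)\<^sup>2 - (1/2) * (norm v)\<^sup>2) - \<i> * complex_of_real (u \<bullet> v)) * exp (- \<i> * complex_of_real (u \<bullet> \<xi>)) =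
        exp (complex_of_real (- (1/2) * (norm u)\<^sup>2 - (1/2) * (norm v)\<^sup>2) - \<i> * complex_of_real (u \<bullet> (v + \<xi>)))"
      unfolding exp_add[symmetric] by (rule arg_cong[where f=exp]) (simp add: inner_add_right algebra_simps)
    then show ?thesis
      by (simp add: U_fock_eq R_integrand_def q_fun_def c_def mult_ac)
  qed
  obtain C where C: "C \<ge> 0" "\<And>\<xi> v. \<bar>q_fun k \<xi> v\<bar> \<le> C" using q_fun_bounded by blast
  have U [measurable]: "U_fock \<alpha> f \<in> borel_measurable (borel \<Otimes>\<^sub>M borel)"
    using borel_measurable_integrable[OF int] by (simp add: borel_prod measurable_cong_sets[OF sets_mu_tilde refl])
  have intW: "integrable mu_tilde (\<lambda>(u, v). ?W u v)"
  proof (rule Bochner_Integration.integrable_bound[OF integrable_mult_right[OF int, of "complex_of_real C"]])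
    have "(\<lambda>(u, v). ?W u v) \<in> borel_measurable (borel \<Otimes>\<^sub>M borel)" by measurable
    then show "(\<lambda>(u, v). ?W u v) \<in> borel_measurable mu_tilde"
      by (simp add: borel_prod measurable_cong_sets[OF sets_mu_tilde refl])
    show "AE p in mu_tilde. norm (case p of (u, v) \<Rightarrow> ?W u v) \<le> norm (complex_of_real C * U_fock \<alpha> f p)"
    proof (rule AE_I2)
      fix p :: "'n rvec \<times> 'n rvec"
      show "norm (case p of (u, v) \<Rightarrow> ?W u v) \<le> norm (complex_of_real C * U_fock \<alpha> f p)"
        using C by (cases p) (simp add: norm_mult norm_exp_eq_Re mult.commute[of _ "\<bar>_\<bar>"] mult_right_mono)
    qed
  qed
  have eqW: "(\<lambda>(u, v). ?W u v) = (\<lambda>p. complex_of_real c * R_integrand \<alpha> k f \<xi> p)"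
    unfolding W by auto
  show "integrable lborel (R_integrand \<alpha> k f \<xi>)"
  proof -
    have "integrable lborel (\<lambda>p. complex_of_real (1 / c) * (complex_of_real c * R_integrand \<alpha> k f \<xi> p))"
      using intW unfolding eqW integrable_mu_tilde_iff by (rule integrable_mult_right)
    then show ?thesis using c by simp
  qed
  have "q_coeff k (partial_fourier (U_fock \<alpha> f)) \<xi> = integral\<^sup>L mu_tilde (\<lambda>v. integral\<^sup>L mu_tilde (\<lambda>u. ?W u v))"
    by (simp add: q_coeff_def partial_fourier_def fourier_integral_def)
  also have "\<dots> = integral\<^sup>L mu_tilde (\<lambda>(u, v). ?W u v)"
    using mu_pair.integral_snd[of ?W] intW by (simp only: mu_tilde_prod)
  also have "\<dots> = complex_of_real (mu_const TYPE('n rvec \<times> 'n rvec) * c) * integral\<^sup>L lborel (R_integrand \<alpha> k f \<xi>)"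
    unfolding eqW integral_mu_tilde by (simp add: scaleR_conv_of_real)
  also have "mu_const TYPE('n rvec \<times> 'n rvec) * c = 1 / pi powr (3 * real CARD('n) / 4)"
  \<comment> \<open>All powers of \<open>2\<close> cancel, and \<open>pi\<close> keeps the exponent
    \<open>- n / 2 - n / 2 + n / 4 = - 3 n / 4\<close>.\<close>
  proof -
    let ?n = "real CARD('n)"
    have "mu_const TYPE('n rvec \<times> 'n rvec) * c =
        ((2 powr (- ?n / 2) * 2 powr (- ?n / 2)) * (2 powr (?n / 2) * 2 powr (?n / 2))) *
        (pi powr (- ?n / 2) * pi powr (- ?n / 2) * pi powr (?n / 4))"
      by (simp add: mu_const_prod mu_const_rvec c_def powr_mult)
    also have "\<dots> = pi powr (- (3 * ?n / 4))"
      unfolding powr_add[symmetric] by (simp add: field_simps)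
    finally show ?thesis by (simp only: powr_minus_divide)
  qed
  finally show "q_coeff k (partial_fourier (U_fock \<alpha> f)) \<xi> =
      complex_of_real (1 / pi powr (3 * real CARD('n) / 4)) * integral\<^sup>L lborel (R_integrand \<alpha> k f \<xi>)" .
qed

theorem proposition9p2:
  fixes \<alpha> :: real and m d :: nat
  assumes "m \<ge> 1" and "\<alpha> > 0"
    and "d = (CARD('n::{finite,linorder}) + m - 1) choose CARD('n)"
  shows "fock_isometric_isomorphism \<alpha> m d
           (R_fock \<alpha> m :: ('n cvec \<Rightarrow> complex) \<Rightarrow> nat \<Rightarrow> 'n rvec l2) \<and>
         (\<forall>(f :: 'n cvec \<Rightarrow> complex) \<in> fock_space \<alpha> m.
           integrable lborel (\<lambda>z. cmod (f z) * exp (- (\<alpha> / 2) * (norm z)\<^sup>2)) \<longrightarrow>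
           (\<forall>j\<in>{1..d}.
             let h = (\<lambda>\<xi>. complex_of_real (1 / pi powr (3 * real CARD('n) / 4)) *
                       integral\<^sup>L lborel (R_integrand \<alpha> (lex_enum m j) f \<xi>))
             in (\<forall>\<xi>. integrable lborel (R_integrand \<alpha> (lex_enum m j) f \<xi>)) \<and>
                square_integrable h \<and> R_fock \<alpha> m f j = abs_l2 h))"
proof (intro conjI ballI impI)
  let ?R = "R_fock \<alpha> m :: ('n cvec \<Rightarrow> complex) \<Rightarrow> nat \<Rightarrow> 'n rvec l2"
  have d: "d = card (multi_indices m :: ('n \<Rightarrow> nat) set)"
    using card_multi_indices(2)[OF assms(1), where 'n='n] assms(3) by simp
  \<comment> \<open>Values of \<open>R_fock\<close> are extensional on \<open>{1..d}\<close>, so the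
    algebraic identities only have to be checked at these indices.\<close>
  have restr: "F = (\<lambda>j\<in>{1..d}. G j)" if "F \<in> extensional {1..d}" "\<And>j. j \<in> {1..d} \<Longrightarrow> F j = G j"
    for F G :: "nat \<Rightarrow> 'n rvec l2"
    using that by (auto simp: extensional_def)
  show "fock_isometric_isomorphism \<alpha> m d ?R"
    unfolding fock_isometric_isomorphism_def
  proof (intro conjI ballI allI)
    show "bij_betw ?R (fock_space \<alpha> m) (l2_tuples d)"
      unfolding d by (rule R_fock_bij_betw[OF assms(1,2)])
    show "?R (\<lambda>z. f z + g z) = (\<lambda>j\<in>{1..d}. ?R f j + ?R g j)" if "f \<in> fock_space \<alpha> m" "g \<in> fock_space \<alpha> m" for f g
      by (rule restr; unfold d) (rule R_fock_extensional, rule R_fock_add[OF assms(2) that])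
    show "?R (\<lambda>z. c * f z) = (\<lambda>j\<in>{1..d}. scaleC_l2 c (?R f j))" if "f \<in> fock_space \<alpha> m" for c f
      by (rule restr; unfold d) (rule R_fock_extensional, rule R_fock_cmult[OF assms(2) that])
    show "l2_tuple_norm d (?R f) = fock_norm \<alpha> f" if "f \<in> fock_space \<alpha> m" for f
      unfolding d by (rule R_fock_norm[OF assms(1,2) that])
  qed
  fix f :: "'n cvec \<Rightarrow> complex" and j
  assume f: "f \<in> fock_space \<alpha> m" and "integrable lborel (\<lambda>z. cmod (f z) * exp (- (\<alpha> / 2) * (norm z)\<^sup>2))"
    and j: "j \<in> {1..d}"
  then have int: "integrable mu_tilde (U_fock \<alpha> f)"
    using integrable_U_fock[OF assms(2) fock_spaceD(3)] by blast
  \<comment> \<open>This is where the integrability assumption makes the abstract transform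
    concrete: on slice-integrable functions \<open>fourier_tensor_id\<close> is the partial Fourier
    integral.\<close>
  have sl: "slice_integrable (U_fock \<alpha> f)"
    by (rule integrable_imp_slice_integrable[OF square_integrable_U_fock[OF assms(2) f] int])
  let ?g = "partial_fourier (U_fock \<alpha> f)"
  have g: "square_integrable ?g" by (rule partial_fourier_isometry(1)[OF sl])
  have h: "(\<lambda>\<xi>. complex_of_real (1 / pi powr (3 * real CARD('n) / 4)) *
      integral\<^sup>L lborel (R_integrand \<alpha> (lex_enum m j) f \<xi>)) = q_coeff (lex_enum m j) ?g"
    using q_coeff_partial_fourier_U_fock(2)[OF int] by auto
  have "?R f j = abs_l2 (q_coeff (lex_enum m j) ?g)"
    by (rule R_fock_eq[OF g fourier_tensor_id_properties(4)[OF sl, symmetric] j[unfolded d]])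
  then show "let h = (\<lambda>\<xi>. complex_of_real (1 / pi powr (3 * real CARD('n) / 4)) *
        integral\<^sup>L lborel (R_integrand \<alpha> (lex_enum m j) f \<xi>))
      in (\<forall>\<xi>. integrable lborel (R_integrand \<alpha> (lex_enum m j) f \<xi>)) \<and>
        square_integrable h \<and> ?R f j = abs_l2 h"
    unfolding h Let_def using q_coeff_partial_fourier_U_fock(1)[OF int] square_integrable_q_coeff[OF g] by blast
qed

end
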